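(* There exists an injective homomorphism of $K$-algebras $$\iota\colon \mathbb{SH}_{g=2}\longrightarrow \widehat{\mathbb L}_K$$ such that $\iota(\mathcal O_{A_k})=L_{A_k}$ for $k=1,2,3$ and $\iota(\mathcal O_{B_{ij}})=L_{B_{ij}}$ for $1\le i<j\le 3$. Moreover $\iota$ is equivariant with respect to the actions of the mapping class group $\Gamma_{2,0}$ on both sides, that is, $\iota\circ a_k=\tau_{A_k}\circ\iota$ for $k=1,2,3$ and $\iota\circ b_{ij}=\tau_{B_{ij}}\circ\iota$ for $1\le i<j\le 3$.
   Context: **Source algebra.** Let $q^{1/2},t$ be independent indeterminates and $K=\mathbb C(q^{1/2},t)$. In variables $x_{12},x_{13},x_{23}$ let $T_{ij}$ be the $q$-shift in $x_{ij}$: it substitutes $x_{ij}\mapsto qx_{ij}$ and fixes the other two variables. We put $x_{ji}=x_{ij}$, $T_{ji}=T_{ij}$. Let $\mathcal O_{B_{ij}}$ be multiplication by $x_{ij}+x_{ij}^{-1}$, and for $\{k,i,j\}=\{1,2,3\}$ let $$\mathcal O_{A_k}=\sum_{a,b\in\{\pm1\}}ab\,\frac{(1-t x_{ki}^a x_{kj}^b x_{ij})(1-t x_{ki}^a x_{kj}^b x_{ij}^{-1})}{t x_{ki}^a x_{kj}^b (x_{ki}-x_{ki}^{-1})(x_{kj}-x_{kj}^{-1})}\,T_{ki}^aT_{kj}^b .$$ $\mathbb{SH}_{g=2}$ (the genus 2 spherical DAHA, or Arthamonov–Shakirov algebra) is the $K$-algebra of $q$-difference operators generated by the $\mathcal O_{A_k}$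 ($k=1,2,3$) and $\mathcal O_{B_{ij}}$ ($1\le i<j\le3$). Let $\Gamma_{2,0}$ be the mapping class group of the closed genus 2 surface. It is generated by Dehn twists $a_k$ ($k=1,2,3$) along curves $A_k$ and $b_{ij}$ ($1\le i<j\le 3$) along curves $B_{ij}$, where the $B_{ij}$ form a pants decomposition by three non-separating curves, the $A_k$ are three pairwise disjoint non-separating curves, and $A_k$ meets $B_{ij}$ once if $k\in\{i,j\}$ and is disjoint from it otherwise. It acts on $\mathbb{SH}_{g=2}$ by $K$-algebra automorphisms with $$a_k^{\pm1}(\mathcal O_{B_{ij}})=\pm(q-q^{-1})^{-1}\big(q^{1/2}\mathcal O_{B_{ij}}\mathcal O_{A_k}-q^{-1/2}\mathcal O_{A_k}\mathcal O_{B_{ij}}\big)\ \text{ if }k\in\{i,j\},\qquad a_k^{\pm1}(\mathcal O_{B_{ij}})=\mathcal O_{B_{ij}}\ \text{ if }k\notin\{i,j\},$$ $$b_{ij}^{\pm1}(\mathcal O_{A_k})=\pm(q-q^{-1})^{-1}\big(q^{1/2}\mathcal O_{A_k}\mathcal O_{B_{ij}}-q^{-1/2}\mathcal O_{B_{ij}}\mathcal O_{A_k}\big)\ \text{ if }k\in\{i,j\},\qquad b_{ij}^{\pm1}(\mathcal O_{A_k})=\mathcal O_{A_k}\ \text{ if }k\notin\{i,j\},$$ $a_k^{\pm1}(\mathcal O_{A_j})=\mathcal O_{A_j}$ and $b_{ij}^{\pm1}(\mathcal O_{B_{kl}})=\mathcal O_{B_{kl}}$. (That these formulas define an action is a known result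 of Arthamonov–Shakirov.) **Quantum cluster structure.** A quiver on vertices $1,\dots,7$ is a skew-symmetric integer matrix $\varepsilon$, where $\varepsilon_{ij}$ is the number of arrows $i\to j$ minus the number of arrows $j\to i$. It determines the lattice $\Lambda=\bigoplus_{i=1}^7\mathbb Z e_i$ with skew form $(e_i,e_j)=\varepsilon_{ij}$, extended to $\Lambda\otimes\mathbb Q$. Set $$\widetilde\Lambda=\{\lambda\in\tfrac12\Lambda : (\mu,\lambda)\in\mathbb Z\ \ \forall\mu\in\Lambda\}.$$ The quantum torus $\mathcal T_{\widetilde\Lambda}$ is the free $\mathbb Z[q^{\pm1/2}]$-module with basis $Y_\lambda$, $\lambda\in\widetilde\Lambda$, and multiplication $q^{(\lambda,\mu)}Y_\lambda Y_\mu=Y_{\lambda+\mu}$; write $Y_i=Y_{e_i}$. The mutation of the quiver at $k$ is the quiver with lattice $\Lambda'$ (basis $e_i'$) and form such that the linear map $\mu_k\colon\Lambda\to\Lambda'$, $e_k\mapsto -e_k'$, $e_i\mapsto e_i'+\max\{\varepsilon_{ik},0\}e_k'$ ($i\ne k$), is an isometry. The quantum mutation $\mu_k^q\colon\mathrm{Frac}(\mathcal T_{\widetilde\Lambda})\to\mathrm{Frac}(\mathcal T_{\widetilde\Lambda'})$ is the isomorphism of skew fields determined by $$Y_\lambda\mapsto\Psi_q(Y_k')\,Y'_{\mu_k(\lambda)}\,\Psi_q(Y_k')^{-1},\qquad \Psi_q(Y)=\frac{1}{(-qY;q^2)_\infty}=\prod_{m\ge 0}\frac{1}{1+q^{2m+1}Y},$$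 the conjugation being a birational map because $\Psi_q(qY)=(1+Y)\Psi_q(q^{-1}Y)$. A permutation $\pi$ of the vertices acts by $e_i\mapsto e'_{\pi(i)}$. Composites are read right to left. The universally Laurent algebra is the subalgebra of $\mathcal T_{\widetilde\Lambda}$ of elements whose image under every finite sequence of quantum mutations lies in the corresponding quantum torus. Composites of mutations and permutations returning to the original quiver act on it by automorphisms. Let $\widehat{\mathbb L}$ be the universally Laurent algebra for the quiver $X_7$: double arrows $2\Rightarrow1$, $4\Rightarrow3$, $6\Rightarrow5$ and single arrows $7\to2$, $7\to4$, $7\to6$, $1\to7$, $3\to7$, $5\to7$. Put $c=e_7+\frac12\sum_{i=1}^6e_i$; the element $Y_c$ is central and invertible. Make $\widehat{\mathbb L}$ a $\mathbb Z[q^{\pm1/2},t^{\pm1}]$-algebra by letting $t$ act as $-qY_c^{-1}$, and put $\widehat{\mathbb L}_K=K\otimes_{\mathbb Z[q^{\pm1/2},t^{\pm1}]}\widehat{\mathbb L}$. The following elements belong to $\widehat{\mathbb L}$: $$L_{B_{12}}=Y_{-\frac12(e_5+e_6)}+Y_{\frac12(e_6-e_5)}+Y_{\frac12(e_5+e_6)},$$ $$L_{B_{13}}=Y_{-\frac12(e_3+e_4)}+Y_{\frac12(e_4-e_3)}+Y_{\frac12(e_3+e_4)},$$ $$L_{B_{23}}=Y_{-\frac12(e_1+e_2)}+Y_{\frac12(e_2-e_1)}+Y_{\frac12(e_1+e_2)},$$ $$L_{A_1}=Y_{e_7+\frac12(e_2+e_1+e_3+e_5)}+L_{B_{23}}Y_{\frac12(e_3+e_5)}+Y_{-e_7-\frac12(e_2+e_1+e_3+e_5)}(1+qY_{e_3})(1+qY_{e_5}),$$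 $$L_{A_2}=Y_{e_7+\frac12(e_4+e_1+e_3+e_5)}+L_{B_{13}}Y_{\frac12(e_1+e_5)}+Y_{-e_7-\frac12(e_4+e_1+e_3+e_5)}(1+qY_{e_1})(1+qY_{e_5}),$$ $$L_{A_3}=Y_{e_7+\frac12(e_6+e_1+e_3+e_5)}+L_{B_{12}}Y_{\frac12(e_1+e_3)}+Y_{-e_7-\frac12(e_6+e_1+e_3+e_5)}(1+qY_{e_1})(1+qY_{e_3}).$$ **Action of $\Gamma_{2,0}$ on $\widehat{\mathbb L}$.** The Dehn twists along the $B$-cycles act by the cluster automorphisms $$\tau_{B_{12}}=\big((5\,6)\circ\mu_5^q\big)^{-1},\qquad \tau_{B_{13}}=\big((3\,4)\circ\mu_3^q\big)^{-1},\qquad \tau_{B_{23}}=\big((1\,2)\circ\mu_1^q\big)^{-1}.$$ Let $\sigma=(1\,5)(3\,7)\circ\mu^q_7\mu^q_3\mu^q_5\mu^q_1\mu^q_7\mu^q_3$, an involutive cluster automorphism satisfying $\sigma(L_{B_{ij}})=L_{A_k}$ and $\sigma(L_{A_k})=L_{B_{ij}}$ for $\{i,j,k\}=\{1,2,3\}$, $i<j$. The Dehn twists along the $A$-cycles act by $\tau_{A_k}=\sigma\circ\tau_{B_{ij}}\circ\sigma^{-1}$ for $\{i,j,k\}=\{1,2,3\}$, $i<j$. All these fix $Y_c$ and hence extend $K$-linearly to $\widehat{\mathbb L}_K$.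
   Formalization: The printed formulas for the inverse twists a_k^{-1}, b_ij^{-1} contradict those for a_k, b_ij (they would give a_k^{-1}(O_B) = -a_k(O_B)); the twists are defined here by the "+1" formulas alone, as the unique K-algebra automorphisms with those values. *)

theory Defs
  imports
    "HOL-Library.Poly_Mapping"
    "HOL-Library.Numeral_Type"
    "HOL-Computational_Algebra.Polynomial"
    "HOL-Computational_Algebra.Fraction_Field"
    "HOL-Combinatorics.Transposition"
    "HOL-Analysis.Finite_Cartesian_Product"
    "HOL-Analysis.Cartesian_Space"
    "HOL-Analysis.Infinite_Products"
    "HOL-Algebra.QuotRing"
begin

section \<open>The field of scalars and q-difference operators\<close>

text \<open>
  \<open>K = Frac \<complex>[q\<^sup>1\<^sup>/\<^sup>2][t]\<close>, and the operators act on
  \<open>K(x\<^sub>1\<^sub>2, x\<^sub>1\<^sub>3, x\<^sub>2\<^sub>3) = Frac K[x\<^sub>1\<^sub>2][x\<^sub>1\<^sub>3][x\<^sub>2\<^sub>3]\<close>; in both cases the last variable is the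
  outermost one.
\<close>

type_synonym scalar = "complex poly poly fract"
type_synonym ratfun = "scalar poly poly poly fract"
type_synonym qdop = "ratfun \<Rightarrow> ratfun"

definition qh :: scalar where
  "qh = Fract [:[:0, 1:]:] 1"

definition qq :: scalar where
  "qq = qh ^ 2"

definition tt :: scalar where
  "tt = Fract [:0, 1:] 1"

definition const :: "scalar \<Rightarrow> ratfun" where
  "const c = Fract [:[:[:c:]:]:] 1"

definition xvar :: "nat \<Rightarrow> nat \<Rightarrow> ratfun" where
  "xvar i j =
     (if {i, j} = {1, 2} then Fract [:[:[:0, 1:]:]:] 1
      else if {i, j} = {1, 3} then Fract [:[:0, 1:]:] 1
      else Fract [:0, 1:] 1)"

text \<open>The substitution \<open>x\<^sub>i\<^sub>j \<mapsto> c x\<^sub>i\<^sub>j\<close>, first on polynomials, then on their fractions.\<close>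

definition poly_scale ::
  "nat \<Rightarrow> nat \<Rightarrow> scalar \<Rightarrow> scalar poly poly poly \<Rightarrow> scalar poly poly poly" where
  "poly_scale i j c =
     (if {i, j} = {1, 2} then map_poly (map_poly (\<lambda>p. pcompose p [:0, c:]))
      else if {i, j} = {1, 3} then map_poly (\<lambda>p. pcompose p [:0, [:c:]:])
      else (\<lambda>p. pcompose p [:0, [:[:c:]:]:]))"

definition fract_extend :: "('a::idom \<Rightarrow> 'a) \<Rightarrow> 'a fract \<Rightarrow> 'a fract" where
  "fract_extend h f = (THE r. \<exists>a b. b \<noteq> 0 \<and> f = Fract a b \<and> r = Fract (h a) (h b))"

lemma fract_extend_Fract:
  assumes "\<And>a b. h (a * b) = h a * h b" "\<And>a. h a = 0 \<longleftrightarrow> a = 0" "b \<noteq> 0"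
  shows "fract_extend h (Fract a b) = Fract (h a) (h b)"
  unfolding fract_extend_def
proof (rule the_equality)
  fix r assume "\<exists>c d. d \<noteq> 0 \<and> Fract a b = Fract c d \<and> r = Fract (h c) (h d)"
  then obtain c d where cd: "d \<noteq> 0" "Fract a b = Fract c d" "r = Fract (h c) (h d)"
    by blast
  then have "h (a * d) = h (c * b)"
    using assms(3) by (simp add: eq_fract)
  then show "r = Fract (h a) (h b)"
    using cd assms by (simp add: eq_fract)
qed (use assms(3) in blast)

text \<open>\<open>Tshift i j a\<close> is the power \<open>T\<^sub>i\<^sub>j\<^sup>a\<close> of the q-shift.\<close>

definition Tshift :: "nat \<Rightarrow> nat \<Rightarrow> int \<Rightarrow> qdop" where
  "Tshift i j a = fract_extend (poly_scale i j (qq powi a))"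

definition scal_op :: "scalar \<Rightarrow> qdop" where
  "scal_op c = (\<lambda>f. const c * f)"

definition O_B :: "nat \<Rightarrow> nat \<Rightarrow> qdop" where
  "O_B i j = (\<lambda>f. (xvar i j + inverse (xvar i j)) * f)"

definition O_A_formula :: "nat \<Rightarrow> nat \<Rightarrow> nat \<Rightarrow> qdop" where
  "O_A_formula k i j = (\<lambda>f. \<Sum>a\<in>{1, -1::int}. \<Sum>b\<in>{1, -1::int}.
      of_int (a * b) *
      ((1 - const tt * xvar k i powi a * xvar k j powi b * xvar i j) *
       (1 - const tt * xvar k i powi a * xvar k j powi b * inverse (xvar i j)) /
       (const tt * xvar k i powi a * xvar k j powi b *
        (xvar k i - inverse (xvar k i)) * (xvar k j - inverse (xvar k j)))) *
      Tshift k i a (Tshift k j b f))"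

definition O_A :: "nat \<Rightarrow> qdop" where
  "O_A k = (if k = 1 then O_A_formula 1 2 3
            else if k = 2 then O_A_formula 2 1 3
            else O_A_formula 3 1 2)"

inductive_set SH_set :: "qdop set" where
  scalar: "scal_op c \<in> SH_set"
| O_A: "k \<in> {1, 2, 3} \<Longrightarrow> O_A k \<in> SH_set"
| O_B: "1 \<le> i \<Longrightarrow> i < j \<Longrightarrow> j \<le> 3 \<Longrightarrow> O_B i j \<in> SH_set"
| add: "D \<in> SH_set \<Longrightarrow> E \<in> SH_set \<Longrightarrow> (\<lambda>f. D f + E f) \<in> SH_set"
| mult: "D \<in> SH_set \<Longrightarrow> E \<in> SH_set \<Longrightarrow> D \<circ> E \<in> SH_set"

definition SH :: "qdop ring" where
  "SH = \<lparr>carrier = SH_set, mult = (\<circ>), one = id,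
         zero = (\<lambda>_. 0), add = (\<lambda>D E f. D f + E f)\<rparr>"

text \<open>The scalars of a \<open>K\<close>-algebra are given by its structure map \<open>K \<rightarrow> A\<close>.\<close>

definition K_alg_hom ::
  "'a ring \<Rightarrow> (scalar \<Rightarrow> 'a) \<Rightarrow> 'b ring \<Rightarrow> (scalar \<Rightarrow> 'b) \<Rightarrow> ('a \<Rightarrow> 'b) set" where
  "K_alg_hom A sA B sB = {h \<in> ring_hom A B. \<forall>c. h (sA c) = sB c}"


section \<open>The mapping class group action on the source algebra\<close>

text \<open>\<open>(q - q\<^sup>-\<^sup>1)\<^sup>-\<^sup>1 (q\<^sup>1\<^sup>/\<^sup>2 P Q - q\<^sup>-\<^sup>1\<^sup>/\<^sup>2 Q P)\<close>\<close>

definition q_bracket :: "qdop \<Rightarrow> qdop \<Rightarrow> qdop" where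
  "q_bracket P Q = (\<lambda>f. const (inverse (qq - inverse qq)) *
     (const qh * P (Q f) - const (inverse qh) * Q (P f)))"

definition SH_aut :: "(qdop \<Rightarrow> qdop) set" where
  "SH_aut = {\<phi> \<in> K_alg_hom SH scal_op SH scal_op.
               bij_betw \<phi> (carrier SH) (carrier SH) \<and> \<phi> \<in> extensional (carrier SH)}"

text \<open>
  An automorphism is determined by its values on the generators, so at most one
  \<open>\<phi>\<close> qualifies; \<open>extensional\<close> fixes the irrelevant values outside the algebra.
  The values of the inverse twists follow: they are
  \<open>-(q - q\<^sup>-\<^sup>1)\<^sup>-\<^sup>1 (q\<^sup>-\<^sup>1\<^sup>/\<^sup>2 P Q - q\<^sup>1\<^sup>/\<^sup>2 Q P)\<close>.
\<close>

definition dehn_a :: "nat \<Rightarrow> qdop \<Rightarrow> qdop" where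
  "dehn_a k = (THE \<phi>. \<phi> \<in> SH_aut \<and>
     (\<forall>i j. 1 \<le> i \<and> i < j \<and> j \<le> 3 \<longrightarrow>
        \<phi> (O_B i j) = (if k \<in> {i, j} then q_bracket (O_B i j) (O_A k) else O_B i j)) \<and>
     (\<forall>l\<in>{1, 2, 3}. \<phi> (O_A l) = O_A l))"

definition dehn_b :: "nat \<Rightarrow> nat \<Rightarrow> qdop \<Rightarrow> qdop" where
  "dehn_b i j = (THE \<phi>. \<phi> \<in> SH_aut \<and>
     (\<forall>k\<in>{1, 2, 3}.
        \<phi> (O_A k) = (if k \<in> {i, j} then q_bracket (O_A k) (O_B i j) else O_A k)) \<and>
     (\<forall>k l. 1 \<le> k \<and> k < l \<and> l \<le> 3 \<longrightarrow> \<phi> (O_B k l) = O_B k l))"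


section \<open>Quivers and quantum tori\<close>

text \<open>
  The vertices \<open>1, \<dots>, 7\<close> are the elements of the seven-element type \<open>7\<close>, in which \<open>7 = 0\<close>.
  An element of \<open>\<Lambda> \<otimes> \<rat>\<close> is its coordinate vector in the basis \<open>e\<^sub>1, \<dots>, e\<^sub>7\<close>.
\<close>

type_synonym quiver = "7 \<Rightarrow> 7 \<Rightarrow> int"
type_synonym weight = "rat ^ 7"

definition ebas :: "7 \<Rightarrow> weight" where
  "ebas i = axis i 1"

definition form :: "quiver \<Rightarrow> weight \<Rightarrow> weight \<Rightarrow> rat" where
  "form Q v w = (\<Sum>i\<in>UNIV. \<Sum>j\<in>UNIV. of_int (Q i j) * v $ i * w $ j)"

definition Lat :: "weight set" where
  "Lat = {v. \<forall>i. v $ i \<in> \<int>}"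

definition Lat_tilde :: "quiver \<Rightarrow> weight set" where
  "Lat_tilde Q = {v. 2 *s v \<in> Lat \<and> (\<forall>w\<in>Lat. form Q w v \<in> \<int>)}"

text \<open>
  \<open>\<int>[q\<^sup>\<plusminus>\<^sup>1\<^sup>/\<^sup>2]\<close> is the group ring of \<open>\<int>\<close>, the exponent \<open>n\<close> standing for \<open>q\<^sup>n\<^sup>/\<^sup>2\<close>.
  \<open>qpow r\<close> is \<open>q\<^sup>r\<close> for half-integral \<open>r\<close>.
\<close>

type_synonym qlaurent = "int \<Rightarrow>\<^sub>0 int"

definition qpow :: "rat \<Rightarrow> qlaurent" where
  "qpow r = Poly_Mapping.single \<lfloor>2 * r\<rfloor> 1"

type_synonym qtorus = "weight \<Rightarrow>\<^sub>0 qlaurent"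

definition Y :: "weight \<Rightarrow> qtorus" where
  "Y v = Poly_Mapping.single v 1"

definition qt_const :: "qlaurent \<Rightarrow> qtorus" where
  "qt_const r = Poly_Mapping.single 0 r"

definition qt_mult :: "quiver \<Rightarrow> qtorus \<Rightarrow> qtorus \<Rightarrow> qtorus" where
  "qt_mult Q f g =
     (\<Sum>v\<in>Poly_Mapping.keys f. \<Sum>w\<in>Poly_Mapping.keys g.
        Poly_Mapping.single (v + w)
          (qpow (- form Q v w) * Poly_Mapping.lookup f v * Poly_Mapping.lookup g w))"

definition torus :: "quiver \<Rightarrow> qtorus ring" where
  "torus Q = \<lparr>carrier = {f. Poly_Mapping.keys f \<subseteq> Lat_tilde Q},
              mult = qt_mult Q, one = Y 0, zero = 0, add = (+)\<rparr>"

lemma Y_mult: "Y v \<otimes>\<^bsub>torus Q\<^esub> Y w = qt_const (qpow (- form Q v w)) \<otimes>\<^bsub>torus Q\<^esub> Y (v + w)"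
proof -
  have "qpow 0 = 1"
    by (simp add: qpow_def)
  moreover have "qpow r \<noteq> 0" for r
    by (simp add: qpow_def)
  ultimately show ?thesis
    by (simp add: torus_def qt_mult_def Y_def qt_const_def form_def)
qed


section \<open>Skew fields of fractions\<close>

text \<open>
  Right fractions \<open>a b\<^sup>-\<^sup>1\<close> of a (not necessarily commutative) Ore domain. A sum is formed over
  a common right multiple of the denominators, and a product \<open>a b\<^sup>-\<^sup>1 c d\<^sup>-\<^sup>1\<close> after writing
  \<open>b\<^sup>-\<^sup>1 c\<close> as \<open>u v\<^sup>-\<^sup>1\<close>.
\<close>

definition ore_rel :: "'a ring \<Rightarrow> (('a \<times> 'a) \<times> ('a \<times> 'a)) set" where
  "ore_rel R = {((a, b), (c, d)).
     a \<in> carrier R \<and> c \<in> carrier R \<and> b \<in> carrier R - {\<zero>\<^bsub>R\<^esub>} \<and> d \<in> carrier R - {\<zero>\<^bsub>R\<^esub>} \<and>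
     (\<exists>u\<in>carrier R. \<exists>v\<in>carrier R.
        b \<otimes>\<^bsub>R\<^esub> u = d \<otimes>\<^bsub>R\<^esub> v \<and> b \<otimes>\<^bsub>R\<^esub> u \<noteq> \<zero>\<^bsub>R\<^esub> \<and> a \<otimes>\<^bsub>R\<^esub> u = c \<otimes>\<^bsub>R\<^esub> v)}"

definition rfrac :: "'a ring \<Rightarrow> 'a \<Rightarrow> 'a \<Rightarrow> ('a \<times> 'a) set" where
  "rfrac R a b = ore_rel R `` {(a, b)}"

definition ore_add :: "'a ring \<Rightarrow> ('a \<times> 'a) set \<Rightarrow> ('a \<times> 'a) set \<Rightarrow> ('a \<times> 'a) set" where
  "ore_add R S T = \<Union>{rfrac R (a \<otimes>\<^bsub>R\<^esub> u \<oplus>\<^bsub>R\<^esub> c \<otimes>\<^bsub>R\<^esub> v) (b \<otimes>\<^bsub>R\<^esub> u) |a b c d u v.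
     (a, b) \<in> S \<and> (c, d) \<in> T \<and> u \<in> carrier R \<and> v \<in> carrier R \<and>
     b \<otimes>\<^bsub>R\<^esub> u = d \<otimes>\<^bsub>R\<^esub> v \<and> b \<otimes>\<^bsub>R\<^esub> u \<noteq> \<zero>\<^bsub>R\<^esub>}"

definition ore_mult :: "'a ring \<Rightarrow> ('a \<times> 'a) set \<Rightarrow> ('a \<times> 'a) set \<Rightarrow> ('a \<times> 'a) set" where
  "ore_mult R S T = \<Union>{rfrac R (a \<otimes>\<^bsub>R\<^esub> u) (d \<otimes>\<^bsub>R\<^esub> v) |a b c d u v.
     (a, b) \<in> S \<and> (c, d) \<in> T \<and> u \<in> carrier R \<and> v \<in> carrier R \<and>
     b \<otimes>\<^bsub>R\<^esub> u = c \<otimes>\<^bsub>R\<^esub> v \<and> v \<noteq> \<zero>\<^bsub>R\<^esub>}"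

definition Frac :: "'a ring \<Rightarrow> ('a \<times> 'a) set ring" where
  "Frac R = \<lparr>carrier = (carrier R \<times> (carrier R - {\<zero>\<^bsub>R\<^esub>})) // ore_rel R,
             mult = ore_mult R, one = rfrac R \<one>\<^bsub>R\<^esub> \<one>\<^bsub>R\<^esub>,
             zero = rfrac R \<zero>\<^bsub>R\<^esub> \<one>\<^bsub>R\<^esub>, add = ore_add R\<rparr>"

type_synonym qfrac = "(qtorus \<times> qtorus) set"

definition to_Frac :: "quiver \<Rightarrow> qtorus \<Rightarrow> qfrac" where
  "to_Frac Q f = rfrac (torus Q) f \<one>\<^bsub>torus Q\<^esub>"


section \<open>Mutations\<close>

definition mu_lat :: "quiver \<Rightarrow> 7 \<Rightarrow> weight \<Rightarrow> weight" where
  "mu_lat Q k v = (\<chi> i. if i = k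
     then - v $ k + (\<Sum>j\<in>UNIV - {k}. of_int (max (Q j k) 0) * v $ j) else v $ i)"

lemma mu_lat_ebas:
  "mu_lat Q k (ebas k) = - ebas k"
  "i \<noteq> k \<Longrightarrow> mu_lat Q k (ebas i) = ebas i + of_int (max (Q i k) 0) *s ebas k"
proof -
  have "(\<Sum>j\<in>UNIV - {k}. of_int (max (Q j k) 0) * ebas i $ j) =
        (\<Sum>j\<in>UNIV - {k}. if j = i then of_int (max (Q j k) 0) else (0::rat))" for i
    by (intro sum.cong refl) (auto simp: ebas_def axis_def)
  then have *: "(\<Sum>j\<in>UNIV - {k}. of_int (max (Q j k) 0) * ebas i $ j) =
        (if i = k then 0 else of_int (max (Q i k) 0) :: rat)" for i
    by simp
  show "mu_lat Q k (ebas k) = - ebas k"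
    unfolding vec_eq_iff mu_lat_def * by (simp add: ebas_def axis_def)
  show "mu_lat Q k (ebas i) = ebas i + of_int (max (Q i k) 0) *s ebas k" if "i \<noteq> k"
    unfolding vec_eq_iff mu_lat_def * using that by (simp add: ebas_def axis_def)
qed

definition mutate :: "quiver \<Rightarrow> 7 \<Rightarrow> quiver" where
  "mutate Q k = (THE Q'. \<forall>v w. form Q' (mu_lat Q k v) (mu_lat Q k w) = form Q v w)"

lemma form_axis: "form Q (axis i 1) (axis j 1) = of_int (Q i j)"
proof -
  have "form Q (axis i 1) (axis j 1) =
    (\<Sum>a\<in>UNIV. \<Sum>b\<in>UNIV. if b = j then (if a = i then of_int (Q a b) else 0) else 0)"
    unfolding form_def by (intro sum.cong refl) (auto simp: axis_def)
  then show ?thesis by simp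
qed

lemma form_add_left: "form Q (v + v') w = form Q v w + form Q v' w"
  by (simp add: form_def algebra_simps sum.distrib)

lemma form_add_right: "form Q v (w + w') = form Q v w + form Q v w'"
  by (simp add: form_def algebra_simps sum.distrib)

lemma form_scale_left: "form Q (a *s v) w = a * form Q v w"
  by (simp add: form_def sum_distrib_left algebra_simps)

lemma form_scale_right: "form Q v (a *s w) = a * form Q v w"
  by (simp add: form_def sum_distrib_left algebra_simps)

lemma form_axis_left: "form Q (axis k 1) w = (\<Sum>j\<in>UNIV. of_int (Q k j) * w $ j)"
proof -
  have "form Q (axis k 1) w =
    (\<Sum>a\<in>UNIV. if a = k then (\<Sum>b\<in>UNIV. of_int (Q a b) * w $ b) else 0)"
    unfolding form_def by (intro sum.cong refl) (auto simp: axis_def)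
  then show ?thesis by simp
qed

lemma form_axis_right: "form Q v (axis k 1) = (\<Sum>i\<in>UNIV. of_int (Q i k) * v $ i)"
proof -
  have "form Q v (axis k 1) = (\<Sum>b\<in>UNIV. \<Sum>a\<in>UNIV. of_int (Q a b) * v $ a * axis k 1 $ b)"
    unfolding form_def by (rule sum.swap)
  also have "\<dots> = (\<Sum>b\<in>UNIV. if b = k then (\<Sum>a\<in>UNIV. of_int (Q a b) * v $ a) else 0)"
    by (intro sum.cong refl) (auto simp: axis_def)
  finally show ?thesis by simp
qed

lemma mu_lat_involution: "mu_lat Q k (mu_lat Q k v) = v"
proof -
  have "(\<Sum>j\<in>UNIV - {k}. of_int (max (Q j k) 0) * mu_lat Q k v $ j) =
        (\<Sum>j\<in>UNIV - {k}. of_int (max (Q j k) 0) * v $ j)"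
    by (intro sum.cong refl) (simp add: mu_lat_def)
  then show ?thesis
    by (simp add: vec_eq_iff mu_lat_def)
qed

lemma mutate_isometry_formula:
  fixes Q :: quiver and k :: 7
  assumes skew: "\<And>i j. Q i j = - Q j i"
  defines "Q' \<equiv> (\<lambda>i j. if i = k \<or> j = k then - Q i j
                   else Q i j + max (Q i k) 0 * Q k j + max (Q j k) 0 * Q i k)"
  shows "form Q' (mu_lat Q k v) (mu_lat Q k w) = form Q v w"
proof -
  have Qkk: "Q i i = 0" for i using skew[of i i] by simp
  define S where "S v = (\<Sum>j\<in>UNIV. of_int (max (Q j k) 0) * v $ j)" for v :: weight
  have mu: "mu_lat Q k v = v + (S v - 2 * v $ k) *s axis k 1" for v
  proof -
    have "S v = (\<Sum>j\<in>UNIV - {k}. of_int (max (Q j k) 0) * v $ j)"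
      unfolding S_def by (subst sum.remove[of _ k]) (auto simp: Qkk)
    then show ?thesis
      by (simp add: vec_eq_iff mu_lat_def axis_def)
  qed
  have Q': "of_int (Q' i j) = (of_int (Q i j) + of_int (max (Q i k) 0) * of_int (Q k j)
        + of_int (max (Q j k) 0) * of_int (Q i k)
        - (if i = k then 2 * of_int (Q k j) else 0)
        - (if j = k then 2 * of_int (Q i k) else 0) :: rat)" for i j
    by (auto simp: Q'_def Qkk)
  have form': "form Q' v w = form Q v w + S v * form Q (axis k 1) w + S w * form Q v (axis k 1)
      - 2 * v $ k * form Q (axis k 1) w - 2 * w $ k * form Q v (axis k 1)" for v w
  proof -
    have "form Q' v w = (\<Sum>i\<in>UNIV. \<Sum>j\<in>UNIV. of_int (Q i j) * v $ i * w $ j)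
        + (\<Sum>i\<in>UNIV. \<Sum>j\<in>UNIV. (of_int (max (Q i k) 0) * v $ i) * (of_int (Q k j) * w $ j))
        + (\<Sum>i\<in>UNIV. \<Sum>j\<in>UNIV. (of_int (Q i k) * v $ i) * (of_int (max (Q j k) 0) * w $ j))
        - (\<Sum>i\<in>UNIV. \<Sum>j\<in>UNIV. (if i = k then 2 * v $ i else 0) * (of_int (Q k j) * w $ j))
        - (\<Sum>i\<in>UNIV. \<Sum>j\<in>UNIV. (of_int (Q i k) * v $ i) * (if j = k then 2 * w $ j else 0))"
      unfolding form_def Q' sum.distrib[symmetric] sum_subtractf[symmetric]
      by (intro sum.cong refl) (simp add: algebra_simps)
    also have "\<dots> = form Q v w + S v * form Q (axis k 1) w + form Q v (axis k 1) * S w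
        - 2 * v $ k * form Q (axis k 1) w - form Q v (axis k 1) * (2 * w $ k)"
      unfolding sum_product[symmetric] form_axis_left form_axis_right S_def
      by (simp add: form_def[of Q v w])
    finally show ?thesis by (simp add: algebra_simps)
  qed
  have kk: "form Q (axis k 1) (axis k 1) = 0"
    by (simp add: form_axis Qkk)
  have f1: "form Q' v w = form Q (mu_lat Q k v) (mu_lat Q k w)" for v w
    unfolding form' mu form_add_left form_add_right form_scale_left form_scale_right kk
    by (simp add: algebra_simps)
  show ?thesis
    by (simp add: f1 mu_lat_involution)
qed

lemma mutate_eq:
  assumes skew: "\<And>i j. Q i j = - Q j i"
  shows "mutate Q k = (\<lambda>i j. if i = k \<or> j = k then - Q i j
            else Q i j + max (Q i k) 0 * Q k j + max (Q j k) 0 * Q i k)"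
    (is "_ = ?Q'")
  unfolding mutate_def
proof (rule the_equality)
  show "\<forall>v w. form ?Q' (mu_lat Q k v) (mu_lat Q k w) = form Q v w"
    using mutate_isometry_formula[of Q, OF skew] by blast
next
  fix R assume R: "\<forall>v w. form R (mu_lat Q k v) (mu_lat Q k w) = form Q v w"
  have "form R v w = form ?Q' v w" for v w
    using R[rule_format, of "mu_lat Q k v" "mu_lat Q k w"]
      mutate_isometry_formula[of Q, OF skew, of k "mu_lat Q k v" "mu_lat Q k w"]
    unfolding mu_lat_involution by (rule trans[OF _ sym])
  from this[of "axis i 1" "axis j 1" for i j]
  have "R i j = ?Q' i j" for i j
    unfolding form_axis of_int_eq_iff .
  then show "R = ?Q'"
    by (intro ext)
qed

lemma mutate_isometry:
  assumes "\<And>i j. Q i j = - Q j i"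
  shows "form (mutate Q k) (mu_lat Q k v) (mu_lat Q k w) = form Q v w"
  unfolding mutate_eq[of Q, OF assms] by (rule mutate_isometry_formula[of Q, OF assms])

text \<open>
  The quantum dilogarithm, for complex \<open>q\<close> with \<open>\<bar>q\<bar> < 1\<close>. It is not itself an element of the
  quantum torus, but \<open>Y\<^sub>k Y\<^sub>u = q\<^sup>-\<^sup>2\<^sup>n Y\<^sub>u Y\<^sub>k\<close> with \<open>n = (e\<^sub>k, u)\<close> (lemma \<open>Y_commute\<close>) gives
  \<open>\<Psi>\<^sub>q(Y\<^sub>k) Y\<^sub>u \<Psi>\<^sub>q(Y\<^sub>k)\<^sup>-\<^sup>1 = Y\<^sub>u \<Psi>\<^sub>q(q\<^sup>-\<^sup>2\<^sup>n Y\<^sub>k) / \<Psi>\<^sub>q(Y\<^sub>k)\<close>, and that quotient is a polynomial or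
  the inverse of a polynomial in \<open>Y\<^sub>k\<close> by the functional equation (lemmas \<open>qdilog_ratio_pos\<close>,
  \<open>qdilog_ratio_neg\<close>). \<open>Ad_Psi\<close> is the resulting fraction.
\<close>

definition qdilog :: "complex \<Rightarrow> complex \<Rightarrow> complex" where
  "qdilog q y = inverse (prodinf (\<lambda>m. 1 + q ^ (2 * m + 1) * y))"

lemma qdilog_shift:
  assumes "norm q < 1" "\<And>m. 1 + q ^ (2 * m + 1) * y \<noteq> 0"
  shows "qdilog q (q ^ 2 * y) = (1 + q * y) * qdilog q y"
proof -
  define f where "f m = 1 + q ^ (2 * m + 1) * y" for m
  have "norm (q ^ 2) < 1"
    using assms(1) by (simp add: norm_power power_less_one_iff)
  then have "summable (\<lambda>m. norm (q * y) * norm (q ^ 2) ^ m)"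
    by (intro summable_mult summable_geometric) auto
  moreover have "norm (f m - 1) = norm (q * y) * norm (q ^ 2) ^ m" for m
    by (simp add: f_def norm_mult norm_power mult_ac flip: power_mult)
  ultimately have "convergent_prod f"
    by (intro abs_convergent_prod_imp_convergent_prod summable_imp_abs_convergent_prod) simp
  moreover have f0: "f 0 = 1 + q * y" "f 0 \<noteq> 0"
    using assms(2)[of 0] by (simp_all add: f_def)
  ultimately have "prodinf (\<lambda>m. f (Suc m)) = prodinf f / f 0"
    by (intro prodinf_split_head)
  moreover have "(\<lambda>m. f (Suc m)) = (\<lambda>m. 1 + q ^ (2 * m + 1) * (q ^ 2 * y))"
    by (simp add: f_def fun_eq_iff power2_eq_square mult_ac)
  then have "qdilog q (q ^ 2 * y) = inverse (prodinf (\<lambda>m. f (Suc m)))"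
    unfolding qdilog_def by simp
  moreover have "qdilog q y = inverse (prodinf f)"
    unfolding qdilog_def f_def ..
  ultimately show ?thesis
    unfolding f0(1) by (simp only: divide_inverse inverse_mult_distrib inverse_inverse_eq mult.commute)
qed

lemma qdilog_functional_equation:
  assumes "norm q < 1" "q \<noteq> 0" "\<And>m. 1 + q ^ (2 * m) * y \<noteq> 0"
  shows "qdilog q (q * y) = (1 + y) * qdilog q (inverse q * y)"
proof -
  have "q ^ (2 * m + 1) * (inverse q * y) = q ^ (2 * m) * y" for m
    using assms(2) by simp
  then have "qdilog q (q ^ 2 * (inverse q * y)) = (1 + q * (inverse q * y)) * qdilog q (inverse q * y)"
    using assms(1,3) by (intro qdilog_shift) metis+
  moreover have "q ^ 2 * (inverse q * y) = q * y" "q * (inverse q * y) = y"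
    using assms(2) by (simp_all add: power2_eq_square)
  ultimately show ?thesis
    by simp
qed

lemma qdilog_ratio_pos:
  assumes "norm q < 1" "\<And>m. 1 + q ^ (2 * m + 1) * y \<noteq> 0"
  shows "qdilog q (q ^ (2 * n) * y) = (\<Prod>j<n. 1 + q ^ (2 * j + 1) * y) * qdilog q y"
proof (induction n)
  case (Suc n)
  have "1 + q ^ (2 * m + 1) * (q ^ (2 * n) * y) \<noteq> 0" for m
    using assms(2)[of "m + n"] by (simp add: power_add mult_ac distrib_left)
  then have "qdilog q (q ^ 2 * (q ^ (2 * n) * y)) = (1 + q * (q ^ (2 * n) * y)) * qdilog q (q ^ (2 * n) * y)"
    by (intro qdilog_shift assms) auto
  moreover have "q ^ (2 * Suc n) * y = q ^ 2 * (q ^ (2 * n) * y)"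
    by (simp add: power2_eq_square mult_ac)
  ultimately show ?case
    by (simp only: Suc prod.lessThan_Suc) (simp add: mult_ac)
qed simp

lemma qdilog_ratio_neg:
  assumes "norm q < 1" "q \<noteq> 0" "\<And>m. 1 + q powi (2 * int m + 1 - 2 * int n) * y \<noteq> 0"
  shows "qdilog q (q powi (- 2 * int n) * y) * (\<Prod>j<n. 1 + q powi (- (2 * int j + 1)) * y) = qdilog q y"
proof -
  define z where "z = q powi (- 2 * int n) * y"
  have pw: "q ^ m * z = q powi (int m - 2 * int n) * y" for m
    using assms(2) by (simp add: z_def power_int_diff power_int_minus divide_inverse)
  have nz: "1 + q ^ (2 * m + 1) * z \<noteq> 0" for m
    unfolding pw using assms(3)[of m] by (simp add: algebra_simps)
  have "y = q ^ (2 * n) * z"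
    unfolding pw by simp
  then have "qdilog q y = (\<Prod>j<n. 1 + q ^ (2 * j + 1) * z) * qdilog q z"
    using qdilog_ratio_pos[OF assms(1) nz, of n] by simp
  also have "(\<Prod>j<n. 1 + q ^ (2 * j + 1) * z) = (\<Prod>j<n. 1 + q ^ (2 * (n - Suc j) + 1) * z)"
    by (rule prod.nat_diff_reindex[symmetric])
  also have "\<dots> = (\<Prod>j<n. 1 + q powi (- (2 * int j + 1)) * y)"
    unfolding pw by (intro prod.cong refl) (simp add: of_nat_diff algebra_simps)
  finally show ?thesis
    by (simp add: z_def mult_ac)
qed

lemma Y_commute:
  assumes "\<And>i j. Q i j = - Q j i" "2 * form Q v w \<in> \<int>"
  shows "Y v \<otimes>\<^bsub>torus Q\<^esub> Y w =
    qt_const (qpow (- 2 * form Q v w)) \<otimes>\<^bsub>torus Q\<^esub> (Y w \<otimes>\<^bsub>torus Q\<^esub> Y v)"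
proof -
  have skew: "form Q w v = - form Q v w"
  proof -
    have swap: "of_int (Q i j) * w $ i * v $ j = - (of_int (Q j i) * v $ j * w $ i)" for i j
      by (subst assms(1)) simp
    have "form Q w v = (\<Sum>j\<in>UNIV. \<Sum>i\<in>UNIV. of_int (Q i j) * w $ i * v $ j)"
      unfolding form_def by (rule sum.swap)
    also have "\<dots> = (\<Sum>j\<in>UNIV. \<Sum>i\<in>UNIV. - (of_int (Q j i) * v $ j * w $ i))"
      by (simp only: swap)
    finally show ?thesis by (simp add: form_def sum_negf)
  qed
  obtain n where n: "2 * form Q v w = of_int n"
    using assms(2) by (auto elim: Ints_cases)
  have half: "qpow (of_int m / 2) = Poly_Mapping.single m 1" for m
    by (simp add: qpow_def)
  have "- form Q v w = of_int (- n) / 2" "- 2 * form Q v w = of_int (- 2 * n) / 2"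
    "form Q v w = of_int n / 2"
    using n by auto
  then have pow: "qpow (- 2 * form Q v w) * qpow (form Q v w) = qpow (- form Q v w)"
    by (simp only: half mult_single) simp
  have nz: "qpow r \<noteq> 0" for r
    by (simp add: qpow_def)
  have YY: "Y a \<otimes>\<^bsub>torus Q\<^esub> Y b = Poly_Mapping.single (a + b) (qpow (- form Q a b))" for a b
    by (simp add: torus_def qt_mult_def Y_def)
  have cY: "qt_const r \<otimes>\<^bsub>torus Q\<^esub> Poly_Mapping.single a s = Poly_Mapping.single a (r * s)"
    if "r \<noteq> 0" "s \<noteq> 0" for r s a
    using that by (simp add: torus_def qt_mult_def qt_const_def form_def qpow_def)
  have "qt_const (qpow (- 2 * form Q v w)) \<otimes>\<^bsub>torus Q\<^esub> (Y w \<otimes>\<^bsub>torus Q\<^esub> Y v)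
      = Poly_Mapping.single (w + v) (qpow (- 2 * form Q v w) * qpow (form Q v w))"
    by (simp only: YY cY nz skew minus_minus not_False_eq_True)
  also have "\<dots> = Y v \<otimes>\<^bsub>torus Q\<^esub> Y w"
    unfolding YY pow by (simp only: add.commute[of w v])
  finally show ?thesis
    by (rule sym)
qed

text \<open>\<open>qt_prod Q k s n\<close> is \<open>\<Prod>\<^sub>j\<^sub><\<^sub>n (1 + q\<^sup>s\<^sup>(\<^sup>2\<^sup>j\<^sup>+\<^sup>1\<^sup>) Y\<^sub>k)\<close>; the factors commute.\<close>

primrec qt_prod :: "quiver \<Rightarrow> 7 \<Rightarrow> int \<Rightarrow> nat \<Rightarrow> qtorus" where
  "qt_prod Q k s 0 = Y 0"
| "qt_prod Q k s (Suc n) = qt_mult Q (qt_prod Q k s n)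
     (Y 0 + qt_mult Q (qt_const (qpow (of_int (s * (2 * int n + 1))))) (Y (ebas k)))"

definition Ad_Psi :: "quiver \<Rightarrow> 7 \<Rightarrow> weight \<Rightarrow> qfrac" where
  "Ad_Psi Q k u = (let n = \<lfloor>form Q (ebas k) u\<rfloor> in
     if n \<le> 0 then to_Frac Q (qt_mult Q (Y u) (qt_prod Q k 1 (nat (- n))))
     else rfrac (torus Q) (Y u) (qt_prod Q k (- 1) (nat n)))"

text \<open>The quantum mutation is \<open>\<int>[q\<^sup>\<plusminus>\<^sup>1\<^sup>/\<^sup>2]\<close>-linear, and is pinned down by its values on the \<open>Y\<^sub>v\<close>.\<close>

definition qmut :: "quiver \<Rightarrow> 7 \<Rightarrow> qfrac \<Rightarrow> qfrac" where
  "qmut Q k = (THE \<phi>.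
     \<phi> \<in> ring_iso (Frac (torus Q)) (Frac (torus (mutate Q k))) \<and>
     \<phi> \<in> extensional (carrier (Frac (torus Q))) \<and>
     (\<forall>r. \<phi> (to_Frac Q (qt_const r)) = to_Frac (mutate Q k) (qt_const r)) \<and>
     (\<forall>v\<in>Lat_tilde Q. \<phi> (to_Frac Q (Y v)) = Ad_Psi (mutate Q k) k (mu_lat Q k v)))"

text \<open>Sequences of mutations are lists, the head being performed first.\<close>

primrec mutate_seq :: "7 list \<Rightarrow> quiver \<Rightarrow> quiver" where
  "mutate_seq [] Q = Q"
| "mutate_seq (k # ks) Q = mutate_seq ks (mutate Q k)"

primrec qmut_seq :: "7 list \<Rightarrow> quiver \<Rightarrow> qfrac \<Rightarrow> qfrac" where
  "qmut_seq [] Q = id"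
| "qmut_seq (k # ks) Q = qmut_seq ks (mutate Q k) \<circ> qmut Q k"

definition laurent_set :: "quiver \<Rightarrow> qtorus set" where
  "laurent_set Q = {f \<in> carrier (torus Q). \<forall>ks.
     qmut_seq ks Q (to_Frac Q f) \<in> to_Frac (mutate_seq ks Q) ` carrier (torus (mutate_seq ks Q))}"

definition perm_lat :: "(7 \<Rightarrow> 7) \<Rightarrow> weight \<Rightarrow> weight" where
  "perm_lat \<pi> v = (\<Sum>i\<in>UNIV. v $ i *s ebas (\<pi> i))"

definition perm_torus :: "(7 \<Rightarrow> 7) \<Rightarrow> qtorus \<Rightarrow> qtorus" where
  "perm_torus \<pi> f = (\<Sum>v\<in>Poly_Mapping.keys f.
     Poly_Mapping.single (perm_lat \<pi> v) (Poly_Mapping.lookup f v))"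

definition perm_Frac :: "(7 \<Rightarrow> 7) \<Rightarrow> qfrac \<Rightarrow> qfrac" where
  "perm_Frac \<pi> S = map_prod (perm_torus \<pi>) (perm_torus \<pi>) ` S"

text \<open>
  The composite of the mutations \<open>ks\<close> followed by the permutation \<open>\<pi>\<close>, as a map of the universally
  Laurent algebra; it is only used when the composite returns to the quiver \<open>Q\<close>.
\<close>

definition cluster_map :: "quiver \<Rightarrow> (7 \<Rightarrow> 7) \<Rightarrow> 7 list \<Rightarrow> qtorus \<Rightarrow> qtorus" where
  "cluster_map Q \<pi> ks f = (THE g. g \<in> carrier (torus Q) \<and>
     to_Frac Q g = perm_Frac \<pi> (qmut_seq ks Q (to_Frac Q f)))"


section \<open>The quiver \<open>X\<^sub>7\<close>\<close>

definition quiver_of_arrows :: "(7 \<times> 7) list \<Rightarrow> quiver" where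
  "quiver_of_arrows as i j = int (count_list as (i, j)) - int (count_list as (j, i))"

definition X7 :: quiver where
  "X7 = quiver_of_arrows
     [(2, 1), (2, 1), (4, 3), (4, 3), (6, 5), (6, 5),
      (7, 2), (7, 4), (7, 6), (1, 7), (3, 7), (5, 7)]"

abbreviation L7 :: "qtorus set" where
  "L7 \<equiv> laurent_set X7"

definition Lhat :: "qtorus ring" where
  "Lhat = (torus X7)\<lparr>carrier := L7\<rparr>"

abbreviation mult_X7 :: "qtorus \<Rightarrow> qtorus \<Rightarrow> qtorus" (infixl \<open>\<odot>\<close> 70) where
  "f \<odot> g \<equiv> qt_mult X7 f g"

definition L_B :: "nat \<Rightarrow> nat \<Rightarrow> qtorus" where
  "L_B i j =
     (if {i, j} = {1, 2} then
        Y (- (1/2) *s (ebas 5 + ebas 6)) + Y ((1/2) *s (ebas 6 - ebas 5)) + Y ((1/2) *s (ebas 5 + ebas 6))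
      else if {i, j} = {1, 3} then
        Y (- (1/2) *s (ebas 3 + ebas 4)) + Y ((1/2) *s (ebas 4 - ebas 3)) + Y ((1/2) *s (ebas 3 + ebas 4))
      else
        Y (- (1/2) *s (ebas 1 + ebas 2)) + Y ((1/2) *s (ebas 2 - ebas 1)) + Y ((1/2) *s (ebas 1 + ebas 2)))"

definition one_qY :: "7 \<Rightarrow> qtorus" where
  "one_qY i = Y 0 + qt_const (qpow 1) \<odot> Y (ebas i)"

definition L_A :: "nat \<Rightarrow> qtorus" where
  "L_A k =
     (if k = 1 then
        Y (ebas 7 + (1/2) *s (ebas 2 + ebas 1 + ebas 3 + ebas 5)) + L_B 2 3 \<odot> Y ((1/2) *s (ebas 3 + ebas 5))
        + Y (- ebas 7 - (1/2) *s (ebas 2 + ebas 1 + ebas 3 + ebas 5)) \<odot> one_qY 3 \<odot> one_qY 5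
      else if k = 2 then
        Y (ebas 7 + (1/2) *s (ebas 4 + ebas 1 + ebas 3 + ebas 5)) + L_B 1 3 \<odot> Y ((1/2) *s (ebas 1 + ebas 5))
        + Y (- ebas 7 - (1/2) *s (ebas 4 + ebas 1 + ebas 3 + ebas 5)) \<odot> one_qY 1 \<odot> one_qY 5
      else
        Y (ebas 7 + (1/2) *s (ebas 6 + ebas 1 + ebas 3 + ebas 5)) + L_B 1 2 \<odot> Y ((1/2) *s (ebas 1 + ebas 3))
        + Y (- ebas 7 - (1/2) *s (ebas 6 + ebas 1 + ebas 3 + ebas 5)) \<odot> one_qY 1 \<odot> one_qY 3)"

text \<open>Here \<open>transpose k l\<close> is the transposition of the vertices \<open>k\<close> and \<open>l\<close>.\<close>

definition tau_B :: "nat \<Rightarrow> nat \<Rightarrow> qtorus \<Rightarrow> qtorus" where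
  "tau_B i j =
     (if {i, j} = {1, 2} then inv_into L7 (cluster_map X7 (Transposition.transpose 5 6) [5])
      else if {i, j} = {1, 3} then inv_into L7 (cluster_map X7 (Transposition.transpose 3 4) [3])
      else inv_into L7 (cluster_map X7 (Transposition.transpose 1 2) [1]))"

definition sigma :: "qtorus \<Rightarrow> qtorus" where
  "sigma = cluster_map X7 (Transposition.transpose 1 5 \<circ> Transposition.transpose 3 7)
     [3, 7, 1, 5, 3, 7]"

definition tau_A :: "nat \<Rightarrow> qtorus \<Rightarrow> qtorus" where
  "tau_A k = sigma \<circ>
     (if k = 1 then tau_B 2 3 else if k = 2 then tau_B 1 3 else tau_B 1 2) \<circ>
     inv_into L7 sigma"


section \<open>Base change\<close>

text \<open>
  Let a commutative ring \<open>R\<close> map to \<open>K\<close> by \<open>\<phi>\<close> and act on an \<open>R\<close>-algebra \<open>M\<close> by \<open>act\<close>. The tensor product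
  \<open>K \<otimes>\<^sub>R M\<close> is the quotient of the free abelian group on \<open>K \<times> M\<close> by the biadditive and
  \<open>R\<close>-balanced relations; that group is the monoid ring of \<open>K \<times> M\<close>, in which these relations
  span an ideal, so that the quotient carries the product
  \<open>(k \<otimes> m)(k' \<otimes> m') = kk' \<otimes> mm'\<close>.
\<close>

definition tensor_free :: "'m ring \<Rightarrow> (('k::field \<times> 'm) \<Rightarrow>\<^sub>0 int) ring" where
  "tensor_free M = \<lparr>carrier = {F. Poly_Mapping.keys F \<subseteq> UNIV \<times> carrier M},
     mult = (\<lambda>F G. \<Sum>(k, m)\<in>Poly_Mapping.keys F. \<Sum>(k', m')\<in>Poly_Mapping.keys G.
       Poly_Mapping.single (k * k', m \<otimes>\<^bsub>M\<^esub> m')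
         (Poly_Mapping.lookup F (k, m) * Poly_Mapping.lookup G (k', m'))),
     one = Poly_Mapping.single (1, \<one>\<^bsub>M\<^esub>) 1, zero = 0, add = (+)\<rparr>"

inductive_set tensor_rel :: "'m ring \<Rightarrow> ('r \<Rightarrow> 'k) \<Rightarrow> ('r \<Rightarrow> 'm \<Rightarrow> 'm) \<Rightarrow> (('k::field \<times> 'm) \<Rightarrow>\<^sub>0 int) set"
  for M :: "'m ring" and \<phi> :: "'r \<Rightarrow> 'k::field" and act :: "'r \<Rightarrow> 'm \<Rightarrow> 'm" where
  zero: "0 \<in> tensor_rel M \<phi> act"
| diff: "F \<in> tensor_rel M \<phi> act \<Longrightarrow> G \<in> tensor_rel M \<phi> act \<Longrightarrow> F - G \<in> tensor_rel M \<phi> act"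
| add_left: "m \<in> carrier M \<Longrightarrow>
    Poly_Mapping.single (k + k', m) 1 - Poly_Mapping.single (k, m) 1
      - Poly_Mapping.single (k', m) 1 \<in> tensor_rel M \<phi> act"
| add_right: "m \<in> carrier M \<Longrightarrow> m' \<in> carrier M \<Longrightarrow>
    Poly_Mapping.single (k, m \<oplus>\<^bsub>M\<^esub> m') 1 - Poly_Mapping.single (k, m) 1
      - Poly_Mapping.single (k, m') 1 \<in> tensor_rel M \<phi> act"
| balanced: "m \<in> carrier M \<Longrightarrow>
    Poly_Mapping.single (k * \<phi> r, m) 1 - Poly_Mapping.single (k, act r m) 1 \<in> tensor_rel M \<phi> act"

text \<open>\<open>\<int>[q\<^sup>\<plusminus>\<^sup>1\<^sup>/\<^sup>2, t\<^sup>\<plusminus>\<^sup>1]\<close>: Laurent polynomials in \<open>t\<close> over \<open>\<int>[q\<^sup>\<plusminus>\<^sup>1\<^sup>/\<^sup>2]\<close>.\<close>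

type_synonym qtlaurent = "int \<Rightarrow>\<^sub>0 qlaurent"

definition qlaurent_to_K :: "qlaurent \<Rightarrow> scalar" where
  "qlaurent_to_K r = (\<Sum>n\<in>Poly_Mapping.keys r. of_int (Poly_Mapping.lookup r n) * qh powi n)"

definition qtlaurent_to_K :: "qtlaurent \<Rightarrow> scalar" where
  "qtlaurent_to_K r = (\<Sum>n\<in>Poly_Mapping.keys r. qlaurent_to_K (Poly_Mapping.lookup r n) * tt powi n)"

definition c7 :: weight where
  "c7 = ebas 7 + (1/2) *s (ebas 1 + ebas 2 + ebas 3 + ebas 4 + ebas 5 + ebas 6)"

definition t_image :: qtorus where
  "t_image = qt_const (- qpow 1) \<odot> Y (- c7)"

definition qtlaurent_act :: "qtlaurent \<Rightarrow> qtorus \<Rightarrow> qtorus" where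
  "qtlaurent_act r f = (\<Sum>n\<in>Poly_Mapping.keys r.
     qt_const (Poly_Mapping.lookup r n) \<odot> (t_image [^]\<^bsub>torus X7\<^esub> n)) \<odot> f"

definition LK_free :: "((scalar \<times> qtorus) \<Rightarrow>\<^sub>0 int) ring" where
  "LK_free = tensor_free Lhat"

definition LK_rel :: "((scalar \<times> qtorus) \<Rightarrow>\<^sub>0 int) set" where
  "LK_rel = tensor_rel Lhat qtlaurent_to_K qtlaurent_act"

definition Lhat_K :: "((scalar \<times> qtorus) \<Rightarrow>\<^sub>0 int) set ring" where
  "Lhat_K = LK_free Quot LK_rel"

definition tensor :: "scalar \<Rightarrow> qtorus \<Rightarrow> ((scalar \<times> qtorus) \<Rightarrow>\<^sub>0 int) set" where
  "tensor k f = LK_rel +>\<^bsub>LK_free\<^esub> Poly_Mapping.single (k, f) 1"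

text \<open>The \<open>K\<close>-linear extension \<open>k \<otimes> f \<mapsto> k \<otimes> \<tau> f\<close> of a map \<open>\<tau>\<close>, on cosets.\<close>

definition K_extend ::
  "(qtorus \<Rightarrow> qtorus) \<Rightarrow> ((scalar \<times> qtorus) \<Rightarrow>\<^sub>0 int) set \<Rightarrow> ((scalar \<times> qtorus) \<Rightarrow>\<^sub>0 int) set" where
  "K_extend \<tau> S = (\<Union>F\<in>S. LK_rel +>\<^bsub>LK_free\<^esub>
     (\<Sum>(k, f)\<in>Poly_Mapping.keys F.
        Poly_Mapping.single (k, \<tau> f) (Poly_Mapping.lookup F (k, f))))"

end

theory Submission
  imports Defs "HOL-Real_Asymp.Real_Asymp"
begin

text \<open>
  Let \<open>h\<^sub>n(x)\<close> be the continuous \<open>q\<close>-Hermite polynomials, given by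
  \<open>(1 - q\<^sup>2\<^sup>(\<^sup>n\<^sup>+\<^sup>1\<^sup>)) h\<^sub>n\<^sub>+\<^sub>1 = (x + x\<^sup>-\<^sup>1) h\<^sub>n - h\<^sub>n\<^sub>-\<^sub>1\<close>. In the family of the products
  \<open>H\<^sub>a\<^sub>b\<^sub>c = h\<^sub>a(x\<^sub>2\<^sub>3) h\<^sub>b(x\<^sub>1\<^sub>3) h\<^sub>c(x\<^sub>1\<^sub>2)\<close>, both \<open>O\<^sub>B\<close> and \<open>O\<^sub>A\<close> become combinations of index
  shifts with coefficients monomial in \<open>q\<^sup>a, q\<^sup>b, q\<^sup>c\<close>. These index operators form a quantum torus, on
  which \<open>Y\<^sub>v\<close> acts by a shift and a monomial, and \<open>O\<^sub>A, O\<^sub>B\<close> are the images of \<open>L\<^sub>A, L\<^sub>B\<close>.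
  So \<open>\<iota> D\<close> can be taken to be the set of all \<open>F\<close> in the base change that act on the family as \<open>D\<close> does.
  It is a single coset and determines \<open>D\<close> because both actions are faithful: the \<open>H\<^sub>a\<^sub>b\<^sub>c\<close> are
  simultaneous eigenvectors with distinct eigenvalues, and distinct automorphisms of a field are
  linearly independent.

  On the cluster side, an element of the torus is universally Laurent as soon as it remains Laurent
  under each single mutation, so that membership in \<open>L7\<close> is a finite computation, as are the values of
  \<open>\<sigma>\<close> and of the inverse twists on the generators. The twists themselves are then given by the cubic
  relation \<open>B\<^sup>2A - (q + q\<^sup>-\<^sup>1) BAB + AB\<^sup>2 = - (q - q\<^sup>-\<^sup>1)\<^sup>2 A\<close>.
\<close>

text \<open>Mutations are given by definite descriptions on skew fields of fractions, so these
  fields must exist first: the torus is shown to be an Ore domain by counting coefficients, and a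
  mutation is built on torus elements over an explicit common denominator before it is extended to
  fractions.

  \<open>\<Psi>\<^sub>q\<close> is an infinite product. Finite windows of it serve as denominators;
  to compare Laurentness in a direction j before and after mutating at k, a truncated series is
  used, slice by slice in the k-th coordinate.

  That faithfulness survives the base change is not formal. It does because the coefficients of an
  element of \<open>Lhat\<close>, once Y_c is set to -q/t, lie in the image of the Laurent ring, so
  that the terms of a relation can be eliminated one at a time.

  Operators act on the values of the family and the torus on its indices. The two commute, which is
  why products keep their order. With h_n = 0 for n < 0 the recurrence holds for all integers, but
  the products are independent only for nonnegative indices, so coefficients are compared at large
  ones.\<close>

abbreviation (input) "keys \<equiv> Poly_Mapping.keys"
abbreviation (input) "lookup \<equiv> Poly_Mapping.lookup"
abbreviation (input) "single \<equiv> Poly_Mapping.single"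

subsection \<open>Skew fields of fractions of Ore domains\<close>

lemma (in Group.monoid) inv_mult_Units:
  assumes "x \<in> Units G" "y \<in> Units G"
  shows "inv (x \<otimes> y) = inv y \<otimes> inv x"
proof (rule inv_unique'[symmetric])
  have C: "x \<in> carrier G" "y \<in> carrier G" "inv x \<in> carrier G" "inv y \<in> carrier G"
    using assms by auto
  have "x \<otimes> y \<otimes> (inv y \<otimes> inv x) = x \<otimes> (y \<otimes> inv y) \<otimes> inv x"
    using C by (simp only: m_assoc m_closed)
  then show "x \<otimes> y \<otimes> (inv y \<otimes> inv x) = \<one>"
    using assms C by simp
  have "inv y \<otimes> inv x \<otimes> (x \<otimes> y) = inv y \<otimes> (inv x \<otimes> x) \<otimes> y"
    using C by (simp only: m_assoc m_closed)
  then show "inv y \<otimes> inv x \<otimes> (x \<otimes> y) = \<one>"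
    using assms C by simp
qed (use assms in auto)

text \<open>Right fractions call for the right Ore condition. The numerator \<open>a\<close> may
  vanish, so just \<open>u\<close> is required to be nonzero; for nonzero \<open>a\<close> the
  cofactor \<open>v\<close> is nonzero as well.\<close>

locale ore_domain = ring R for R :: "'a ring" (structure) +
  assumes one_neq_zero: "\<one> \<noteq> \<zero>"
    and integral: "\<lbrakk>a \<in> carrier R; b \<in> carrier R; a \<otimes> b = \<zero>\<rbrakk> \<Longrightarrow> a = \<zero> \<or> b = \<zero>"
    and ore: "\<lbrakk>a \<in> carrier R; b \<in> carrier R; b \<noteq> \<zero>\<rbrakk> \<Longrightarrow>
      \<exists>u\<in>carrier R. \<exists>v\<in>carrier R. u \<noteq> \<zero> \<and> a \<otimes> u = b \<otimes> v"

locale division_ring = ring R for R :: "'a ring" (structure) +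
  assumes d_one_neq_zero: "\<one> \<noteq> \<zero>"
    and nonzero_Units: "\<lbrakk>a \<in> carrier R; a \<noteq> \<zero>\<rbrakk> \<Longrightarrow> a \<in> Units R"

context ore_domain
begin

lemma mult_nonzero [simp]:
  "\<lbrakk>a \<in> carrier R; b \<in> carrier R; a \<noteq> \<zero>; b \<noteq> \<zero>\<rbrakk> \<Longrightarrow> a \<otimes> b \<noteq> \<zero>"
  using integral by blast

lemma lcancel:
  assumes "a \<in> carrier R" "x \<in> carrier R" "y \<in> carrier R" "a \<noteq> \<zero>" "a \<otimes> x = a \<otimes> y"
  shows "x = y"
proof -
  have "a \<otimes> (x \<ominus> y) = \<zero>"
    using assms by (simp add: a_minus_def r_distr r_minus r_neg)
  then have "x \<ominus> y = \<zero>"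
    using integral[of a "x \<ominus> y"] assms by auto
  then show ?thesis
    using assms by (metis a_minus_def minus_equality minus_minus a_inv_closed a_comm)
qed

lemma rcancel:
  assumes "a \<in> carrier R" "x \<in> carrier R" "y \<in> carrier R" "a \<noteq> \<zero>" "x \<otimes> a = y \<otimes> a"
  shows "x = y"
proof -
  have "(x \<ominus> y) \<otimes> a = \<zero>"
    using assms by (simp add: a_minus_def l_distr l_minus r_neg)
  then have "x \<ominus> y = \<zero>"
    using integral[of "x \<ominus> y" a] assms by auto
  then show ?thesis
    using assms by (metis a_minus_def minus_equality minus_minus a_inv_closed a_comm)
qed

lemma ore_both:
  assumes "a \<in> carrier R" "b \<in> carrier R" "a \<noteq> \<zero>" "b \<noteq> \<zero>"
  obtains u v where "u \<in> carrier R" "v \<in> carrier R" "u \<noteq> \<zero>" "v \<noteq> \<zero>" "a \<otimes> u = b \<otimes> v"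
proof -
  obtain u v where uv: "u \<in> carrier R" "v \<in> carrier R" "u \<noteq> \<zero>" "a \<otimes> u = b \<otimes> v"
    using ore[of a b] assms by blast
  have "v \<noteq> \<zero>"
  proof
    assume "v = \<zero>"
    then have "a \<otimes> u = \<zero>" using uv assms by simp
    then show False using uv assms integral by blast
  qed
  with uv that show ?thesis by blast
qed

lemma ore_ex:
  "\<lbrakk>a \<in> carrier R; b \<in> carrier R; a \<noteq> \<zero>; b \<noteq> \<zero>\<rbrakk> \<Longrightarrow>
    \<exists>u v. u \<in> carrier R \<and> v \<in> carrier R \<and> u \<noteq> \<zero> \<and> v \<noteq> \<zero> \<and> a \<otimes> u = b \<otimes> v"
  using ore_both by metis

text \<open>One witness decides equality of fractions, and then every pair with equal denominators
  passes the same test: a common right multiple of \<open>u'\<close> and \<open>u\<close> reduces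
  the new pair to the old one, after which \<open>d\<close> and \<open>s\<close> are
  cancelled.\<close>

lemma ore_rel_cross:
  assumes "((a, b), (c, d)) \<in> ore_rel R" "u' \<in> carrier R" "v' \<in> carrier R" "b \<otimes> u' = d \<otimes> v'"
  shows "a \<otimes> u' = c \<otimes> v'"
proof -
  have C: "a \<in> carrier R" "c \<in> carrier R" "b \<in> carrier R" "d \<in> carrier R" "b \<noteq> \<zero>" "d \<noteq> \<zero>"
    using assms(1) by (auto simp: ore_rel_def)
  obtain u v where uv: "u \<in> carrier R" "v \<in> carrier R" "b \<otimes> u = d \<otimes> v" "b \<otimes> u \<noteq> \<zero>" "a \<otimes> u = c \<otimes> v"
    using assms(1) unfolding ore_rel_def by blast
  have "u \<noteq> \<zero>" using uv(4) C(3) by (metis r_null)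
  obtain s t where st: "s \<in> carrier R" "t \<in> carrier R" "s \<noteq> \<zero>" "u' \<otimes> s = u \<otimes> t"
    using ore[of u' u] assms uv \<open>u \<noteq> \<zero>\<close> by blast
  have "d \<otimes> (v' \<otimes> s) = d \<otimes> v' \<otimes> s"
    using C assms(2,3) st(1) by (simp add: m_assoc)
  also have "\<dots> = b \<otimes> u' \<otimes> s"
    unfolding assms(4) ..
  also have "\<dots> = b \<otimes> (u' \<otimes> s)"
    using C assms(2,3) st(1) by (simp add: m_assoc)
  also have "\<dots> = b \<otimes> u \<otimes> t"
    unfolding st(4) using C st(2) uv(1) by (simp add: m_assoc)
  also have "\<dots> = d \<otimes> (v \<otimes> t)"
    unfolding uv(3) using C st(2) uv(2) by (simp add: m_assoc)
  finally have vs: "v' \<otimes> s = v \<otimes> t"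
    using lcancel[of d "v' \<otimes> s" "v \<otimes> t"] C assms(3) st(1,2) uv(2) by simp
  have "a \<otimes> u' \<otimes> s = a \<otimes> (u' \<otimes> s)"
    using C assms(2) st(1) by (simp add: m_assoc)
  also have "\<dots> = a \<otimes> u \<otimes> t"
    unfolding st(4) using C st(2) uv(1) by (simp add: m_assoc)
  also have "\<dots> = c \<otimes> (v \<otimes> t)"
    unfolding uv(5) using C st(2) uv(2) by (simp add: m_assoc)
  also have "\<dots> = c \<otimes> v' \<otimes> s"
    unfolding vs[symmetric] using C assms(3) st(1) by (simp add: m_assoc)
  finally show ?thesis
    using rcancel[of s "a \<otimes> u'" "c \<otimes> v'"] C assms(2,3) st(1,3) by simp
qed

lemma ore_relI:
  "\<lbrakk>a \<in> carrier R; c \<in> carrier R; b \<in> carrier R; d \<in> carrier R; b \<noteq> \<zero>; d \<noteq> \<zero>;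
    u \<in> carrier R; v \<in> carrier R; u \<noteq> \<zero>; b \<otimes> u = d \<otimes> v; a \<otimes> u = c \<otimes> v\<rbrakk>
   \<Longrightarrow> ((a, b), (c, d)) \<in> ore_rel R"
  unfolding ore_rel_def using mult_nonzero by fast

lemma ore_rel_carrier:
  assumes "((a, b), (c, d)) \<in> ore_rel R"
  shows "a \<in> carrier R" "c \<in> carrier R" "b \<in> carrier R" "d \<in> carrier R" "b \<noteq> \<zero>" "d \<noteq> \<zero>"
  using assms by (auto simp: ore_rel_def)

lemma ore_rel_refl:
  "\<lbrakk>a \<in> carrier R; b \<in> carrier R; b \<noteq> \<zero>\<rbrakk> \<Longrightarrow> ((a, b), (a, b)) \<in> ore_rel R"
  by (rule ore_relI[where u = \<one> and v = \<one>]) (auto simp: one_neq_zero)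

lemma ore_rel_sym: "((a, b), (c, d)) \<in> ore_rel R \<Longrightarrow> ((c, d), (a, b)) \<in> ore_rel R"
  by (auto simp: ore_rel_def) metis

lemma ore_rel_trans:
  assumes "((a, b), (c, d)) \<in> ore_rel R" "((c, d), (e, f)) \<in> ore_rel R"
  shows "((a, b), (e, f)) \<in> ore_rel R"
proof -
  note C = ore_rel_carrier[OF assms(1)] ore_rel_carrier[OF assms(2)]
  obtain u v where uv: "u \<in> carrier R" "v \<in> carrier R" "u \<noteq> \<zero>" "v \<noteq> \<zero>" "b \<otimes> u = d \<otimes> v"
    using ore_both[of b d] C by metis
  obtain s w where sw: "s \<in> carrier R" "w \<in> carrier R" "s \<noteq> \<zero>" "w \<noteq> \<zero>" "d \<otimes> v \<otimes> s = f \<otimes> w"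
    using ore_ex[of "d \<otimes> v" f] C uv(1-4) by auto
  have 1: "a \<otimes> (u \<otimes> s) = c \<otimes> (v \<otimes> s)"
    using ore_rel_cross[OF assms(1), of "u \<otimes> s" "v \<otimes> s"] C uv sw by (simp add: m_assoc[symmetric])
  have 2: "c \<otimes> (v \<otimes> s) = e \<otimes> w"
    using ore_rel_cross[OF assms(2), of "v \<otimes> s" w] C uv sw by (simp add: m_assoc[symmetric])
  show ?thesis
    by (rule ore_relI[where u = "u \<otimes> s" and v = w])
      (use C uv sw 1 2 in \<open>auto simp flip: m_assoc\<close>)
qed

lemma equiv_ore_rel: "equiv (carrier R \<times> (carrier R - {\<zero>})) (ore_rel R)"
proof (rule equivI)
  show "ore_rel R \<subseteq> (carrier R \<times> (carrier R - {\<zero>})) \<times> (carrier R \<times> (carrier R - {\<zero>}))"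
    by (auto simp: ore_rel_def)
  show "refl_on (carrier R \<times> (carrier R - {\<zero>})) (ore_rel R)"
    by (auto simp: refl_on_def intro: ore_rel_refl)
  show "sym (ore_rel R)"
    by (rule symI) (metis ore_rel_sym surj_pair)
  show "trans (ore_rel R)"
    by (rule transI) (metis ore_rel_trans surj_pair)
qed

lemma mem_rfrac: "(c, d) \<in> rfrac R a b \<longleftrightarrow> ((a, b), (c, d)) \<in> ore_rel R"
  by (simp add: rfrac_def)

lemma rfrac_eqI: "((a, b), (c, d)) \<in> ore_rel R \<Longrightarrow> rfrac R a b = rfrac R c d"
  unfolding rfrac_def by (rule equiv_class_eq[OF equiv_ore_rel])

lemma rfrac_eqD:
  assumes "rfrac R a b = rfrac R c d" "c \<in> carrier R" "d \<in> carrier R" "d \<noteq> \<zero>"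
  shows "((a, b), (c, d)) \<in> ore_rel R"
  using ore_rel_refl[OF assms(2-4)] assms(1) mem_rfrac by metis

lemma rfrac_cancel:
  assumes "a \<in> carrier R" "b \<in> carrier R" "b \<noteq> \<zero>" "u \<in> carrier R" "u \<noteq> \<zero>"
  shows "rfrac R (a \<otimes> u) (b \<otimes> u) = rfrac R a b"
  by (rule rfrac_eqI, rule ore_relI[where u = \<one> and v = u]) (use assms in \<open>auto simp: one_neq_zero\<close>)

lemma rfrac_closed [simp]:
  assumes "a \<in> carrier R" "b \<in> carrier R" "b \<noteq> \<zero>"
  shows "rfrac R a b \<in> carrier (Frac R)"
  using assms unfolding Frac_def rfrac_def by (auto intro: quotientI)

lemma Frac_cases:
  assumes "x \<in> carrier (Frac R)"
  obtains a b where "a \<in> carrier R" "b \<in> carrier R" "b \<noteq> \<zero>" "x = rfrac R a b"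
  using assms unfolding Frac_def rfrac_def by (auto elim!: quotientE)

lemma Frac_common2:
  assumes "x \<in> carrier (Frac R)" "y \<in> carrier (Frac R)"
  obtains a c s where "a \<in> carrier R" "c \<in> carrier R" "s \<in> carrier R" "s \<noteq> \<zero>"
    "x = rfrac R a s" "y = rfrac R c s"
proof -
  obtain a b where ab: "a \<in> carrier R" "b \<in> carrier R" "b \<noteq> \<zero>" "x = rfrac R a b"
    using Frac_cases[OF assms(1)] .
  obtain c d where cd: "c \<in> carrier R" "d \<in> carrier R" "d \<noteq> \<zero>" "y = rfrac R c d"
    using Frac_cases[OF assms(2)] .
  obtain u v where uv: "u \<in> carrier R" "v \<in> carrier R" "u \<noteq> \<zero>" "v \<noteq> \<zero>" "b \<otimes> u = d \<otimes> v"
    using ore_both[of b d] ab cd by metis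
  show ?thesis
  proof
    show "x = rfrac R (a \<otimes> u) (b \<otimes> u)"
      using ab uv(1-4) by (simp add: rfrac_cancel)
    show "y = rfrac R (c \<otimes> v) (b \<otimes> u)"
      unfolding uv(5) using cd uv by (simp add: rfrac_cancel)
  qed (use ab cd uv(1-4) in auto)
qed

lemma Frac_common3:
  assumes "x \<in> carrier (Frac R)" "y \<in> carrier (Frac R)" "z \<in> carrier (Frac R)"
  obtains a c e s where "a \<in> carrier R" "c \<in> carrier R" "e \<in> carrier R" "s \<in> carrier R" "s \<noteq> \<zero>"
    "x = rfrac R a s" "y = rfrac R c s" "z = rfrac R e s"
proof -
  obtain a c b where ab: "a \<in> carrier R" "c \<in> carrier R" "b \<in> carrier R" "b \<noteq> \<zero>"
    "x = rfrac R a b" "y = rfrac R c b"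
    using Frac_common2[OF assms(1,2)] .
  obtain e d where cd: "e \<in> carrier R" "d \<in> carrier R" "d \<noteq> \<zero>" "z = rfrac R e d"
    using Frac_cases[OF assms(3)] .
  obtain u v where uv: "u \<in> carrier R" "v \<in> carrier R" "u \<noteq> \<zero>" "v \<noteq> \<zero>" "b \<otimes> u = d \<otimes> v"
    using ore_both[of b d] ab cd by metis
  show ?thesis
  proof
    show "x = rfrac R (a \<otimes> u) (b \<otimes> u)" "y = rfrac R (c \<otimes> u) (b \<otimes> u)"
      using ab uv(1-4) by (simp_all add: rfrac_cancel)
    show "z = rfrac R (e \<otimes> v) (b \<otimes> u)"
      unfolding uv(5) using cd uv by (simp add: rfrac_cancel)
  qed (use ab cd uv(1-4) in auto)
qed

lemma Frac_sel: "add (Frac R) = ore_add R" "mult (Frac R) = ore_mult R"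
  by (simp_all add: Frac_def)

text \<open>The definition takes the union over all representatives and all common multiples. It
  yields a class because every choice leads to the same one, so that the union runs over a
  singleton.\<close>

lemma Frac_add:
  assumes "a \<in> carrier R" "c \<in> carrier R" "s \<in> carrier R" "s \<noteq> \<zero>"
  shows "rfrac R a s \<oplus>\<^bsub>Frac R\<^esub> rfrac R c s = rfrac R (a \<oplus> c) s"
proof -
  have eq: "rfrac R (a' \<otimes> u \<oplus> c' \<otimes> v) (b' \<otimes> u) = rfrac R (a \<oplus> c) s"
    if "(a', b') \<in> rfrac R a s" "(c', d') \<in> rfrac R c s" "u \<in> carrier R" "v \<in> carrier R"
      "b' \<otimes> u = d' \<otimes> v" "b' \<otimes> u \<noteq> \<zero>" for a' b' c' d' u v
  proof -
    have r1: "((a', b'), (a, s)) \<in> ore_rel R" and r2: "((c', d'), (c, s)) \<in> ore_rel R"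
      using that ore_rel_sym by (auto simp: mem_rfrac)
    note C = ore_rel_carrier[OF r1] ore_rel_carrier[OF r2]
    note t = that(3,4,6)
    obtain x y where xy: "x \<in> carrier R" "y \<in> carrier R" "x \<noteq> \<zero>" "y \<noteq> \<zero>" "b' \<otimes> u \<otimes> x = s \<otimes> y"
      using ore_ex[of "b' \<otimes> u" s] C t by auto
    have 1: "a' \<otimes> (u \<otimes> x) = a \<otimes> y"
      using ore_rel_cross[OF r1, of "u \<otimes> x" y] C that xy by (simp add: m_assoc[symmetric])
    have 2: "c' \<otimes> (v \<otimes> x) = c \<otimes> y"
      using ore_rel_cross[OF r2, of "v \<otimes> x" y] C that xy by (simp add: m_assoc[symmetric])
    show ?thesis
      by (rule rfrac_eqI, rule ore_relI[where u = x and v = y])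
        (use C that xy 1 2 in \<open>auto simp: l_distr m_assoc\<close>)
  qed
  have "(a, s) \<in> rfrac R a s" "(c, s) \<in> rfrac R c s"
    using assms by (auto simp: mem_rfrac ore_rel_refl)
  then have ex: "rfrac R (a \<otimes> \<one> \<oplus> c \<otimes> \<one>) (s \<otimes> \<one>) \<in>
    {rfrac R (a' \<otimes> u \<oplus> c' \<otimes> v) (b' \<otimes> u) |a' b' c' d' u v.
     (a', b') \<in> rfrac R a s \<and> (c', d') \<in> rfrac R c s \<and> u \<in> carrier R \<and> v \<in> carrier R \<and>
     b' \<otimes> u = d' \<otimes> v \<and> b' \<otimes> u \<noteq> \<zero>}"
    using assms by fastforce
  have "y = rfrac R (a \<oplus> c) s"
    if y: "y \<in> {rfrac R (a' \<otimes> u \<oplus> c' \<otimes> v) (b' \<otimes> u) |a' b' c' d' u v.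
     (a', b') \<in> rfrac R a s \<and> (c', d') \<in> rfrac R c s \<and> u \<in> carrier R \<and> v \<in> carrier R \<and>
     b' \<otimes> u = d' \<otimes> v \<and> b' \<otimes> u \<noteq> \<zero>}" (is "_ \<in> ?S") for y
  proof -
    from y obtain a' b' c' d' u v where 1: "y = rfrac R (a' \<otimes> u \<oplus> c' \<otimes> v) (b' \<otimes> u)"
      and 2: "(a', b') \<in> rfrac R a s" "(c', d') \<in> rfrac R c s" "u \<in> carrier R" "v \<in> carrier R"
       "b' \<otimes> u = d' \<otimes> v" "b' \<otimes> u \<noteq> \<zero>" by blast
    from 1 eq[OF 2] show ?thesis by (rule trans)
  qed
  with ex have "?S = {rfrac R (a \<oplus> c) s}"
    by (metis (no_types, lifting) is_singletonI' is_singleton_the_elem singletonD empty_iff)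
  then show ?thesis
    unfolding Frac_sel ore_add_def by (simp only: cSup_singleton)
qed

lemma Frac_mult:
  assumes "a \<in> carrier R" "b \<in> carrier R" "b \<noteq> \<zero>" "c \<in> carrier R" "d \<in> carrier R" "d \<noteq> \<zero>"
    "u \<in> carrier R" "v \<in> carrier R" "v \<noteq> \<zero>" "b \<otimes> u = c \<otimes> v"
  shows "rfrac R a b \<otimes>\<^bsub>Frac R\<^esub> rfrac R c d = rfrac R (a \<otimes> u) (d \<otimes> v)"
proof -
  have eq: "rfrac R (a' \<otimes> u') (d' \<otimes> v') = rfrac R (a \<otimes> u) (d \<otimes> v)"
    if "(a', b') \<in> rfrac R a b" "(c', d') \<in> rfrac R c d" "u' \<in> carrier R" "v' \<in> carrier R"
      "b' \<otimes> u' = c' \<otimes> v'" "v' \<noteq> \<zero>" for a' b' c' d' u' v'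
  proof -
    have r1: "((a', b'), (a, b)) \<in> ore_rel R" and r2: "((c', d'), (c, d)) \<in> ore_rel R"
      using that ore_rel_sym by (auto simp: mem_rfrac)
    note C = ore_rel_carrier[OF r1] ore_rel_carrier[OF r2] assms(7-9) that(3,4,6)
    obtain x y where xy: "x \<in> carrier R" "y \<in> carrier R" "x \<noteq> \<zero>" "y \<noteq> \<zero>"
        "d' \<otimes> v' \<otimes> x = d \<otimes> v \<otimes> y"
      using ore_ex[of "d' \<otimes> v'" "d \<otimes> v"] C by auto
    have 1: "c' \<otimes> (v' \<otimes> x) = c \<otimes> (v \<otimes> y)"
      using ore_rel_cross[OF r2, of "v' \<otimes> x" "v \<otimes> y"] C xy by (simp add: m_assoc[symmetric])
    have "b' \<otimes> (u' \<otimes> x) = c' \<otimes> (v' \<otimes> x)"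
      using C xy that(5) by (simp add: m_assoc[symmetric])
    also have "\<dots> = c \<otimes> v \<otimes> y"
      using C xy 1 by (simp add: m_assoc[symmetric])
    also have "\<dots> = b \<otimes> (u \<otimes> y)"
      unfolding assms(10)[symmetric] using C xy by (simp add: m_assoc)
    finally have 2: "a' \<otimes> (u' \<otimes> x) = a \<otimes> (u \<otimes> y)"
      using ore_rel_cross[OF r1, of "u' \<otimes> x" "u \<otimes> y"] C xy by simp
    show ?thesis
      by (rule rfrac_eqI, rule ore_relI[where u = x and v = y])
        (use C xy 2 in \<open>auto simp: m_assoc\<close>)
  qed
  have "(a, b) \<in> rfrac R a b" "(c, d) \<in> rfrac R c d"
    using assms by (auto simp: mem_rfrac ore_rel_refl)
  then have ex: "rfrac R (a \<otimes> u) (d \<otimes> v) \<in>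
    {rfrac R (a' \<otimes> u') (d' \<otimes> v') |a' b' c' d' u' v'.
     (a', b') \<in> rfrac R a b \<and> (c', d') \<in> rfrac R c d \<and> u' \<in> carrier R \<and> v' \<in> carrier R \<and>
     b' \<otimes> u' = c' \<otimes> v' \<and> v' \<noteq> \<zero>}"
    using assms by blast
  from this eq have "{rfrac R (a' \<otimes> u') (d' \<otimes> v') |a' b' c' d' u' v'.
     (a', b') \<in> rfrac R a b \<and> (c', d') \<in> rfrac R c d \<and> u' \<in> carrier R \<and> v' \<in> carrier R \<and>
     b' \<otimes> u' = c' \<otimes> v' \<and> v' \<noteq> \<zero>} = {rfrac R (a \<otimes> u) (d \<otimes> v)}"
    by blast
  then show ?thesis
    unfolding Frac_sel ore_mult_def by (simp only: cSup_singleton)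
qed

lemma Frac_mult_chain:
  assumes "a \<in> carrier R" "b \<in> carrier R" "b \<noteq> \<zero>" "d \<in> carrier R" "d \<noteq> \<zero>"
  shows "rfrac R a b \<otimes>\<^bsub>Frac R\<^esub> rfrac R b d = rfrac R a d"
  using Frac_mult[of a b b d \<one> \<one>] assms by (simp add: one_neq_zero)

lemma Frac_one: "s \<in> carrier R \<Longrightarrow> s \<noteq> \<zero> \<Longrightarrow> \<one>\<^bsub>Frac R\<^esub> = rfrac R s s"
  using rfrac_cancel[of \<one> \<one> s] by (simp add: Frac_def one_neq_zero)

lemma Frac_zero: "s \<in> carrier R \<Longrightarrow> s \<noteq> \<zero> \<Longrightarrow> \<zero>\<^bsub>Frac R\<^esub> = rfrac R \<zero> s"
  using rfrac_cancel[of \<zero> \<one> s] by (simp add: Frac_def one_neq_zero)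

lemma Frac_mult_ex:
  assumes "a \<in> carrier R" "b \<in> carrier R" "b \<noteq> \<zero>" "c \<in> carrier R" "d \<in> carrier R" "d \<noteq> \<zero>"
  obtains u v where "u \<in> carrier R" "v \<in> carrier R" "v \<noteq> \<zero>" "b \<otimes> u = c \<otimes> v"
    "rfrac R a b \<otimes>\<^bsub>Frac R\<^esub> rfrac R c d = rfrac R (a \<otimes> u) (d \<otimes> v)"
proof -
  obtain v u where "u \<in> carrier R" "v \<in> carrier R" "v \<noteq> \<zero>" "c \<otimes> v = b \<otimes> u"
    using ore[of c b] assms by blast
  then show ?thesis
    using that[of u v] Frac_mult[of a b c d u v] assms by simp
qed

text \<open>The two bracketings select unrelated Ore multiples. Once the final denominators are
  brought to a common multiple, cancelling \<open>f\<close>, \<open>d\<close> and \<open>b\<close>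
  in turn forces the numerators to agree.\<close>

lemma Frac_m_assoc:
  assumes "x \<in> carrier (Frac R)" "y \<in> carrier (Frac R)" "z \<in> carrier (Frac R)"
  shows "x \<otimes>\<^bsub>Frac R\<^esub> y \<otimes>\<^bsub>Frac R\<^esub> z = x \<otimes>\<^bsub>Frac R\<^esub> (y \<otimes>\<^bsub>Frac R\<^esub> z)"
proof -
  obtain a b where ab: "a \<in> carrier R" "b \<in> carrier R" "b \<noteq> \<zero>" "x = rfrac R a b"
    using Frac_cases[OF assms(1)] .
  obtain c d where cd: "c \<in> carrier R" "d \<in> carrier R" "d \<noteq> \<zero>" "y = rfrac R c d"
    using Frac_cases[OF assms(2)] .
  obtain e f where ef: "e \<in> carrier R" "f \<in> carrier R" "f \<noteq> \<zero>" "z = rfrac R e f"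
    using Frac_cases[OF assms(3)] .
  obtain u v where uv: "u \<in> carrier R" "v \<in> carrier R" "v \<noteq> \<zero>" "d \<otimes> u = e \<otimes> v"
    "y \<otimes>\<^bsub>Frac R\<^esub> z = rfrac R (c \<otimes> u) (f \<otimes> v)"
    using Frac_mult_ex[of c d e f] cd ef by metis
  obtain u' v' where uv': "u' \<in> carrier R" "v' \<in> carrier R" "v' \<noteq> \<zero>" "b \<otimes> u' = c \<otimes> u \<otimes> v'"
    "x \<otimes>\<^bsub>Frac R\<^esub> (y \<otimes>\<^bsub>Frac R\<^esub> z) = rfrac R (a \<otimes> u') (f \<otimes> v \<otimes> v')"
    using Frac_mult_ex[OF ab(1-3) m_closed[OF cd(1) uv(1)] m_closed[OF ef(2) uv(2)] mult_nonzero[OF ef(2) uv(2) ef(3) uv(3)]]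
    unfolding ab(4) uv(5) by metis
  obtain p q where pq: "p \<in> carrier R" "q \<in> carrier R" "q \<noteq> \<zero>" "b \<otimes> p = c \<otimes> q"
    "x \<otimes>\<^bsub>Frac R\<^esub> y = rfrac R (a \<otimes> p) (d \<otimes> q)"
    using Frac_mult_ex[of a b c d] ab cd by metis
  obtain r w where rw: "r \<in> carrier R" "w \<in> carrier R" "w \<noteq> \<zero>" "d \<otimes> q \<otimes> r = e \<otimes> w"
    "x \<otimes>\<^bsub>Frac R\<^esub> y \<otimes>\<^bsub>Frac R\<^esub> z = rfrac R (a \<otimes> p \<otimes> r) (f \<otimes> w)"
    using Frac_mult_ex[OF m_closed[OF ab(1) pq(1)] m_closed[OF cd(2) pq(2)] mult_nonzero[OF cd(2) pq(2) cd(3) pq(3)] ef(1-3)]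
    unfolding ef(4) pq(5) by metis
  note C = ab(1-3) cd(1-3) ef(1-3) uv(1-3) uv'(1-3) pq(1-3) rw(1-3)
  obtain X Y where XY: "X \<in> carrier R" "Y \<in> carrier R" "X \<noteq> \<zero>" "Y \<noteq> \<zero>"
    "f \<otimes> w \<otimes> X = f \<otimes> v \<otimes> v' \<otimes> Y"
    using ore_ex[of "f \<otimes> w" "f \<otimes> v \<otimes> v'"] C by auto
  have 1: "w \<otimes> X = v \<otimes> v' \<otimes> Y"
  proof (rule lcancel[of f])
    show "f \<otimes> (w \<otimes> X) = f \<otimes> (v \<otimes> v' \<otimes> Y)"
      using XY(5) by (simp add: m_assoc C XY(1,2))
  qed (use XY(1,2) C in simp_all)
  have "d \<otimes> (q \<otimes> r \<otimes> X) = d \<otimes> q \<otimes> r \<otimes> X"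
    using C XY by (simp add: m_assoc)
  also have "\<dots> = e \<otimes> (w \<otimes> X)"
    unfolding rw(4) using C XY by (simp add: m_assoc)
  also have "\<dots> = e \<otimes> v \<otimes> (v' \<otimes> Y)"
    unfolding 1 using C XY by (simp add: m_assoc)
  also have "\<dots> = d \<otimes> (u \<otimes> v' \<otimes> Y)"
    unfolding uv(4)[symmetric] using C XY by (simp add: m_assoc)
  finally have 2: "q \<otimes> r \<otimes> X = u \<otimes> v' \<otimes> Y"
    by (rule lcancel[of d, rotated 4]) (use C XY(1-4) in simp_all)
  have "b \<otimes> (p \<otimes> r \<otimes> X) = b \<otimes> p \<otimes> (r \<otimes> X)"
    using C XY by (simp add: m_assoc)
  also have "\<dots> = c \<otimes> (q \<otimes> r \<otimes> X)"
    unfolding pq(4) using C XY by (simp add: m_assoc)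
  also have "\<dots> = c \<otimes> u \<otimes> v' \<otimes> Y"
    unfolding 2 using C XY by (simp add: m_assoc)
  also have "\<dots> = b \<otimes> (u' \<otimes> Y)"
    unfolding uv'(4)[symmetric] using C XY by (simp add: m_assoc)
  finally have 3: "p \<otimes> r \<otimes> X = u' \<otimes> Y"
    by (rule lcancel[of b, rotated 4]) (use C XY(1-4) in simp_all)
  show ?thesis
    unfolding rw(5) uv'(5)
    by (rule rfrac_eqI, rule ore_relI[where u = X and v = Y])
      (use C XY 3 in \<open>auto simp: m_assoc\<close>)
qed

lemma Frac_r_distr:
  assumes "x \<in> carrier (Frac R)" "y \<in> carrier (Frac R)" "z \<in> carrier (Frac R)"
  shows "z \<otimes>\<^bsub>Frac R\<^esub> (x \<oplus>\<^bsub>Frac R\<^esub> y) = z \<otimes>\<^bsub>Frac R\<^esub> x \<oplus>\<^bsub>Frac R\<^esub> z \<otimes>\<^bsub>Frac R\<^esub> y"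
proof -
  obtain c e s where ces: "c \<in> carrier R" "e \<in> carrier R" "s \<in> carrier R" "s \<noteq> \<zero>"
    "x = rfrac R c s" "y = rfrac R e s"
    using Frac_common2[OF assms(1,2)] .
  obtain a b where ab: "a \<in> carrier R" "b \<in> carrier R" "b \<noteq> \<zero>" "z = rfrac R a b"
    using Frac_cases[OF assms(3)] .
  obtain v u where uv: "u \<in> carrier R" "v \<in> carrier R" "v \<noteq> \<zero>" "c \<otimes> v = b \<otimes> u"
    using ore[of c b] ces ab by metis
  obtain v' u' where uv': "u' \<in> carrier R" "v' \<in> carrier R" "v' \<noteq> \<zero>" "e \<otimes> v' = b \<otimes> u'"
    using ore[of e b] ces ab by metis
  obtain w w' where w: "w \<in> carrier R" "w' \<in> carrier R" "w \<noteq> \<zero>" "w' \<noteq> \<zero>" "v \<otimes> w = v' \<otimes> w'"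
    using ore_both[of v v'] uv uv' by metis
  note C = ces(1-4) ab(1-3) uv(1-3) uv'(1-3) w(1-4)
  have x: "b \<otimes> (u \<otimes> w) = c \<otimes> (v \<otimes> w)"
    using C uv(4) by (simp add: m_assoc[symmetric])
  have y: "b \<otimes> (u' \<otimes> w') = e \<otimes> (v \<otimes> w)"
    using C uv'(4) w(5) by (simp add: m_assoc[symmetric])
  have zx: "z \<otimes>\<^bsub>Frac R\<^esub> x = rfrac R (a \<otimes> (u \<otimes> w)) (s \<otimes> (v \<otimes> w))"
    unfolding ab(4) ces(5) using C x by (intro Frac_mult) auto
  have zy: "z \<otimes>\<^bsub>Frac R\<^esub> y = rfrac R (a \<otimes> (u' \<otimes> w')) (s \<otimes> (v \<otimes> w))"
    unfolding ab(4) ces(6) using C y by (intro Frac_mult) auto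
  have xy: "x \<oplus>\<^bsub>Frac R\<^esub> y = rfrac R (c \<oplus> e) s"
    unfolding ces(5,6) using C by (intro Frac_add) auto
  have "z \<otimes>\<^bsub>Frac R\<^esub> (x \<oplus>\<^bsub>Frac R\<^esub> y) = rfrac R (a \<otimes> (u \<otimes> w \<oplus> u' \<otimes> w')) (s \<otimes> (v \<otimes> w))"
    unfolding xy ab(4) using C x y by (intro Frac_mult) (auto simp: l_distr r_distr)
  then show ?thesis
    unfolding zx zy using C by (simp add: Frac_add r_distr)
qed

lemma Frac_l_distr:
  assumes "x \<in> carrier (Frac R)" "y \<in> carrier (Frac R)" "z \<in> carrier (Frac R)"
  shows "(x \<oplus>\<^bsub>Frac R\<^esub> y) \<otimes>\<^bsub>Frac R\<^esub> z = x \<otimes>\<^bsub>Frac R\<^esub> z \<oplus>\<^bsub>Frac R\<^esub> y \<otimes>\<^bsub>Frac R\<^esub> z"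
proof -
  obtain c e s where ces: "c \<in> carrier R" "e \<in> carrier R" "s \<in> carrier R" "s \<noteq> \<zero>"
    "x = rfrac R c s" "y = rfrac R e s"
    using Frac_common2[OF assms(1,2)] .
  obtain a b where ab: "a \<in> carrier R" "b \<in> carrier R" "b \<noteq> \<zero>" "z = rfrac R a b"
    using Frac_cases[OF assms(3)] .
  obtain v u where uv: "u \<in> carrier R" "v \<in> carrier R" "v \<noteq> \<zero>" "a \<otimes> v = s \<otimes> u"
    using ore[of a s] ces ab by metis
  note C = ces(1-4) ab(1-3) uv(1-3)
  have "x \<otimes>\<^bsub>Frac R\<^esub> z = rfrac R (c \<otimes> u) (b \<otimes> v)" "y \<otimes>\<^bsub>Frac R\<^esub> z = rfrac R (e \<otimes> u) (b \<otimes> v)"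
    "x \<oplus>\<^bsub>Frac R\<^esub> y = rfrac R (c \<oplus> e) s"
    "rfrac R (c \<oplus> e) s \<otimes>\<^bsub>Frac R\<^esub> z = rfrac R ((c \<oplus> e) \<otimes> u) (b \<otimes> v)"
    unfolding ab(4) ces(5,6)
    by (rule Frac_mult Frac_add; use C uv(4) in auto)+
  then show ?thesis
    using C by (simp add: Frac_add l_distr)
qed

lemma Frac_ring: "ring (Frac R)"
proof (rule ringI)
  show "abelian_group (Frac R)"
  proof (rule abelian_groupI)
    fix x y z assume x: "x \<in> carrier (Frac R)" and y: "y \<in> carrier (Frac R)"
    obtain a c s where ac: "a \<in> carrier R" "c \<in> carrier R" "s \<in> carrier R" "s \<noteq> \<zero>"
      "x = rfrac R a s" "y = rfrac R c s"
      using Frac_common2[OF x y] .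
    then show "x \<oplus>\<^bsub>Frac R\<^esub> y \<in> carrier (Frac R)" "x \<oplus>\<^bsub>Frac R\<^esub> y = y \<oplus>\<^bsub>Frac R\<^esub> x"
      by (simp_all add: Frac_add a_comm)
    show "\<zero>\<^bsub>Frac R\<^esub> \<oplus>\<^bsub>Frac R\<^esub> x = x"
      using ac by (simp add: Frac_zero[of s] Frac_add)
    show "\<exists>y\<in>carrier (Frac R). y \<oplus>\<^bsub>Frac R\<^esub> x = \<zero>\<^bsub>Frac R\<^esub>"
      using ac by (intro bexI[of _ "rfrac R (\<ominus> a) s"]) (auto simp: Frac_zero[of s] Frac_add l_neg)
    show "x \<oplus>\<^bsub>Frac R\<^esub> y \<oplus>\<^bsub>Frac R\<^esub> z = x \<oplus>\<^bsub>Frac R\<^esub> (y \<oplus>\<^bsub>Frac R\<^esub> z)" if z: "z \<in> carrier (Frac R)"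
      by (rule Frac_common3[OF x y z]) (simp add: Frac_add a_assoc)
  qed (simp_all add: one_neq_zero Frac_zero[of \<one>])
  show "Group.monoid (Frac R)"
  proof (rule monoidI)
    fix x y z assume x: "x \<in> carrier (Frac R)" and y: "y \<in> carrier (Frac R)"
    obtain a b where ab: "a \<in> carrier R" "b \<in> carrier R" "b \<noteq> \<zero>" "x = rfrac R a b"
      using Frac_cases[OF x] .
    obtain c d where cd: "c \<in> carrier R" "d \<in> carrier R" "d \<noteq> \<zero>" "y = rfrac R c d"
      using Frac_cases[OF y] .
    show "x \<otimes>\<^bsub>Frac R\<^esub> y \<in> carrier (Frac R)"
      using Frac_mult_ex[of a b c d] ab cd by (metis m_closed mult_nonzero rfrac_closed)
    show "\<one>\<^bsub>Frac R\<^esub> \<otimes>\<^bsub>Frac R\<^esub> x = x"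
      using Frac_mult[of \<one> \<one> a b a \<one>] ab one_neq_zero by (simp add: Frac_one[of \<one>])
    show "x \<otimes>\<^bsub>Frac R\<^esub> \<one>\<^bsub>Frac R\<^esub> = x"
      using Frac_mult_chain[of a b b] ab by (simp add: Frac_one[of b])
    show "x \<otimes>\<^bsub>Frac R\<^esub> y \<otimes>\<^bsub>Frac R\<^esub> z = x \<otimes>\<^bsub>Frac R\<^esub> (y \<otimes>\<^bsub>Frac R\<^esub> z)" if z: "z \<in> carrier (Frac R)"
      using Frac_m_assoc x y z .
  qed (simp add: Frac_one[of \<one>] one_neq_zero)
qed (fact Frac_l_distr Frac_r_distr)+

lemma Frac_inverse:
  assumes "a \<in> carrier R" "b \<in> carrier R" "a \<noteq> \<zero>" "b \<noteq> \<zero>"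
  shows "rfrac R a b \<in> Units (Frac R)" "inv\<^bsub>Frac R\<^esub> (rfrac R a b) = rfrac R b a"
proof -
  interpret F: ring "Frac R" by (rule Frac_ring)
  have 1: "rfrac R a b \<otimes>\<^bsub>Frac R\<^esub> rfrac R b a = \<one>\<^bsub>Frac R\<^esub>" "rfrac R b a \<otimes>\<^bsub>Frac R\<^esub> rfrac R a b = \<one>\<^bsub>Frac R\<^esub>"
    using assms by (simp_all add: Frac_mult_chain Frac_one[of a] flip: Frac_one[of b])
  then show "rfrac R a b \<in> Units (Frac R)"
    unfolding Units_def using assms by (auto intro!: bexI[of _ "rfrac R b a"])
  show "inv\<^bsub>Frac R\<^esub> (rfrac R a b) = rfrac R b a"
    using F.inv_unique'[of "rfrac R a b" "rfrac R b a"] assms 1 by simp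
qed

lemma rfrac_eq_zero_iff:
  assumes "a \<in> carrier R" "b \<in> carrier R" "b \<noteq> \<zero>"
  shows "rfrac R a b = \<zero>\<^bsub>Frac R\<^esub> \<longleftrightarrow> a = \<zero>"
proof
  assume "rfrac R a b = \<zero>\<^bsub>Frac R\<^esub>"
  then have r: "((a, b), (\<zero>, b)) \<in> ore_rel R"
    using assms by (intro rfrac_eqD) (auto simp: Frac_zero[of b])
  from ore_rel_cross[OF r, of \<one> \<one>] show "a = \<zero>"
    using assms by simp
qed (use assms in \<open>simp add: Frac_zero[of b]\<close>)

lemma Frac_division_ring: "division_ring (Frac R)"
proof -
  interpret F: ring "Frac R" by (rule Frac_ring)
  show ?thesis
  proof (intro division_ring.intro division_ring_axioms.intro Frac_ring)
    show "\<one>\<^bsub>Frac R\<^esub> \<noteq> \<zero>\<^bsub>Frac R\<^esub>"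
      using rfrac_eq_zero_iff[of \<one> \<one>] one_neq_zero by (simp add: Frac_one[of \<one>])
    fix x assume x: "x \<in> carrier (Frac R)" "x \<noteq> \<zero>\<^bsub>Frac R\<^esub>"
    obtain a b where ab: "a \<in> carrier R" "b \<in> carrier R" "b \<noteq> \<zero>" "x = rfrac R a b"
      using Frac_cases[OF x(1)] .
    then have "a \<noteq> \<zero>"
      using x(2) rfrac_eq_zero_iff[of a b] by simp
    with ab show "x \<in> Units (Frac R)"
      using Frac_inverse(1)[of a b] by simp
  qed
qed

abbreviation emb :: "'a \<Rightarrow> ('a \<times> 'a) set" where
  "emb a \<equiv> rfrac R a \<one>"

lemma emb_hom: "emb \<in> ring_hom R (Frac R)"
proof (rule ring_hom_memI)
  fix x y assume "x \<in> carrier R" "y \<in> carrier R"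
  then show "emb (x \<otimes> y) = emb x \<otimes>\<^bsub>Frac R\<^esub> emb y" "emb (x \<oplus> y) = emb x \<oplus>\<^bsub>Frac R\<^esub> emb y"
    using Frac_mult[of x \<one> y \<one> y \<one>] by (simp_all add: Frac_add one_neq_zero)
qed (auto simp: one_neq_zero Frac_one[of \<one>])

lemma emb_inj: "inj_on emb (carrier R)"
proof (rule inj_onI)
  fix x y assume xy: "x \<in> carrier R" "y \<in> carrier R" "emb x = emb y"
  then have r: "((x, \<one>), (y, \<one>)) \<in> ore_rel R"
    by (intro rfrac_eqD) (auto simp: one_neq_zero)
  from ore_rel_cross[OF r, of \<one> \<one>] show "x = y"
    using xy by simp
qed

lemma rfrac_emb:
  assumes "a \<in> carrier R" "b \<in> carrier R" "b \<noteq> \<zero>"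
  shows "rfrac R a b = emb a \<otimes>\<^bsub>Frac R\<^esub> inv\<^bsub>Frac R\<^esub> (emb b)"
  using assms by (simp add: Frac_inverse one_neq_zero Frac_mult_chain)

text \<open>The images of an inverse are compared without inverting in \<open>D\<close>: insert
  \<psi>(b b^-1) = 1 after \<phi>(b^-1) and replace \<psi>(b) by \<phi>(b); what is left is
  \<psi>(b^-1).\<close>

lemma Frac_hom_unique:
  assumes "\<phi> \<in> ring_hom (Frac R) D" "\<psi> \<in> ring_hom (Frac R) D" "ring D"
    "\<And>a. a \<in> carrier R \<Longrightarrow> \<phi> (emb a) = \<psi> (emb a)" "x \<in> carrier (Frac R)"
  shows "\<phi> x = \<psi> x"
proof -
  interpret F: ring "Frac R" by (rule Frac_ring)
  interpret D: ring D by fact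
  note [simp] = ring_hom_closed[OF assms(1)] ring_hom_mult[OF assms(1)] ring_hom_one[OF assms(1)]
    ring_hom_closed[OF assms(2)] ring_hom_mult[OF assms(2)] ring_hom_one[OF assms(2)]
  obtain a b where ab: "a \<in> carrier R" "b \<in> carrier R" "b \<noteq> \<zero>" "x = rfrac R a b"
    using Frac_cases[OF assms(5)] .
  have u: "emb b \<in> Units (Frac R)" "inv\<^bsub>Frac R\<^esub> (emb b) = rfrac R \<one> b"
    using Frac_inverse[of b \<one>] ab one_neq_zero by auto
  have ib: "rfrac R \<one> b \<in> carrier (Frac R)" "emb b \<in> carrier (Frac R)" "emb a \<in> carrier (Frac R)"
    using ab one_neq_zero by auto
  have 1: "emb b \<otimes>\<^bsub>Frac R\<^esub> rfrac R \<one> b = \<one>\<^bsub>Frac R\<^esub>" "rfrac R \<one> b \<otimes>\<^bsub>Frac R\<^esub> emb b = \<one>\<^bsub>Frac R\<^esub>"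
    using ab one_neq_zero by (simp_all add: Frac_mult_chain Frac_one[of \<one>] flip: Frac_one[of b])
  have "\<phi> (rfrac R \<one> b) = \<phi> (rfrac R \<one> b) \<otimes>\<^bsub>D\<^esub> \<psi> (emb b \<otimes>\<^bsub>Frac R\<^esub> rfrac R \<one> b)"
    using ib 1 by simp
  also have "\<dots> = \<phi> (rfrac R \<one> b) \<otimes>\<^bsub>D\<^esub> (\<phi> (emb b) \<otimes>\<^bsub>D\<^esub> \<psi> (rfrac R \<one> b))"
    using ib ab assms(4)[of b] by simp
  also have "\<dots> = \<phi> (rfrac R \<one> b \<otimes>\<^bsub>Frac R\<^esub> emb b) \<otimes>\<^bsub>D\<^esub> \<psi> (rfrac R \<one> b)"
    using ib by (simp add: D.m_assoc)
  also have "\<dots> = \<psi> (rfrac R \<one> b)"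
    using ib 1 by simp
  finally show ?thesis
    using ab ib assms(4)[of a] rfrac_emb[of a b] u(2) by simp
qed

text \<open>Injectivity turns the image of every denominator into a unit of \<open>D\<close>.
  Extensionality is part of the conclusion because the definite description of \<open>qmut\<close>
  asks for it.\<close>

lemma Frac_hom_extend:
  assumes "h \<in> ring_hom R D" "inj_on h (carrier R)" "division_ring D"
  obtains H where "H \<in> ring_hom (Frac R) D" "H \<in> extensional (carrier (Frac R))"
    "\<And>a. a \<in> carrier R \<Longrightarrow> H (emb a) = h a"
    "\<And>a b. \<lbrakk>a \<in> carrier R; b \<in> carrier R; b \<noteq> \<zero>\<rbrakk> \<Longrightarrow> H (rfrac R a b) = h a \<otimes>\<^bsub>D\<^esub> inv\<^bsub>D\<^esub> (h b)"
proof -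
  interpret D: division_ring D by fact
  note [simp] = ring_hom_closed[OF assms(1)] ring_hom_mult[OF assms(1)] ring_hom_one[OF assms(1)]
    ring_hom_add[OF assms(1)]
  define H where "H = (\<lambda>x\<in>carrier (Frac R). THE y. \<exists>a\<in>carrier R. \<exists>b\<in>carrier R. b \<noteq> \<zero> \<and>
      x = rfrac R a b \<and> y = h a \<otimes>\<^bsub>D\<^esub> inv\<^bsub>D\<^esub> (h b))"
  have U: "h b \<in> Units D" if "b \<in> carrier R" "b \<noteq> \<zero>" for b
  proof -
    have "h \<zero> = \<zero>\<^bsub>D\<^esub>"
      using assms(1) ring_axioms D.ring_axioms ring_hom_zero by blast
    then have "h b \<noteq> \<zero>\<^bsub>D\<^esub>"
      using that inj_onD[OF assms(2), of b \<zero>] by auto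
    then show ?thesis
      using that by (intro D.nonzero_Units) auto
  qed
  have inv_mult: "inv\<^bsub>D\<^esub> (h (b \<otimes> u)) = inv\<^bsub>D\<^esub> (h u) \<otimes>\<^bsub>D\<^esub> inv\<^bsub>D\<^esub> (h b)"
    if "b \<in> carrier R" "b \<noteq> \<zero>" "u \<in> carrier R" "u \<noteq> \<zero>" for b u
    using that U by (simp add: D.inv_mult_Units)
  have cancel: "h (a \<otimes> u) \<otimes>\<^bsub>D\<^esub> inv\<^bsub>D\<^esub> (h (b \<otimes> u)) = h a \<otimes>\<^bsub>D\<^esub> inv\<^bsub>D\<^esub> (h b)"
    if "a \<in> carrier R" "b \<in> carrier R" "b \<noteq> \<zero>" "u \<in> carrier R" "u \<noteq> \<zero>" for a b u
  proof -
    have "h (a \<otimes> u) \<otimes>\<^bsub>D\<^esub> inv\<^bsub>D\<^esub> (h (b \<otimes> u)) =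
      h a \<otimes>\<^bsub>D\<^esub> (h u \<otimes>\<^bsub>D\<^esub> inv\<^bsub>D\<^esub> (h u)) \<otimes>\<^bsub>D\<^esub> inv\<^bsub>D\<^esub> (h b)"
      unfolding inv_mult[OF that(2-5)] ring_hom_mult[OF assms(1) that(1,4)]
      using that U[OF that(2,3)] U[OF that(4,5)]
      by (simp only: D.m_assoc D.m_closed D.Units_inv_closed D.Units_closed ring_hom_closed[OF assms(1)])
    then show ?thesis
      using that U by (simp del: ring_hom_mult)
  qed
  have H: "H (rfrac R a b) = h a \<otimes>\<^bsub>D\<^esub> inv\<^bsub>D\<^esub> (h b)"
    if ab: "a \<in> carrier R" "b \<in> carrier R" "b \<noteq> \<zero>" for a b
  proof -
    have "(THE y. \<exists>a'\<in>carrier R. \<exists>b'\<in>carrier R. b' \<noteq> \<zero> \<and>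
      rfrac R a b = rfrac R a' b' \<and> y = h a' \<otimes>\<^bsub>D\<^esub> inv\<^bsub>D\<^esub> (h b')) = h a \<otimes>\<^bsub>D\<^esub> inv\<^bsub>D\<^esub> (h b)"
    proof (rule the_equality)
      fix y assume "\<exists>a'\<in>carrier R. \<exists>b'\<in>carrier R. b' \<noteq> \<zero> \<and>
        rfrac R a b = rfrac R a' b' \<and> y = h a' \<otimes>\<^bsub>D\<^esub> inv\<^bsub>D\<^esub> (h b')"
      then obtain a' b' where a': "a' \<in> carrier R" "b' \<in> carrier R" "b' \<noteq> \<zero>"
        "rfrac R a b = rfrac R a' b'" "y = h a' \<otimes>\<^bsub>D\<^esub> inv\<^bsub>D\<^esub> (h b')" by blast
      obtain u v where uv: "u \<in> carrier R" "v \<in> carrier R" "u \<noteq> \<zero>" "v \<noteq> \<zero>" "b \<otimes> u = b' \<otimes> v"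
        using ore_ex[OF ab(2) a'(2) ab(3) a'(3)] by metis
      have "a \<otimes> u = a' \<otimes> v"
        using ore_rel_cross[OF rfrac_eqD[OF a'(4)]] a' uv by blast
      then show "y = h a \<otimes>\<^bsub>D\<^esub> inv\<^bsub>D\<^esub> (h b)"
        using cancel[of a b u] cancel[of a' b' v] ab a' uv by metis
    qed (use that in blast)
    then show ?thesis
      using that by (simp add: H_def)
  qed
  have Hemb: "H (emb a) = h a" if "a \<in> carrier R" for a
    using H[of a \<one>] that one_neq_zero by simp
  have hom: "H \<in> ring_hom (Frac R) D"
  proof (rule ring_hom_memI)
    fix x assume x: "x \<in> carrier (Frac R)"
    show "H x \<in> carrier D"
      by (rule Frac_cases[OF x]) (simp add: H U)
    fix y assume y: "y \<in> carrier (Frac R)"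
    show "H (x \<oplus>\<^bsub>Frac R\<^esub> y) = H x \<oplus>\<^bsub>D\<^esub> H y"
      by (rule Frac_common2[OF x y]) (simp add: H Frac_add D.l_distr U)
    obtain a b where ab: "a \<in> carrier R" "b \<in> carrier R" "b \<noteq> \<zero>" "x = rfrac R a b"
      using Frac_cases[OF x] .
    obtain c d where cd: "c \<in> carrier R" "d \<in> carrier R" "d \<noteq> \<zero>" "y = rfrac R c d"
      using Frac_cases[OF y] .
    obtain u v where uv: "u \<in> carrier R" "v \<in> carrier R" "v \<noteq> \<zero>" "b \<otimes> u = c \<otimes> v"
      "x \<otimes>\<^bsub>Frac R\<^esub> y = rfrac R (a \<otimes> u) (d \<otimes> v)"
      using Frac_mult_ex[of a b c d] ab cd by metis
    have U': "h b \<in> Units D" "h v \<in> Units D" "h d \<in> Units D"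
      using U ab cd uv by auto
    \<comment> \<open>The Ore pair satisfies b u = c v; inside \<open>D\<close> this says that u
      v^-1 is another way to write b^-1 c.\<close>
    have e: "h u \<otimes>\<^bsub>D\<^esub> inv\<^bsub>D\<^esub> (h v) = inv\<^bsub>D\<^esub> (h b) \<otimes>\<^bsub>D\<^esub> h c"
    proof -
      have "h u \<otimes>\<^bsub>D\<^esub> inv\<^bsub>D\<^esub> (h v) = inv\<^bsub>D\<^esub> (h b) \<otimes>\<^bsub>D\<^esub> (h b \<otimes>\<^bsub>D\<^esub> h u) \<otimes>\<^bsub>D\<^esub> inv\<^bsub>D\<^esub> (h v)"
        using U' uv(1) ab(1-3) by (simp flip: D.m_assoc)
      also have "h b \<otimes>\<^bsub>D\<^esub> h u = h c \<otimes>\<^bsub>D\<^esub> h v"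
        using uv(4) ring_hom_mult[OF assms(1) ab(2) uv(1)] ring_hom_mult[OF assms(1) cd(1) uv(2)] by simp
      also have "inv\<^bsub>D\<^esub> (h b) \<otimes>\<^bsub>D\<^esub> (h c \<otimes>\<^bsub>D\<^esub> h v) \<otimes>\<^bsub>D\<^esub> inv\<^bsub>D\<^esub> (h v) =
          inv\<^bsub>D\<^esub> (h b) \<otimes>\<^bsub>D\<^esub> h c \<otimes>\<^bsub>D\<^esub> (h v \<otimes>\<^bsub>D\<^esub> inv\<^bsub>D\<^esub> (h v))"
        using U' uv(1,2) ab(1-3) cd(1-3) by (simp add: D.m_assoc)
      finally show ?thesis
        using U' uv(1,2) ab(1-3) cd(1-3) by simp
    qed
    have "H (x \<otimes>\<^bsub>Frac R\<^esub> y) = h a \<otimes>\<^bsub>D\<^esub> (h u \<otimes>\<^bsub>D\<^esub> inv\<^bsub>D\<^esub> (h v)) \<otimes>\<^bsub>D\<^esub> inv\<^bsub>D\<^esub> (h d)"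
      unfolding uv(5) using ab(1-3) cd(1-3) uv(1-3) U' H[of "a \<otimes> u" "d \<otimes> v"] inv_mult[of d v]
      by (simp add: D.m_assoc)
    also have "\<dots> = H x \<otimes>\<^bsub>D\<^esub> H y"
      unfolding e ab(4) cd(4) using ab(1-3) cd(1-3) U' by (simp add: H D.m_assoc)
    finally show "H (x \<otimes>\<^bsub>Frac R\<^esub> y) = H x \<otimes>\<^bsub>D\<^esub> H y" .
  qed (use Hemb[of \<one>] one_neq_zero in \<open>simp add: Frac_one[of \<one>]\<close>)
  show ?thesis
  proof (rule that[OF hom _ Hemb H])
    show "H \<in> extensional (carrier (Frac R))"
      unfolding H_def by (rule restrict_extensional)
  qed
qed

end

subsection \<open>Additive extension to finitely supported functions\<close>

text \<open>\<open>L\<close> receives the exponent together with the coefficient. Products,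
  mutations, lattice maps and the actions on families all have this form, so additivity only has to
  be checked for \<open>L\<close> in its coefficient.\<close>

definition pm_lin :: "('a \<Rightarrow> 'b::zero \<Rightarrow> 'c::comm_monoid_add) \<Rightarrow> ('a \<Rightarrow>\<^sub>0 'b) \<Rightarrow> 'c" where
  "pm_lin L f = (\<Sum>v\<in>keys f. L v (lookup f v))"

lemma pm_lin_superset:
  assumes "\<And>v. L v 0 = 0" "finite S" "keys f \<subseteq> S"
  shows "pm_lin L f = (\<Sum>v\<in>S. L v (lookup f v))"
  unfolding pm_lin_def
  by (rule sum.mono_neutral_left) (use assms in \<open>auto simp: in_keys_iff\<close>)

lemma pm_lin_zero [simp]: "pm_lin L 0 = 0"
  by (simp add: pm_lin_def)

lemma pm_lin_single: "(\<And>v. L v 0 = 0) \<Longrightarrow> pm_lin L (single v c) = L v c"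
  by (simp add: pm_lin_superset[of L "{v}"])

lemma pm_lin_add:
  fixes f g :: "'a \<Rightarrow>\<^sub>0 'b::comm_monoid_add"
  assumes "\<And>v. L v 0 = 0" "\<And>v a b. L v (a + b) = L v a + L v b"
  shows "pm_lin L (f + g) = pm_lin L f + pm_lin L g"
proof -
  \<comment> \<open>Supports may shrink under addition, so all three sums are taken over one common
    finite set.\<close>
  define S where "S = keys f \<union> keys g"
  have "finite S" "keys f \<subseteq> S" "keys g \<subseteq> S" "keys (f + g) \<subseteq> S"
    using keys_add[of f g] by (auto simp: S_def)
  then show ?thesis
    using assms by (simp add: pm_lin_superset lookup_add sum.distrib)
qed

lemma pm_lin_fun_zero [simp]: "pm_lin (\<lambda>v a. 0) f = 0"
  by (simp add: pm_lin_def)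

lemma pm_lin_fun_add: "pm_lin (\<lambda>v a. L v a + L' v a) f = pm_lin L f + pm_lin L' f"
  by (simp add: pm_lin_def sum.distrib)

lemma pm_lin_uminus:
  fixes f :: "'a \<Rightarrow>\<^sub>0 'b::ab_group_add" and L :: "'a \<Rightarrow> 'b \<Rightarrow> 'c::ab_group_add"
  assumes "\<And>v. L v 0 = 0" "\<And>v a b. L v (a + b) = L v a + L v b"
  shows "pm_lin L (- f) = - pm_lin L f"
  using pm_lin_add[of L f "- f"] assms by (simp add: eq_neg_iff_add_eq_0 add.commute)

lemma pm_lin_diff:
  fixes f :: "'a \<Rightarrow>\<^sub>0 'b::ab_group_add" and L :: "'a \<Rightarrow> 'b \<Rightarrow> 'c::ab_group_add"
  assumes "\<And>v. L v 0 = 0" "\<And>v a b. L v (a + b) = L v a + L v b"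
  shows "pm_lin L (f - g) = pm_lin L f - pm_lin L g"
  using pm_lin_add[of L f "- g"] pm_lin_uminus[of L g] assms by simp

lemma keys_pm_lin: "keys (pm_lin L f) \<subseteq> (\<Union>v\<in>keys f. keys (L v (lookup f v)))"
  unfolding pm_lin_def by (rule keys_sum)

lemma pm_lin_id:
  fixes f :: "'a \<Rightarrow>\<^sub>0 'b::comm_monoid_add"
  shows "pm_lin single f = f"
proof (rule poly_mapping_eqI)
  fix k
  have "lookup (pm_lin single f) k =
    (\<Sum>v\<in>keys f. if v = k then lookup f k else 0)"
    unfolding pm_lin_def lookup_sum by (intro sum.cong) (auto simp: lookup_single when_def)
  then show "lookup (pm_lin single f) k = lookup f k"
    by (simp add: in_keys_iff)
qed

text \<open>Reduces identities to monomials while the condition on the supports is carried along, as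
  membership in a torus requires.\<close>

lemma pm_induct_keys [consumes 1, case_names zero single add]:
  fixes f :: "'a \<Rightarrow>\<^sub>0 'b::comm_monoid_add"
  assumes "keys f \<subseteq> A" "P 0" "\<And>v c. v \<in> A \<Longrightarrow> P (single v c)"
    "\<And>f g. keys f \<subseteq> A \<Longrightarrow> keys g \<subseteq> A \<Longrightarrow> P f \<Longrightarrow> P g \<Longrightarrow> P (f + g)"
  shows "P f"
proof -
  have "keys (\<Sum>v\<in>S. single v (c v)) \<subseteq> A \<and> P (\<Sum>v\<in>S. single v (c v))"
    if "finite S" "S \<subseteq> A" for S and c :: "'a \<Rightarrow> 'b"
    using that
  proof (induction S rule: finite_induct)
    case (insert x S)
    have "keys (single x (c x)) \<subseteq> A"
      using insert by auto
    then show ?case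
      using insert assms(3,4) keys_add[of "single x (c x)" "\<Sum>v\<in>S. single v (c v)"] by auto
  qed (use assms(2) in auto)
  from this[of "keys f" "lookup f"] show ?thesis
    using assms(1) pm_lin_id[of f] by (simp add: pm_lin_def)
qed

lemma pm_induct [case_names zero single add]:
  fixes f :: "'a \<Rightarrow>\<^sub>0 'b::comm_monoid_add"
  assumes "P 0" "\<And>v c. P (single v c)" "\<And>f g. P f \<Longrightarrow> P g \<Longrightarrow> P (f + g)"
  shows "P f"
  by (rule pm_induct_keys[of f UNIV]) (use assms in auto)

definition scl :: "'b::semiring_0 \<Rightarrow> ('a \<Rightarrow>\<^sub>0 'b) \<Rightarrow> ('a \<Rightarrow>\<^sub>0 'b)" where
  "scl r f = Poly_Mapping.map ((*) r) f"

lemma lookup_scl [simp]: "lookup (scl r f) v = r * lookup f v"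
  unfolding scl_def by (simp add: Poly_Mapping.map.rep_eq when_def)

lemma scl_single [simp]: "scl r (single v c) = single v (r * c)"
  by (rule poly_mapping_eqI) (simp add: lookup_single when_def)

lemma scl_add: "scl r (f + g) = scl r f + scl r g"
  by (rule poly_mapping_eqI) (simp add: lookup_add distrib_left)

lemma scl_zero [simp]: "scl r 0 = 0"
  by (rule poly_mapping_eqI) simp

lemma scl_scl: "scl r (scl s f) = scl (r * s) f"
  by (rule poly_mapping_eqI) (simp add: mult.assoc)

lemma keys_scl: "keys (scl r f) \<subseteq> keys f"
  by (auto simp: in_keys_iff)

subsection \<open>Quantum tori as domains\<close>

lemma torus_sel [simp]:
  "carrier (torus Q) = {f. keys f \<subseteq> Lat_tilde Q}" "mult (torus Q) = qt_mult Q"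
  "one (torus Q) = Y 0" "zero (torus Q) = 0" "add (torus Q) = (+)"
  by (simp_all add: torus_def)

lemma qt_mult_lin:
  "qt_mult Q f g = pm_lin (\<lambda>v a. pm_lin (\<lambda>w b. single (v + w) (qpow (- form Q v w) * a * b)) g) f"
  by (simp add: qt_mult_def pm_lin_def)

lemma qt_mult_single [simp]:
  "qt_mult Q (single v a) (single w b) =
    single (v + w) (qpow (- form Q v w) * a * b)"
  by (simp add: qt_mult_lin pm_lin_single)

lemma qt_mult_add_left: "qt_mult Q (f + f') g = qt_mult Q f g + qt_mult Q f' g"
  unfolding qt_mult_lin
  by (rule pm_lin_add) (simp_all add: algebra_simps single_add flip: pm_lin_fun_add)

lemma qt_mult_add_right: "qt_mult Q f (g + g') = qt_mult Q f g + qt_mult Q f g'"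
  unfolding qt_mult_lin
  by (subst pm_lin_fun_add[symmetric], intro arg_cong2[where f = pm_lin] ext refl pm_lin_add)
    (simp_all add: algebra_simps single_add)

lemma qt_mult_zero [simp]: "qt_mult Q 0 g = 0" "qt_mult Q f 0 = 0"
  by (simp_all add: qt_mult_lin)

lemma qt_mult_uminus: "qt_mult Q (- f) g = - qt_mult Q f g" "qt_mult Q f (- g) = - qt_mult Q f g"
  using qt_mult_add_left[of Q f "- f" g] qt_mult_add_right[of Q f g "- g"]
  by (simp_all add: eq_neg_iff_add_eq_0 add.commute)

lemma qt_mult_diff: "qt_mult Q (f - f') g = qt_mult Q f g - qt_mult Q f' g"
   "qt_mult Q f (g - g') = qt_mult Q f g - qt_mult Q f g'"
  using qt_mult_add_left[of Q f "- f'" g] qt_mult_add_right[of Q f g "- g'"]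
  by (simp_all add: qt_mult_uminus)

lemma qt_mult_sum_right: "qt_mult Q f (\<Sum>i\<in>I. g i) = (\<Sum>i\<in>I. qt_mult Q f (g i))"
  by (induction I rule: infinite_finite_induct) (auto simp: qt_mult_add_right)

lemma qt_mult_sum_left: "qt_mult Q (\<Sum>i\<in>I. g i) f = (\<Sum>i\<in>I. qt_mult Q (g i) f)"
  by (induction I rule: infinite_finite_induct) (auto simp: qt_mult_add_left)

lemma form_zero [simp]: "form Q 0 w = 0" "form Q v 0 = 0"
  by (simp_all add: form_def)

lemma form_uminus_left [simp]: "form Q (- v) w = - form Q v w"
  and form_uminus_right [simp]: "form Q v (- w) = - form Q v w"
  by (simp_all add: form_def sum_negf)

lemma qpow_zero [simp]: "qpow 0 = 1"
  by (simp add: qpow_def)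

lemma qpow_nonzero [simp]: "qpow r \<noteq> 0"
  by (simp add: qpow_def)

lemma qpow_add: "2 * r \<in> \<int> \<Longrightarrow> 2 * s \<in> \<int> \<Longrightarrow> qpow (r + s) = qpow r * qpow s"
  by (auto simp: qpow_def mult_single algebra_simps elim!: Ints_cases)

lemma qpow_uminus: "2 * r \<in> \<int> \<Longrightarrow> qpow r * qpow (- r) = 1"
  using qpow_add[of r "- r"] by simp

lemma scl_qt_mult:
  "qt_mult Q (scl r f) g = scl r (qt_mult Q f g)" "qt_mult Q f (scl r g) = scl r (qt_mult Q f g)"
proof -
  show "qt_mult Q (scl r f) g = scl r (qt_mult Q f g)"
  proof (induction f rule: pm_induct)
    case (single v a)
    show ?case
      by (induction g rule: pm_induct) (simp_all add: qt_mult_add_right scl_add mult_ac)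
  qed (simp_all add: qt_mult_add_left scl_add)
  show "qt_mult Q f (scl r g) = scl r (qt_mult Q f g)"
  proof (induction f rule: pm_induct)
    case (single v a)
    show ?case
      by (induction g rule: pm_induct) (simp_all add: qt_mult_add_right scl_add mult_ac)
  qed (simp_all add: qt_mult_add_left scl_add)
qed

lemma qt_mult_const:
  "qt_mult Q (qt_const r) f = scl r f" "qt_mult Q f (qt_const r) = scl r f"
  by (induction f rule: pm_induct;
      simp add: qt_const_def qt_mult_add_left qt_mult_add_right scl_add mult_ac)+

lemma qt_mult_one [simp]: "qt_mult Q (Y 0) f = f" "qt_mult Q f (Y 0) = f"
proof -
  have "scl 1 f = f" by (rule poly_mapping_eqI) simp
  then show "qt_mult Q (Y 0) f = f" "qt_mult Q f (Y 0) = f"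
    using qt_mult_const[where Q = Q and r = 1 and f = f] by (simp_all add: Y_def qt_const_def)
qed

lemma Lat_add: "v \<in> Lat \<Longrightarrow> w \<in> Lat \<Longrightarrow> v + w \<in> Lat"
  and Lat_uminus: "v \<in> Lat \<Longrightarrow> - v \<in> Lat"
  and Lat_zero [simp]: "0 \<in> Lat"
  by (auto simp: Lat_def)

lemma Lat_ebas [simp]: "ebas k \<in> Lat"
  by (auto simp: Lat_def ebas_def axis_def)

lemma form_Lat: "v \<in> Lat \<Longrightarrow> w \<in> Lat \<Longrightarrow> form Q v w \<in> \<int>"
  by (auto simp: Lat_def form_def intro!: Ints_sum Ints_mult)

lemma Lat_tilde_add: "v \<in> Lat_tilde Q \<Longrightarrow> w \<in> Lat_tilde Q \<Longrightarrow> v + w \<in> Lat_tilde Q"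
  by (auto simp: Lat_tilde_def Lat_def form_add_right distrib_left)

lemma Lat_tilde_uminus: "v \<in> Lat_tilde Q \<Longrightarrow> - v \<in> Lat_tilde Q"
  by (auto simp: Lat_tilde_def Lat_def)

lemma Lat_tilde_zero [simp]: "0 \<in> Lat_tilde Q"
  by (auto simp: Lat_tilde_def Lat_def)

lemma Lat_tilde_Lat: "v \<in> Lat \<Longrightarrow> v \<in> Lat_tilde Q"
  using form_Lat by (auto simp: Lat_tilde_def Lat_def)

lemma Lat_tilde_ebas [simp]: "ebas k \<in> Lat_tilde Q"
  by (rule Lat_tilde_Lat) simp

lemma form_ebas_Ints: "v \<in> Lat_tilde Q \<Longrightarrow> form Q (ebas k) v \<in> \<int>"
  by (simp add: Lat_tilde_def)

lemma form_half: "v \<in> Lat_tilde Q \<Longrightarrow> w \<in> Lat_tilde Q \<Longrightarrow> 2 * form Q v w \<in> \<int>"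
  by (auto simp: Lat_tilde_def simp flip: form_scale_left)

lemma keys_qt_mult:
  "keys (qt_mult Q f g) \<subseteq> {v + w |v w. v \<in> keys f \<and> w \<in> keys g}"
  unfolding qt_mult_def
  by (rule order.trans[OF keys_sum], rule UN_least, rule order.trans[OF keys_sum]) (auto split: if_splits)

text \<open>The floor in \<open>qpow\<close> leaves it multiplicative on half-integers only. The
  form takes such values on \<open>Lat_tilde Q\<close>, and this is where the supports have to
  lie.\<close>

lemma qt_mult_assoc:
  assumes "keys f \<subseteq> Lat_tilde Q" "keys g \<subseteq> Lat_tilde Q" "keys h \<subseteq> Lat_tilde Q"
  shows "qt_mult Q (qt_mult Q f g) h = qt_mult Q f (qt_mult Q g h)"
  using assms(1)
proof (induction f rule: pm_induct_keys)
  case (single v a)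
  note v = this
  show ?case using assms(2)
  proof (induction g rule: pm_induct_keys)
    case (single w b)
    note w = this
    show ?case using assms(3)
    proof (induction h rule: pm_induct_keys)
      case (single u c)
      have "qpow (- form Q (v + w) u) * qpow (- form Q v w) = qpow (- form Q v (w + u)) * qpow (- form Q w u)"
      proof -
        have "- form Q (v + w) u + - form Q v w = - form Q v (w + u) + - form Q w u"
          by (simp add: form_add_left form_add_right)
        moreover have "2 * - form Q (v + w) u \<in> \<int>" "2 * - form Q v w \<in> \<int>"
          "2 * - form Q v (w + u) \<in> \<int>" "2 * - form Q w u \<in> \<int>"
          using v w single by (simp_all add: form_half Lat_tilde_add)
        ultimately show ?thesis
          using qpow_add by metis
      qed
      then show ?case
        by (simp add: mult_ac add.assoc)
    qed (auto simp: qt_mult_add_right)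
  qed (auto simp: qt_mult_add_left qt_mult_add_right)
qed (auto simp: qt_mult_add_left)

lemma torus_mult_closed:
  "\<lbrakk>keys f \<subseteq> Lat_tilde Q; keys g \<subseteq> Lat_tilde Q\<rbrakk> \<Longrightarrow> keys (qt_mult Q f g) \<subseteq> Lat_tilde Q"
  using keys_qt_mult[of Q f g] Lat_tilde_add by blast

lemma torus_add_closed:
  fixes f g :: qtorus
  shows "\<lbrakk>keys f \<subseteq> A; keys g \<subseteq> A\<rbrakk> \<Longrightarrow> keys (f + g) \<subseteq> A"
  using keys_add[of f g] by blast

lemma keys_Y [simp]: "keys (Y v) = {v}"
  by (simp add: Y_def)

lemma torus_ring: "ring (torus Q)"
proof (rule ringI)
  show "abelian_group (torus Q)"
  proof (rule abelian_groupI)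
    show "\<exists>y\<in>carrier (torus Q). y \<oplus>\<^bsub>torus Q\<^esub> x = \<zero>\<^bsub>torus Q\<^esub>" if "x \<in> carrier (torus Q)" for x
      using that by (intro bexI[of _ "- x"]) auto
  qed (auto simp: add_ac dest: keys_add[THEN subsetD])
  show "Group.monoid (torus Q)"
    by (rule monoidI) (auto simp: qt_mult_assoc dest: torus_mult_closed[THEN subsetD, rotated 2])
qed (auto simp: qt_mult_add_left qt_mult_add_right)

lemma lookup_qt_mult:
  "lookup (qt_mult Q f g) u = (\<Sum>v\<in>keys f. \<Sum>w\<in>keys g.
    if v + w = u then qpow (- form Q v w) * lookup f v * lookup g w else 0)"
  by (simp add: qt_mult_def lookup_sum lookup_single when_def)

section \<open>A group order on the weights and the absence of zero divisors\<close>

lemma ex_inj_7_nat: "\<exists>e :: 7 \<Rightarrow> nat. inj e"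
  using finite_imp_inj_to_nat_seg[of "UNIV :: 7 set"] by auto

text \<open>Weights are ordered through an additive embedding into the ordered group of rational polynomials.\<close>

definition weight_poly :: "weight \<Rightarrow> rat poly" where
  "weight_poly v = (\<Sum>i\<in>UNIV. monom (v $ i) ((SOME e :: 7 \<Rightarrow> nat. inj e) i))"

lemma weight_poly_add: "weight_poly (v + w) = weight_poly v + weight_poly w"
  by (simp add: weight_poly_def sum.distrib flip: add_monom)

lemma inj_weight_poly: "inj weight_poly"
proof (rule injI)
  fix v w assume eq: "weight_poly v = weight_poly w"
  define e where "e = (SOME e :: 7 \<Rightarrow> nat. inj e)"
  have e: "inj e"
    unfolding e_def by (rule someI_ex[OF ex_inj_7_nat])
  have co: "coeff (weight_poly u) (e i) = u $ i" for u i
    using e by (simp add: weight_poly_def coeff_sum inj_eq flip: e_def)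
  show "v = w"
    unfolding vec_eq_iff using eq co by metis
qed

text \<open>Leading terms cannot cancel: in a totally ordered group the sum of the two largest
  weights has a single decomposition, and its coefficient is a product of nonzero elements of a
  domain.\<close>

lemma qt_mult_eq_zero:
  assumes "qt_mult Q f g = 0"
  shows "f = 0 \<or> g = 0"
proof (rule ccontr)
  assume "\<not> (f = 0 \<or> g = 0)"
  then have ne: "keys f \<noteq> {}" "keys g \<noteq> {}" by auto
  have top: "\<exists>v\<in>S. \<forall>w\<in>S. weight_poly w \<le> weight_poly v" if "finite S" "S \<noteq> {}" for S
  proof -
    have "Max (weight_poly ` S) \<in> weight_poly ` S"
      using that by (intro Max_in) auto
    then obtain v where "v \<in> S" "weight_poly v = Max (weight_poly ` S)" by (metis imageE)
    then show ?thesis using that by (metis Max_ge finite_imageI imageI)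
  qed
  obtain v where v: "v \<in> keys f" "\<And>v'. v' \<in> keys f \<Longrightarrow> weight_poly v' \<le> weight_poly v"
    using top[OF finite_keys ne(1)] by blast
  obtain w where w: "w \<in> keys g" "\<And>w'. w' \<in> keys g \<Longrightarrow> weight_poly w' \<le> weight_poly w"
    using top[OF finite_keys ne(2)] by blast
  have eq: "v' + w' = v + w \<longleftrightarrow> v' = v \<and> w' = w" if "v' \<in> keys f" "w' \<in> keys g" for v' w'
  proof
    assume s: "v' + w' = v + w"
    then have "weight_poly v' + weight_poly w' = weight_poly v + weight_poly w"
      by (simp flip: weight_poly_add)
    with v(2)[OF that(1)] w(2)[OF that(2)] have "weight_poly v' = weight_poly v"
      by linarith
    then have "v' = v" using inj_weight_poly by (simp add: inj_eq)
    with s show "v' = v \<and> w' = w" by simp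
  qed auto
  have "lookup (qt_mult Q f g) (v + w) = (\<Sum>v'\<in>keys f. \<Sum>w'\<in>keys g.
    if v' = v \<and> w' = w then qpow (- form Q v w) * lookup f v * lookup g w else 0)"
    unfolding lookup_qt_mult by (intro sum.cong refl) (simp add: eq cong: if_cong)
  also have "\<dots> = (\<Sum>v'\<in>keys f. if v' = v then (\<Sum>w'\<in>keys g.
    if w' = w then qpow (- form Q v w) * lookup f v * lookup g w else 0) else 0)"
    by (intro sum.cong refl) simp
  also have "\<dots> = qpow (- form Q v w) * lookup f v * lookup g w"
    using v(1) w(1) by simp
  also have "\<dots> \<noteq> 0"
    using v(1) w(1) by (simp add: in_keys_iff)
  finally show False
    using assms by simp
qed

text \<open>Gaussian elimination that multiplies rows crosswise instead of dividing, because the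
  coefficients \<open>qlaurent\<close> form a domain and not a field.\<close>

lemma linear_system_nontrivial:
  fixes A :: "'e \<Rightarrow> 'x \<Rightarrow> 'a::idom"
  assumes "finite E" "finite X" "card E < card X"
  shows "\<exists>c. (\<exists>x\<in>X. c x \<noteq> 0) \<and> (\<forall>e\<in>E. (\<Sum>x\<in>X. A e x * c x) = 0)"
  using assms
proof (induction E arbitrary: X A rule: finite_induct)
  case empty
  then show ?case
    by (intro exI[of _ "\<lambda>_. 1"]) (auto simp: card_gt_0_iff)
next
  case (insert e E)
  show ?case
  proof (cases "\<forall>x\<in>X. A e x = 0")
    case True
    obtain c where "\<exists>x\<in>X. c x \<noteq> 0" "\<forall>e\<in>E. (\<Sum>x\<in>X. A e x * c x) = 0"
      using insert.IH[of X A] insert.prems insert.hyps by (metis Suc_lessD card_insert_disjoint)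
    then show ?thesis
      using True by (intro exI[of _ c]) auto
  next
    case False
    then obtain x0 where x0: "x0 \<in> X" "A e x0 \<noteq> 0" by blast
    \<comment> \<open>Row \<open>e'\<close> with the unknown \<open>x0\<close> eliminated against
      row \<open>e\<close>. The solution \<open>d\<close> below restores \<open>x0\<close> and
      rescales the other unknowns by the pivot \<open>A e x0\<close>.\<close>
    define A' where "A' e' x = A e x0 * A e' x - A e' x0 * A e x" for e' x
    obtain c where c: "\<exists>x\<in>X - {x0}. c x \<noteq> 0" "\<forall>e\<in>E. (\<Sum>x\<in>X - {x0}. A' e x * c x) = 0"
    proof -
      have "card E < card (X - {x0})"
        using insert.prems insert.hyps x0 by (simp add: card_insert_disjoint)
      from insert.IH[OF _ this, of A'] insert.prems(1) that show ?thesis by blast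
    qed
    define d where "d x = (if x = x0 then - (\<Sum>x\<in>X - {x0}. A e x * c x) else A e x0 * c x)" for x
    have sum: "(\<Sum>x\<in>X. A e' x * d x) = (\<Sum>x\<in>X - {x0}. A' e' x * c x)" for e'
    proof -
      have "(\<Sum>x\<in>X. A e' x * d x) = A e' x0 * d x0 + (\<Sum>x\<in>X - {x0}. A e' x * d x)"
        using x0 insert by (simp add: sum.remove)
      also have "(\<Sum>x\<in>X - {x0}. A e' x * d x) = (\<Sum>x\<in>X - {x0}. A e' x * (A e x0 * c x))"
        by (intro sum.cong) (auto simp: d_def)
      finally show ?thesis
        by (simp add: d_def A'_def sum_distrib_left algebra_simps sum_subtractf)
    qed
    have "(\<Sum>x\<in>X. A e x * d x) = 0"
      unfolding sum by (simp add: A'_def algebra_simps)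
    moreover have "\<exists>x\<in>X. d x \<noteq> 0"
      using c(1) x0 by (auto simp: d_def)
    ultimately show ?thesis
      using c(2) sum by (intro exI[of _ d]) auto
  qed
qed

section \<open>Growth of boxes of weights and the Ore condition\<close>

definition box :: "quiver \<Rightarrow> nat \<Rightarrow> weight set" where
  "box Q N = {v \<in> Lat_tilde Q. \<forall>i. \<bar>v $ i\<bar> \<le> of_nat N}"

lemma box_inj: "inj_on (\<lambda>v i. \<lfloor>2 * v $ i\<rfloor>) (Lat_tilde Q)"
proof (rule inj_onI)
  fix v w assume *: "v \<in> Lat_tilde Q" "w \<in> Lat_tilde Q" "(\<lambda>i. \<lfloor>2 * v $ i\<rfloor>) = (\<lambda>i. \<lfloor>2 * w $ i\<rfloor>)"
  have "v $ i = w $ i" for i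
  proof -
    have "2 * v $ i \<in> \<int>" "2 * w $ i \<in> \<int>" "\<lfloor>2 * v $ i\<rfloor> = \<lfloor>2 * w $ i\<rfloor>"
      using * by (auto simp: Lat_tilde_def Lat_def fun_eq_iff)
    then show ?thesis
      by (auto elim!: Ints_cases)
  qed
  then show "v = w" by (simp add: vec_eq_iff)
qed

text \<open>Weights in \<open>Lat_tilde Q\<close> have half-integral coordinates, so each of the
  seven takes at most 4N + 1 values between -N and N.\<close>

lemma box_finite: "finite (box Q N)"
  and box_card: "card (box Q N) \<le> (4 * N + 1) ^ 7"
proof -
  define F where "F = (\<lambda>(v::weight) i. \<lfloor>2 * v $ i\<rfloor>)"
  define T where "T = PiE (UNIV :: 7 set) (\<lambda>_. {- 2 * int N..2 * int N})"
  have sub: "F ` box Q N \<subseteq> T"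
  proof -
    have "- 2 * int N \<le> \<lfloor>2 * v $ i\<rfloor> \<and> \<lfloor>2 * v $ i\<rfloor> \<le> 2 * int N" if "v \<in> box Q N" for v i
    proof -
      have "\<bar>v $ i\<bar> \<le> of_nat N" using that by (simp add: box_def)
      then have "of_int (- 2 * int N) \<le> 2 * v $ i" "2 * v $ i \<le> of_int (2 * int N)"
        by auto
      then show ?thesis
        by (simp add: le_floor_iff floor_le_iff)
    qed
    then show ?thesis
      by (auto simp: F_def T_def)
  qed
  have inj: "inj_on F (box Q N)"
    using box_inj[of Q] unfolding F_def by (rule inj_on_subset) (auto simp: box_def)
  have T: "finite T" "card T = (4 * N + 1) ^ 7"
  proof -
    have "card {- 2 * int N..2 * int N} = 4 * N + 1" by simp
    then show "card T = (4 * N + 1) ^ 7"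
      by (simp add: T_def card_PiE)
    show "finite T" by (auto simp: T_def intro!: finite_PiE)
  qed
  show "finite (box Q N)"
    using inj_on_finite[OF inj sub T(1)] .
  show "card (box Q N) \<le> (4 * N + 1) ^ 7"
    using card_inj_on_le[OF inj sub T(1)] T(2) by simp
qed

text \<open>Otherwise every enlargement by \<open>s\<close> would at least double the box, and 2^k
  would stay below a polynomial of degree 7 in k.\<close>

lemma box_growth: "\<exists>N. card (box Q (N + s)) < 2 * card (box Q N)"
proof (rule ccontr)
  assume "\<not> ?thesis"
  then have *: "2 * card (box Q N) \<le> card (box Q (N + s))" for N
    by (meson not_le)
  have "2 ^ k \<le> card (box Q (k * s))" for k
  proof (induction k)
    case 0
    have "{0} \<subseteq> box Q 0" by (simp add: box_def)
    then have "card {0::weight} \<le> card (box Q 0)" by (rule card_mono[OF box_finite])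
    then show ?case by simp
  next
    case (Suc k)
    then show ?case using *[of "k * s"] by (simp add: add.commute)
  qed
  then have "2 ^ k \<le> (4 * (k * s) + 1) ^ 7" for k
    using box_card[of Q "k * s"] order.trans by blast
  then have "real (2 ^ k) \<le> real ((4 * (k * s) + 1) ^ 7)" for k
    using of_nat_le_iff by blast
  then have le: "2 ^ k \<le> (1 + 4 * (real k * real s)) ^ 7" for k
    by simp
  \<comment> \<open>\<open>s + 1\<close> replaces \<open>s\<close> so that the linear coefficient is
    positive even for s = 0.\<close>
  have "eventually (\<lambda>k. (4 * (real k * (real s + 1)) + 1) ^ 7 < 2 ^ k) at_top"
    by real_asymp
  then obtain k where "(4 * (real k * (real s + 1)) + 1) ^ 7 < 2 ^ k"
    by (auto simp: eventually_at_top_linorder)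
  moreover have "(1 + 4 * (real k * real s)) ^ 7 \<le> (4 * (real k * (real s + 1)) + 1) ^ 7"
    by (intro power_mono) (auto simp: algebra_simps)
  ultimately show False
    using le[of k] by linarith
qed

text \<open>The unknowns are the coefficients of the two cofactors on the box of size N, the
  equations are the coefficients of the combination on the box of size N + s. By
  \<open>box_growth\<close> some N leaves more unknowns than equations.\<close>

lemma torus_ore:
  assumes "keys a \<subseteq> Lat_tilde Q" "keys b \<subseteq> Lat_tilde Q" "b \<noteq> 0"
  shows "\<exists>u v. keys u \<subseteq> Lat_tilde Q \<and> keys v \<subseteq> Lat_tilde Q \<and> u \<noteq> 0 \<and> qt_mult Q a u = qt_mult Q b v"
proof -
  have "\<exists>s. \<forall>v\<in>keys a \<union> keys b. v \<in> box Q s"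
  proof -
    have "\<exists>s::nat. \<forall>v\<in>S. \<forall>i. \<bar>v $ i\<bar> \<le> of_nat s" if "finite S" for S :: "weight set"
      using that
    proof (induction S rule: finite_induct)
      case (insert v S)
      obtain s :: nat where s: "\<forall>v\<in>S. \<forall>i. \<bar>v $ i\<bar> \<le> of_nat s" using insert by blast
      obtain t :: nat where t: "(\<Sum>i\<in>UNIV. \<bar>v $ i\<bar>) \<le> of_nat t"
        using real_arch_simple by blast
      have "\<bar>v $ i\<bar> \<le> of_nat t" for i
        using t member_le_sum[of i UNIV "\<lambda>i. \<bar>v $ i\<bar>"] by simp
      then show ?case
        using s by (intro exI[of _ "s + t"]) (force simp: add_increasing add_increasing2)
    qed auto
    from this[of "keys a \<union> keys b"] obtain t where
      "\<forall>v\<in>keys a \<union> keys b. \<forall>i. \<bar>v $ i\<bar> \<le> of_nat t" by auto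
    then show ?thesis
      using assms unfolding box_def by (intro exI[of _ t]) auto
  qed
  then obtain s where s: "keys a \<subseteq> box Q s" "keys b \<subseteq> box Q s" by auto
  have box_add: "v + w \<in> box Q (N + s)" if "w \<in> box Q N" "v \<in> box Q s" for v w N
  proof -
    have "\<bar>v $ i + w $ i\<bar> \<le> rat_of_nat (N + s)" for i
    proof -
      have "\<bar>v $ i\<bar> \<le> rat_of_nat s" "\<bar>w $ i\<bar> \<le> rat_of_nat N"
        using that by (simp_all add: box_def)
      then show ?thesis
        using abs_triangle_ineq[of "v $ i" "w $ i"] by simp
    qed
    then show ?thesis
      using that by (auto simp: box_def Lat_tilde_add)
  qed
  obtain N where N: "card (box Q (N + s)) < 2 * card (box Q N)"
    using box_growth by blast
  define X where "X = box Q N \<times> (UNIV :: bool set)"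
  define ab where "ab \<beta> = (if \<beta> then b else a)" for \<beta>
  define A where "A y x = lookup (qt_mult Q (ab (snd x)) (Y (fst x))) y" for y x
  have X: "finite X" "card X = 2 * card (box Q N)"
    by (auto simp: X_def box_finite card_cartesian_product)
  obtain c where c: "\<exists>x\<in>X. c x \<noteq> 0" "\<forall>y\<in>box Q (N + s). (\<Sum>x\<in>X. A y x * c x) = 0"
    using linear_system_nontrivial[of "box Q (N + s)" X A] X N box_finite by auto
  define w where "w \<beta> = (\<Sum>v\<in>box Q N. scl (c (v, \<beta>)) (Y v))" for \<beta>
  have kw: "keys (w \<beta>) \<subseteq> box Q N" for \<beta>
    unfolding w_def using keys_sum keys_scl by fastforce
  have kab: "keys (ab \<beta>) \<subseteq> box Q s" for \<beta>
    using s by (simp add: ab_def)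
  have lw: "lookup (w \<beta>) v = c (v, \<beta>)" if "v \<in> box Q N" for v \<beta>
    using that unfolding w_def lookup_sum
    by (simp add: Y_def lookup_single when_def if_distrib[where f = "(*) _"] box_finite cong: if_cong)
  have "qt_mult Q a (w False) + qt_mult Q b (w True) = 0"
  proof (rule poly_mapping_eqI)
    fix y
    show "lookup (qt_mult Q a (w False) + qt_mult Q b (w True)) y = lookup 0 y"
    proof (cases "y \<in> box Q (N + s)")
      case True
      have "lookup (qt_mult Q (ab \<beta>) (w \<beta>)) y = (\<Sum>v\<in>box Q N. A y (v, \<beta>) * c (v, \<beta>))" for \<beta>
        unfolding w_def qt_mult_sum_right lookup_sum scl_qt_mult A_def by (simp add: mult.commute)
      from this[of False] this[of True]
      have "lookup (qt_mult Q a (w False) + qt_mult Q b (w True)) y =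
        (\<Sum>\<beta>\<in>UNIV. \<Sum>v\<in>box Q N. A y (v, \<beta>) * c (v, \<beta>))"
        by (simp add: ab_def lookup_add UNIV_bool)
      also have "\<dots> = (\<Sum>x\<in>X. A y x * c x)"
        unfolding X_def by (subst sum.swap) (simp add: sum.cartesian_product)
      finally show ?thesis
        using c(2) True by simp
    next
      case False
      have "y \<notin> keys (qt_mult Q (ab \<beta>) (w \<beta>))" for \<beta>
        using False keys_qt_mult[of Q "ab \<beta>" "w \<beta>"] kab[of \<beta>] kw[of \<beta>] box_add by blast
      from this[of True] this[of False] show ?thesis
        by (simp add: ab_def lookup_add in_keys_iff)
    qed
  qed
  then have eq: "qt_mult Q a (w False) = qt_mult Q b (- w True)"
    by (simp add: qt_mult_uminus eq_neg_iff_add_eq_0)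
  \<comment> \<open>If this cofactor were zero, the other one would be annihilated by
    \<open>b\<close> and vanish too, since there are no zero divisors; the solution would be
    trivial.\<close>
  have "w False \<noteq> 0"
  proof
    assume 0: "w False = 0"
    then have "qt_mult Q b (- w True) = 0" using eq by simp
    then have 1: "w True = 0" using qt_mult_eq_zero assms(3) by fastforce
    have "c (v, \<beta>) = 0" if "v \<in> box Q N" for v \<beta>
      using lw[OF that, of \<beta>] 0 1 by (cases \<beta>) auto
    then show False using c(1) by (auto simp: X_def)
  qed
  moreover have "keys (w \<beta>) \<subseteq> Lat_tilde Q" for \<beta>
    using kw[of \<beta>] by (auto simp: box_def)
  ultimately show ?thesis
    using eq by (intro exI[of _ "w False"] exI[of _ "- w True"]) auto
qed

lemma Y_nonzero [simp]: "Y v \<noteq> 0"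
  unfolding Y_def by (metis lookup_single_eq lookup_zero zero_neq_one)

lemma torus_ore_domain: "ore_domain (torus Q)"
proof (intro ore_domain.intro ore_domain_axioms.intro torus_ring)
  fix a b assume *: "a \<in> carrier (torus Q)" "b \<in> carrier (torus Q)"
  then show "a = \<zero>\<^bsub>torus Q\<^esub> \<or> b = \<zero>\<^bsub>torus Q\<^esub>" if "a \<otimes>\<^bsub>torus Q\<^esub> b = \<zero>\<^bsub>torus Q\<^esub>"
    using that qt_mult_eq_zero[of Q a b] by simp
  assume "b \<noteq> \<zero>\<^bsub>torus Q\<^esub>"
  with * torus_ore[of a Q b]
  show "\<exists>u\<in>carrier (torus Q). \<exists>v\<in>carrier (torus Q).
      u \<noteq> \<zero>\<^bsub>torus Q\<^esub> \<and> a \<otimes>\<^bsub>torus Q\<^esub> u = b \<otimes>\<^bsub>torus Q\<^esub> v"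
    by auto
qed simp

subsection \<open>Quantum mutations exist\<close>

lemma scl_add_left: "scl (a + b) f = scl a f + scl b f"
  by (rule poly_mapping_eqI) (simp add: lookup_add distrib_right)

lemma scl_zero_left [simp]: "scl 0 f = 0"
  by (rule poly_mapping_eqI) simp

lemma scl_one [simp]: "scl (1::'b::semiring_1) f = f"
  by (rule poly_mapping_eqI) simp

lemma scl_eq_zero_iff [simp]: "scl (r::'b::idom) f = 0 \<longleftrightarrow> r = 0 \<or> f = 0"
  by (auto simp: poly_mapping_eq_iff fun_eq_iff)

lemma scl_Y: "scl r (Y v) = single v r"
  by (simp add: Y_def)

lemma qt_mult_Y [simp]: "qt_mult Q (Y v) (Y w) = scl (qpow (- form Q v w)) (Y (v + w))"
  by (simp add: Y_def)

lemma keys_scl_subset: "keys f \<subseteq> A \<Longrightarrow> keys (scl r f) \<subseteq> A"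
  by (rule order.trans[OF keys_scl])

lemma ebas_nth [simp]: "ebas k $ i = (if i = k then 1 else 0)"
  by (simp add: ebas_def axis_def)

definition skew :: "quiver \<Rightarrow> bool" where
  "skew Q \<longleftrightarrow> (\<forall>i j. Q i j = - Q j i)"

lemma skewD: "skew Q \<Longrightarrow> Q i j = - Q j i"
  unfolding skew_def by blast

lemma form_skew: "skew Q \<Longrightarrow> form Q w v = - form Q v w"
proof -
  assume Q: "skew Q"
  have swap: "of_int (Q i j) * w $ i * v $ j = - (of_int (Q j i) * v $ j * w $ i)" for i j
    by (subst skewD[OF Q]) simp
  have "form Q w v = (\<Sum>j\<in>UNIV. \<Sum>i\<in>UNIV. of_int (Q i j) * w $ i * v $ j)"
    unfolding form_def by (rule sum.swap)
  also have "\<dots> = (\<Sum>j\<in>UNIV. \<Sum>i\<in>UNIV. - (of_int (Q j i) * v $ j * w $ i))"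
    by (simp only: swap)
  finally show ?thesis by (simp add: form_def sum_negf)
qed

lemma form_self [simp]: "skew Q \<Longrightarrow> form Q v v = 0"
  using form_skew[of Q v v] by simp

lemma mutate_skew: "skew Q \<Longrightarrow> skew (mutate Q k)"
proof -
  assume Q: "skew Q"
  have *: "Q i j = - Q j i" for i j using skewD[OF Q] .
  show ?thesis
    unfolding skew_def mutate_eq[of Q, OF *]
  proof (intro allI)
    fix i j
    show "(if i = k \<or> j = k then - Q i j else Q i j + max (Q i k) 0 * Q k j + max (Q j k) 0 * Q i k) =
      - (if j = k \<or> i = k then - Q j i else Q j i + max (Q j k) 0 * Q k i + max (Q i k) 0 * Q j k)"
      using *[of i j] *[of k j] *[of i k] by (auto simp: algebra_simps)
  qed
qed

lemma mutate_mutate: "skew Q \<Longrightarrow> mutate (mutate Q k) k = Q"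
proof -
  assume Q: "skew Q"
  have *: "Q i j = - Q j i" for i j using skewD[OF Q] .
  have **: "mutate Q k i j = - mutate Q k j i" for i j using skewD[OF mutate_skew[OF Q]] .
  have kk: "Q k k = 0" using *[of k k] by simp
  have m: "max (- x) 0 = max x 0 - x" for x :: int by auto
  define R where "R = mutate Q k"
  have R: "R i j = (if i = k \<or> j = k then - Q i j
      else Q i j + max (Q i k) 0 * Q k j + max (Q j k) 0 * Q i k)" for i j
    unfolding R_def mutate_eq[of Q, OF *] ..
  have R2: "mutate R k i j = (if i = k \<or> j = k then - R i j
      else R i j + max (R i k) 0 * R k j + max (R j k) 0 * R i k)" for i j
    unfolding R_def by (subst mutate_eq[of "mutate Q k" k, OF **]) (rule refl)
  have "mutate R k i j = Q i j" for i j
    unfolding R2 R using *[of k j] *[of k i] by (auto simp: kk m algebra_simps)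
  then have "mutate (mutate Q k) k i j = Q i j" for i j
    unfolding R_def .
  then show ?thesis by (intro ext)
qed

lemma mutate_isom: "skew Q \<Longrightarrow> form (mutate Q k) (mu_lat Q k v) (mu_lat Q k w) = form Q v w"
  using skewD by (intro mutate_isometry)

lemma mu_lat_add: "mu_lat Q k (v + w) = mu_lat Q k v + mu_lat Q k w"
  by (simp add: mu_lat_def vec_eq_iff algebra_simps sum.distrib)

lemma mu_lat_scale: "mu_lat Q k (a *s v) = a *s mu_lat Q k v"
  by (simp add: mu_lat_def vec_eq_iff algebra_simps sum_distrib_left)

lemma mu_lat_zero [simp]: "mu_lat Q k 0 = 0"
  by (simp add: mu_lat_def vec_eq_iff)

lemma mu_lat_uminus: "mu_lat Q k (- v) = - mu_lat Q k v"
  using mu_lat_scale[of Q k "-1" v] by simp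

lemma mu_lat_inj: "mu_lat Q k v = mu_lat Q k w \<longleftrightarrow> v = w"
  by (metis mu_lat_involution)

lemma mu_lat_nth: "i \<noteq> k \<Longrightarrow> mu_lat Q k v $ i = v $ i"
  by (simp add: mu_lat_def)

lemma mu_lat_Lat: "v \<in> Lat \<Longrightarrow> mu_lat Q k v \<in> Lat"
  by (auto simp: Lat_def mu_lat_def intro!: Ints_sum)

lemma mu_lat_tilde:
  assumes "skew Q" "v \<in> Lat_tilde Q"
  shows "mu_lat Q k v \<in> Lat_tilde (mutate Q k)"
proof -
  have "2 *s mu_lat Q k v \<in> Lat"
    using assms(2) mu_lat_Lat[of "2 *s v"] by (simp add: Lat_tilde_def mu_lat_scale)
  moreover have "form (mutate Q k) w (mu_lat Q k v) = form Q (mu_lat Q k w) v" for w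
    using mutate_isom[OF assms(1), of k "mu_lat Q k w" v] by (simp add: mu_lat_involution)
  ultimately show ?thesis
    using assms(2) mu_lat_Lat by (auto simp: Lat_tilde_def)
qed

definition dg :: "quiver \<Rightarrow> 7 \<Rightarrow> weight \<Rightarrow> int" where
  "dg Q k v = \<lfloor>form Q (ebas k) v\<rfloor>"

lemma dg_of_int: "v \<in> Lat_tilde Q \<Longrightarrow> of_int (dg Q k v) = form Q (ebas k) v"
  using form_ebas_Ints[of v Q k] by (auto simp: dg_def elim: Ints_cases)

lemma dg_eqI: "form Q (ebas k) v = of_int n \<Longrightarrow> dg Q k v = n"
  by (simp add: dg_def)

lemma dg_add: "v \<in> Lat_tilde Q \<Longrightarrow> w \<in> Lat_tilde Q \<Longrightarrow> dg Q k (v + w) = dg Q k v + dg Q k w"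
  by (rule dg_eqI) (simp add: form_add_right dg_of_int)

lemma dg_uminus: "v \<in> Lat_tilde Q \<Longrightarrow> dg Q k (- v) = - dg Q k v"
  by (rule dg_eqI) (simp add: dg_of_int)

lemma dg_zero [simp]: "dg Q k 0 = 0"
  by (simp add: dg_def)

lemma dg_mu:
  assumes "skew Q" "v \<in> Lat_tilde Q"
  shows "dg (mutate Q k) k (mu_lat Q k v) = - dg Q k v"
proof (rule dg_eqI)
  have "form (mutate Q k) (ebas k) (mu_lat Q k v) = form (mutate Q k) (mu_lat Q k (- ebas k)) (mu_lat Q k v)"
    by (simp add: mu_lat_uminus mu_lat_ebas(1))
  then show "form (mutate Q k) (ebas k) (mu_lat Q k v) = of_int (- dg Q k v)"
    using assms by (simp add: mutate_isom dg_of_int)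
qed

section \<open>The commuting factors in one direction\<close>

definition line :: "7 \<Rightarrow> weight set" where
  "line k = {a *s ebas k |a. True}"

lemma line_memI [intro]: "a *s ebas k \<in> line k" "ebas k \<in> line k" "0 \<in> line k" "- ebas k \<in> line k"
proof -
  show "a *s ebas k \<in> line k" for a by (auto simp: line_def)
  from this[of 1] this[of 0] this[of "-1"]
  show "ebas k \<in> line k" "0 \<in> line k" "- ebas k \<in> line k" by auto
qed

lemma form_line: "skew Q \<Longrightarrow> v \<in> line k \<Longrightarrow> w \<in> line k \<Longrightarrow> form Q v w = 0"
  by (auto simp: line_def form_scale_left form_scale_right)

lemma line_commute:
  assumes "skew Q" "keys f \<subseteq> line k" "keys g \<subseteq> line k"
  shows "qt_mult Q f g = qt_mult Q g f"
  using assms(2)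
proof (induction f rule: pm_induct_keys)
  case (single v a)
  note v = this
  show ?case using assms(3)
    by (induction g rule: pm_induct_keys)
      (use v assms(1) in \<open>auto simp: form_line qt_mult_add_left qt_mult_add_right add.commute mult.commute\<close>)
qed (auto simp: qt_mult_add_left qt_mult_add_right)

definition lf :: "7 \<Rightarrow> int \<Rightarrow> qtorus" where
  "lf k s = Y 0 + scl (qpow (of_int s)) (Y (ebas k))"

text \<open>A window of the product for \<open>\<Psi>\<^sub>q\<close>: the factors 1 + q^r Y_k for r
  = s + 1, s + 3, ..., s + 2n - 1. Both products occurring in \<open>Ad_Psi\<close> are windows, one
  starting at 0 and one ending at 0, and with a free starting point conjugation by a monomial is a
  mere translation.\<close>

primrec pr :: "quiver \<Rightarrow> 7 \<Rightarrow> int \<Rightarrow> nat \<Rightarrow> qtorus" where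
  "pr Q k s 0 = Y 0"
| "pr Q k s (Suc n) = qt_mult Q (pr Q k s n) (lf k (s + 2 * int n + 1))"

lemma keys_lf: "keys (lf k s) \<subseteq> {of_nat i *s ebas k |i. True}"
proof -
  have "keys (lf k s) \<subseteq> {0, ebas k}"
    unfolding lf_def using keys_add[of "Y 0" "scl (qpow (of_int s)) (Y (ebas k))"]
      keys_scl[of "qpow (of_int s)" "Y (ebas k)"] by auto
  moreover have "0 = of_nat 0 *s ebas k" "ebas k = of_nat 1 *s ebas k" by auto
  ultimately show ?thesis by blast
qed

lemma keys_pr: "keys (pr Q k s n) \<subseteq> {of_nat i *s ebas k |i. True}"
proof (induction n)
  case 0
  have "(0::weight) = of_nat 0 *s ebas k" by simp
  then show ?case by (auto simp del: of_nat_0)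
next
  case (Suc n)
  have "v \<in> {of_nat i *s ebas k |i. True}" if "v \<in> keys (pr Q k s (Suc n))" for v
  proof -
    obtain x y where xy: "x \<in> keys (pr Q k s n)" "y \<in> keys (lf k (s + 2 * int n + 1))" "v = x + y"
      using \<open>v \<in> _\<close> keys_qt_mult[of Q "pr Q k s n" "lf k (s + 2 * int n + 1)"] by auto
    obtain i j where "x = of_nat i *s ebas k" "y = of_nat j *s ebas k"
      using xy(1,2) Suc keys_lf[of k "s + 2 * int n + 1"] by blast
    then have "v = of_nat (i + j) *s ebas k"
      using xy(3) by (simp add: vector_sadd_rdistrib)
    then show ?thesis by blast
  qed
  then show ?case by blast
qed

lemma nonneg_line_subset: "{of_nat i *s ebas k |i. True} \<subseteq> line k" "line k \<inter> Lat \<subseteq> Lat_tilde Q"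
  "{of_nat i *s ebas k |i. True} \<subseteq> Lat_tilde Q"
proof -
  show "{of_nat i *s ebas k |i. True} \<subseteq> line k" by auto
  show "line k \<inter> Lat \<subseteq> Lat_tilde Q" using Lat_tilde_Lat by auto
  have "of_nat i *s ebas k \<in> Lat" for i by (auto simp: Lat_def ebas_def axis_def)
  then show "{of_nat i *s ebas k |i. True} \<subseteq> Lat_tilde Q"
    using Lat_tilde_Lat by blast
qed

lemma keys_pr_line: "keys (pr Q k s n) \<subseteq> line k"
  and keys_pr_Lat_tilde [simp]: "keys (pr Q k s n) \<subseteq> Lat_tilde Q'"
  and keys_lf_line: "keys (lf k s) \<subseteq> line k"
  and keys_lf_Lat_tilde [simp]: "keys (lf k s) \<subseteq> Lat_tilde Q'"
  using keys_pr keys_lf nonneg_line_subset by (blast intro: order.trans)+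

lemma lookup_lf_0 [simp]: "lookup (lf k s) 0 = 1"
proof -
  have "ebas k \<noteq> 0" by (metis axis_eq_0_iff ebas_def zero_neq_one)
  then show ?thesis by (simp add: lf_def Y_def lookup_add lookup_single when_def)
qed

lemma lf_nonzero [simp]: "lf k s \<noteq> 0"
  using lookup_lf_0[of k s] by (metis lookup_zero zero_neq_one)

lemma pr_nonzero [simp]: "pr Q k s n \<noteq> 0"
  by (induction n) (auto dest!: qt_mult_eq_zero)

lemma pr_split:
  assumes "skew Q"
  shows "pr Q k s (n + m) = qt_mult Q (pr Q k s n) (pr Q k (s + 2 * int n) m)"
  by (induction m) (auto simp: qt_mult_assoc algebra_simps)

lemma pr_Suc': "skew Q \<Longrightarrow> pr Q k s (Suc n) = qt_mult Q (lf k (s + 1)) (pr Q k (s + 2) n)"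
  using pr_split[of Q k s 1 n] by simp

lemma qt_prod_pos: "qt_prod Q k 1 n = pr Q k 0 n"
  by (induction n) (auto simp: lf_def qt_mult_const)

text \<open>The exponents -1, -3, ..., 1 - 2n fill the window from -2n to 0 in reverse order; the
  factors commute, so a new one may be put in front.\<close>

lemma qt_prod_neg: "skew Q \<Longrightarrow> qt_prod Q k (- 1) n = pr Q k (- 2 * int n) n"
proof (induction n)
  case (Suc n)
  have "qt_prod Q k (- 1) (Suc n) = qt_mult Q (pr Q k (- 2 * int n) n) (lf k (- 2 * int (Suc n) + 1))"
    using Suc by (simp add: lf_def qt_mult_const algebra_simps)
  also have "\<dots> = qt_mult Q (lf k (- 2 * int (Suc n) + 1)) (pr Q k (- 2 * int n) n)"
    by (rule line_commute[OF Suc.prems keys_pr_line keys_lf_line])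
  also have "\<dots> = pr Q k (- 2 * int (Suc n)) (Suc n)"
    using pr_Suc'[OF Suc.prems, of k "- 2 * int (Suc n)" n] by (simp add: algebra_simps)
  finally show ?case .
qed simp

lemma lf_Y:
  assumes "skew Q" "w \<in> Lat_tilde Q"
  shows "qt_mult Q (lf k s) (Y w) = qt_mult Q (Y w) (lf k (s - 2 * dg Q k w))"
proof -
  have f: "form Q (ebas k) w = of_int (dg Q k w)" "form Q w (ebas k) = - of_int (dg Q k w)"
    using assms dg_of_int[of w Q k] form_skew[of Q w "ebas k"] by simp_all
  have "qpow (of_int s) * qpow (- of_int (dg Q k w)) = qpow (of_int s + - of_int (dg Q k w))"
    by (rule qpow_add[symmetric]) auto
  moreover have "qpow (of_int (s - 2 * dg Q k w)) * qpow (of_int (dg Q k w)) =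
      qpow (of_int (s - 2 * dg Q k w) + of_int (dg Q k w))"
    by (rule qpow_add[symmetric]) auto
  ultimately show ?thesis
    by (simp add: lf_def qt_mult_add_left qt_mult_add_right scl_qt_mult scl_scl f add.commute)
qed

text \<open>Passing a monomial multiplies Y_k by a power of q, which translates the window by -2
  (e_k, w).\<close>

lemma pr_Y:
  assumes "skew Q" "w \<in> Lat_tilde Q"
  shows "qt_mult Q (pr Q k s n) (Y w) = qt_mult Q (Y w) (pr Q k (s - 2 * dg Q k w) n)"
proof (induction n)
  case (Suc n)
  have kw: "keys (Y w) \<subseteq> Lat_tilde Q" using assms by simp
  have "qt_mult Q (pr Q k s (Suc n)) (Y w) = qt_mult Q (pr Q k s n) (qt_mult Q (lf k (s + 2 * int n + 1)) (Y w))"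
    using kw by (simp add: qt_mult_assoc)
  also have "\<dots> = qt_mult Q (qt_mult Q (pr Q k s n) (Y w)) (lf k (s + 2 * int n + 1 - 2 * dg Q k w))"
    using kw by (simp only: lf_Y[OF assms] qt_mult_assoc keys_pr_Lat_tilde keys_lf_Lat_tilde)
  also have "\<dots> = qt_mult Q (Y w) (pr Q k (s - 2 * dg Q k w) (Suc n))"
    unfolding Suc using kw by (simp add: qt_mult_assoc algebra_simps)
  finally show ?case .
qed simp

section \<open>Mutation of torus elements over an explicit denominator\<close>

lemma to_Frac_hom: "to_Frac Q \<in> ring_hom (torus Q) (Frac (torus Q))"
proof -
  interpret ore_domain "torus Q" by (rule torus_ore_domain)
  show ?thesis using emb_hom unfolding to_Frac_def[abs_def] .
qed

lemma to_Frac_inj: "inj_on (to_Frac Q) (carrier (torus Q))"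
proof -
  interpret ore_domain "torus Q" by (rule torus_ore_domain)
  show ?thesis using emb_inj unfolding to_Frac_def[abs_def] .
qed

text \<open>The numerator of the mutated element over the common denominator \<open>DN\<close>. With
  d = (e_k, v), mutation multiplies the monomial by the window from 0 to 2d, or by the inverse of
  the window from 2d to 0 if d is negative. Multiplied by the window from -2N to 0, both become the
  window from -2N to 2d. The condition \<open>bnd\<close> keeps its length N + d
  nonnegative.\<close>

definition NF :: "quiver \<Rightarrow> 7 \<Rightarrow> nat \<Rightarrow> qtorus \<Rightarrow> qtorus" where
  "NF Q k N f = pm_lin (\<lambda>v a. scl a (qt_mult (mutate Q k) (Y (mu_lat Q k v))
     (pr (mutate Q k) k (- 2 * int N) (nat (int N + dg Q k v))))) f"

definition bnd :: "quiver \<Rightarrow> 7 \<Rightarrow> nat \<Rightarrow> qtorus \<Rightarrow> bool" where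
  "bnd Q k N f \<longleftrightarrow> (\<forall>v\<in>keys f. - dg Q k v \<le> int N)"

abbreviation DN :: "quiver \<Rightarrow> 7 \<Rightarrow> nat \<Rightarrow> qtorus" where
  "DN Q k N \<equiv> pr Q k (- 2 * int N) N"

lemma NF_add: "NF Q k N (f + g) = NF Q k N f + NF Q k N g"
  unfolding NF_def by (rule pm_lin_add) (auto simp: scl_add_left)

lemma NF_diff: "NF Q k N (f - g) = NF Q k N f - NF Q k N g"
  unfolding NF_def by (rule pm_lin_diff) (auto simp: scl_add_left)

lemma NF_zero [simp]: "NF Q k N 0 = 0"
  by (simp add: NF_def)

lemma NF_single: "NF Q k N (single v a) = scl a (qt_mult (mutate Q k) (Y (mu_lat Q k v))
     (pr (mutate Q k) k (- 2 * int N) (nat (int N + dg Q k v))))"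
  unfolding NF_def by (rule pm_lin_single) auto

lemma NF_Y: "NF Q k N (Y v) = qt_mult (mutate Q k) (Y (mu_lat Q k v))
     (pr (mutate Q k) k (- 2 * int N) (nat (int N + dg Q k v)))"
  unfolding Y_def[of v] NF_single by simp

lemma NF_scl: "NF Q k N (scl r f) = scl r (NF Q k N f)"
  by (induction f rule: pm_induct) (simp_all add: NF_add scl_add NF_single scl_scl)

lemma NF_closed:
  assumes "skew Q" "keys f \<subseteq> Lat_tilde Q"
  shows "keys (NF Q k N f) \<subseteq> Lat_tilde (mutate Q k)"
  using assms(2)
proof (induction f rule: pm_induct_keys)
  case (single v c)
  then show ?case
    unfolding NF_single by (intro keys_scl_subset torus_mult_closed) (auto simp: mu_lat_tilde assms)
qed (auto simp: NF_add dest: keys_add[THEN subsetD])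

lemma bnd_mono: "bnd Q k N f \<Longrightarrow> N \<le> M \<Longrightarrow> bnd Q k M f"
  by (force simp: bnd_def)

lemma bnd_ex: "\<exists>N. bnd Q k N f"
proof -
  have "\<exists>N::nat. \<forall>v\<in>S. - dg Q k v \<le> int N" if "finite S" for S
    using that
  proof (induction S rule: finite_induct)
    case (insert v S)
    then obtain N where "\<forall>v\<in>S. - dg Q k v \<le> int N" by blast
    then show ?case
      by (intro exI[of _ "N + nat (- dg Q k v)"]) (auto intro: order.trans)
  qed auto
  then show ?thesis by (simp add: bnd_def)
qed

lemma bnd_ex2: "\<exists>N. bnd Q k N f \<and> bnd Q k N g"
  using bnd_ex[of Q k f] bnd_ex[of Q k g] bnd_mono by (metis le_add1 le_add2)

lemma bnd_add: "bnd Q k N f \<Longrightarrow> bnd Q k N g \<Longrightarrow> bnd Q k N (f + g)"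
  using keys_add[of f g] by (auto simp: bnd_def)

text \<open>Raising N to M extends all windows downwards by the same M - N factors. Since the
  factors commute, these can be collected on the right, where a fraction cancels them.\<close>

lemma NF_mono:
  assumes "skew Q" "bnd Q k N f" "N \<le> M" "keys f \<subseteq> Lat_tilde Q"
  shows "NF Q k M f = qt_mult (mutate Q k) (NF Q k N f) (pr (mutate Q k) k (- 2 * int M) (M - N))"
proof -
  let ?Q = "mutate Q k" and ?E = "pr (mutate Q k) k (- 2 * int M) (M - N)"
  have Q': "skew ?Q" by (rule mutate_skew[OF assms(1)])
  have mono: "NF Q k M (single v a) = qt_mult ?Q (NF Q k N (single v a)) ?E"
    if "- dg Q k v \<le> int N" "v \<in> Lat_tilde Q" for v a
  proof -
    have n: "nat (int M + dg Q k v) = (M - N) + nat (int N + dg Q k v)"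
      using that assms(3) by auto
    have s: "- 2 * int M + 2 * int (M - N) = - 2 * int N"
      using assms(3) by (simp add: of_nat_diff)
    have "pr ?Q k (- 2 * int M) (nat (int M + dg Q k v)) =
      qt_mult ?Q ?E (pr ?Q k (- 2 * int N) (nat (int N + dg Q k v)))"
      unfolding n pr_split[OF Q'] s ..
    also have "\<dots> = qt_mult ?Q (pr ?Q k (- 2 * int N) (nat (int N + dg Q k v))) ?E"
      by (rule line_commute[OF Q' keys_pr_line keys_pr_line])
    finally show ?thesis
      using mu_lat_tilde[OF assms(1) that(2)] by (simp add: NF_single scl_qt_mult qt_mult_assoc)
  qed
  have "NF Q k M f = qt_mult ?Q (NF Q k N f) ?E"
    if "keys f \<subseteq> {v \<in> Lat_tilde Q. - dg Q k v \<le> int N}" for f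
    using that by (induction f rule: pm_induct_keys) (auto simp: NF_add qt_mult_add_left mono)
  then show ?thesis
    using assms(2,4) by (auto simp: bnd_def)
qed

lemma DN_mono:
  assumes "skew Q" "N \<le> M"
  shows "DN Q k M = qt_mult Q (DN Q k N) (pr Q k (- 2 * int M) (M - N))"
proof -
  have "DN Q k M = qt_mult Q (pr Q k (- 2 * int M) (M - N)) (pr Q k (- 2 * int M + 2 * int (M - N)) N)"
    using pr_split[OF assms(1), of k "- 2 * int M" "M - N" N] assms(2) by simp
  also have "- 2 * int M + 2 * int (M - N) = - 2 * int N"
    using assms by (simp add: of_nat_diff)
  also have "qt_mult Q (pr Q k (- 2 * int M) (M - N)) (DN Q k N) = qt_mult Q (DN Q k N) (pr Q k (- 2 * int M) (M - N))"
    by (rule line_commute[OF assms(1) keys_pr_line keys_pr_line])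
  finally show ?thesis .
qed

definition qmut_tor :: "quiver \<Rightarrow> 7 \<Rightarrow> qtorus \<Rightarrow> qfrac" where
  "qmut_tor Q k f = (let N = (SOME N. bnd Q k N f) in
     rfrac (torus (mutate Q k)) (NF Q k N f) (DN (mutate Q k) k N))"

text \<open>Any admissible N may replace the chosen one: both are compared with their maximum, which
  multiplies numerator and denominator by the same element.\<close>

lemma qmut_tor_eq:
  assumes "skew Q" "bnd Q k N f" "keys f \<subseteq> Lat_tilde Q"
  shows "qmut_tor Q k f = rfrac (torus (mutate Q k)) (NF Q k N f) (DN (mutate Q k) k N)"
proof -
  let ?Q = "mutate Q k"
  interpret R: ore_domain "torus ?Q" by (rule torus_ore_domain)
  have le: "rfrac (torus ?Q) (NF Q k M f) (DN ?Q k M) = rfrac (torus ?Q) (NF Q k N f) (DN ?Q k N)"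
    if "bnd Q k N f" "N \<le> M" for N M
    unfolding NF_mono[OF assms(1) that assms(3)] DN_mono[OF mutate_skew[OF assms(1)] that(2)]
    using R.rfrac_cancel[of "NF Q k N f" "DN ?Q k N" "pr ?Q k (- 2 * int M) (M - N)"]
      NF_closed[OF assms(1,3)] by simp
  define M where "M = (SOME N. bnd Q k N f)"
  have M: "bnd Q k M f"
    unfolding M_def by (rule someI_ex[OF bnd_ex])
  show ?thesis
    using le[OF M, of "max M N"] le[OF assms(2), of "max M N"]
    by (simp add: qmut_tor_def flip: M_def)
qed

text \<open>All exponents are nonnegative multiples of e_k, so only constant terms contribute. The
  value 1 is what makes multiplication by a window unitriangular for the k-th coordinate.\<close>

lemma lookup_pr_0 [simp]:
  assumes "skew R"
  shows "lookup (pr R k s n) 0 = 1"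
proof (induction n)
  case (Suc n)
  have *: "x + y = 0 \<longleftrightarrow> x = 0 \<and> y = 0"
    if xy: "x \<in> keys (pr R k s n)" "y \<in> keys (lf k (s + 2 * int n + 1))" for x y
  proof -
    obtain i j where ij: "x = of_nat i *s ebas k" "y = of_nat j *s ebas k"
      using keys_pr[of R k s n] keys_lf[of k "s + 2 * int n + 1"] xy by blast
    show ?thesis
    proof
      assume "x + y = 0"
      then have "(x + y) $ k = 0" by simp
      then have "(of_nat i :: rat) + of_nat j = 0" unfolding ij by simp
      then have "i = 0 \<and> j = 0" by (metis add_is_0 of_nat_add of_nat_eq_0_iff)
      then show "x = 0 \<and> y = 0" unfolding ij by simp
    qed simp
  qed
  have in0: "0 \<in> keys (pr R k s n)" "0 \<in> keys (lf k t)" for t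
    using Suc by (auto simp: in_keys_iff)
  have "lookup (pr R k s (Suc n)) 0 =
    (\<Sum>x\<in>keys (pr R k s n). \<Sum>y\<in>keys (lf k (s + 2 * int n + 1)).
      if x = 0 then (if y = 0 then 1 else 0) else 0)"
    unfolding pr.simps lookup_qt_mult by (intro sum.cong refl) (use Suc in \<open>simp add: *\<close>)
  also have "\<dots> = (\<Sum>x\<in>keys (pr R k s n). if x = 0 then
     (\<Sum>y\<in>keys (lf k (s + 2 * int n + 1)). if y = 0 then 1 else 0) else 0)"
    by (intro sum.cong refl) simp
  finally show ?case using in0 by simp
qed (simp add: Y_def)

text \<open>Apart from its constant term, a window only contributes weights with larger k-th
  coordinate. A weight of \<open>f\<close> whose image is lowest in that coordinate therefore keeps
  its coefficient in the numerator.\<close>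

lemma NF_eq_zero:
  assumes "skew Q" "NF Q k N f = 0" "bnd Q k N f"
  shows "f = 0"
proof (rule ccontr)
  assume "f \<noteq> 0"
  let ?Q = "mutate Q k" and ?\<mu> = "mu_lat Q k"
  define S where "S = (\<lambda>v. ?\<mu> v $ k) ` keys f"
  have "finite S" "S \<noteq> {}" using \<open>f \<noteq> 0\<close> by (auto simp: S_def)
  then have "Min S \<in> S" by (rule Min_in)
  then obtain v where v: "v \<in> keys f" "?\<mu> v $ k = Min S" by (auto simp: S_def)
  have min: "?\<mu> v $ k \<le> ?\<mu> w $ k" if "w \<in> keys f" for w
    unfolding v(2) using that \<open>finite S\<close> by (auto simp: S_def)
  define p where "p w = pr ?Q k (- 2 * int N) (nat (int N + dg Q k w))" for w
  have "lookup (qt_mult ?Q (Y (?\<mu> w)) (p w)) (?\<mu> v) = (if w = v then 1 else 0)"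
    if w: "w \<in> keys f" for w
  proof -
    have *: "?\<mu> w + y = ?\<mu> v \<longleftrightarrow> y = 0 \<and> w = v" if y: "y \<in> keys (p w)" for y
    proof
      obtain i where i: "y = of_nat i *s ebas k"
        using keys_pr[of ?Q k "- 2 * int N" "nat (int N + dg Q k w)"] y by (auto simp: p_def)
      assume e: "?\<mu> w + y = ?\<mu> v"
      then have "(?\<mu> w + y) $ k = ?\<mu> v $ k" by simp
      then have "?\<mu> w $ k + of_nat i = ?\<mu> v $ k" unfolding i by simp
      with min[OF w] have "i = 0" by simp
      then have "y = 0" using i by simp
      with e show "y = 0 \<and> w = v" by (simp add: mu_lat_inj)
    qed auto
    have Y1: "lookup (Y u) u = 1" for u by (simp add: Y_def)
    have "lookup (qt_mult ?Q (Y (?\<mu> w)) (p w)) (?\<mu> v) =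
      (\<Sum>y\<in>keys (p w). if ?\<mu> w + y = ?\<mu> v then
        qpow (- form ?Q (?\<mu> w) y) * lookup (p w) y else 0)"
      unfolding lookup_qt_mult keys_Y by (simp only: sum.insert finite.emptyI empty_iff not_False_eq_True
        sum.empty add_0_right Y1 mult_1_right)
    also have "\<dots> =
      (\<Sum>y\<in>keys (p w). if y = 0 then (if w = v then 1 else 0) else 0)"
      by (intro sum.cong refl) (auto simp: * p_def mutate_skew assms(1))
    also have "\<dots> = (if w = v then 1 else 0)"
      by (auto simp: p_def in_keys_iff mutate_skew assms(1))
    finally show ?thesis .
  qed
  then have "lookup (NF Q k N f) (?\<mu> v) =
    (\<Sum>w\<in>keys f. if w = v then lookup f w else 0)"
    unfolding NF_def pm_lin_def lookup_sum lookup_scl by (intro sum.cong) (auto simp: p_def)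
  also have "\<dots> = lookup f v"
    using v(1) by simp
  finally show False
    using assms(2) v(1) by (simp add: in_keys_iff)
qed

lemma qmut_tor_hom:
  assumes Q: "skew Q"
  shows "qmut_tor Q k \<in> ring_hom (torus Q) (Frac (torus (mutate Q k)))"
    and "inj_on (qmut_tor Q k) (carrier (torus Q))"
proof -
  let ?Q = "mutate Q k" and ?\<mu> = "mu_lat Q k"
  interpret R: ore_domain "torus ?Q" by (rule torus_ore_domain)
  interpret F: ring "Frac (torus ?Q)" by (rule R.Frac_ring)
  have Q': "skew ?Q" by (rule mutate_skew[OF Q])
  note [simp] = NF_closed[OF Q]
  have closed: "qmut_tor Q k f \<in> carrier (Frac (torus ?Q))" if "keys f \<subseteq> Lat_tilde Q" for f
  proof -
    obtain N where "bnd Q k N f" using bnd_ex by blast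
    then show ?thesis using that by (simp add: qmut_tor_eq[OF Q])
  qed
  have add: "qmut_tor Q k (f + g) = qmut_tor Q k f \<oplus>\<^bsub>Frac (torus ?Q)\<^esub> qmut_tor Q k g"
    if fg: "keys f \<subseteq> Lat_tilde Q" "keys g \<subseteq> Lat_tilde Q" for f g
  proof -
    obtain N where "bnd Q k N f" "bnd Q k N g" using bnd_ex2 by blast
    then show ?thesis
      using fg torus_add_closed[OF fg] by (simp add: qmut_tor_eq[OF Q, of k N] bnd_add R.Frac_add NF_add)
  qed
  have zero: "qmut_tor Q k 0 = \<zero>\<^bsub>Frac (torus ?Q)\<^esub>"
    using R.Frac_zero[of "DN ?Q k 0"] by (simp add: qmut_tor_eq[OF Q, of k 0] bnd_def)
  have mono: "qmut_tor Q k (qt_mult Q (single v a) (single w b)) =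
      qmut_tor Q k (single v a) \<otimes>\<^bsub>Frac (torus ?Q)\<^esub> qmut_tor Q k (single w b)"
    if v: "v \<in> Lat_tilde Q" and w: "w \<in> Lat_tilde Q" for v w a b
  proof -
    define n where "n = dg Q k v"
    define m where "m = dg Q k w"
    \<comment> \<open>Carried past the second monomial, the window of the first denominator moves by
      2m, from -2N to -2M with M = N - m. At level M the numerator of the second fraction equals
      that first denominator times a monomial, so the product of the fractions needs no further
      common multiple.\<close>
    define N where "N = nat \<bar>n\<bar> + nat \<bar>m\<bar>"
    define M where "M = nat (int N - m)"
    have M: "int M = int N - m" "int N = int M + m" by (auto simp: M_def N_def)
    have nm: "int N + n \<ge> 0" "int M + m \<ge> 0" "int M + (n + m) \<ge> 0" "nat (int M + m) = N"
      "nat (int M + (n + m)) = nat (int N + n)"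
      using M by (auto simp: N_def)
    have B: "bnd Q k N (single v a)" "bnd Q k M (single w b)"
      "bnd Q k M (single (v + w) c)" for c
      using nm v w by (auto simp: bnd_def n_def m_def dg_add)
    have K: "keys (single v a) \<subseteq> Lat_tilde Q" "keys (single w b) \<subseteq> Lat_tilde Q"
      "keys (single (v + w) c) \<subseteq> Lat_tilde Q" for c
      using v w Lat_tilde_add[OF v w] by auto
    have \<mu>: "?\<mu> v \<in> Lat_tilde ?Q" "?\<mu> w \<in> Lat_tilde ?Q" using v w mu_lat_tilde[OF Q] by auto
    have s: "- 2 * int N - 2 * dg ?Q k (?\<mu> w) = - 2 * int M"
      using dg_mu[OF Q w, of k] M(1) by (simp add: m_def)
    have DY: "qt_mult ?Q (DN ?Q k N) (Y (?\<mu> w)) = qt_mult ?Q (Y (?\<mu> w)) (pr ?Q k (- 2 * int M) N)"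
      using pr_Y[OF Q' \<mu>(2), of k "- 2 * int N" N] unfolding s .
    have pY: "qt_mult ?Q (pr ?Q k (- 2 * int N) j) (Y (?\<mu> w)) = qt_mult ?Q (Y (?\<mu> w)) (pr ?Q k (- 2 * int M) j)" for j
      using pr_Y[OF Q' \<mu>(2), of k "- 2 * int N" j] unfolding s .
    have NFw: "NF Q k M (single w b) = qt_mult ?Q (DN ?Q k N) (scl b (Y (?\<mu> w)))"
      unfolding NF_single scl_qt_mult DY nm(4)[unfolded m_def] by simp
    have NFv: "NF Q k N (single v a) = scl a (qt_mult ?Q (Y (?\<mu> v)) (pr ?Q k (- 2 * int N) (nat (int N + n))))"
      by (simp add: NF_single n_def)
    have "qmut_tor Q k (single v a) \<otimes>\<^bsub>Frac (torus ?Q)\<^esub> qmut_tor Q k (single w b) =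
      rfrac (torus ?Q) (NF Q k N (single v a)) (DN ?Q k N) \<otimes>\<^bsub>Frac (torus ?Q)\<^esub>
      rfrac (torus ?Q) (NF Q k M (single w b)) (DN ?Q k M)"
      using B K by (simp only: qmut_tor_eq[OF Q])
    also have "\<dots> = rfrac (torus ?Q) (NF Q k N (single v a) \<otimes>\<^bsub>torus ?Q\<^esub> scl b (Y (?\<mu> w))) (DN ?Q k M \<otimes>\<^bsub>torus ?Q\<^esub> Y 0)"
    proof (rule R.Frac_mult)
      show "NF Q k M (single w b) \<in> carrier (torus ?Q)"
        "NF Q k N (single v a) \<in> carrier (torus ?Q)"
        using NF_closed[OF Q K(1)] NF_closed[OF Q K(2)] by auto
      show "scl b (Y (?\<mu> w)) \<in> carrier (torus ?Q)"
        using keys_scl_subset[of "Y (?\<mu> w)" "Lat_tilde ?Q"] \<mu> by simp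
    qed (auto simp: NFw)
    also have "NF Q k N (single v a) \<otimes>\<^bsub>torus ?Q\<^esub> scl b (Y (?\<mu> w)) =
      scl (a * b) (qt_mult ?Q (qt_mult ?Q (Y (?\<mu> v)) (Y (?\<mu> w))) (pr ?Q k (- 2 * int M) (nat (int N + n))))"
      using \<mu> by (simp only: NFv torus_sel scl_qt_mult scl_scl qt_mult_assoc pY keys_Y keys_pr_Lat_tilde
          insert_subset empty_subsetI simp_thms mult.commute[of b a])
    also have "\<dots> = NF Q k M (qt_mult Q (single v a) (single w b))"
      using nm(5) v w
      by (simp add: NF_single n_def m_def dg_add mutate_isom[OF Q] mu_lat_add scl_qt_mult scl_scl mult_ac)
    also have "rfrac (torus ?Q) \<dots> (DN ?Q k M \<otimes>\<^bsub>torus ?Q\<^esub> Y 0) = qmut_tor Q k (qt_mult Q (single v a) (single w b))"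
      using qmut_tor_eq[OF Q B(3) K(3)] by simp
    finally show ?thesis ..
  qed
  have mult: "qmut_tor Q k (qt_mult Q f g) = qmut_tor Q k f \<otimes>\<^bsub>Frac (torus ?Q)\<^esub> qmut_tor Q k g"
    if f: "keys f \<subseteq> Lat_tilde Q" and g: "keys g \<subseteq> Lat_tilde Q" for f g
    using f
  proof (induction f rule: pm_induct_keys)
    case (single v a)
    then have K: "keys (single v a) \<subseteq> Lat_tilde Q" by auto
    show ?case using g
      by (induction g rule: pm_induct_keys)
        (use K single in \<open>simp_all add: mono[unfolded qt_mult_single] zero closed add torus_mult_closed F.r_distr qt_mult_add_right\<close>)
  qed (use g in \<open>simp_all add: zero closed add torus_mult_closed F.l_distr qt_mult_add_left\<close>)
  have one: "qmut_tor Q k (Y 0) = \<one>\<^bsub>Frac (torus ?Q)\<^esub>"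
    using R.Frac_one[of "Y 0"] qmut_tor_eq[OF Q, of k 0 "Y 0"]
    by (simp add: bnd_def NF_Y)
  show "qmut_tor Q k \<in> ring_hom (torus Q) (Frac (torus ?Q))"
    by (rule ring_hom_memI) (auto simp: closed mult add one)
  show "inj_on (qmut_tor Q k) (carrier (torus Q))"
  proof (rule inj_onI)
    fix f g assume fg: "f \<in> carrier (torus Q)" "g \<in> carrier (torus Q)" "qmut_tor Q k f = qmut_tor Q k g"
    obtain N where N: "bnd Q k N f" "bnd Q k N g" using bnd_ex2 by blast
    have K: "keys f \<subseteq> Lat_tilde Q" "keys g \<subseteq> Lat_tilde Q" using fg by auto
    have "rfrac (torus ?Q) (NF Q k N f) (DN ?Q k N) = rfrac (torus ?Q) (NF Q k N g) (DN ?Q k N)"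
      using fg(3) N K by (simp add: qmut_tor_eq[OF Q])
    then have r: "((NF Q k N f, DN ?Q k N), (NF Q k N g, DN ?Q k N)) \<in> ore_rel (torus ?Q)"
      using K by (intro R.rfrac_eqD) auto
    have "NF Q k N f = NF Q k N g"
      using R.ore_rel_cross[OF r, of "Y 0" "Y 0"] by simp
    then have "NF Q k N (f - g) = 0"
      by (simp add: NF_diff)
    moreover have "bnd Q k N (f - g)"
      using N keys_diff[of f g] by (auto simp: bnd_def)
    ultimately have "f - g = 0"
      using NF_eq_zero[OF Q] by blast
    then show "f = g" by simp
  qed
qed

lemma to_Frac_mult: "\<lbrakk>keys f \<subseteq> Lat_tilde Q; keys g \<subseteq> Lat_tilde Q\<rbrakk> \<Longrightarrow>
    to_Frac Q (qt_mult Q f g) = to_Frac Q f \<otimes>\<^bsub>Frac (torus Q)\<^esub> to_Frac Q g"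
  using ring_hom_mult[OF to_Frac_hom[of Q]] by simp

lemma to_Frac_closed: "keys f \<subseteq> Lat_tilde Q \<Longrightarrow> to_Frac Q f \<in> carrier (Frac (torus Q))"
  using ring_hom_closed[OF to_Frac_hom[of Q]] by simp

lemma to_Frac_eq_iff: "\<lbrakk>keys f \<subseteq> Lat_tilde Q; keys g \<subseteq> Lat_tilde Q\<rbrakk> \<Longrightarrow>
    to_Frac Q f = to_Frac Q g \<longleftrightarrow> f = g"
  using inj_onD[OF to_Frac_inj[of Q]] by auto

lemma qmut_tor_Y_pos:
  assumes "skew Q" "v \<in> Lat_tilde Q" "0 \<le> dg Q k v"
  shows "qmut_tor Q k (Y v) = to_Frac (mutate Q k)
    (qt_mult (mutate Q k) (Y (mu_lat Q k v)) (pr (mutate Q k) k 0 (nat (dg Q k v))))"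
  using qmut_tor_eq[OF assms(1), of k 0 "Y v"] assms
  by (simp add: bnd_def to_Frac_def NF_Y)

lemma qmut_tor_Y_neg:
  assumes "skew Q" "v \<in> Lat_tilde Q" "dg Q k v \<le> 0"
  shows "qmut_tor Q k (Y v) = rfrac (torus (mutate Q k)) (Y (mu_lat Q k v)) (DN (mutate Q k) k (nat (- dg Q k v)))"
  using qmut_tor_eq[OF assms(1), of k "nat (- dg Q k v)" "Y v"] assms
  by (simp add: bnd_def NF_Y)

lemma qmut_tor_Y:
  assumes "skew Q" "v \<in> Lat_tilde Q"
  shows "qmut_tor Q k (Y v) = Ad_Psi (mutate Q k) k (mu_lat Q k v)"
proof -
  have n: "\<lfloor>form (mutate Q k) (ebas k) (mu_lat Q k v)\<rfloor> = - dg Q k v"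
    using dg_mu[OF assms] by (simp add: dg_def)
  show ?thesis
  proof (cases "0 \<le> dg Q k v")
    case True
    then show ?thesis
      unfolding Ad_Psi_def Let_def n using assms by (simp add: qmut_tor_Y_pos qt_prod_pos)
  next
    case False
    then show ?thesis
      unfolding Ad_Psi_def Let_def n using assms by (simp add: qmut_tor_Y_neg qt_prod_neg mutate_skew)
  qed
qed

lemma qmut_tor_const:
  assumes "skew Q"
  shows "qmut_tor Q k (qt_const r) = to_Frac (mutate Q k) (qt_const r)"
  using qmut_tor_eq[OF assms, of k 0 "qt_const r"]
  by (simp add: bnd_def qt_const_def NF_single to_Frac_def scl_Y)

lemma dg_line [simp]: "skew Q \<Longrightarrow> dg Q k (a *s ebas k) = 0" "skew Q \<Longrightarrow> dg Q k (ebas k) = 0"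
  by (simp_all add: dg_def form_scale_right)

lemma qmut_tor_lf:
  assumes "skew Q"
  shows "qmut_tor Q k (lf k s) = to_Frac (mutate Q k)
    (qt_mult (mutate Q k) (lf k (- s)) (scl (qpow (of_int s)) (Y (- ebas k))))"
proof -
  have "bnd Q k 0 (lf k s)"
    using keys_lf[of k s] assms by (auto simp: bnd_def)
  then have "qmut_tor Q k (lf k s) = to_Frac (mutate Q k) (NF Q k 0 (lf k s))"
    by (simp add: qmut_tor_eq[OF assms] to_Frac_def)
  also have "NF Q k 0 (lf k s) = Y 0 + scl (qpow (of_int s)) (Y (- ebas k))"
    using assms
    by (simp add: lf_def NF_add NF_scl NF_Y mu_lat_ebas(1))
  also have "\<dots> = qt_mult (mutate Q k) (lf k (- s)) (scl (qpow (of_int s)) (Y (- ebas k)))"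
    using qpow_uminus[of "of_int s"] mutate_skew[OF assms, of k]
    by (simp add: lf_def qt_mult_add_left scl_qt_mult scl_scl scl_add add.commute)
  finally show ?thesis .
qed

text \<open>Factor by factor, 1 + q^r Y^-1 = (1 + q^-r Y) q^r Y^-1, and the exponents 1, 3, ..., 2n
  - 1 add up to n^2.\<close>

lemma qmut_tor_pr:
  assumes "skew Q"
  shows "qmut_tor Q k (pr Q k 0 n) = to_Frac (mutate Q k)
    (qt_mult (mutate Q k) (DN (mutate Q k) k n) (scl (qpow (of_int (int n ^ 2))) (Y (- (of_nat n *s ebas k)))))"
proof (induction n)
  case 0
  then show ?case
    using qmut_tor_Y_pos[OF assms, of 0 k] by simp
next
  case (Suc n)
  let ?Q = "mutate Q k" and ?F = "Frac (torus (mutate Q k))"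
  define M where "M n = scl (qpow (of_int (int n ^ 2))) (Y (- (of_nat n *s ebas k)))" for n
  define m where "m = scl (qpow (of_int (2 * int n + 1))) (Y (- ebas k))"
  have Q': "skew ?Q" by (rule mutate_skew[OF assms])
  have kL: "- (of_nat i *s ebas k) \<in> line k" "- (of_nat i *s ebas k) \<in> Lat" for i
    using line_memI(1)[of "- of_nat i" k] by (auto simp: Lat_def)
  have kM: "keys (M i) \<subseteq> line k" "keys (M i) \<subseteq> Lat_tilde R" for i R
    unfolding M_def using kL Lat_tilde_Lat by (auto intro!: keys_scl_subset)
  have km: "keys m \<subseteq> line k" "keys m \<subseteq> Lat_tilde R" for R
    unfolding m_def using kL[of 1] Lat_tilde_Lat by (auto intro!: keys_scl_subset)
  have Mm: "qt_mult ?Q (M n) m = M (Suc n)"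
  proof -
    have "form ?Q (- (of_nat n *s ebas k)) (- ebas k) = 0"
      using Q' by (simp add: form_scale_left)
    moreover have "qpow (of_int (int n ^ 2)) * qpow (of_int (2 * int n + 1)) = qpow (of_int (int n ^ 2) + of_int (2 * int n + 1))"
      by (rule qpow_add[symmetric]) auto
    moreover have "of_int (int n ^ 2) + of_int (2 * int n + 1) = (of_int (int (Suc n) ^ 2) :: rat)"
      by (simp add: power2_eq_square algebra_simps)
    ultimately show ?thesis
      unfolding M_def m_def scl_qt_mult scl_scl qt_mult_Y
      by (simp add: mult.commute algebra_simps)
  qed
  have "qmut_tor Q k (pr Q k 0 (Suc n)) = qmut_tor Q k (pr Q k 0 n) \<otimes>\<^bsub>?F\<^esub> qmut_tor Q k (lf k (2 * int n + 1))"
    using ring_hom_mult[OF qmut_tor_hom(1)[OF assms, of k], of "pr Q k 0 n" "lf k (2 * int n + 1)"] by simp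
  also have "\<dots> = to_Frac ?Q (qt_mult ?Q (DN ?Q k n) (M n)) \<otimes>\<^bsub>?F\<^esub> to_Frac ?Q (qt_mult ?Q (lf k (- (2 * int n + 1))) m)"
    unfolding qmut_tor_lf[OF assms] Suc M_def m_def ..
  also have "\<dots> = to_Frac ?Q (qt_mult ?Q (qt_mult ?Q (DN ?Q k n) (M n)) (qt_mult ?Q (lf k (- (2 * int n + 1))) m))"
    by (rule to_Frac_mult[symmetric]) (use kM km in \<open>simp_all add: torus_mult_closed\<close>)
  also have "qt_mult ?Q (qt_mult ?Q (DN ?Q k n) (M n)) (qt_mult ?Q (lf k (- (2 * int n + 1))) m) =
     qt_mult ?Q (DN ?Q k n) (qt_mult ?Q (qt_mult ?Q (M n) (lf k (- (2 * int n + 1)))) m)"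
    using kM km by (simp add: qt_mult_assoc torus_mult_closed)
  also have "qt_mult ?Q (M n) (lf k (- (2 * int n + 1))) = qt_mult ?Q (lf k (- (2 * int n + 1))) (M n)"
    using kM by (intro line_commute[OF Q' _ keys_lf_line]) auto
  also have "qt_mult ?Q (DN ?Q k n) (qt_mult ?Q (qt_mult ?Q (lf k (- (2 * int n + 1))) (M n)) m) =
    qt_mult ?Q (qt_mult ?Q (DN ?Q k n) (lf k (- (2 * int n + 1)))) (qt_mult ?Q (M n) m)"
    using kM km by (simp add: qt_mult_assoc torus_mult_closed)
  also have "qt_mult ?Q (DN ?Q k n) (lf k (- (2 * int n + 1))) = qt_mult ?Q (lf k (- (2 * int n + 1))) (DN ?Q k n)"
    by (rule line_commute[OF Q' keys_pr_line keys_lf_line])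
  also have "\<dots> = DN ?Q k (Suc n)"
    using pr_Suc'[OF Q', of k "- 2 * int (Suc n)" n] by (simp add: algebra_simps)
  finally show ?case
    unfolding Mm unfolding M_def .
qed

text \<open>The second map uses the signs of the mutated quiver. Since max(-x, 0) - max(x, 0) = -x,
  the composite is a transvection along e_k and not the identity; conjugation by the two
  dilogarithms makes up for it.\<close>

lemma mu_lat_twice:
  assumes "skew Q" "v \<in> Lat_tilde Q"
  shows "mu_lat (mutate Q k) k (mu_lat Q k v) = v + of_int (dg Q k v) *s ebas k"
proof -
  have sk: "Q i j = - Q j i" for i j using skewD[OF assms(1)] .
  have kk: "Q k k = 0" using sk[of k k] by simp
  have Q': "mutate Q k j k = - Q j k" for j
    using mutate_eq[of Q k, OF sk] by simp
  have "of_int (dg Q k v) = form Q (ebas k) v" by (rule dg_of_int[OF assms(2)])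
  also have "\<dots> = (\<Sum>j\<in>UNIV. of_int (Q k j) * v $ j)"
    unfolding ebas_def by (rule form_axis_left)
  also have "\<dots> = (\<Sum>j\<in>UNIV - {k}. of_int (Q k j) * v $ j)"
    by (subst sum.remove[of _ k]) (auto simp: kk)
  finally have d: "of_int (dg Q k v) = (\<Sum>j\<in>UNIV - {k}. of_int (Q k j) * v $ j)" .
  have "(\<Sum>j\<in>UNIV - {k}. of_int (max (- Q j k) 0) * v $ j) - (\<Sum>j\<in>UNIV - {k}. of_int (max (Q j k) 0) * v $ j)
    = (\<Sum>j\<in>UNIV - {k}. of_int (Q k j) * v $ j)"
    unfolding sum_subtractf[symmetric]
  proof (intro sum.cong refl)
    fix j
    have "max (- Q j k) 0 - max (Q j k) 0 = Q k j" using sk[of k j] by auto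
    then have "rat_of_int (Q k j) = of_int (max (- Q j k) 0) - of_int (max (Q j k) 0)"
      by (metis of_int_diff)
    then show "of_int (max (- Q j k) 0) * v $ j - of_int (max (Q j k) 0) * v $ j = of_int (Q k j) * v $ j"
      by (simp only: left_diff_distrib)
  qed
  then have e: "(\<Sum>j\<in>UNIV - {k}. of_int (max (- Q j k) 0) * v $ j) =
     (\<Sum>j\<in>UNIV - {k}. of_int (max (Q j k) 0) * v $ j) + of_int (dg Q k v)"
    unfolding d by simp
  have "(\<Sum>j\<in>UNIV - {k}. of_int (max (mutate Q k j k) 0) * mu_lat Q k v $ j) =
    (\<Sum>j\<in>UNIV - {k}. of_int (max (- Q j k) 0) * v $ j)"
    by (intro sum.cong refl) (simp add: Q' mu_lat_nth)
  then have "mu_lat (mutate Q k) k (mu_lat Q k v) $ k = v $ k + of_int (dg Q k v)"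
    by (simp add: mu_lat_def[of "mutate Q k"] e) (simp add: mu_lat_def)
  then show ?thesis
    by (auto simp: vec_eq_iff mu_lat_nth)
qed

section \<open>Extension to the skew field and involutivity\<close>

lemma qmut_ext_ex:
  assumes "skew Q"
  shows "\<exists>H. H \<in> ring_hom (Frac (torus Q)) (Frac (torus (mutate Q k))) \<and>
    H \<in> extensional (carrier (Frac (torus Q))) \<and>
    (\<forall>f\<in>carrier (torus Q). H (to_Frac Q f) = qmut_tor Q k f)"
proof -
  interpret R: ore_domain "torus Q" by (rule torus_ore_domain)
  interpret R': ore_domain "torus (mutate Q k)" by (rule torus_ore_domain)
  obtain H where "H \<in> ring_hom (Frac (torus Q)) (Frac (torus (mutate Q k)))" "H \<in> extensional (carrier (Frac (torus Q)))"
    "\<And>a. a \<in> carrier (torus Q) \<Longrightarrow> H (R.emb a) = qmut_tor Q k a"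
    using R.Frac_hom_extend[OF qmut_tor_hom[OF assms, of k] R'.Frac_division_ring] by metis
  then show ?thesis
    unfolding to_Frac_def by blast
qed

definition qmut_ext :: "quiver \<Rightarrow> 7 \<Rightarrow> qfrac \<Rightarrow> qfrac" where
  "qmut_ext Q k = (SOME H. H \<in> ring_hom (Frac (torus Q)) (Frac (torus (mutate Q k))) \<and>
    H \<in> extensional (carrier (Frac (torus Q))) \<and>
    (\<forall>f\<in>carrier (torus Q). H (to_Frac Q f) = qmut_tor Q k f))"

lemma qmut_ext:
  assumes "skew Q"
  shows "qmut_ext Q k \<in> ring_hom (Frac (torus Q)) (Frac (torus (mutate Q k)))"
    "qmut_ext Q k \<in> extensional (carrier (Frac (torus Q)))"
    "keys f \<subseteq> Lat_tilde Q \<Longrightarrow> qmut_ext Q k (to_Frac Q f) = qmut_tor Q k f"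
  using someI_ex[OF qmut_ext_ex[OF assms, of k]] unfolding qmut_ext_def by auto

lemma Frac_torus_hom_unique:
  assumes "\<phi> \<in> ring_hom (Frac (torus Q)) (Frac (torus Q'))" "\<psi> \<in> ring_hom (Frac (torus Q)) (Frac (torus Q'))"
    "\<And>r. \<phi> (to_Frac Q (qt_const r)) = \<psi> (to_Frac Q (qt_const r))"
    "\<And>v. v \<in> Lat_tilde Q \<Longrightarrow> \<phi> (to_Frac Q (Y v)) = \<psi> (to_Frac Q (Y v))"
    "x \<in> carrier (Frac (torus Q))"
  shows "\<phi> x = \<psi> x"
proof -
  interpret R: ore_domain "torus Q" by (rule torus_ore_domain)
  interpret R': ore_domain "torus Q'" by (rule torus_ore_domain)
  let ?F = "Frac (torus Q)" and ?G = "Frac (torus Q')"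
  have "\<phi> (to_Frac Q f) = \<psi> (to_Frac Q f)" if "keys f \<subseteq> Lat_tilde Q" for f
    using that
  proof (induction f rule: pm_induct_keys)
    case zero
    then show ?case using assms(3)[of 0] by (simp add: qt_const_def)
  next
    case (single v c)
    have "single v c = qt_mult Q (qt_const c) (Y v)"
      by (simp add: qt_mult_const scl_Y)
    moreover have "keys (qt_const c) \<subseteq> Lat_tilde Q" by (simp add: qt_const_def)
    ultimately show ?case
      using single assms(3,4) by (simp add: to_Frac_mult to_Frac_closed ring_hom_mult[OF assms(1)] ring_hom_mult[OF assms(2)])
  next
    case (add f g)
    have "to_Frac Q (f + g) = to_Frac Q f \<oplus>\<^bsub>?F\<^esub> to_Frac Q g"
      using ring_hom_add[OF to_Frac_hom[of Q], of f g] add by simp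
    then show ?case
      using add by (simp add: to_Frac_closed ring_hom_add[OF assms(1)] ring_hom_add[OF assms(2)])
  qed
  then show ?thesis
    using R.Frac_hom_unique[OF assms(1,2) R'.Frac_ring _ assms(5)] unfolding to_Frac_def by simp
qed

text \<open>For n = (e_k, v) >= 0 the window created by the first mutation is sent, by
  \<open>qmut_tor_pr\<close>, to the denominator created by the second one times q^(n^2) Y_k^-n. The
  denominators cancel and the monomial undoes the transvection of \<open>mu_lat_twice\<close>.
  Monomials of negative degree are inverses of such ones.\<close>

lemma qmut_ext_involution:
  assumes "skew Q" "x \<in> carrier (Frac (torus Q))"
  shows "qmut_ext (mutate Q k) k (qmut_ext Q k x) = x"
proof -
  let ?Q = "mutate Q k" and ?F = "Frac (torus Q)"
  interpret R: ore_domain "torus Q" by (rule torus_ore_domain)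
  interpret R': ore_domain "torus ?Q" by (rule torus_ore_domain)
  interpret F: Submission.division_ring ?F by (rule R.Frac_division_ring)
  have Q': "skew ?Q" by (rule mutate_skew[OF assms(1)])
  note QQ = mutate_mutate[OF assms(1), of k]
  define H where "H = qmut_ext ?Q k \<circ> qmut_ext Q k"
  have H': "qmut_ext ?Q k \<in> ring_hom (Frac (torus ?Q)) ?F"
    using qmut_ext(1)[OF Q', of k] unfolding QQ .
  have H: "H \<in> ring_hom ?F ?F"
    unfolding H_def by (rule ring_hom_trans[OF qmut_ext(1)[OF assms(1)] H'])
  have tor: "qmut_ext ?Q k (to_Frac ?Q f) = qmut_tor ?Q k f" if "keys f \<subseteq> Lat_tilde ?Q" for f
    using qmut_ext(3)[OF Q' that] .
  have pos: "H (to_Frac Q (Y v)) = to_Frac Q (Y v)" if v: "v \<in> Lat_tilde Q" "0 \<le> dg Q k v" for v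
  proof -
    let ?n = "nat (dg Q k v)"
    have \<mu>: "mu_lat Q k v \<in> Lat_tilde ?Q" by (rule mu_lat_tilde[OF assms(1) v(1)])
    have n: "nat (- dg ?Q k (mu_lat Q k v)) = ?n"
      using dg_mu[OF assms(1) v(1)] by simp
    define w where "w = v + of_int (dg Q k v) *s ebas k"
    have w: "w \<in> Lat_tilde Q" "mu_lat ?Q k (mu_lat Q k v) = w"
      using mu_lat_twice[OF assms(1) v(1)] mu_lat_tilde[OF Q' \<mu>, of k] unfolding QQ w_def by simp_all
    define M where "M = scl (qpow (of_int (int ?n ^ 2))) (Y (- (of_nat ?n *s ebas k)))"
    have kM: "keys M \<subseteq> Lat_tilde Q"
      unfolding M_def by (intro keys_scl_subset) (auto intro!: Lat_tilde_Lat simp: Lat_def)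
    have "H (to_Frac Q (Y v)) = qmut_ext ?Q k (to_Frac ?Q (Y (mu_lat Q k v)) \<otimes>\<^bsub>Frac (torus ?Q)\<^esub> to_Frac ?Q (pr ?Q k 0 ?n))"
      using v \<mu> by (simp add: H_def qmut_ext(3)[OF assms(1)] qmut_tor_Y_pos[OF assms(1)] to_Frac_mult)
    also have "\<dots> = qmut_tor ?Q k (Y (mu_lat Q k v)) \<otimes>\<^bsub>?F\<^esub> qmut_tor ?Q k (pr ?Q k 0 ?n)"
      using \<mu> by (simp add: ring_hom_mult[OF H'] to_Frac_closed tor)
    also have "qmut_tor ?Q k (pr ?Q k 0 ?n) = to_Frac Q (qt_mult Q (DN Q k ?n) M)"
      using qmut_tor_pr[OF Q', of k ?n] unfolding QQ M_def .
    also have "qmut_tor ?Q k (Y (mu_lat Q k v)) = rfrac (torus Q) (Y w) (DN Q k ?n)"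
      using qmut_tor_Y_neg[OF Q' \<mu>, of k] dg_mu[OF assms(1) v(1), of k] v(2) unfolding QQ w(2) n by simp
    also have "rfrac (torus Q) (Y w) (DN Q k ?n) \<otimes>\<^bsub>?F\<^esub> to_Frac Q (qt_mult Q (DN Q k ?n) M) =
      rfrac (torus Q) (Y w \<otimes>\<^bsub>torus Q\<^esub> M) (Y 0 \<otimes>\<^bsub>torus Q\<^esub> Y 0)"
      unfolding to_Frac_def torus_sel(3)
      by (rule R.Frac_mult) (use w kM in \<open>simp_all add: torus_mult_closed\<close>)
    also have "Y w \<otimes>\<^bsub>torus Q\<^esub> M = Y v"
    proof -
      have f: "form Q w (of_int (dg Q k v) *s ebas k) = - of_int (dg Q k v ^ 2)"
        using assms(1) v form_skew[OF assms(1), of v "ebas k"]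
        by (simp add: w_def form_add_left form_scale_right form_scale_left power2_eq_square dg_of_int[OF v(1), symmetric])
      have "qpow (of_int (dg Q k v ^ 2)) * qpow (- of_int (dg Q k v ^ 2)) = 1"
        by (rule qpow_uminus) auto
      moreover have "w - of_nat ?n *s ebas k = v"
        using v(2) by (simp add: w_def)
      ultimately show ?thesis
        unfolding M_def torus_sel scl_qt_mult qt_mult_Y scl_scl using v(2) by (simp add: f)
    qed
    finally show ?thesis
      by (simp add: to_Frac_def)
  qed
  have Y: "H (to_Frac Q (Y v)) = to_Frac Q (Y v)" if v: "v \<in> Lat_tilde Q" for v
  proof (cases "0 \<le> dg Q k v")
    case True
    then show ?thesis using pos v by simp
  next
    case False
    have v': "- v \<in> Lat_tilde Q" "0 \<le> dg Q k (- v)"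
      using v False by (auto simp: Lat_tilde_uminus dg_uminus)
    let ?x = "to_Frac Q (Y v)" and ?y = "to_Frac Q (Y (- v))"
    have xy: "?x \<in> carrier ?F" "?y \<in> carrier ?F" using v v' by (auto intro!: to_Frac_closed)
    have 1: "?x \<otimes>\<^bsub>?F\<^esub> ?y = \<one>\<^bsub>?F\<^esub>" "?y \<otimes>\<^bsub>?F\<^esub> ?x = \<one>\<^bsub>?F\<^esub>"
      using to_Frac_mult[of "Y v" Q "Y (- v)"] to_Frac_mult[of "Y (- v)" Q "Y v"] v v' assms(1)
        ring_hom_one[OF to_Frac_hom[of Q]] by simp_all
    have Hx: "H ?x \<in> carrier ?F" by (rule ring_hom_closed[OF H xy(1)])
    have "H ?x \<otimes>\<^bsub>?F\<^esub> ?y = H (?x \<otimes>\<^bsub>?F\<^esub> ?y)"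
      using ring_hom_mult[OF H xy] pos[OF v'] by simp
    also have "\<dots> = \<one>\<^bsub>?F\<^esub>" unfolding 1 by (rule ring_hom_one[OF H])
    finally have "H ?x \<otimes>\<^bsub>?F\<^esub> ?y \<otimes>\<^bsub>?F\<^esub> ?x = ?x" using xy by simp
    then show ?thesis using Hx xy 1 by (simp add: F.m_assoc)
  qed
  have C: "H (to_Frac Q (qt_const r)) = to_Frac Q (qt_const r)" for r
  proof -
    have "keys (qt_const r) \<subseteq> Lat_tilde R" for R by (simp add: qt_const_def)
    then show ?thesis
      using qmut_tor_const[OF Q', of k r] by (simp add: H_def qmut_ext(3)[OF assms(1)] qmut_tor_const[OF assms(1)] tor QQ)
  qed
  have "id \<in> ring_hom ?F ?F" by (rule ring_hom_memI) auto
  from Frac_torus_hom_unique[OF H this _ _ assms(2)] Y C show ?thesis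
    by (simp add: H_def)
qed

text \<open>Bijectivity comes from the involution, uniqueness from the fact that constants and
  monomials generate the skew field.\<close>

lemma qmut_eq_ext:
  assumes "skew Q"
  shows "qmut Q k = qmut_ext Q k"
  unfolding qmut_def
proof (rule the_equality)
  let ?Q = "mutate Q k" and ?F = "Frac (torus Q)" and ?G = "Frac (torus (mutate Q k))"
  have Q': "skew ?Q" by (rule mutate_skew[OF assms])
  have H': "qmut_ext ?Q k \<in> ring_hom ?G ?F"
    using qmut_ext(1)[OF Q', of k] unfolding mutate_mutate[OF assms] .
  have kc: "keys (qt_const r) \<subseteq> Lat_tilde Q" for r by (simp add: qt_const_def)
  have inv: "qmut_ext Q k (qmut_ext ?Q k y) = y" if "y \<in> carrier ?G" for y
    using qmut_ext_involution[OF Q' that, of k] unfolding mutate_mutate[OF assms] .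
  have "bij_betw (qmut_ext Q k) (carrier ?F) (carrier ?G)"
    by (rule bij_betwI[where g = "qmut_ext ?Q k"])
      (auto simp: inv qmut_ext_involution[OF assms] ring_hom_closed[OF H'] ring_hom_closed[OF qmut_ext(1)[OF assms]])
  then show "qmut_ext Q k \<in> ring_iso ?F ?G \<and> qmut_ext Q k \<in> extensional (carrier ?F) \<and>
    (\<forall>r. qmut_ext Q k (to_Frac Q (qt_const r)) = to_Frac ?Q (qt_const r)) \<and>
    (\<forall>v\<in>Lat_tilde Q. qmut_ext Q k (to_Frac Q (Y v)) = Ad_Psi ?Q k (mu_lat Q k v))"
    using qmut_ext[OF assms, where k = k] kc by (auto simp: ring_iso_def qmut_tor_const[OF assms] qmut_tor_Y[OF assms])
  fix \<phi> assume \<phi>: "\<phi> \<in> ring_iso ?F ?G \<and> \<phi> \<in> extensional (carrier ?F) \<and>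
    (\<forall>r. \<phi> (to_Frac Q (qt_const r)) = to_Frac ?Q (qt_const r)) \<and>
    (\<forall>v\<in>Lat_tilde Q. \<phi> (to_Frac Q (Y v)) = Ad_Psi ?Q k (mu_lat Q k v))"
  show "\<phi> = qmut_ext Q k"
  proof (rule extensionalityI[where A = "carrier ?F"])
    fix x assume "x \<in> carrier ?F"
    then show "\<phi> x = qmut_ext Q k x"
    proof (rule Frac_torus_hom_unique[of \<phi> Q ?Q "qmut_ext Q k", rotated 4])
      show "\<phi> \<in> ring_hom ?F ?G" using \<phi> unfolding ring_iso_def by blast
      show "\<phi> (to_Frac Q (qt_const r)) = qmut_ext Q k (to_Frac Q (qt_const r))" for r
        using \<phi> by (simp only: qmut_ext(3)[OF assms kc] qmut_tor_const[OF assms] simp_thms)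
      show "\<phi> (to_Frac Q (Y v)) = qmut_ext Q k (to_Frac Q (Y v))" if "v \<in> Lat_tilde Q" for v
      proof -
        have "\<phi> (to_Frac Q (Y v)) = Ad_Psi ?Q k (mu_lat Q k v)" using \<phi> that by blast
        then show ?thesis using that by (simp add: qmut_ext(3)[OF assms] qmut_tor_Y[OF assms])
      qed
    qed (rule qmut_ext(1)[OF assms])
  qed (use \<phi> qmut_ext(2)[OF assms] in blast)+
qed

lemma qmut_hom: "skew Q \<Longrightarrow> qmut Q k \<in> ring_hom (Frac (torus Q)) (Frac (torus (mutate Q k)))"
  using qmut_ext(1) by (simp add: qmut_eq_ext)

lemma qmut_involution: "skew Q \<Longrightarrow> x \<in> carrier (Frac (torus Q)) \<Longrightarrow> qmut (mutate Q k) k (qmut Q k x) = x"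
  by (simp add: qmut_eq_ext mutate_skew qmut_ext_involution)

text \<open>Laurentness after a mutation becomes right divisibility by a window inside the torus,
  which makes most of the later arguments free of fractions.\<close>

lemma qmut_to_Frac_iff:
  assumes "skew Q" "keys f \<subseteq> Lat_tilde Q" "keys g \<subseteq> Lat_tilde (mutate Q k)" "bnd Q k N f"
  shows "qmut Q k (to_Frac Q f) = to_Frac (mutate Q k) g \<longleftrightarrow> NF Q k N f = qt_mult (mutate Q k) g (DN (mutate Q k) k N)"
proof -
  let ?Q = "mutate Q k"
  interpret R: ore_domain "torus ?Q" by (rule torus_ore_domain)
  have e: "qmut Q k (to_Frac Q f) = rfrac (torus ?Q) (NF Q k N f) (DN ?Q k N)"
    using assms by (simp add: qmut_eq_ext qmut_ext(3) qmut_tor_eq)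
  show ?thesis
  proof
    assume "qmut Q k (to_Frac Q f) = to_Frac ?Q g"
    then have "rfrac (torus ?Q) (NF Q k N f) (DN ?Q k N) = rfrac (torus ?Q) g (Y 0)"
      unfolding e unfolding to_Frac_def torus_sel(3) .
    then have r: "((NF Q k N f, DN ?Q k N), (g, Y 0)) \<in> ore_rel (torus ?Q)"
      by (rule R.rfrac_eqD) (use assms in simp_all)
    from R.ore_rel_cross[OF r, of "Y 0" "DN ?Q k N"] show "NF Q k N f = qt_mult ?Q g (DN ?Q k N)"
      by simp
  next
    assume "NF Q k N f = qt_mult ?Q g (DN ?Q k N)"
    then show "qmut Q k (to_Frac Q f) = to_Frac ?Q g"
      unfolding e unfolding to_Frac_def torus_sel(3)
      using R.rfrac_cancel[of g "Y 0" "DN ?Q k N"] assms by simp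
  qed
qed

subsection \<open>Isometries of lattices\<close>

lemma scl_diff: "scl r (f - g) = scl r f - scl r (g :: 'a \<Rightarrow>\<^sub>0 'b::ring)"
  by (rule poly_mapping_eqI) (simp add: lookup_minus right_diff_distrib)

lemma scl_cancel: "(r::'b::idom) \<noteq> 0 \<Longrightarrow> scl r f = scl r g \<longleftrightarrow> f = g"
  by (auto simp: poly_mapping_eq_iff fun_eq_iff)

definition lat_map :: "(weight \<Rightarrow> weight) \<Rightarrow> qtorus \<Rightarrow> qtorus" where
  "lat_map \<nu> f = pm_lin (\<lambda>v a. single (\<nu> v) a) f"

lemma lat_map_add: "lat_map \<nu> (f + g) = lat_map \<nu> f + lat_map \<nu> g"
  unfolding lat_map_def by (rule pm_lin_add) (auto simp: single_add)

lemma lat_map_single [simp]: "lat_map \<nu> (single v a) = single (\<nu> v) a"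
  unfolding lat_map_def by (rule pm_lin_single) auto

lemma lat_map_zero [simp]: "lat_map \<nu> 0 = 0"
  by (simp add: lat_map_def)

lemma lat_map_Y [simp]: "lat_map \<nu> (Y v) = Y (\<nu> v)"
  by (simp only: Y_def lat_map_single)

lemma lat_map_scl: "lat_map \<nu> (scl r f) = scl r (lat_map \<nu> f)"
  by (induction f rule: pm_induct) (simp_all add: lat_map_add scl_add)

lemma keys_lat_map: "keys (lat_map \<nu> f) \<subseteq> \<nu> ` keys f"
  unfolding lat_map_def by (rule order.trans[OF keys_pm_lin]) (auto split: if_splits)

lemma lat_map_comp: "lat_map \<nu> (lat_map \<nu>' f) = lat_map (\<lambda>v. \<nu> (\<nu>' v)) f"
  by (induction f rule: pm_induct) (simp_all add: lat_map_add)

lemma lat_map_ident: "lat_map (\<lambda>v. v) f = f"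
  unfolding lat_map_def by (rule pm_lin_id)

text \<open>The isometry need not permute the basis: relabellings of vertices and the lattice
  mutations \<open>mu_lat\<close> both qualify. That \<open>Lat\<close> is preserved in both
  directions carries the integrality condition of \<open>Lat_tilde\<close> along.\<close>

locale lat_iso =
  fixes Q1 Q2 :: quiver and \<nu> \<nu>' :: "weight \<Rightarrow> weight"
  assumes skew1: "skew Q1" and skew2: "skew Q2"
    and add: "\<nu> (v + w) = \<nu> v + \<nu> w" and scale: "\<nu> (a *s v) = a *s \<nu> v"
    and isom: "form Q2 (\<nu> v) (\<nu> w) = form Q1 v w"
    and inv1: "\<nu>' (\<nu> v) = v" and inv2: "\<nu> (\<nu>' v) = v"
    and Lat1: "v \<in> Lat \<Longrightarrow> \<nu> v \<in> Lat" and Lat2: "v \<in> Lat \<Longrightarrow> \<nu>' v \<in> Lat"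
begin

lemma inverse: "lat_iso Q2 Q1 \<nu>' \<nu>"
proof
  show "\<nu>' (v + w) = \<nu>' v + \<nu>' w" for v w
    using arg_cong[of _ _ \<nu>', OF add[of "\<nu>' v" "\<nu>' w"]] unfolding inv1 inv2 by simp
  show "\<nu>' (a *s v) = a *s \<nu>' v" for a v
    using arg_cong[of _ _ \<nu>', OF scale[of a "\<nu>' v"]] unfolding inv1 inv2 by simp
  show "form Q1 (\<nu>' v) (\<nu>' w) = form Q2 v w" for v w
    using isom[of "\<nu>' v" "\<nu>' w"] unfolding inv2 by simp
qed (auto simp: skew1 skew2 inv1 inv2 Lat1 Lat2)

lemma zero: "\<nu> 0 = 0"
  using scale[of 0 0] by simp

lemma tilde: "v \<in> Lat_tilde Q1 \<Longrightarrow> \<nu> v \<in> Lat_tilde Q2"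
proof -
  assume v: "v \<in> Lat_tilde Q1"
  have "form Q2 w (\<nu> v) = form Q1 (\<nu>' w) v" for w
    using isom[of "\<nu>' w" v] inv2 by simp
  moreover have "2 *s \<nu> v \<in> Lat"
    using v Lat1[of "2 *s v"] by (simp add: Lat_tilde_def scale)
  ultimately show ?thesis
    using v Lat2 by (auto simp: Lat_tilde_def)
qed

lemma map_mult: "lat_map \<nu> (qt_mult Q1 f g) = qt_mult Q2 (lat_map \<nu> f) (lat_map \<nu> g)"
proof (induction f rule: pm_induct)
  case (single v a)
  show ?case
    by (induction g rule: pm_induct) (simp_all add: qt_mult_add_right lat_map_add isom add)
qed (simp_all add: qt_mult_add_left lat_map_add)

lemma map_inv: "lat_map \<nu>' (lat_map \<nu> f) = f"
  by (simp add: lat_map_comp inv1 lat_map_ident)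

lemma map_closed: "keys f \<subseteq> Lat_tilde Q1 \<Longrightarrow> keys (lat_map \<nu> f) \<subseteq> Lat_tilde Q2"
  using keys_lat_map[of \<nu> f] tilde by blast

lemma dg_map:
  assumes "\<nu> (ebas j) = ebas j'"
  shows "dg Q2 j' (\<nu> v) = dg Q1 j v"
  using isom[of "ebas j" v] by (simp add: dg_def assms)

lemma map_pr:
  assumes "\<nu> (ebas j) = ebas j'"
  shows "lat_map \<nu> (pr Q1 j s n) = pr Q2 j' s n"
proof -
  have "lat_map \<nu> (lf j s) = lf j' s" for s
    by (simp add: lf_def lat_map_add lat_map_scl zero assms)
  then show ?thesis
    by (induction n) (simp_all add: zero map_mult)
qed

text \<open>Conjugating by the two lattice mutations gives an isometry of the mutated quivers. It
  again matches the two directions, because both mutations reverse the sign of their own basis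
  vector.\<close>

lemma mutated:
  assumes "\<nu> (ebas j) = ebas j'"
  shows "lat_iso (mutate Q1 j) (mutate Q2 j') (\<lambda>v. mu_lat Q2 j' (\<nu> (mu_lat Q1 j v))) (\<lambda>v. mu_lat Q1 j (\<nu>' (mu_lat Q2 j' v)))"
    and "mu_lat Q2 j' (\<nu> (mu_lat Q1 j (ebas j))) = ebas j'"
proof -
  show "mu_lat Q2 j' (\<nu> (mu_lat Q1 j (ebas j))) = ebas j'"
    using scale[of "-1" "ebas j"] by (simp add: mu_lat_ebas assms mu_lat_uminus)
  show "lat_iso (mutate Q1 j) (mutate Q2 j') (\<lambda>v. mu_lat Q2 j' (\<nu> (mu_lat Q1 j v))) (\<lambda>v. mu_lat Q1 j (\<nu>' (mu_lat Q2 j' v)))"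
  proof
    show "form (mutate Q2 j') (mu_lat Q2 j' (\<nu> (mu_lat Q1 j v))) (mu_lat Q2 j' (\<nu> (mu_lat Q1 j w))) = form (mutate Q1 j) v w" for v w
      using mutate_isom[OF skew1, of j "mu_lat Q1 j v" "mu_lat Q1 j w"]
      by (simp add: mutate_isom[OF skew2] isom mu_lat_involution)
  qed (auto simp: mutate_skew skew1 skew2 mu_lat_add mu_lat_scale add scale mu_lat_involution inv1 inv2 mu_lat_Lat Lat1 Lat2)
qed

text \<open>Mutation at j sees the lattice only through e_j and the form, so it is enough that e_j
  goes to e_j'. Hence Laurentness at j can be transported along \<open>mu_lat Q k\<close> even
  though that map moves other basis vectors.\<close>

lemma qmut_map:
  assumes j: "\<nu> (ebas j) = ebas j'"
    and f: "keys f \<subseteq> Lat_tilde Q1" and g: "keys g \<subseteq> Lat_tilde (mutate Q1 j)"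
    and fg: "qmut Q1 j (to_Frac Q1 f) = to_Frac (mutate Q1 j) g"
  shows "qmut Q2 j' (to_Frac Q2 (lat_map \<nu> f)) =
    to_Frac (mutate Q2 j') (lat_map (\<lambda>v. mu_lat Q2 j' (\<nu> (mu_lat Q1 j v))) g)"
proof -
  let ?\<nu> = "\<lambda>v. mu_lat Q2 j' (\<nu> (mu_lat Q1 j v))"
  interpret M: lat_iso "mutate Q1 j" "mutate Q2 j'" ?\<nu> "\<lambda>v. mu_lat Q1 j (\<nu>' (mu_lat Q2 j' v))"
    by (rule mutated(1)[OF j])
  obtain N where N: "bnd Q1 j N f" using bnd_ex by blast
  have N': "bnd Q2 j' N (lat_map \<nu> f)"
    using N keys_lat_map[of \<nu> f] dg_map[OF j] by (auto simp: bnd_def)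
  have NF: "lat_map ?\<nu> (NF Q1 j N f) = NF Q2 j' N (lat_map \<nu> f)" for f
    by (induction f rule: pm_induct)
      (simp_all add: NF_add lat_map_add NF_single lat_map_scl M.map_mult M.map_pr[OF mutated(2)[OF j]] mu_lat_involution dg_map[OF j])
  have "NF Q1 j N f = qt_mult (mutate Q1 j) g (DN (mutate Q1 j) j N)"
    using qmut_to_Frac_iff[OF skew1 f g N] fg by simp
  then have "NF Q2 j' N (lat_map \<nu> f) = qt_mult (mutate Q2 j') (lat_map ?\<nu> g) (DN (mutate Q2 j') j' N)"
    by (simp add: M.map_mult M.map_pr[OF mutated(2)[OF j]] flip: NF)
  then show ?thesis
    using qmut_to_Frac_iff[OF skew2 map_closed[OF f] M.map_closed[OF g] N'] by simp
qed

end

lemma mu_lat_iso: "skew Q \<Longrightarrow> lat_iso Q (mutate Q k) (mu_lat Q k) (mu_lat Q k)"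
  by unfold_locales (auto simp: mutate_skew mu_lat_add mu_lat_scale mutate_isom mu_lat_involution mu_lat_Lat)

subsection \<open>Universally Laurent elements are detected by single mutations\<close>

definition lau :: "quiver \<Rightarrow> 7 \<Rightarrow> qtorus \<Rightarrow> bool" where
  "lau Q j f \<longleftrightarrow> keys f \<subseteq> Lat_tilde Q \<and>
    (\<exists>g. keys g \<subseteq> Lat_tilde (mutate Q j) \<and> qmut Q j (to_Frac Q f) = to_Frac (mutate Q j) g)"

lemma lau_iff:
  assumes "skew Q" "bnd Q j N f"
  shows "lau Q j f \<longleftrightarrow> keys f \<subseteq> Lat_tilde Q \<and>
    (\<exists>g. keys g \<subseteq> Lat_tilde (mutate Q j) \<and> NF Q j N f = qt_mult (mutate Q j) g (DN (mutate Q j) j N))"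
  using qmut_to_Frac_iff[OF assms(1) _ _ assms(2)] by (auto simp: lau_def)

lemma lauI:
  "\<lbrakk>skew Q; bnd Q j N f; keys f \<subseteq> Lat_tilde Q; keys g \<subseteq> Lat_tilde (mutate Q j);
    NF Q j N f = qt_mult (mutate Q j) g (DN (mutate Q j) j N)\<rbrakk> \<Longrightarrow> lau Q j f"
  using lau_iff by blast

lemma lau_keys: "lau Q j f \<Longrightarrow> keys f \<subseteq> Lat_tilde Q"
  by (simp add: lau_def)

lemma lau_mult:
  assumes "skew Q" "lau Q j f" "lau Q j g"
  shows "lau Q j (qt_mult Q f g)"
proof -
  let ?Q = "mutate Q j"
  obtain f' g' where fg: "keys f' \<subseteq> Lat_tilde ?Q" "qmut Q j (to_Frac Q f) = to_Frac ?Q f'"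
    "keys g' \<subseteq> Lat_tilde ?Q" "qmut Q j (to_Frac Q g) = to_Frac ?Q g'"
    using assms by (auto simp: lau_def)
  note k = lau_keys[OF assms(2)] lau_keys[OF assms(3)]
  have "qmut Q j (to_Frac Q (qt_mult Q f g)) = to_Frac ?Q (qt_mult ?Q f' g')"
    using fg k ring_hom_mult[OF qmut_hom[OF assms(1), of j]] by (simp add: to_Frac_mult to_Frac_closed)
  then show ?thesis
    unfolding lau_def using fg(1,3) k
    by (intro conjI exI[of _ "qt_mult ?Q f' g'"]) (simp_all add: torus_mult_closed)
qed

lemma lau_add:
  assumes "skew Q" "lau Q j f" "lau Q j g"
  shows "lau Q j (f + g)"
proof -
  obtain N where N: "bnd Q j N f" "bnd Q j N g" using bnd_ex2 by blast
  obtain f' g' where "keys f' \<subseteq> Lat_tilde (mutate Q j)" "NF Q j N f = qt_mult (mutate Q j) f' (DN (mutate Q j) j N)"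
    "keys g' \<subseteq> Lat_tilde (mutate Q j)" "NF Q j N g = qt_mult (mutate Q j) g' (DN (mutate Q j) j N)"
    using assms lau_iff[OF assms(1) N(1)] lau_iff[OF assms(1) N(2)] by blast
  then show ?thesis
    using lau_keys[OF assms(2)] lau_keys[OF assms(3)]
    by (intro lauI[OF assms(1) bnd_add[OF N], of "f' + g'"])
      (simp_all add: torus_add_closed NF_add qt_mult_add_left)
qed

lemma lau_scl:
  assumes "skew Q" "lau Q j f"
  shows "lau Q j (scl r f)"
proof -
  obtain N where N: "bnd Q j N f" using bnd_ex by blast
  then have N': "bnd Q j N (scl r f)" using keys_scl[of r f] by (auto simp: bnd_def)
  obtain f' where "keys f' \<subseteq> Lat_tilde (mutate Q j)" "NF Q j N f = qt_mult (mutate Q j) f' (DN (mutate Q j) j N)"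
    using assms lau_iff[OF assms(1) N(1)] by blast
  then show ?thesis
    using lau_keys[OF assms(2)]
    by (intro lauI[OF assms(1) N', of "scl r f'"]) (simp_all add: keys_scl_subset NF_scl scl_qt_mult)
qed

lemma lau_zero: "skew Q \<Longrightarrow> lau Q j 0"
  using lau_iff[of Q j 0 0] by (auto simp: bnd_def intro: exI[of _ 0])

lemma lau_diff:
  assumes "skew Q" "lau Q j f" "lau Q j g"
  shows "lau Q j (f - g)"
proof -
  have "f - g = f + scl (- 1) g" by (rule poly_mapping_eqI) (simp add: lookup_add lookup_minus)
  then show ?thesis using lau_add[OF assms(1,2) lau_scl[OF assms(1,3)]] by (simp only:)
qed

lemma lau_sum: "skew Q \<Longrightarrow> (\<And>i. i \<in> I \<Longrightarrow> lau Q j (f i)) \<Longrightarrow> lau Q j (\<Sum>i\<in>I. f i)"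
  by (induction I rule: infinite_finite_induct) (auto simp: lau_zero lau_add)

lemma lau_Y:
  assumes "skew Q" "v \<in> Lat_tilde Q" "0 \<le> dg Q j v"
  shows "lau Q j (Y v)"
proof -
  have "bnd Q j 0 (Y v)" using assms by (simp add: bnd_def)
  from lau_iff[OF assms(1) this] show ?thesis
    using assms NF_closed[of Q "Y v" j 0] by auto
qed

section \<open>Slices in one coordinate and division by scalars\<close>

definition cpart :: "7 \<Rightarrow> rat \<Rightarrow> qtorus \<Rightarrow> qtorus" where
  "cpart k c f = pm_lin (\<lambda>v a. if v $ k = c then single v a else 0) f"

lemma cpart_add: "cpart k c (f + g) = cpart k c f + cpart k c g"
  unfolding cpart_def by (rule pm_lin_add) (auto simp: single_add)

lemma cpart_zero [simp]: "cpart k c 0 = 0"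
  by (simp add: cpart_def)

lemma cpart_single: "cpart k c (single v a) = (if v $ k = c then single v a else 0)"
  unfolding cpart_def by (rule pm_lin_single) auto

lemma cpart_scl: "cpart k c (scl r f) = scl r (cpart k c f)"
  by (induction f rule: pm_induct) (simp_all add: cpart_add scl_add cpart_single)

lemma cpart_sum: "cpart k c (\<Sum>i\<in>I. f i) = (\<Sum>i\<in>I. cpart k c (f i))"
  by (induction I rule: infinite_finite_induct) (auto simp: cpart_add)

lemma lookup_cpart: "lookup (cpart k c f) v = (if v $ k = c then lookup f v else 0)"
  by (induction f rule: pm_induct) (auto simp: cpart_add lookup_add cpart_single lookup_single when_def)

lemma keys_cpart: "keys (cpart k c f) = {v \<in> keys f. v $ k = c}"
  by (auto simp: in_keys_iff lookup_cpart split: if_splits)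

lemma sum_cpart: "(\<Sum>c\<in>(\<lambda>v. v $ k) ` keys f. cpart k c f) = f"
proof (rule poly_mapping_eqI)
  fix v
  have "lookup (\<Sum>c\<in>(\<lambda>v. v $ k) ` keys f. cpart k c f) v =
    (if v $ k \<in> (\<lambda>v. v $ k) ` keys f then lookup f v else 0)"
    by (simp add: lookup_sum lookup_cpart)
  then show "lookup (\<Sum>c\<in>(\<lambda>v. v $ k) ` keys f. cpart k c f) v = lookup f v"
    by (auto simp: in_keys_iff)
qed

lemma cpart_mult_right:
  assumes "keys p \<subseteq> {v. v $ k = d}"
  shows "cpart k c (qt_mult Q f p) = qt_mult Q (cpart k (c - d) f) p"
proof (induction f rule: pm_induct)
  case (single v a)
  show ?case using assms
    by (induction p rule: pm_induct_keys)
      (auto simp: qt_mult_add_right cpart_add cpart_single algebra_simps)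
qed (simp_all add: qt_mult_add_left cpart_add)

lemma cpart_mult_left:
  assumes "keys p \<subseteq> {v. v $ k = d}"
  shows "cpart k c (qt_mult Q p f) = qt_mult Q p (cpart k (c - d) f)"
proof (induction f rule: pm_induct)
  case (single v a)
  show ?case using assms
    by (induction p rule: pm_induct_keys)
      (auto simp: qt_mult_add_left cpart_add cpart_single algebra_simps)
qed (simp_all add: qt_mult_add_right cpart_add)

lemma keys_pr_nth: "j \<noteq> k \<Longrightarrow> keys (pr Q j s n) \<subseteq> {v. v $ k = 0}"
  using keys_pr[of Q j s n] by auto

lemma cpart_NF:
  assumes "j \<noteq> k"
  shows "cpart k c (NF Q j N f) = NF Q j N (cpart k c f)"
proof (induction f rule: pm_induct)
  case (single v a)
  show ?case
    using cpart_mult_right[OF keys_pr_nth[OF assms], of c "mutate Q j" "Y (mu_lat Q j v)"] assms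
    by (simp add: NF_single cpart_scl cpart_single[of _ _ _ 1, folded Y_def] mu_lat_nth cpart_single)
qed (simp_all add: NF_add cpart_add)

text \<open>Mutation at j multiplies by polynomials in Y_j alone and leaves the k-th coordinate of a
  weight unchanged, so every slice is Laurent by itself.\<close>

lemma lau_cpart:
  assumes "skew Q" "lau Q j f" "j \<noteq> k"
  shows "lau Q j (cpart k c f)"
proof -
  obtain N where N: "bnd Q j N f" using bnd_ex by blast
  then have N': "bnd Q j N (cpart k c f)" by (auto simp: bnd_def keys_cpart)
  obtain g where "keys g \<subseteq> Lat_tilde (mutate Q j)" "NF Q j N f = qt_mult (mutate Q j) g (DN (mutate Q j) j N)"
    using assms lau_iff[OF assms(1) N] by blast
  then show ?thesis
    using lau_keys[OF assms(2)] cpart_mult_right[OF keys_pr_nth[OF assms(3)], of c "mutate Q j" g]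
    by (intro lauI[OF assms(1) N', of "cpart k c g"]) (auto simp: keys_cpart simp flip: cpart_NF[OF assms(3)])
qed

lemma lookup_mult_right:
  "lookup (qt_mult Q h p) v = (\<Sum>y\<in>keys p.
    qpow (- form Q (v - y) y) * lookup h (v - y) * lookup p y)"
proof -
  have "lookup (qt_mult Q h p) v = (\<Sum>y\<in>keys p. \<Sum>w\<in>keys h.
    if w = v - y then qpow (- form Q w y) * lookup h w * lookup p y else 0)"
    unfolding lookup_qt_mult by (subst sum.swap) (intro sum.cong refl, auto simp: algebra_simps)
  also have "\<dots> = (\<Sum>y\<in>keys p.
    qpow (- form Q (v - y) y) * lookup h (v - y) * lookup p y)"
    by (intro sum.cong refl) (simp add: in_keys_iff)
  finally show ?thesis .
qed

lemma min_coordinate: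
  fixes S :: "weight set"
  assumes "finite S" "S \<noteq> {}"
  obtains v where "v \<in> S" "\<And>w. w \<in> S \<Longrightarrow> v $ k \<le> w $ k"
proof -
  have "Min ((\<lambda>v. v $ k) ` S) \<in> (\<lambda>v. v $ k) ` S" using assms by (intro Min_in) auto
  then obtain v where "v \<in> S" "v $ k = Min ((\<lambda>v. v $ k) ` S)" by (metis (mono_tags) imageE)
  then show ?thesis using that[of v] assms by simp
qed

lemma lookup_mult_min:
  assumes p: "lookup p 0 = 1" "keys p \<subseteq> {of_nat i *s ebas k |i. True}"
  obtains c where "lookup (qt_mult Q h p) v = lookup h v +
      (\<Sum>y\<in>keys p - {0}. c y * lookup h (v - y))"
    and "\<And>y. y \<in> keys p - {0} \<Longrightarrow> (v - y) $ k < v $ k"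
proof
  have "0 \<in> keys p" using p by (simp add: in_keys_iff)
  then show "lookup (qt_mult Q h p) v = lookup h v +
      (\<Sum>y\<in>keys p - {0}. (qpow (- form Q (v - y) y) * lookup p y) * lookup h (v - y))"
    unfolding lookup_mult_right by (subst sum.remove) (auto simp: p mult_ac)
  fix y assume y: "y \<in> keys p - {0}"
  then obtain i where i: "y = of_nat i *s ebas k" using p by blast
  with y have "i \<noteq> 0" by auto
  then show "(v - y) $ k < v $ k" unfolding i by simp
qed

text \<open>Multiplication by \<open>p\<close> is unitriangular for the k-th coordinate. A lowest
  coefficient of \<open>h\<close> not divisible by \<open>r\<close> would reappear modulo
  \<open>r\<close> in the product.\<close>

lemma gauss_lemma:
  assumes p: "lookup p 0 = 1" "keys p \<subseteq> {of_nat i *s ebas k |i. True}"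
    and eq: "qt_mult Q h p = scl r F"
  obtains g where "h = scl r g" "keys g \<subseteq> keys h"
proof -
  have dvd: "r dvd lookup h v" for v
  proof (rule ccontr)
    assume "\<not> r dvd lookup h v"
    define S where "S = {v \<in> keys h. \<not> r dvd lookup h v}"
    have "v \<in> S" using \<open>\<not> r dvd _\<close> by (auto simp: S_def in_keys_iff)
    then have "finite S" "S \<noteq> {}" by (auto simp: S_def)
    then obtain u where u: "u \<in> S" "\<And>w. w \<in> S \<Longrightarrow> u $ k \<le> w $ k"
      using min_coordinate by blast
    obtain c where c: "lookup (qt_mult Q h p) u = lookup h u +
      (\<Sum>y\<in>keys p - {0}. c y * lookup h (u - y))"
      "\<And>y. y \<in> keys p - {0} \<Longrightarrow> (u - y) $ k < u $ k"
      by (rule lookup_mult_min[OF p, of Q h u]) blast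
    have "r dvd lookup h (u - y)" if "y \<in> keys p - {0}" for y
      using c(2)[OF that] u(2)[of "u - y"] by (cases "u - y \<in> keys h") (auto simp: S_def in_keys_iff)
    then have "r dvd (\<Sum>y\<in>keys p - {0}. c y * lookup h (u - y))"
      by (intro dvd_sum dvd_mult) auto
    moreover have "r dvd lookup (qt_mult Q h p) u" unfolding eq by simp
    ultimately have "r dvd lookup h u"
      unfolding c(1) by (simp add: dvd_add_left_iff)
    with u(1) show False by (simp add: S_def)
  qed
  define q where "q v = (SOME c. lookup h v = r * c)" for v
  have q: "lookup h v = r * q v" for v
    unfolding q_def by (rule someI_ex) (use dvd[of v] in \<open>auto elim: dvdE\<close>)
  define g where "g = (\<Sum>v\<in>keys h. single v (q v))"
  have g: "lookup g v = (if v \<in> keys h then q v else 0)" for v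
    unfolding g_def lookup_sum by (simp add: lookup_single when_def)
  show ?thesis
  proof
    show "h = scl r g"
      by (rule poly_mapping_eqI) (use q in \<open>auto simp: g in_keys_iff\<close>)
    show "keys g \<subseteq> keys h"
      by (auto simp: in_keys_iff[of _ g] g split: if_splits)
  qed
qed

text \<open>Needed because clearing the denominators of the dilogarithm series leaves a leading
  coefficient that need not be a unit.\<close>

lemma lau_saturated:
  assumes "skew Q" "r \<noteq> 0" "lau Q j (scl r f)" "keys f \<subseteq> Lat_tilde Q"
  shows "lau Q j f"
proof -
  let ?Q = "mutate Q j"
  have Q': "skew ?Q" by (rule mutate_skew[OF assms(1)])
  obtain N where N: "bnd Q j N f" using bnd_ex by blast
  then have N': "bnd Q j N (scl r f)" using keys_scl[of r f] by (auto simp: bnd_def)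
  obtain h where h: "keys h \<subseteq> Lat_tilde ?Q" "NF Q j N (scl r f) = qt_mult ?Q h (DN ?Q j N)"
    using assms lau_iff[OF assms(1) N'] by blast
  obtain g where g: "h = scl r g" "keys g \<subseteq> keys h"
    by (rule gauss_lemma[OF lookup_pr_0[OF Q'] keys_pr h(2)[symmetric, unfolded NF_scl]])
  have "scl r (NF Q j N f) = scl r (qt_mult ?Q g (DN ?Q j N))"
    using h(2) by (simp add: NF_scl g(1) scl_qt_mult)
  then have "NF Q j N f = qt_mult ?Q g (DN ?Q j N)"
    using assms(2) by (simp add: scl_cancel)
  then show ?thesis
    using assms(4) g(2) h(1) by (intro lauI[OF assms(1) N, of g]) auto
qed

lemma lau_map:
  assumes "lat_iso Q1 Q2 \<nu> \<nu>'" "\<nu> (ebas j) = ebas j'" "lau Q1 j f"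
  shows "lau Q2 j' (lat_map \<nu> f)"
proof -
  interpret lat_iso Q1 Q2 \<nu> \<nu>' by fact
  interpret M: lat_iso "mutate Q1 j" "mutate Q2 j'" "\<lambda>v. mu_lat Q2 j' (\<nu> (mu_lat Q1 j v))" "\<lambda>v. mu_lat Q1 j (\<nu>' (mu_lat Q2 j' v))"
    by (rule mutated(1)[OF assms(2)])
  show ?thesis
    using assms(3) qmut_map[OF assms(2)] map_closed M.map_closed unfolding lau_def by blast
qed

text \<open>
  Up to the common factor \<open>\<Prod>\<^sub>l (q\<^sup>2\<^sup>l - 1)\<close>, the numbers \<open>psi_coeff I i\<close> are the first \<open>I\<close>
  coefficients of the series \<open>\<Psi>\<^sub>q(Y)\<close>, which is characterised by \<open>\<Psi>\<^sub>q(q\<^sup>2 Y) = (1 + q Y) \<Psi>\<^sub>q(Y)\<close>.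
\<close>

definition psi_coeff :: "nat \<Rightarrow> nat \<Rightarrow> qlaurent" where
  "psi_coeff I i = qpow (of_nat i) * (\<Prod>l\<in>{Suc i..I}. qpow (2 * of_nat l) - 1)"

lemma qpow_of_nat_add: "qpow (of_nat a + of_nat b) = qpow (of_nat a) * qpow (of_nat b)"
  by (rule qpow_add) auto

lemma qpow_Ints_add: "r \<in> \<int> \<Longrightarrow> s \<in> \<int> \<Longrightarrow> qpow (r + s) = qpow r * qpow s"
  by (rule qpow_add) auto

lemma psi_coeff_Suc:
  assumes "i < I"
  shows "psi_coeff I (Suc i) * (qpow (2 * of_nat (Suc i)) - 1) = qpow 1 * psi_coeff I i"
proof -
  have "{Suc i..I} = insert (Suc i) {Suc (Suc i)..I}" using assms by auto
  moreover have "qpow (of_nat (Suc i)) = qpow 1 * qpow (of_nat i)"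
    using qpow_of_nat_add[of 1 i] by simp
  ultimately show ?thesis
    by (simp add: psi_coeff_def mult_ac)
qed

lemma psi_coeff_0: "psi_coeff I 0 \<noteq> 0"
proof -
  have "qpow (2 * of_nat l) - 1 \<noteq> 0" if "l \<noteq> 0" for l
  proof -
    have "qpow (2 * of_nat l) = single (4 * int l) 1"
      by (simp add: qpow_def) (metis floor_of_int of_int_mult of_int_numeral of_int_of_nat_eq)
    moreover have "single (4 * int l) 1 \<noteq> single 0 (1::int)"
      using that by (metis lookup_single_eq lookup_single_not_eq mult_eq_0_iff of_nat_eq_0_iff zero_neq_numeral zero_neq_one)
    ultimately show ?thesis by (simp only: single_one right_minus_eq not_False_eq_True)
  qed
  then show ?thesis by (simp add: psi_coeff_def)
qed

text \<open>The series of \<open>\<Psi>\<^sub>q(q\<^sup>t Y\<^sub>k)\<close>, cleared of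
  denominators and cut off after degree \<open>I\<close>.\<close>

definition psi_poly :: "7 \<Rightarrow> nat \<Rightarrow> int \<Rightarrow> qtorus" where
  "psi_poly k I t = (\<Sum>i\<le>I. scl (psi_coeff I i * qpow (of_int (t * int i))) (Y (of_nat i *s ebas k)))"

definition high :: "7 \<Rightarrow> nat \<Rightarrow> qtorus \<Rightarrow> bool" where
  "high k I f \<longleftrightarrow> keys f \<subseteq> {of_nat i *s ebas k |i. I < i}"

lemma high_add: "high k I f \<Longrightarrow> high k I g \<Longrightarrow> high k I (f + g)"
  using keys_add[of f g] unfolding high_def by blast

lemma high_diff: "high k I f \<Longrightarrow> high k I g \<Longrightarrow> high k I (f - g)"
  using keys_diff[of f g] unfolding high_def by blast

lemma high_mult:
  assumes "keys p \<subseteq> {of_nat i *s ebas k |i. True}" "high k I f"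
  shows "high k I (qt_mult Q p f)"
proof -
  have "v \<in> {of_nat i *s ebas k |i. I < i}" if "v \<in> keys (qt_mult Q p f)" for v
  proof -
    obtain x y where xy: "x \<in> keys p" "y \<in> keys f" "v = x + y"
      using \<open>v \<in> _\<close> keys_qt_mult[of Q p f] by auto
    obtain a where a: "x = of_nat a *s ebas k" using xy(1) assms(1) by blast
    obtain b where b: "y = of_nat b *s ebas k" "I < b" using xy(2) assms(2) unfolding high_def by blast
    have "v = of_nat (a + b) *s ebas k" "I < a + b"
      using xy(3) a b by (simp_all add: vector_sadd_rdistrib)
    then show ?thesis by blast
  qed
  then show ?thesis unfolding high_def by blast
qed

lemma keys_psi_poly: "keys (psi_poly k I t) \<subseteq> {of_nat i *s ebas k |i. True}"
  unfolding psi_poly_def using keys_scl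
  by (intro order.trans[OF keys_sum] UN_least order.trans[OF keys_scl]) auto

lemma keys_psi_poly_line: "keys (psi_poly k I t) \<subseteq> line k"
  and keys_psi_poly_tilde [simp]: "keys (psi_poly k I t) \<subseteq> Lat_tilde Q"
  by (rule order.trans[OF keys_psi_poly], rule nonneg_line_subset)+

text \<open>The functional equation of \<open>\<Psi>\<^sub>q\<close> holds in all degrees up to
  \<open>I\<close>. The only error is the top coefficient times Y_k, which sits in degree I +
  1.\<close>

lemma psi_poly_step:
  assumes "skew Q"
  shows "high k I (qt_mult Q (lf k (t + 1)) (psi_poly k I t) - psi_poly k I (t + 2))"
proof -
  define A where "A i = scl (psi_coeff I i * qpow (of_int (t * int i))) (Y (of_nat i *s ebas k))" for i
  define B where "B i = scl (qpow (of_int (t + 1)) * psi_coeff I i * qpow (of_int (t * int i))) (Y (of_nat (Suc i) *s ebas k))" for i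
  define C where "C i = scl (psi_coeff I i * qpow (of_int ((t + 2) * int i))) (Y (of_nat i *s ebas k))" for i
  have AB: "C (Suc i) = A (Suc i) + B i" if "i < I" for i
  proof -
    have "psi_coeff I (Suc i) * qpow (2 * of_nat (Suc i)) = psi_coeff I (Suc i) + qpow 1 * psi_coeff I i"
      using psi_coeff_Suc[OF that] by (simp add: algebra_simps)
    moreover have "qpow (of_int ((t + 2) * int (Suc i))) = qpow (2 * of_nat (Suc i)) * qpow (of_int (t * int (Suc i)))"
      by (subst qpow_Ints_add[symmetric]) (auto simp: algebra_simps)
    moreover have "qpow 1 * qpow (of_int (t * int (Suc i))) = qpow (of_int (t + 1)) * qpow (of_int (t * int i))"
      by (subst (1 2) qpow_Ints_add[symmetric]) (auto simp: algebra_simps)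
    ultimately have "psi_coeff I (Suc i) * qpow (of_int ((t + 2) * int (Suc i))) =
      psi_coeff I (Suc i) * qpow (of_int (t * int (Suc i))) + qpow (of_int (t + 1)) * psi_coeff I i * qpow (of_int (t * int i))"
    proof -
      assume 1: "psi_coeff I (Suc i) * qpow (2 * of_nat (Suc i)) = psi_coeff I (Suc i) + qpow 1 * psi_coeff I i"
        and 2: "qpow (of_int ((t + 2) * int (Suc i))) = qpow (2 * of_nat (Suc i)) * qpow (of_int (t * int (Suc i)))"
        and 3: "qpow 1 * qpow (of_int (t * int (Suc i))) = qpow (of_int (t + 1)) * qpow (of_int (t * int i))"
      have "psi_coeff I (Suc i) * qpow (of_int ((t + 2) * int (Suc i))) =
        (psi_coeff I (Suc i) + qpow 1 * psi_coeff I i) * qpow (of_int (t * int (Suc i)))"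
        unfolding 2 by (simp only: mult.assoc[symmetric] 1)
      also have "\<dots> = psi_coeff I (Suc i) * qpow (of_int (t * int (Suc i))) +
         psi_coeff I i * (qpow 1 * qpow (of_int (t * int (Suc i))))"
        by (simp only: distrib_right mult.assoc mult.left_commute)
      also have "\<dots> = psi_coeff I (Suc i) * qpow (of_int (t * int (Suc i))) + qpow (of_int (t + 1)) * psi_coeff I i * qpow (of_int (t * int i))"
        unfolding 3 by (simp only: mult.assoc mult.left_commute)
      finally show ?thesis .
    qed
    then show ?thesis
      unfolding A_def B_def C_def by (simp only: scl_add_left)
  qed
  have "qt_mult Q (lf k (t + 1)) (psi_poly k I t) = (\<Sum>i\<le>I. A i) + (\<Sum>i\<le>I. B i)"
  proof -
    have "qt_mult Q (Y (ebas k)) (Y (of_nat i *s ebas k)) = Y (of_nat (Suc i) *s ebas k)" for i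
      using form_line[OF assms, of "ebas k" k "of_nat i *s ebas k"]
      by (simp add: line_memI vector_sadd_rdistrib)
    then have "qt_mult Q (scl (qpow (of_int (t + 1))) (Y (ebas k))) (A i) = B i" for i
      unfolding A_def B_def by (simp only: scl_qt_mult scl_scl mult_ac)
    then show ?thesis
      unfolding psi_poly_def lf_def A_def[symmetric] qt_mult_add_left by (simp add: qt_mult_sum_right)
  qed
  moreover have "(\<Sum>i\<le>I. C i) = (\<Sum>i\<le>I. A i) + (\<Sum>i<I. B i)"
  proof -
    have "C 0 = A 0" by (simp add: A_def C_def)
    then show ?thesis
      using AB by (simp add: lessThan_Suc_atMost[symmetric] sum.lessThan_Suc_shift sum.distrib del: sum.lessThan_Suc)
  qed
  moreover have "(\<Sum>i\<le>I. B i) = (\<Sum>i<I. B i) + B I"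
    by (simp flip: lessThan_Suc_atMost)
  ultimately have e: "qt_mult Q (lf k (t + 1)) (psi_poly k I t) - psi_poly k I (t + 2) = B I"
    by (simp add: psi_poly_def C_def)
  have "high k I (B I)"
    unfolding high_def B_def by (rule keys_scl_subset, unfold keys_Y) blast
  then show ?thesis
    unfolding e .
qed

lemma psi_poly_steps:
  assumes "skew Q"
  shows "high k I (qt_mult Q (pr Q k t n) (psi_poly k I t) - psi_poly k I (t + 2 * int n))"
proof (induction n)
  case 0
  then show ?case by (simp add: high_def)
next
  case (Suc n)
  let ?l = "lf k (t + 2 * int n + 1)"
  have "qt_mult Q (pr Q k t (Suc n)) (psi_poly k I t) = qt_mult Q (qt_mult Q ?l (pr Q k t n)) (psi_poly k I t)"
    by (simp only: pr.simps line_commute[OF assms keys_pr_line keys_lf_line])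
  also have "\<dots> = qt_mult Q ?l (qt_mult Q (pr Q k t n) (psi_poly k I t))"
    by (rule qt_mult_assoc) simp_all
  finally have "qt_mult Q (pr Q k t (Suc n)) (psi_poly k I t) - psi_poly k I (t + 2 * int (Suc n)) =
     qt_mult Q ?l (qt_mult Q (pr Q k t n) (psi_poly k I t) - psi_poly k I (t + 2 * int n)) +
     (qt_mult Q ?l (psi_poly k I (t + 2 * int n)) - psi_poly k I (t + 2 * int n + 2))"
    by (simp add: qt_mult_diff algebra_simps)
  then show ?case
    using high_add[OF high_mult[OF keys_lf Suc] psi_poly_step[OF assms, of k I "t + 2 * int n"]] by simp
qed

lemma psi_poly_Y:
  assumes "skew Q" "w \<in> Lat_tilde Q"
  shows "qt_mult Q (psi_poly k I t) (Y w) = qt_mult Q (Y w) (psi_poly k I (t - 2 * dg Q k w))"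
  unfolding psi_poly_def qt_mult_sum_left qt_mult_sum_right
proof (intro sum.cong refl)
  fix i
  have f: "form Q (of_nat i *s ebas k) w = of_int (int i * dg Q k w)"
    "form Q w (of_nat i *s ebas k) = - of_int (int i * dg Q k w)"
    using assms dg_of_int[of w Q k] form_skew[of Q w "ebas k"] by (simp_all add: form_scale_left form_scale_right)
  have "qpow (of_int (t * int i)) * qpow (- of_int (int i * dg Q k w)) =
    qpow (of_int ((t - 2 * dg Q k w) * int i)) * qpow (of_int (int i * dg Q k w))"
    by (subst (1 2) qpow_Ints_add[symmetric]) (auto simp: algebra_simps)
  then show "qt_mult Q (scl (psi_coeff I i * qpow (of_int (t * int i))) (Y (of_nat i *s ebas k))) (Y w) =
    qt_mult Q (Y w) (scl (psi_coeff I i * qpow (of_int ((t - 2 * dg Q k w) * int i))) (Y (of_nat i *s ebas k)))"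
    by (simp only: scl_qt_mult scl_scl qt_mult_Y f minus_minus mult.assoc add.commute[of w])
qed

text \<open>
  This is \<open>g \<Psi>\<^sub>q(Y\<^sub>k) = \<Psi>\<^sub>q(Y\<^sub>k) f\<close> for a truncated series \<open>\<Psi>\<^sub>q\<close>, when \<open>g\<close> is the mutation of \<open>f\<close>
  and the two lattices are identified by \<open>\<mu>\<^sub>k\<close>.
\<close>

lemma psi_intertwine:
  assumes Q: "skew Q" and f: "keys f \<subseteq> Lat_tilde Q" and g: "keys g \<subseteq> Lat_tilde (mutate Q k)"
    and fg: "qmut Q k (to_Frac Q f) = to_Frac (mutate Q k) g"
    and b: "\<And>v. v \<in> keys f \<Longrightarrow> b \<le> mu_lat Q k v $ k"
    and w: "w \<in> keys (qt_mult (mutate Q k) (psi_poly k I 0) (lat_map (mu_lat Q k) f) - qt_mult (mutate Q k) g (psi_poly k I 0))"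
  shows "b + of_nat I < w $ k"
proof -
  let ?Q = "mutate Q k" and ?\<mu> = "mu_lat Q k" and ?X = "psi_poly k I 0"
  have Q': "skew ?Q" by (rule mutate_skew[OF Q])
  interpret \<mu>: lat_iso Q ?Q ?\<mu> ?\<mu> by (rule mu_lat_iso[OF Q])
  obtain N where N: "bnd Q k N f" using bnd_ex by blast
  let ?D = "DN ?Q k N"
  have NF: "NF Q k N f = qt_mult ?Q g ?D"
    using qmut_to_Frac_iff[OF Q f g N] fg by simp
  \<comment> \<open>The defect of the relation, multiplied on the right by the denominator of the
    mutation. In this form it is defined for every \<open>f\<close> and additive, so it can be
    computed on monomials.\<close>
  define W where "W f = qt_mult ?Q (qt_mult ?Q ?X (lat_map ?\<mu> f)) ?D - qt_mult ?Q (NF Q k N f) ?X" for f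
  have single: "x $ k > b + of_nat I"
    if v: "v \<in> Lat_tilde Q" "- dg Q k v \<le> int N" "b \<le> ?\<mu> v $ k" and x: "x \<in> keys (W (single v a))" for v a x
  proof -
    define n where "n = nat (int N + dg Q k v)"
    define u where "u = ?\<mu> v"
    have u: "u \<in> Lat_tilde ?Q" using v \<mu>.tilde by (simp add: u_def)
    have n: "- 2 * dg ?Q k u = - 2 * int N + 2 * int n"
      using v dg_mu[OF Q v(1), of k] by (simp add: n_def u_def)
    define P where "P = pr ?Q k (- 2 * int N) n"
    define X' where "X' = psi_poly k I (- 2 * int N)"
    define h1 where "h1 = qt_mult ?Q P X' - psi_poly k I (- 2 * int N + 2 * int n)"
    define h2 where "h2 = qt_mult ?Q ?D X' - ?X"
    have h: "high k I h1" "high k I h2"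
      using psi_poly_steps[OF Q', of k I "- 2 * int N" n] psi_poly_steps[OF Q', of k I "- 2 * int N" N]
      by (simp_all add: h1_def h2_def P_def X'_def)
    have kk: "keys P \<subseteq> line k" "keys X' \<subseteq> line k" "keys ?D \<subseteq> line k" "keys ?X \<subseteq> line k"
      "keys P \<subseteq> Lat_tilde ?Q" "keys X' \<subseteq> Lat_tilde ?Q" "keys ?D \<subseteq> Lat_tilde ?Q" "keys ?X \<subseteq> Lat_tilde ?Q"
      by (simp_all add: P_def X'_def keys_pr_line keys_psi_poly_line)
    have "qt_mult ?Q ?X (Y u) = qt_mult ?Q (Y u) (qt_mult ?Q P X' - h1)"
      using psi_poly_Y[OF Q' u, of k I 0] n by (simp add: h1_def)
    then have "qt_mult ?Q (qt_mult ?Q ?X (Y u)) ?D = qt_mult ?Q (Y u) (qt_mult ?Q (qt_mult ?Q P X') ?D - qt_mult ?Q h1 ?D)"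
      using u kk h(1) by (simp add: qt_mult_diff qt_mult_assoc torus_mult_closed h1_def)
    moreover have "qt_mult ?Q (qt_mult ?Q P X') ?D = qt_mult ?Q P (qt_mult ?Q ?D X')"
      using kk line_commute[OF Q' kk(2,3)] by (simp add: qt_mult_assoc)
    moreover have "qt_mult ?Q ?D X' = ?X + h2" by (simp add: h2_def)
    moreover have "qt_mult ?Q h1 ?D = qt_mult ?Q ?D h1"
      using h(1) nonneg_line_subset(1)[of k] by (intro line_commute[OF Q' _ kk(3)]) (auto simp: high_def)
    ultimately have "qt_mult ?Q (qt_mult ?Q ?X (Y u)) ?D - qt_mult ?Q (qt_mult ?Q (Y u) P) ?X =
      qt_mult ?Q (Y u) (qt_mult ?Q P h2 - qt_mult ?Q ?D h1)"
      using u kk by (simp add: qt_mult_add_right qt_mult_diff qt_mult_assoc)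
    moreover have "W (single v a) = scl a (qt_mult ?Q (qt_mult ?Q ?X (Y u)) ?D - qt_mult ?Q (qt_mult ?Q (Y u) P) ?X)"
      by (simp add: W_def NF_scl NF_Y lat_map_scl scl_qt_mult scl_diff P_def u_def n_def flip: scl_Y)
    moreover have hh: "high k I (qt_mult ?Q P h2 - qt_mult ?Q ?D h1)"
      using h keys_pr by (intro high_diff high_mult) (auto simp: P_def)
    ultimately have "x \<in> keys (qt_mult ?Q (Y u) (qt_mult ?Q P h2 - qt_mult ?Q ?D h1))"
      using x keys_scl[of a] by (metis (no_types, lifting) subsetD)
    then obtain y where y: "y \<in> keys (qt_mult ?Q P h2 - qt_mult ?Q ?D h1)" "x = u + y"
      using keys_qt_mult by fastforce
    then obtain i where i: "y = of_nat i *s ebas k" "I < i"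
      using hh unfolding high_def by blast
    then have "x $ k = u $ k + of_nat i" using y by simp
    then show ?thesis using v(3) i(2) by (simp add: u_def add_le_less_mono)
  qed
  have W_add: "W (f + g) = W f + W g" for f g
    by (simp add: W_def lat_map_add NF_add qt_mult_add_left qt_mult_add_right)
  have Wkeys: "keys (W f) \<subseteq> {x. b + of_nat I < x $ k}"
    if "keys f \<subseteq> {v \<in> Lat_tilde Q. - dg Q k v \<le> int N \<and> b \<le> ?\<mu> v $ k}" for f
    using that
  proof (induction f rule: pm_induct_keys)
    case zero
    then show ?case by (simp add: W_def)
  next
    case (add f g)
    then show ?case unfolding W_add by (intro torus_add_closed)
  qed (use single in auto)
  have fk: "keys f \<subseteq> {v \<in> Lat_tilde Q. - dg Q k v \<le> int N \<and> b \<le> ?\<mu> v $ k}"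
    using f N b by (auto simp: bnd_def)
  define V where "V = qt_mult ?Q ?X (lat_map ?\<mu> f) - qt_mult ?Q g ?X"
  have VD: "qt_mult ?Q V ?D = W f"
  proof -
    have "qt_mult ?Q ?X ?D = qt_mult ?Q ?D ?X"
      by (rule line_commute[OF Q' keys_psi_poly_line keys_pr_line])
    then show ?thesis
      using g \<mu>.map_closed[OF f] by (simp add: V_def W_def NF qt_mult_diff qt_mult_assoc)
  qed
  \<comment> \<open>The denominator has constant term 1, so a lowest weight of \<open>V\<close>
    survives in V D. The bound for \<open>W f\<close> therefore applies to \<open>V\<close>.\<close>
  have "keys V \<noteq> {}" using w by (auto simp: V_def)
  then obtain m where m: "m \<in> keys V" "\<And>w. w \<in> keys V \<Longrightarrow> m $ k \<le> w $ k"
    using min_coordinate[OF finite_keys] by blast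
  obtain c where c: "lookup (qt_mult ?Q V ?D) m = lookup V m +
      (\<Sum>y\<in>keys ?D - {0}. c y * lookup V (m - y))"
    "\<And>y. y \<in> keys ?D - {0} \<Longrightarrow> (m - y) $ k < m $ k"
    by (rule lookup_mult_min[where p = ?D and k = k and h = V and v = m and Q = ?Q, OF lookup_pr_0[OF Q'] keys_pr]) blast
  have "lookup V (m - y) = 0" if "y \<in> keys ?D - {0}" for y
    using c(2)[OF that] m(2)[of "m - y"] by (auto simp: in_keys_iff)
  then have "lookup (qt_mult ?Q V ?D) m = lookup V m"
    unfolding c(1) by simp
  then have "m \<in> keys (W f)"
    using m(1) unfolding VD[symmetric] in_keys_iff by simp
  then have "b + of_nat I < m $ k" using Wkeys[OF fk] by blast
  also have "m $ k \<le> w $ k" using m(2) w by (simp add: V_def)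
  finally show ?thesis .
qed

text \<open>A triangular system with coefficients \<open>p\<^sub>i\<close> is solved for \<open>A\<close>, slice by slice in the \<open>k\<close>-th coordinate.\<close>

lemma lau_triangular:
  assumes Q: "skew Q" and jk: "j \<noteq> k" and A: "keys A \<subseteq> Lat_tilde Q"
    and M0: "\<And>f. M 0 f = f"
    and M: "\<And>i f c. cpart k c (M i f) = M i (cpart k (c - of_nat i) f)"
    and Ml: "\<And>i f. lau Q j f \<Longrightarrow> lau Q j (M i f)"
    and ex: "\<And>c. \<exists>I p B. p 0 \<noteq> 0 \<and> lau Q j B \<and> cpart k c (\<Sum>i\<le>I. scl (p i) (M i A)) = cpart k c B"
  shows "lau Q j A"
proof -
  obtain b where b: "\<And>v. v \<in> keys A \<Longrightarrow> b \<le> v $ k"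
  proof (cases "keys A = {}")
    case False
    then show ?thesis using min_coordinate[OF finite_keys False] that by blast
  qed auto
  \<comment> \<open>Since \<open>M i\<close> raises the coordinate by i, the slice at c is tied only
    to slices at c - 1, c - 2, and so on; below the bound \<open>b\<close> all slices
    vanish.\<close>
  have "\<forall>c < b + of_nat n. lau Q j (cpart k c A)" for n
  proof (induction n)
    case 0
    have "cpart k c A = 0" if "c < b" for c
    proof -
      have "keys (cpart k c A) = {}" using b that by (force simp: keys_cpart)
      then show ?thesis by simp
    qed
    then show ?case using lau_zero[OF Q] by simp
  next
    case (Suc n)
    show ?case
    proof (intro allI impI)
      fix c assume c: "c < b + of_nat (Suc n)"
      obtain I p B where IB: "p 0 \<noteq> 0" "lau Q j B" "cpart k c (\<Sum>i\<le>I. scl (p i) (M i A)) = cpart k c B"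
        using ex[of c] by blast
      have "cpart k c B = (\<Sum>i\<le>I. scl (p i) (M i (cpart k (c - of_nat i) A)))"
        unfolding IB(3)[symmetric] cpart_sum cpart_scl M ..
      also have "\<dots> = scl (p 0) (cpart k c A) + (\<Sum>i\<in>{1..I}. scl (p i) (M i (cpart k (c - of_nat i) A)))"
        by (simp add: sum.atMost_shift M0 sum.atLeast1_atMost_eq)
      finally have "scl (p 0) (cpart k c A) = cpart k c B - (\<Sum>i\<in>{1..I}. scl (p i) (M i (cpart k (c - of_nat i) A)))"
        by simp
      moreover have terms: "lau Q j (scl (p i) (M i (cpart k (c - of_nat i) A)))" if "i \<in> {1..I}" for i
      proof -
        have "(1::rat) \<le> of_nat i" using that by simp
        then have "c - of_nat i < b + of_nat n" using c by simp
        then show ?thesis using Suc Ml lau_scl[OF Q] by blast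
      qed
      ultimately have "lau Q j (scl (p 0) (cpart k c A))"
        using lau_diff[OF Q lau_cpart[OF Q IB(2) jk, of c] lau_sum[OF Q terms]] by (simp only:)
      moreover have "keys (cpart k c A) \<subseteq> Lat_tilde Q" using A by (auto simp: keys_cpart)
      ultimately show "lau Q j (cpart k c A)"
        using lau_saturated[OF Q IB(1)] by blast
    qed
  qed
  moreover have "\<exists>n. c < b + of_nat n" for c
    using reals_Archimedean2[of "c - b"] by (auto simp: algebra_simps)
  ultimately have "lau Q j (cpart k c A)" for c by blast
  then have "lau Q j (\<Sum>c\<in>(\<lambda>v. v $ k) ` keys A. cpart k c A)"
    by (rule lau_sum[OF Q])
  then show ?thesis by (simp add: sum_cpart)
qed

text \<open>The sign condition serves twice. It makes \<open>mu_lat Q k\<close> fix e_j, so that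
  Laurentness at j passes from \<open>f\<close> to its image \<open>F\<close>; and it gives the
  powers of Y_k nonnegative degree in direction j of the mutated quiver, so that the truncated
  dilogarithm is Laurent there. The relation g Psi = Psi F can then be solved for either of
  \<open>F\<close> and \<open>g\<close>.\<close>

lemma lau_mutate_iff:
  assumes Q: "skew Q" and jk: "j \<noteq> k" "Q j k \<le> 0"
    and f: "keys f \<subseteq> Lat_tilde Q" and g: "keys g \<subseteq> Lat_tilde (mutate Q k)"
    and fg: "qmut Q k (to_Frac Q f) = to_Frac (mutate Q k) g"
  shows "lau Q j f \<longleftrightarrow> lau (mutate Q k) j g"
proof -
  let ?Q = "mutate Q k" and ?\<mu> = "mu_lat Q k"
  have Q': "skew ?Q" by (rule mutate_skew[OF Q])
  interpret \<mu>: lat_iso Q ?Q ?\<mu> ?\<mu> by (rule mu_lat_iso[OF Q])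
  define F where "F = lat_map ?\<mu> f"
  have F: "keys F \<subseteq> Lat_tilde ?Q" unfolding F_def by (rule \<mu>.map_closed[OF f])
  have ej: "?\<mu> (ebas j) = ebas j" using mu_lat_ebas(2)[OF jk(1), of Q] jk(2) by simp
  have fF: "lau Q j f \<longleftrightarrow> lau ?Q j F"
    using lau_map[OF \<mu>.lat_iso_axioms ej, of f] lau_map[OF \<mu>.inverse ej, of F] \<mu>.map_inv[of f]
    by (auto simp: F_def)
  have Yi: "lau ?Q j (Y (of_nat i *s ebas k))" for i
  proof (rule lau_Y[OF Q'])
    show "of_nat i *s ebas k \<in> Lat_tilde ?Q" using nonneg_line_subset(3)[of k ?Q] by blast
    have sk: "Q a b = - Q b a" for a b using skewD[OF Q] .
    have "form ?Q (ebas j) (of_nat i *s ebas k) = of_int (- int i * Q j k)"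
      unfolding form_scale_right unfolding ebas_def form_axis using mutate_eq[of Q k, OF sk] by simp
    then have "dg ?Q j (of_nat i *s ebas k) = - int i * Q j k" by (rule dg_eqI)
    then show "0 \<le> dg ?Q j (of_nat i *s ebas k)" using jk(2) by (simp add: mult_nonneg_nonpos)
  qed
  have X: "lau ?Q j (psi_poly k I 0)" for I
    unfolding psi_poly_def by (intro lau_sum[OF Q'] lau_scl[OF Q'] Yi)
  obtain b where b: "\<And>v. v \<in> keys f \<Longrightarrow> b \<le> ?\<mu> v $ k"
  proof (cases "keys f = {}")
    case False
    then have "finite (?\<mu> ` keys f)" "?\<mu> ` keys f \<noteq> {}" by auto
    from min_coordinate[OF this, of k] obtain m where "\<And>w. w \<in> ?\<mu> ` keys f \<Longrightarrow> m $ k \<le> w $ k" by blast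
    then show ?thesis using that[of "m $ k"] by blast
  qed auto
  have part: "\<exists>I. cpart k c (qt_mult ?Q (psi_poly k I 0) F) = cpart k c (qt_mult ?Q g (psi_poly k I 0))" for c
  proof -
    \<comment> \<open>The truncation is taken so long that the error in
      \<open>psi_intertwine\<close> lies above the slice at c.\<close>
    obtain I where I: "c < of_nat I + b" using reals_Archimedean2[of "c - b"] by (auto simp: algebra_simps)
    let ?V = "qt_mult ?Q (psi_poly k I 0) F - qt_mult ?Q g (psi_poly k I 0)"
    have "cpart k c ?V = 0"
    proof -
      have "w $ k \<noteq> c" if "w \<in> keys ?V" for w
        using psi_intertwine[OF Q f g fg b, of w I] that I by (fastforce simp: F_def)
      then have "keys (cpart k c ?V) = {}" by (auto simp: keys_cpart)
      then show ?thesis by simp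
    qed
    moreover have "qt_mult ?Q (psi_poly k I 0) F = ?V + qt_mult ?Q g (psi_poly k I 0)" by simp
    ultimately have "cpart k c (qt_mult ?Q (psi_poly k I 0) F) = cpart k c (qt_mult ?Q g (psi_poly k I 0))"
      by (metis add_0 cpart_add)
    then show ?thesis by blast
  qed
  have ki: "keys (Y (of_nat i *s ebas k)) \<subseteq> {v. v $ k = of_nat i}" for i by simp
  have "lau ?Q j F \<longleftrightarrow> lau ?Q j g"
  proof
    assume "lau ?Q j F"
    show "lau ?Q j g"
    proof (rule lau_triangular[OF Q' jk(1) g, where M = "\<lambda>i f. qt_mult ?Q f (Y (of_nat i *s ebas k))"])
      fix c
      obtain I where I: "cpart k c (qt_mult ?Q (psi_poly k I 0) F) = cpart k c (qt_mult ?Q g (psi_poly k I 0))"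
        using part by blast
      have "qt_mult ?Q g (psi_poly k I 0) = (\<Sum>i\<le>I. scl (psi_coeff I i) (qt_mult ?Q g (Y (of_nat i *s ebas k))))"
        by (simp add: psi_poly_def qt_mult_sum_right scl_qt_mult)
      then show "\<exists>I p B. p 0 \<noteq> 0 \<and> lau ?Q j B \<and>
        cpart k c (\<Sum>i\<le>I. scl (p i) (qt_mult ?Q g (Y (of_nat i *s ebas k)))) = cpart k c B"
        by (intro exI[of _ I] exI[of _ "psi_coeff I"] exI[of _ "qt_mult ?Q (psi_poly k I 0) F"] conjI
            psi_coeff_0 lau_mult[OF Q' X \<open>lau ?Q j F\<close>]) (simp only: I)
    qed (use cpart_mult_right[OF ki] lau_mult[OF Q' _ Yi] in auto)
  next
    assume "lau ?Q j g"
    show "lau ?Q j F"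
    proof (rule lau_triangular[OF Q' jk(1) F, where M = "\<lambda>i f. qt_mult ?Q (Y (of_nat i *s ebas k)) f"])
      fix c
      obtain I where I: "cpart k c (qt_mult ?Q (psi_poly k I 0) F) = cpart k c (qt_mult ?Q g (psi_poly k I 0))"
        using part by blast
      have "qt_mult ?Q (psi_poly k I 0) F = (\<Sum>i\<le>I. scl (psi_coeff I i) (qt_mult ?Q (Y (of_nat i *s ebas k)) F))"
        by (simp add: psi_poly_def qt_mult_sum_left scl_qt_mult)
      then show "\<exists>I p B. p 0 \<noteq> 0 \<and> lau ?Q j B \<and>
        cpart k c (\<Sum>i\<le>I. scl (p i) (qt_mult ?Q (Y (of_nat i *s ebas k)) F)) = cpart k c B"
        by (intro exI[of _ I] exI[of _ "psi_coeff I"] exI[of _ "qt_mult ?Q g (psi_poly k I 0)"] conjI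
            psi_coeff_0 lau_mult[OF Q' \<open>lau ?Q j g\<close> X]) (simp only: I[symmetric])
    qed (use cpart_mult_left[OF ki] lau_mult[OF Q' Yi] in auto)
  qed
  with fF show ?thesis by simp
qed

definition uni :: "quiver \<Rightarrow> qtorus \<Rightarrow> bool" where
  "uni Q f \<longleftrightarrow> (\<forall>j. lau Q j f)"

lemma uni_keys: "uni Q f \<Longrightarrow> keys f \<subseteq> Lat_tilde Q"
  using lau_keys by (auto simp: uni_def)

lemma uni_mutate:
  assumes Q: "skew Q" and f: "uni Q f"
  obtains g where "uni (mutate Q k) g" "qmut Q k (to_Frac Q f) = to_Frac (mutate Q k) g"
proof -
  let ?Q = "mutate Q k"
  have Q': "skew ?Q" by (rule mutate_skew[OF Q])
  have fk: "keys f \<subseteq> Lat_tilde Q" by (rule uni_keys[OF f])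
  obtain g where g: "keys g \<subseteq> Lat_tilde ?Q" "qmut Q k (to_Frac Q f) = to_Frac ?Q g"
    using f unfolding uni_def lau_def by blast
  have gf: "qmut ?Q k (to_Frac ?Q g) = to_Frac (mutate ?Q k) f"
    using qmut_involution[OF Q to_Frac_closed[OF fk], of k] g(2) by (simp add: mutate_mutate[OF Q])
  have fk': "keys f \<subseteq> Lat_tilde (mutate ?Q k)" using fk by (simp add: mutate_mutate[OF Q])
  have "lau ?Q j g" for j
  proof (cases "j = k")
    case True
    then show ?thesis using g(1) gf fk' by (auto simp: lau_def)
  next
    case False
    show ?thesis
    proof (cases "Q j k \<le> 0")
      case True
      then show ?thesis using lau_mutate_iff[OF Q False True fk g] f by (simp add: uni_def)
    next
      \<comment> \<open>Mutation reverses the arrows at k, so the sign condition holds for the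
        mutated quiver and the equivalence is applied to the mutation back.\<close>
      case 2: False
      have sk: "Q a b = - Q b a" for a b using skewD[OF Q] .
      have "?Q j k \<le> 0" using 2 mutate_eq[of Q k, OF sk] by simp
      from lau_mutate_iff[OF Q' False this g(1) fk' gf] f show ?thesis
        by (simp add: uni_def mutate_mutate[OF Q])
    qed
  qed
  then show ?thesis by (intro that[of g]) (simp_all add: uni_def g(2))
qed

text \<open>A universally Laurent element in the sense of \<open>uni\<close> mutates to another one,
  so Laurentness after a single step propagates along every sequence.\<close>

lemma laurent_set_eq:
  assumes "skew Q"
  shows "laurent_set Q = {f. uni Q f}"
proof (intro equalityI subsetI CollectI)
  fix f assume f: "f \<in> laurent_set Q"
  then have k: "f \<in> carrier (torus Q)" by (simp add: laurent_set_def)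
  have "qmut_seq [j] Q (to_Frac Q f) \<in> to_Frac (mutate_seq [j] Q) ` carrier (torus (mutate_seq [j] Q))" for j
    using f unfolding laurent_set_def by blast
  then show "uni Q f"
    using k by (auto simp: uni_def lau_def image_iff)
next
  fix f assume "f \<in> {f. uni Q f}"
  then have f: "uni Q f" by simp
  have "qmut_seq ks Q (to_Frac Q f) \<in> to_Frac (mutate_seq ks Q) ` carrier (torus (mutate_seq ks Q))" for ks
    using assms f
  proof (induction ks arbitrary: Q f)
    case Nil
    then show ?case using uni_keys by auto
  next
    case (Cons k ks)
    obtain g where g: "uni (mutate Q k) g" "qmut Q k (to_Frac Q f) = to_Frac (mutate Q k) g"
      using uni_mutate[OF Cons.prems] .
    from Cons.IH[OF mutate_skew[OF Cons.prems(1)] g(1)] show ?case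
      by (simp add: g(2))
  qed
  then show "f \<in> laurent_set Q"
    using uni_keys[OF f] by (simp add: laurent_set_def)
qed

subsection \<open>Mutation of explicit Laurent polynomials\<close>

text \<open>
  Vectors and matrices are tuples. The tuple \<open>v\<close> stands for the weight \<open>v/2\<close>, and a term \<open>(v, s, c)\<close> for
  \<open>c q\<^sup>s\<^sup>/\<^sup>2 Y\<close> at that weight.
\<close>

type_synonym vec7 = "int \<times> int \<times> int \<times> int \<times> int \<times> int \<times> int"
type_synonym mat7 = "vec7 \<times> vec7 \<times> vec7 \<times> vec7 \<times> vec7 \<times> vec7 \<times> vec7"
type_synonym terms = "(vec7 \<times> int \<times> int) list"

fun nth7 :: "'a \<times> 'a \<times> 'a \<times> 'a \<times> 'a \<times> 'a \<times> 'a \<Rightarrow> nat \<Rightarrow> 'a" where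
  "nth7 (a1, a2, a3, a4, a5, a6, a7) i = (if i = 1 then a1 else if i = 2 then a2 else if i = 3 then a3
     else if i = 4 then a4 else if i = 5 then a5 else if i = 6 then a6 else a7)"

definition mk7 :: "(nat \<Rightarrow> 'a) \<Rightarrow> 'a \<times> 'a \<times> 'a \<times> 'a \<times> 'a \<times> 'a \<times> 'a" where
  "mk7 f = (f 1, f 2, f 3, f 4, f 5, f 6, f 7)"

fun dot7 :: "vec7 \<Rightarrow> vec7 \<Rightarrow> int" where
  "dot7 (a1, a2, a3, a4, a5, a6, a7) (b1, b2, b3, b4, b5, b6, b7) =
     a1 * b1 + a2 * b2 + a3 * b3 + a4 * b4 + a5 * b5 + a6 * b6 + a7 * b7"

fun add7 :: "vec7 \<Rightarrow> vec7 \<Rightarrow> vec7" where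
  "add7 (a1, a2, a3, a4, a5, a6, a7) (b1, b2, b3, b4, b5, b6, b7) =
     (a1 + b1, a2 + b2, a3 + b3, a4 + b4, a5 + b5, a6 + b6, a7 + b7)"

fun mv7 :: "mat7 \<Rightarrow> vec7 \<Rightarrow> vec7" where
  "mv7 (r1, r2, r3, r4, r5, r6, r7) w = (dot7 r1 w, dot7 r2 w, dot7 r3 w, dot7 r4 w, dot7 r5 w, dot7 r6 w, dot7 r7 w)"

definition unit7 :: "nat \<Rightarrow> vec7" where
  "unit7 k = mk7 (\<lambda>i. if i = k then 2 else 0)"

definition mutate7 :: "mat7 \<Rightarrow> nat \<Rightarrow> mat7" where
  "mutate7 M k = (let e = (\<lambda>i j. nth7 (nth7 M i) j) in mk7 (\<lambda>i. mk7 (\<lambda>j. if i = k \<or> j = k then - e i j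
     else e i j + max (e i k) 0 * e k j + max (e j k) 0 * e i k)))"

definition mu7 :: "mat7 \<Rightarrow> nat \<Rightarrow> vec7 \<Rightarrow> vec7" where
  "mu7 M k v = mk7 (\<lambda>i. if i = k
     then dot7 (mk7 (\<lambda>j. if j = k then - 1 else max (nth7 (nth7 M j) k) 0)) v else nth7 v i)"

fun ins :: "vec7 \<times> int \<times> int \<Rightarrow> terms \<Rightarrow> terms" where
  "ins (v, s, c) [] = (if c = 0 then [] else [(v, s, c)])"
| "ins (v, s, c) ((w, r, d) # L) = (if v = w \<and> s = r then (if c + d = 0 then L else (v, s, c + d) # L)
     else (w, r, d) # ins (v, s, c) L)"

fun nrm :: "terms \<Rightarrow> terms" where
  "nrm [] = []"
| "nrm (t # L) = ins t (nrm L)"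

definition scale7 :: "int \<Rightarrow> int \<Rightarrow> terms \<Rightarrow> terms" where
  "scale7 s c L = map (\<lambda>(w, r, d). (w, s + r, c * d)) L"

fun mul7 :: "mat7 \<Rightarrow> terms \<Rightarrow> terms \<Rightarrow> terms" where
  "mul7 M [] g = []"
| "mul7 M ((v, s, c) # f) g = map (\<lambda>(w, r, d). (add7 v w, s + r + (- dot7 v (mv7 M w)) div 2, c * d)) g @ mul7 M f g"

fun pr7 :: "mat7 \<Rightarrow> nat \<Rightarrow> nat \<Rightarrow> terms" where
  "pr7 M k 0 = [(mk7 (\<lambda>_. 0), 0, 1)]"
| "pr7 M k (Suc n) = nrm (mul7 M (pr7 M k n) [(mk7 (\<lambda>_. 0), 0, 1), (unit7 k, 2 * (2 * int n + 1), 1)])"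

definition deg7 :: "mat7 \<Rightarrow> nat \<Rightarrow> vec7 \<Rightarrow> int" where
  "deg7 M k v = dot7 (nth7 M k) v div 2"

definition tilde7 :: "mat7 \<Rightarrow> vec7 \<Rightarrow> bool" where
  "tilde7 M v \<longleftrightarrow> (case mv7 M v of (a1, a2, a3, a4, a5, a6, a7) \<Rightarrow>
     even a1 \<and> even a2 \<and> even a3 \<and> even a4 \<and> even a5 \<and> even a6 \<and> even a7)"

definition mono7 :: "mat7 \<Rightarrow> mat7 \<Rightarrow> nat \<Rightarrow> vec7 \<Rightarrow> terms" where
  "mono7 M M' k v = mul7 M' [(mu7 M k v, 0, 1)] (pr7 M' k (nat (deg7 M k v)))"

text \<open>The lowest bad term is taken as the leading term of the image of a monomial under the
  inverse mutation. That fixes the monomial, and subtracting its image leaves only higher terms in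
  its place.\<close>

fun least7 :: "nat \<Rightarrow> (vec7 \<times> int \<times> int) \<Rightarrow> terms \<Rightarrow> vec7 \<times> int \<times> int" where
  "least7 k t [] = t"
| "least7 k t (u # L) = least7 k (if nth7 (fst u) k < nth7 (fst t) k then u else t) L"

text \<open>
  The terms in \<open>bad\<close> are those whose images have a denominator. They are combined into images of
  monomials under the inverse mutation.
\<close>

primrec reduce7 :: "nat \<Rightarrow> mat7 \<Rightarrow> mat7 \<Rightarrow> nat \<Rightarrow> terms \<Rightarrow> terms \<Rightarrow> terms option" where
  "reduce7 0 M M' k bad acc = (if bad = [] then Some (nrm acc) else None)"
| "reduce7 (Suc n) M M' k bad acc = (if bad = [] then Some (nrm acc) else
     let t = least7 k (hd bad) (tl bad); w = mu7 M' k (fst t) in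
     if tilde7 M' w \<and> 0 \<le> deg7 M' k w
     then reduce7 n M M' k (nrm (scale7 (fst (snd t)) (- snd (snd t)) (mono7 M' M k w) @ bad))
       ((w, fst (snd t), snd (snd t)) # acc)
     else None)"

text \<open>The fuel 20 only limits the search: exhaustion yields \<open>None\<close>, which can
  make a check fail but never validates a wrong result.\<close>

definition mut7 :: "mat7 \<Rightarrow> nat \<Rightarrow> terms \<Rightarrow> terms option" where
  "mut7 M k f = (let M' = mutate7 M k in
     if list_all (\<lambda>(v, s, c). tilde7 M v) f
     then reduce7 20 M M' k (filter (\<lambda>(v, s, c). deg7 M k v < 0) f)
       (concat (map (\<lambda>(v, s, c). scale7 s c (mono7 M M' k v)) (filter (\<lambda>(v, s, c). \<not> deg7 M k v < 0) f)))
     else None)"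

fun mut7_seq :: "mat7 \<Rightarrow> nat list \<Rightarrow> terms \<Rightarrow> terms option" where
  "mut7_seq M [] f = Some f"
| "mut7_seq M (k # ks) f = (case mut7 M k f of None \<Rightarrow> None | Some g \<Rightarrow> mut7_seq (mutate7 M k) ks g)"

definition equal7 :: "terms \<Rightarrow> terms \<Rightarrow> bool" where
  "equal7 f g \<longleftrightarrow> nrm (f @ scale7 0 (- 1) g) = []"

text \<open>Coordinates are read off through \<open>p\<close> and not through its inverse; the
  permutations in use are involutions.\<close>

definition perm7 :: "(nat \<Rightarrow> nat) \<Rightarrow> terms \<Rightarrow> terms" where
  "perm7 p f = map (\<lambda>(v, s, c). (mk7 (\<lambda>i. nth7 v (p i)), s, c)) f"

definition X7_mat :: mat7 where
  "X7_mat = ((0, - 2, 0, 0, 0, 0, 1), (2, 0, 0, 0, 0, 0, - 1), (0, 0, 0, - 2, 0, 0, 1), (0, 0, 2, 0, 0, 0, - 1),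
     (0, 0, 0, 0, 0, - 2, 1), (0, 0, 0, 0, 2, 0, - 1), (- 1, 1, - 1, 1, - 1, 1, 0))"

definition LB12 :: terms where
  "LB12 = [((0, 0, 0, 0, - 1, - 1, 0), 0, 1), ((0, 0, 0, 0, - 1, 1, 0), 0, 1), ((0, 0, 0, 0, 1, 1, 0), 0, 1)]"
definition LB13 :: terms where
  "LB13 = [((0, 0, - 1, - 1, 0, 0, 0), 0, 1), ((0, 0, - 1, 1, 0, 0, 0), 0, 1), ((0, 0, 1, 1, 0, 0, 0), 0, 1)]"
definition LB23 :: terms where
  "LB23 = [((- 1, - 1, 0, 0, 0, 0, 0), 0, 1), ((- 1, 1, 0, 0, 0, 0, 0), 0, 1), ((1, 1, 0, 0, 0, 0, 0), 0, 1)]"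

definition one_q7 :: "nat \<Rightarrow> terms" where
  "one_q7 i = [(mk7 (\<lambda>_. 0), 0, 1), (unit7 i, 2, 1)]"

definition LA1 :: terms where
  "LA1 = ((1, 1, 1, 0, 1, 0, 2), 0, 1) # mul7 X7_mat LB23 [((0, 0, 1, 0, 1, 0, 0), 0, 1)] @
     mul7 X7_mat (mul7 X7_mat [((- 1, - 1, - 1, 0, - 1, 0, - 2), 0, 1)] (one_q7 3)) (one_q7 5)"
definition LA2 :: terms where
  "LA2 = ((1, 0, 1, 1, 1, 0, 2), 0, 1) # mul7 X7_mat LB13 [((1, 0, 0, 0, 1, 0, 0), 0, 1)] @
     mul7 X7_mat (mul7 X7_mat [((- 1, 0, - 1, - 1, - 1, 0, - 2), 0, 1)] (one_q7 1)) (one_q7 5)"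
definition LA3 :: terms where
  "LA3 = ((1, 0, 1, 0, 1, 1, 2), 0, 1) # mul7 X7_mat LB12 [((1, 0, 1, 0, 0, 0, 0), 0, 1)] @
     mul7 X7_mat (mul7 X7_mat [((- 1, 0, - 1, 0, - 1, - 1, - 2), 0, 1)] (one_q7 1)) (one_q7 3)"

definition sig7 :: "nat \<Rightarrow> nat" where
  "sig7 i = (if i = 1 then 5 else if i = 5 then 1 else if i = 3 then 7 else if i = 7 then 3 else i)"

definition seq_check :: "(nat \<Rightarrow> nat) \<Rightarrow> nat list \<Rightarrow> terms \<Rightarrow> terms \<Rightarrow> bool" where
  "seq_check p ks f g = (case mut7_seq X7_mat ks f of None \<Rightarrow> False | Some h \<Rightarrow> equal7 (perm7 p h) g)"

definition swap7 :: "nat \<Rightarrow> nat \<Rightarrow> nat \<Rightarrow> nat" where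
  "swap7 a b i = (if i = a then b else if i = b then a else i)"

text \<open>Exponents count powers of q^(1/2), so the left side is (q - q^-1) g and nothing has to
  be divided. The cluster map is applied before inversion, which is why \<open>B\<close> comes first
  in the bracket; in the twist itself the order is the opposite one.\<close>

definition bracket_check :: "(nat \<Rightarrow> nat) \<Rightarrow> nat \<Rightarrow> terms \<Rightarrow> terms \<Rightarrow> bool" where
  "bracket_check p k A B = (case mut7 X7_mat k A of None \<Rightarrow> False | Some h \<Rightarrow> let g = perm7 p h in
     equal7 (scale7 2 1 g @ scale7 (- 2) (- 1) g) (scale7 1 1 (mul7 X7_mat B A) @ scale7 (- 1) (- 1) (mul7 X7_mat A B)))"

text \<open>The monomial Y_(-c). As t acts by -q Y_(-c), fixing this monomial is what makes a
  cluster automorphism linear over t.\<close>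

definition C7 :: terms where
  "C7 = [((- 1, - 1, - 1, - 1, - 1, - 1, - 2), 0, 1)]"

definition C7_inv :: terms where
  "C7_inv = [((1, 1, 1, 1, 1, 1, 2), 0, 1)]"

definition laurent_check :: "terms \<Rightarrow> bool" where
  "laurent_check f = list_all (\<lambda>k. mut7 X7_mat k f \<noteq> None) [1, 2, 3, 4, 5, 6, 7]"

section \<open>The finite computations on the generators\<close>

lemma laurent_checks:
  "laurent_check LB12" "laurent_check LB13" "laurent_check LB23" "laurent_check LA1" "laurent_check LA2" "laurent_check LA3" "laurent_check C7" "laurent_check C7_inv"
  by code_simp+

lemma sigma_checks:
  "seq_check sig7 [3, 7, 1, 5, 3, 7] LB12 LA3"
  "seq_check sig7 [3, 7, 1, 5, 3, 7] LB13 LA2"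
  "seq_check sig7 [3, 7, 1, 5, 3, 7] LB23 LA1"
  "seq_check sig7 [3, 7, 1, 5, 3, 7] LA1 LB23"
  "seq_check sig7 [3, 7, 1, 5, 3, 7] LA2 LB13"
  "seq_check sig7 [3, 7, 1, 5, 3, 7] LA3 LB12"
  "seq_check sig7 [3, 7, 1, 5, 3, 7] C7 C7"
  by code_simp+

lemma twist_LB12_checks:
  "seq_check (swap7 5 6) [5] LB12 LB12"
  "seq_check (swap7 5 6) [5] LB13 LB13"
  "seq_check (swap7 5 6) [5] LB23 LB23"
  "seq_check (swap7 5 6) [5] LA3 LA3"
  "seq_check (swap7 5 6) [5] C7 C7"
  "bracket_check (swap7 5 6) 5 LA1 LB12"
  "bracket_check (swap7 5 6) 5 LA2 LB12"
  by code_simp+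

lemma twist_LB13_checks:
  "seq_check (swap7 3 4) [3] LB12 LB12"
  "seq_check (swap7 3 4) [3] LB13 LB13"
  "seq_check (swap7 3 4) [3] LB23 LB23"
  "seq_check (swap7 3 4) [3] LA2 LA2"
  "seq_check (swap7 3 4) [3] C7 C7"
  "bracket_check (swap7 3 4) 3 LA1 LB13"
  "bracket_check (swap7 3 4) 3 LA3 LB13"
  by code_simp+

lemma twist_LB23_checks:
  "seq_check (swap7 1 2) [1] LB12 LB12"
  "seq_check (swap7 1 2) [1] LB13 LB13"
  "seq_check (swap7 1 2) [1] LB23 LB23"
  "seq_check (swap7 1 2) [1] LA1 LA1"
  "seq_check (swap7 1 2) [1] C7 C7"
  "bracket_check (swap7 1 2) 1 LA2 LB23"
  "bracket_check (swap7 1 2) 1 LA3 LB23"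
  by code_simp+

text \<open>In powers of q^(1/2), the three rescaled copies of \<open>A\<close> add up to (q^2 - 2 +
  q^-2) A = (q - q^-1)^2 A, and the right side is (q + q^-1) BAB.\<close>

definition cubic_check :: "terms \<Rightarrow> terms \<Rightarrow> bool" where
  "cubic_check A B = (let AB = mul7 X7_mat A B; BAB = mul7 X7_mat B AB in
     equal7 (mul7 X7_mat B (mul7 X7_mat B A) @ mul7 X7_mat AB B @ scale7 4 1 A @ scale7 0 (- 2) A @ scale7 (- 4) 1 A)
       (scale7 2 1 BAB @ scale7 (- 2) 1 BAB))"

lemma cubic_checks:
  "cubic_check LA1 LB12" "cubic_check LA2 LB12" "cubic_check LA1 LB13" "cubic_check LA3 LB13" "cubic_check LA2 LB23" "cubic_check LA3 LB23"
  by code_simp+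

lemma quiver_checks:
  "fold (\<lambda>k M. mutate7 M k) [3, 7, 1, 5, 3, 7] X7_mat = mk7 (\<lambda>i. mk7 (\<lambda>j. nth7 (nth7 X7_mat (sig7 i)) (sig7 j)))"
  "fold (\<lambda>k M. mutate7 M k) [5] X7_mat = mk7 (\<lambda>i. mk7 (\<lambda>j. nth7 (nth7 X7_mat (swap7 5 6 i)) (swap7 5 6 j)))"
  "fold (\<lambda>k M. mutate7 M k) [3] X7_mat = mk7 (\<lambda>i. mk7 (\<lambda>j. nth7 (nth7 X7_mat (swap7 3 4 i)) (swap7 3 4 j)))"
  "fold (\<lambda>k M. mutate7 M k) [1] X7_mat = mk7 (\<lambda>i. mk7 (\<lambda>j. nth7 (nth7 X7_mat (swap7 1 2 i)) (swap7 1 2 j)))"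
  by code_simp+

section \<open>From tuples back to the quantum torus\<close>

lemma exhaust_7: "x = 1 \<or> x = 2 \<or> x = 3 \<or> x = 4 \<or> x = 5 \<or> x = 6 \<or> x = (7::7)"
proof (induct x)
  case (of_int z)
  then have "z = 0 \<or> z = 1 \<or> z = 2 \<or> z = 3 \<or> z = 4 \<or> z = 5 \<or> z = 6" by fastforce
  then show ?case by auto
qed

lemma UNIV_7: "UNIV = {1, 2, 3, 4, 5, 6, 7::7}"
  using exhaust_7 by auto

lemma forall_7: "(\<forall>i::7. P i) \<longleftrightarrow> P 1 \<and> P 2 \<and> P 3 \<and> P 4 \<and> P 5 \<and> P 6 \<and> P 7"
  by (metis exhaust_7)

lemma sum_7: "sum f (UNIV::7 set) = f 1 + f 2 + f 3 + f 4 + f 5 + f 6 + f 7"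
  unfolding UNIV_7 by (simp add: add.assoc)

definition idx :: "7 \<Rightarrow> nat" where
  "idx i = (if i = 1 then 1 else if i = 2 then 2 else if i = 3 then 3 else if i = 4 then 4
     else if i = 5 then 5 else if i = 6 then 6 else 7)"

lemma idx_simps [simp]: "idx 1 = 1" "idx 2 = 2" "idx 3 = 3" "idx 4 = 4" "idx 5 = 5" "idx 6 = 6" "idx 7 = 7" "idx 0 = 7"
  by (simp_all add: idx_def)

lemma idx_eq_iff: "idx i = idx j \<longleftrightarrow> i = j"
  using exhaust_7[of i] exhaust_7[of j] by auto

definition wt :: "vec7 \<Rightarrow> weight" where
  "wt v = (\<chi> i. of_int (nth7 v (idx i)) / 2)"

lemma wt_nth [simp]: "wt v $ i = of_int (nth7 v (idx i)) / 2"
  by (simp add: wt_def)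

lemma nth7_mk7 [simp]: "nth7 (mk7 f) (idx i) = f (idx i)"
  using exhaust_7[of i] by (auto simp: mk7_def)

lemma wt_eqI: "(\<And>i. v $ i = of_int (nth7 t (idx i)) / 2) \<Longrightarrow> v = wt t"
  by (simp add: vec_eq_iff)

definition tm :: "vec7 \<times> int \<times> int \<Rightarrow> qtorus" where
  "tm = (\<lambda>(v, s, c). single (wt v) (single s c))"

definition ip :: "terms \<Rightarrow> qtorus" where
  "ip L = sum_list (map tm L)"

lemma ip_simps [simp]: "ip [] = 0" "ip (t # L) = tm t + ip L" "ip (L @ L') = ip L + ip L'"
  by (simp_all add: ip_def)

definition rep :: "quiver \<Rightarrow> mat7 \<Rightarrow> bool" where
  "rep Q M \<longleftrightarrow> (\<forall>i j. Q i j = nth7 (nth7 M (idx i)) (idx j))"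

lemma repD: "rep Q M \<Longrightarrow> Q i j = nth7 (nth7 M (idx i)) (idx j)"
  by (simp add: rep_def)

lemma dot7_sum: "dot7 v w = (\<Sum>i\<in>UNIV. nth7 v (idx i) * nth7 w (idx i))"
  by (cases v; cases w) (simp add: sum_7)

lemma nth7_mv7: "nth7 (mv7 M w) (idx i) = dot7 (nth7 M (idx i)) w"
  using exhaust_7[of i] by (cases M) auto

lemma nth7_add7 [simp]: "nth7 (add7 v w) (idx i) = nth7 v (idx i) + nth7 w (idx i)"
  using exhaust_7[of i] by (cases v; cases w) auto

lemma form_wt:
  assumes "rep Q M"
  shows "form Q (wt v) (wt w) = of_int (dot7 v (mv7 M w)) / 4"
proof -
  have "form Q (wt v) (wt w) = (\<Sum>i\<in>UNIV. \<Sum>j\<in>UNIV. of_int (nth7 (nth7 M (idx i)) (idx j) * nth7 v (idx i) * nth7 w (idx j)) / 4)"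
    unfolding form_def by (intro sum.cong refl) (simp add: repD[OF assms])
  also have "\<dots> = of_int (\<Sum>i\<in>UNIV. nth7 v (idx i) * (\<Sum>j\<in>UNIV. nth7 (nth7 M (idx i)) (idx j) * nth7 w (idx j))) / 4"
    by (simp add: sum_divide_distrib sum_distrib_left mult_ac)
  finally show ?thesis
    by (simp add: dot7_sum[of v] nth7_mv7 dot7_sum[of _ w])
qed

lemma wt_add7: "wt (add7 v w) = wt v + wt w"
  by (simp add: vec_eq_iff add_divide_distrib)

text \<open>The integer division agrees with the floor in \<open>qpow\<close> for every
  \<open>F\<close>, so products of term lists are interpreted correctly without any lattice
  condition.\<close>

lemma qpow_quarter: "qpow (- (of_int F / 4)) = single ((- F) div 2) 1"
proof -
  have "2 * (- (of_int F / 4)) = (of_int (- F) / of_int 2 :: rat)" by simp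
  then show ?thesis
    unfolding qpow_def by (simp only: floor_divide_of_int_eq)
qed

lemma tm_mult:
  assumes "rep Q M"
  shows "qt_mult Q (tm (v, s, c)) (tm (w, r, d)) = tm (add7 v w, s + r + (- dot7 v (mv7 M w)) div 2, c * d)"
  by (simp add: tm_def form_wt[OF assms] qpow_quarter mult_single wt_add7 add_ac)

lemma ip_mul7:
  assumes "rep Q M"
  shows "ip (mul7 M f g) = qt_mult Q (ip f) (ip g)"
proof (induction f)
  case (Cons t f)
  obtain v s c where t: "t = (v, s, c)" by (cases t) auto
  have "ip (map (\<lambda>(w, r, d). (add7 v w, s + r + (- dot7 v (mv7 M w)) div 2, c * d)) g) = qt_mult Q (tm (v, s, c)) (ip g)"
    by (induction g) (auto simp: qt_mult_add_right tm_mult[OF assms])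
  then show ?case
    using Cons by (simp add: t qt_mult_add_left)
qed simp

lemma ip_scale7: "ip (scale7 s c L) = scl (single s c) (ip L)"
  by (induction L) (auto simp: scale7_def tm_def scl_add mult_single)

lemma tm_zero [simp]: "tm (v, s, 0) = 0"
  by (simp add: tm_def)

lemma tm_add: "tm (v, s, c) + tm (v, s, d) = tm (v, s, c + d)"
  by (simp add: tm_def single_add)

lemma ip_ins: "ip (ins t L) = tm t + ip L"
proof (induction L)
  case Nil
  then show ?case by (cases t) auto
next
  case (Cons u L)
  obtain v s c where t: "t = (v, s, c)" by (cases t) auto
  obtain w r d where u: "u = (w, r, d)" by (cases u) auto
  show ?case
  proof (cases "v = w \<and> s = r")
    case True
    then have "tm t + tm u = tm (v, s, c + d)" by (simp add: t u tm_add)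
    then show ?thesis using True by (auto simp: t u add.assoc[symmetric])
  next
    case False
    then show ?thesis using Cons by (auto simp: t u add_ac)
  qed
qed

lemma ip_nrm [simp]: "ip (nrm L) = ip L"
  by (induction L) (auto simp: ip_ins)

lemma equal7_ip: "equal7 f g \<Longrightarrow> ip f = ip g"
proof -
  assume "equal7 f g"
  then have "ip (nrm (f @ scale7 0 (- 1) g)) = 0" by (simp add: equal7_def)
  then have "ip f + scl (- 1) (ip g) = 0" by (simp add: ip_scale7 single_uminus)
  moreover have "scl (- 1) (ip g) = - ip g" by (rule poly_mapping_eqI) simp
  ultimately show ?thesis by simp
qed

lemma wt_unit7: "wt (unit7 (idx k)) = ebas k"
  by (simp add: vec_eq_iff unit7_def idx_eq_iff)

lemma wt_0: "wt (mk7 (\<lambda>_. 0)) = 0"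
  by (simp add: vec_eq_iff)

lemma rep_mutate:
  assumes "skew Q" "rep Q M"
  shows "rep (mutate Q k) (mutate7 M (idx k))"
proof -
  have sk: "Q i j = - Q j i" for i j using skewD[OF assms(1)] .
  show ?thesis
    unfolding rep_def mutate_eq[of Q, OF sk] mutate7_def Let_def
    by (simp add: idx_eq_iff repD[OF assms(2)])
qed

lemma mu_lat_wt:
  assumes "rep Q M"
  shows "mu_lat Q k (wt v) = wt (mu7 M (idx k) v)"
proof (rule wt_eqI)
  fix i
  define c where "c j = (if j = k then - 1 else max (nth7 (nth7 M (idx j)) (idx k)) 0)" for j
  have "(\<Sum>j\<in>UNIV. rat_of_int (c j * nth7 v (idx j)) / 2) =
    rat_of_int (c k * nth7 v (idx k)) / 2 + (\<Sum>j\<in>UNIV - {k}. rat_of_int (c j * nth7 v (idx j)) / 2)"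
    by (rule sum.remove) auto
  also have "(\<Sum>j\<in>UNIV - {k}. rat_of_int (c j * nth7 v (idx j)) / 2) = (\<Sum>j\<in>UNIV - {k}. of_int (max (Q j k) 0) * wt v $ j)"
    by (intro sum.cong refl) (simp add: c_def repD[OF assms])
  finally have "mu_lat Q k (wt v) $ k = (\<Sum>j\<in>UNIV. rat_of_int (c j * nth7 v (idx j)) / 2)"
    by (simp add: mu_lat_def c_def)
  also have "\<dots> = of_int (\<Sum>j\<in>UNIV. c j * nth7 v (idx j)) / 2"
    by (simp add: sum_divide_distrib)
  also have "(\<Sum>j\<in>UNIV. c j * nth7 v (idx j)) =
    dot7 (mk7 (\<lambda>j. if j = idx k then - 1 else max (nth7 (nth7 M j) (idx k)) 0)) v"
    by (simp add: dot7_sum c_def idx_eq_iff)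
  finally show "mu_lat Q k (wt v) $ i = of_int (nth7 (mu7 M (idx k) v) (idx i)) / 2"
    by (cases "i = k") (simp_all add: mu7_def idx_eq_iff mu_lat_nth)
qed

lemma form_ebas_wt:
  assumes "rep Q M"
  shows "form Q (ebas i) (wt v) = of_int (dot7 (nth7 M (idx i)) v) / 2"
  unfolding ebas_def form_axis_left by (simp add: repD[OF assms] dot7_sum sum_divide_distrib)

lemma dg_wt:
  assumes "rep Q M"
  shows "dg Q k (wt v) = deg7 M (idx k) v"
proof -
  have "\<lfloor>rat_of_int a / 2\<rfloor> = a div 2" for a
    using floor_divide_of_int_eq[of a 2, where ?'a = rat] by simp
  then show ?thesis
    by (simp add: dg_def form_ebas_wt[OF assms] deg7_def)
qed

lemma tilde_wt:
  assumes "rep Q M" "tilde7 M v"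
  shows "wt v \<in> Lat_tilde Q"
proof -
  have "even (nth7 (mv7 M v) (idx i))" for i
    using assms(2) exhaust_7[of i] by (cases "mv7 M v") (auto simp: tilde7_def)
  then have e: "even (dot7 (nth7 M (idx i)) v)" for i
    by (simp add: nth7_mv7)
  have i: "form Q (ebas i) (wt v) \<in> \<int>" for i
    using e[of i] by (auto simp: form_ebas_wt[OF assms(1)] elim!: evenE)
  have "form Q w (wt v) \<in> \<int>" if "w \<in> Lat" for w
  proof -
    have "form Q w (wt v) = (\<Sum>i\<in>UNIV. w $ i * form Q (ebas i) (wt v))"
      unfolding ebas_def form_axis_left by (simp add: form_def sum_distrib_left mult_ac)
    then show ?thesis
      using that i by (auto simp: Lat_def intro!: Ints_sum Ints_mult)
  qed
  then show ?thesis
    by (auto simp: Lat_tilde_def Lat_def)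
qed

lemma ip_pr7:
  assumes "rep Q M"
  shows "ip (pr7 M (idx k) n) = pr Q k 0 n"
proof (induction n)
  case 0
  then show ?case by (simp add: tm_def wt_0 Y_def)
next
  case (Suc n)
  have q: "qpow (of_int m) = single (2 * m) 1" for m
  proof -
    have "2 * of_int m = (of_int (2 * m) :: rat)" by simp
    then show ?thesis unfolding qpow_def by (simp only: floor_of_int)
  qed
  have "lf k (0 + 2 * int n + 1) = single 0 (single 0 1) +
    single (ebas k) (single (2 * (2 * int n + 1)) 1)"
    unfolding lf_def scl_Y q by (simp add: Y_def)
  then have "lf k (0 + 2 * int n + 1) = ip [(mk7 (\<lambda>_. 0), 0, 1), (unit7 (idx k), 2 * (2 * int n + 1), 1)]"
    by (simp only: ip_simps tm_def prod.case wt_0 wt_unit7 add_0_right)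
  then show ?case
    using Suc ip_mul7[OF assms] by (simp only: pr7.simps pr.simps ip_nrm)
qed

lemma ip_mono7:
  assumes "rep Q M" "rep (mutate Q k) M'"
  shows "ip (mono7 M M' (idx k) v) =
    qt_mult (mutate Q k) (Y (mu_lat Q k (wt v))) (pr (mutate Q k) k 0 (nat (dg Q k (wt v))))"
  unfolding mono7_def ip_mul7[OF assms(2)] ip_pr7[OF assms(2)] dg_wt[OF assms(1)] mu_lat_wt[OF assms(1)]
  by (simp add: tm_def Y_def)

text \<open>The graph of a mutation between Laurent elements. It is closed under sums and products
  and, mutations being involutive, can be reversed: an image under the inverse mutation is an
  element known to mutate to a monomial.\<close>

definition mut_rel :: "quiver \<Rightarrow> 7 \<Rightarrow> qtorus \<Rightarrow> qtorus \<Rightarrow> bool" where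
  "mut_rel Q k f g \<longleftrightarrow> keys f \<subseteq> Lat_tilde Q \<and> keys g \<subseteq> Lat_tilde (mutate Q k) \<and>
    qmut Q k (to_Frac Q f) = to_Frac (mutate Q k) g"

lemma to_Frac_add: "\<lbrakk>keys f \<subseteq> Lat_tilde Q; keys g \<subseteq> Lat_tilde Q\<rbrakk> \<Longrightarrow>
    to_Frac Q (f + g) = to_Frac Q f \<oplus>\<^bsub>Frac (torus Q)\<^esub> to_Frac Q g"
  using ring_hom_add[OF to_Frac_hom[of Q]] by simp

lemma mut_rel_add: "skew Q \<Longrightarrow> mut_rel Q k f g \<Longrightarrow> mut_rel Q k f' g' \<Longrightarrow> mut_rel Q k (f + f') (g + g')"
  using ring_hom_add[OF qmut_hom[of Q k]] by (simp add: mut_rel_def torus_add_closed to_Frac_add to_Frac_closed)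

lemma mut_rel_mult: "skew Q \<Longrightarrow> mut_rel Q k f g \<Longrightarrow> mut_rel Q k f' g' \<Longrightarrow> mut_rel Q k (qt_mult Q f f') (qt_mult (mutate Q k) g g')"
  using ring_hom_mult[OF qmut_hom[of Q k]] by (simp add: mut_rel_def torus_mult_closed to_Frac_mult to_Frac_closed)

lemma mut_rel_const: "skew Q \<Longrightarrow> mut_rel Q k (qt_const r) (qt_const r)"
proof -
  have "keys (qt_const r) \<subseteq> Lat_tilde R" for R by (simp add: qt_const_def)
  then show "skew Q \<Longrightarrow> mut_rel Q k (qt_const r) (qt_const r)"
    by (simp add: mut_rel_def qmut_eq_ext qmut_ext(3) qmut_tor_const)
qed

lemma mut_rel_scl: "skew Q \<Longrightarrow> mut_rel Q k f g \<Longrightarrow> mut_rel Q k (scl r f) (scl r g)"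
  using mut_rel_mult[OF _ mut_rel_const, of Q k f g r] by (simp add: qt_mult_const)

lemma mut_rel_zero: "skew Q \<Longrightarrow> mut_rel Q k 0 0"
  using mut_rel_const[of Q k 0] by (simp add: qt_const_def)

lemma mut_rel_sym: "skew Q \<Longrightarrow> mut_rel Q k f g \<Longrightarrow> mut_rel (mutate Q k) k g f"
  using qmut_involution[of Q "to_Frac Q f" k] by (simp add: mut_rel_def mutate_mutate to_Frac_closed)

lemma mut_rel_mono:
  assumes "skew Q" "rep Q M" "rep (mutate Q k) M'" "tilde7 M v" "0 \<le> deg7 M (idx k) v"
  shows "mut_rel Q k (tm (v, s, c)) (ip (scale7 s c (mono7 M M' (idx k) v)))"
proof -
  have t: "wt v \<in> Lat_tilde Q" by (rule tilde_wt[OF assms(2,4)])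
  have "mut_rel Q k (Y (wt v)) (ip (mono7 M M' (idx k) v))"
    unfolding mut_rel_def ip_mono7[OF assms(2,3)] using t assms(1,5) dg_wt[OF assms(2), of k v]
    by (simp add: qmut_eq_ext qmut_ext(3) qmut_tor_Y_pos torus_mult_closed mu_lat_tilde)
  from mut_rel_scl[OF assms(1) this, of "single s c"] show ?thesis
    by (simp add: tm_def ip_scale7 scl_Y)
qed

text \<open>The invariant: \<open>acc\<close> represents the mutation of the part \<open>A\<close>
  already treated. Each round moves an element that mutates to a single monomial from
  \<open>bad\<close> to \<open>A\<close> and puts that monomial on \<open>acc\<close>.\<close>

lemma reduce7_sound:
  assumes Q: "skew Q" and M: "rep Q M" "rep (mutate Q k) M'"
  shows "reduce7 n M M' (idx k) bad acc = Some g \<Longrightarrow> mut_rel Q k A (ip acc) \<Longrightarrow> mut_rel Q k (A + ip bad) (ip g)"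
proof (induction n arbitrary: bad acc A)
  case 0
  then show ?case by (auto split: if_splits)
next
  case (Suc n)
  show ?case
  proof (cases "bad = []")
    case True
    then show ?thesis using Suc.prems by auto
  next
    case False
    obtain v s c where t: "least7 (idx k) (hd bad) (tl bad) = (v, s, c)" by (metis prod_cases3)
    define w where "w = mu7 M' (idx k) v"
    have w: "tilde7 M' w" "0 \<le> deg7 M' (idx k) w"
      and r: "reduce7 n M M' (idx k) (nrm (scale7 s (- c) (mono7 M' M (idx k) w) @ bad)) ((w, s, c) # acc) = Some g"
      using Suc.prems(1) False by (auto simp: t Let_def simp flip: w_def split: if_splits)
    have Q': "skew (mutate Q k)" by (rule mutate_skew[OF Q])
    define B where "B = ip (scale7 s c (mono7 M' M (idx k) w))"
    have "mut_rel (mutate Q k) k (tm (w, s, c)) B"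
      unfolding B_def using M w by (intro mut_rel_mono[OF Q']) (simp_all add: mutate_mutate[OF Q])
    from mut_rel_sym[OF Q' this] have "mut_rel Q k B (tm (w, s, c))"
      by (simp add: mutate_mutate[OF Q])
    then have "mut_rel Q k (B + A) (ip ((w, s, c) # acc))"
      using mut_rel_add[OF Q _ Suc.prems(2)] by simp
    from Suc.IH[OF r this] have "mut_rel Q k (B + A + (ip (scale7 s (- c) (mono7 M' M (idx k) w)) + ip bad)) (ip g)"
      by simp
    moreover have "ip (scale7 s (- c) (mono7 M' M (idx k) w)) = - B"
      unfolding B_def ip_scale7 single_uminus by (rule poly_mapping_eqI) simp
    ultimately show ?thesis by (simp add: algebra_simps)
  qed
qed

lemma ip_filter: "ip (filter P f) + ip (filter (\<lambda>x. \<not> P x) f) = ip f"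
  by (induction f) (auto simp: algebra_simps)

lemma mut7_sound:
  assumes Q: "skew Q" and M: "rep Q M" and g: "mut7 M (idx k) f = Some g"
  shows "mut_rel Q k (ip f) (ip g)"
proof -
  define M' where "M' = mutate7 M (idx k)"
  have M': "rep (mutate Q k) M'" unfolding M'_def by (rule rep_mutate[OF Q M])
  define bad where "bad = filter (\<lambda>(v, s, c). deg7 M (idx k) v < 0) f"
  define good where "good = filter (\<lambda>(v, s, c). \<not> deg7 M (idx k) v < 0) f"
  define acc where "acc = concat (map (\<lambda>(v, s, c). scale7 s c (mono7 M M' (idx k) v)) good)"
  have t: "list_all (\<lambda>(v, s, c). tilde7 M v) f" and r: "reduce7 20 M M' (idx k) bad acc = Some g"
    using g by (auto simp: mut7_def Let_def bad_def good_def acc_def M'_def split: if_splits)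
  have "list_all (\<lambda>(v, s, c). tilde7 M v \<and> 0 \<le> deg7 M (idx k) v) good"
    using t by (auto simp: good_def list_all_iff)
  then have "mut_rel Q k (ip good) (ip acc)"
    unfolding acc_def
  proof (induction good)
    case Nil
    then show ?case by (simp add: mut_rel_zero[OF Q])
  next
    case (Cons t good)
    obtain v s c where t: "t = (v, s, c)" by (cases t) auto
    show ?case
      using mut_rel_add[OF Q mut_rel_mono[OF Q M M', of v s c]] Cons by (simp add: t)
  qed
  from reduce7_sound[OF Q M M' r this] show ?thesis
    using ip_filter[of "\<lambda>(v, s, c). deg7 M (idx k) v < 0" f]
    by (simp add: bad_def good_def add.commute case_prod_unfold)
qed

lemma mutate_seq_skew: "skew Q \<Longrightarrow> skew (mutate_seq ks Q)"
  by (induction ks arbitrary: Q) (auto simp: mutate_skew)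

lemma rep_mutate_seq: "skew Q \<Longrightarrow> rep Q M \<Longrightarrow> rep (mutate_seq ks Q) (fold (\<lambda>k M. mutate7 M k) (map idx ks) M)"
  by (induction ks arbitrary: Q M) (auto simp: mutate_skew rep_mutate)

lemma mut7_seq_sound:
  assumes "skew Q" "rep Q M" "mut7_seq M (map idx ks) f = Some g" "keys (ip f) \<subseteq> Lat_tilde Q"
  shows "keys (ip g) \<subseteq> Lat_tilde (mutate_seq ks Q) \<and> qmut_seq ks Q (to_Frac Q (ip f)) = to_Frac (mutate_seq ks Q) (ip g)"
  using assms
proof (induction ks arbitrary: Q M f)
  case (Cons k ks)
  obtain h where h: "mut7 M (idx k) f = Some h" "mut7_seq (mutate7 M (idx k)) (map idx ks) h = Some g"
    using Cons.prems(3) by (auto split: option.splits)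
  have "mut_rel Q k (ip f) (ip h)" by (rule mut7_sound[OF Cons.prems(1,2) h(1)])
  then show ?case
    using Cons.IH[OF mutate_skew[OF Cons.prems(1)] rep_mutate[OF Cons.prems(1,2)] h(2)] by (simp add: mut_rel_def)
qed simp

lemma skew_X7: "skew X7"
  by (simp add: skew_def X7_def quiver_of_arrows_def)

lemma rep_X7: "rep X7 X7_mat"
  unfolding rep_def forall_7 by (simp add: X7_def X7_mat_def quiver_of_arrows_def)

text \<open>Seven single mutations settle membership, by \<open>laurent_set_eq\<close>.\<close>

lemma laurent_check_sound: "laurent_check f \<Longrightarrow> ip f \<in> L7"
proof -
  assume f: "laurent_check f"
  have "lau X7 j (ip f)" for j
  proof -
    have "mut7 X7_mat (idx j) f \<noteq> None"
      using f exhaust_7[of j] by (auto simp: laurent_check_def)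
    then obtain g where "mut7 X7_mat (idx j) f = Some g" by blast
    from mut7_sound[OF skew_X7 rep_X7 this] show ?thesis
      by (auto simp: mut_rel_def lau_def)
  qed
  then show ?thesis
    unfolding laurent_set_eq[OF skew_X7] by (simp add: uni_def)
qed

lemma lat_map_perm7:
  assumes "\<And>i. idx (\<pi> i) = p (idx i)" "\<And>i. \<pi> (\<pi> i) = i"
  shows "lat_map (perm_lat \<pi>) (ip f) = ip (perm7 p f)"
proof -
  have "perm_lat \<pi> (wt v) = wt (mk7 (\<lambda>i. nth7 v (p i)))" for v
  proof (rule wt_eqI)
    fix i
    have "perm_lat \<pi> (wt v) $ i = (\<Sum>j\<in>UNIV. if j = \<pi> i then wt v $ j else 0)"
      unfolding perm_lat_def sum_component
      by (intro sum.cong refl) (use assms(2) in \<open>auto simp del: wt_nth\<close>)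
    then show "perm_lat \<pi> (wt v) $ i = of_int (nth7 (mk7 (\<lambda>i. nth7 v (p i))) (idx i)) / 2"
      by (simp add: assms(1))
  qed
  then show ?thesis
    by (induction f) (auto simp: perm7_def lat_map_add tm_def)
qed

subsection \<open>Cluster automorphisms of the quiver X7\<close>

lemma qmut_seq_uni:
  assumes "skew Q" "uni Q f"
  obtains g where "uni (mutate_seq ks Q) g" "qmut_seq ks Q (to_Frac Q f) = to_Frac (mutate_seq ks Q) g"
  using assms
proof (induction ks arbitrary: Q f thesis)
  case (Cons k ks)
  obtain h where h: "uni (mutate Q k) h" "qmut Q k (to_Frac Q f) = to_Frac (mutate Q k) h"
    using uni_mutate[OF Cons.prems(2,3)] .
  obtain g where "uni (mutate_seq ks (mutate Q k)) g"
    "qmut_seq ks (mutate Q k) (to_Frac (mutate Q k) h) = to_Frac (mutate_seq ks (mutate Q k)) g"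
    using Cons.IH[OF _ mutate_skew[OF Cons.prems(2)] h(1)] by blast
  then show ?case using Cons.prems(1)[of g] h(2) by simp
qed simp

lemma qmut_seq_surj:
  assumes "skew Q" "uni (mutate_seq ks Q) g"
  obtains f where "uni Q f" "qmut_seq ks Q (to_Frac Q f) = to_Frac (mutate_seq ks Q) g"
  using assms
proof (induction ks arbitrary: Q thesis)
  case (Cons k ks)
  let ?Q = "mutate Q k"
  have Q': "skew ?Q" by (rule mutate_skew[OF Cons.prems(2)])
  have "uni (mutate_seq ks ?Q) g" using Cons.prems(3) by simp
  then obtain h where h: "uni ?Q h" "qmut_seq ks ?Q (to_Frac ?Q h) = to_Frac (mutate_seq ks ?Q) g"
    using Cons.IH[OF _ Q'] by blast
  obtain f where f: "uni (mutate ?Q k) f" "qmut ?Q k (to_Frac ?Q h) = to_Frac (mutate ?Q k) f"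
    using uni_mutate[OF Q' h(1)] .
  have "qmut Q k (to_Frac Q f) = to_Frac ?Q h"
    using qmut_involution[OF Q' to_Frac_closed[OF uni_keys[OF h(1)]], of k] f(2) by (simp add: mutate_mutate[OF Cons.prems(2)])
  then show ?case
    using Cons.prems(1)[of f] f(1) h(2) by (simp add: mutate_mutate[OF Cons.prems(2)])
qed simp

lemma qmut_seq_hom: "skew Q \<Longrightarrow> qmut_seq ks Q \<in> ring_hom (Frac (torus Q)) (Frac (torus (mutate_seq ks Q)))"
proof (induction ks arbitrary: Q)
  case Nil
  show ?case by (rule ring_hom_memI) auto
next
  case (Cons k ks)
  then show ?case
    using ring_hom_trans[OF qmut_hom Cons.IH[OF mutate_skew]] by (simp only: qmut_seq.simps mutate_seq.simps)
qed

lemma qmut_seq_inj: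
  assumes "skew Q" "x \<in> carrier (Frac (torus Q))" "y \<in> carrier (Frac (torus Q))"
    "qmut_seq ks Q x = qmut_seq ks Q y"
  shows "x = y"
  using assms
proof (induction ks arbitrary: Q x y)
  case (Cons k ks)
  have c: "qmut Q k z \<in> carrier (Frac (torus (mutate Q k)))" if "z \<in> carrier (Frac (torus Q))" for z
    using ring_hom_closed[OF qmut_hom[OF Cons.prems(1)] that] .
  have "qmut Q k x = qmut Q k y"
    using Cons.IH[OF mutate_skew[OF Cons.prems(1)] c c] Cons.prems by simp
  then show ?case
    using qmut_involution[OF Cons.prems(1)] Cons.prems(2,3) by metis
qed simp

lemma uni_add: "skew Q \<Longrightarrow> uni Q f \<Longrightarrow> uni Q g \<Longrightarrow> uni Q (f + g)"
  by (simp add: uni_def lau_add)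

lemma uni_mult: "skew Q \<Longrightarrow> uni Q f \<Longrightarrow> uni Q g \<Longrightarrow> uni Q (qt_mult Q f g)"
  by (simp add: uni_def lau_mult)

lemma uni_scl: "skew Q \<Longrightarrow> uni Q f \<Longrightarrow> uni Q (scl r f)"
  by (simp add: uni_def lau_scl)

lemma uni_const: "skew Q \<Longrightarrow> uni Q (qt_const r)"
proof -
  assume "skew Q"
  then have "uni Q (scl r (Y 0))" by (intro uni_scl) (auto simp: uni_def intro: lau_Y)
  then show ?thesis by (simp add: scl_Y qt_const_def)
qed

lemma uni_one: "skew Q \<Longrightarrow> uni Q (Y 0)"
  by (auto simp: uni_def intro: lau_Y)

lemma uni_zero: "skew Q \<Longrightarrow> uni Q 0"
  by (auto simp: uni_def intro: lau_zero)

lemma L7_iff: "f \<in> L7 \<longleftrightarrow> uni X7 f"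
  by (simp add: laurent_set_eq[OF skew_X7])

lemma L7_keys: "f \<in> L7 \<Longrightarrow> keys f \<subseteq> Lat_tilde X7"
  by (simp add: L7_iff uni_keys)

lemma L7_closed:
  "f \<in> L7 \<Longrightarrow> g \<in> L7 \<Longrightarrow> f + g \<in> L7" "f \<in> L7 \<Longrightarrow> g \<in> L7 \<Longrightarrow> f \<odot> g \<in> L7" "f \<in> L7 \<Longrightarrow> scl r f \<in> L7"
  "qt_const r \<in> L7" "Y 0 \<in> L7" "0 \<in> L7"
  by (simp_all add: L7_iff uni_add uni_mult uni_scl uni_const uni_one uni_zero skew_X7)

lemma (in lat_iso) map_ore_rel:
  assumes "((a, b), (c, d)) \<in> ore_rel (torus Q1)"
  shows "((lat_map \<nu> a, lat_map \<nu> b), (lat_map \<nu> c, lat_map \<nu> d)) \<in> ore_rel (torus Q2)"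
proof -
  have nz: "lat_map \<nu> f = 0 \<longleftrightarrow> f = 0" for f using map_inv[of f] by auto
  obtain u v where "u \<in> carrier (torus Q1)" "v \<in> carrier (torus Q1)" "qt_mult Q1 b u = qt_mult Q1 d v"
    "qt_mult Q1 b u \<noteq> 0" "qt_mult Q1 a u = qt_mult Q1 c v"
    using assms unfolding ore_rel_def by auto
  then show ?thesis
    using assms unfolding ore_rel_def mem_Collect_eq prod.case
    by (intro conjI bexI[of _ "lat_map \<nu> u"] bexI[of _ "lat_map \<nu> v"])
      (simp_all add: map_closed nz flip: map_mult)
qed

text \<open>The data of a cluster automorphism: the mutated quiver is \<open>X7\<close> with
  relabelled vertices. For \<sigma> and for all three twists the relabelling is an involution, so
  its inverse never appears.\<close>

locale cluster_loop =
  fixes \<pi> :: "7 \<Rightarrow> 7" and ks :: "7 list"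
  assumes inv: "\<And>i. \<pi> (\<pi> i) = i" and loop: "\<And>i j. mutate_seq ks X7 i j = X7 (\<pi> i) (\<pi> j)"
begin

abbreviation Qs :: quiver where "Qs \<equiv> mutate_seq ks X7"

lemma perm_lat_nth: "perm_lat \<pi> v $ i = v $ \<pi> i"
proof -
  have "perm_lat \<pi> v $ i = (\<Sum>j\<in>UNIV. if j = \<pi> i then v $ j else 0)"
    unfolding perm_lat_def sum_component by (intro sum.cong refl) (use inv in auto)
  then show ?thesis by simp
qed

lemma perm_ebas: "perm_lat \<pi> (ebas j) = ebas (\<pi> j)"
  using inv by (auto simp: vec_eq_iff perm_lat_nth)

lemma perm_iso: "lat_iso Qs X7 (perm_lat \<pi>) (perm_lat \<pi>)"
proof
  show "skew Qs" "skew X7" by (simp_all add: skew_X7 mutate_seq_skew)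
  have bij: "bij \<pi>" using inv by (rule involuntory_imp_bij)
  show "form X7 (perm_lat \<pi> v) (perm_lat \<pi> w) = form Qs v w" for v w
  proof -
    have "form X7 (perm_lat \<pi> v) (perm_lat \<pi> w) = (\<Sum>i\<in>UNIV. \<Sum>j\<in>UNIV. of_int (X7 (\<pi> i) (\<pi> j)) * v $ i * w $ j)"
      unfolding form_def
      by (subst sum.reindex_bij_betw[OF bij, symmetric], subst sum.reindex_bij_betw[OF bij, symmetric])
        (simp add: perm_lat_nth inv)
    then show ?thesis by (simp add: form_def loop)
  qed
qed (auto simp: vec_eq_iff perm_lat_nth inv Lat_def)

sublocale P: lat_iso Qs X7 "perm_lat \<pi>" "perm_lat \<pi>"
  by (rule perm_iso)

lemma perm_torus_eq: "perm_torus \<pi> f = lat_map (perm_lat \<pi>) f"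
  by (simp add: perm_torus_def lat_map_def pm_lin_def)

text \<open>\<open>perm_Frac\<close> moves the representatives of a class one by one. That the
  result is a whole class, and not a part of one, is seen by applying the relabelling back.\<close>

lemma perm_Frac_to_Frac:
  assumes "keys g \<subseteq> Lat_tilde Qs"
  shows "perm_Frac \<pi> (to_Frac Qs g) = to_Frac X7 (lat_map (perm_lat \<pi>) g)"
proof -
  let ?p = "lat_map (perm_lat \<pi>)"
  interpret R: ore_domain "torus Qs" by (rule torus_ore_domain)
  interpret R': ore_domain "torus X7" by (rule torus_ore_domain)
  interpret I: lat_iso X7 Qs "perm_lat \<pi>" "perm_lat \<pi>" by (rule P.inverse)
  note fwd = P.map_ore_rel and bwd = I.map_ore_rel
  have one: "?p (Y 0) = Y 0" using P.zero by simp
  show ?thesis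
  proof (intro equalityI subsetI)
    fix x assume "x \<in> perm_Frac \<pi> (to_Frac Qs g)"
    then obtain a b where "x = (?p a, ?p b)" "((g, Y 0), (a, b)) \<in> ore_rel (torus Qs)"
      by (auto simp: perm_Frac_def perm_torus_eq to_Frac_def R.mem_rfrac)
    then show "x \<in> to_Frac X7 (?p g)"
      using fwd[of g "Y 0" a b] one by (simp add: to_Frac_def R'.mem_rfrac)
  next
    fix x assume x: "x \<in> to_Frac X7 (?p g)"
    obtain a b where ab: "x = (a, b)" by (cases x)
    have "((?p (?p g), ?p (Y 0)), (?p a, ?p b)) \<in> ore_rel (torus Qs)"
      using x bwd[of "?p g" "Y 0" a b] by (simp add: ab to_Frac_def R'.mem_rfrac)
    then have "(?p a, ?p b) \<in> to_Frac Qs g"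
      using one P.map_inv[of g] by (simp add: to_Frac_def R.mem_rfrac)
    then have "map_prod ?p ?p (?p a, ?p b) \<in> map_prod ?p ?p ` to_Frac Qs g" by (rule imageI)
    then show "x \<in> perm_Frac \<pi> (to_Frac Qs g)"
      using P.map_inv by (simp add: perm_Frac_def perm_torus_eq[abs_def] ab)
  qed
qed

lemma uni_perm: "uni Qs f \<Longrightarrow> uni X7 (lat_map (perm_lat \<pi>) f)"
proof -
  assume f: "uni Qs f"
  have "lau X7 j (lat_map (perm_lat \<pi>) f)" for j
    using lau_map[OF perm_iso, of "\<pi> j" j f] f inv by (simp add: uni_def perm_ebas)
  then show ?thesis by (simp add: uni_def)
qed

lemma uni_perm': "uni X7 f \<Longrightarrow> uni Qs (lat_map (perm_lat \<pi>) f)"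
proof -
  assume f: "uni X7 f"
  have "lau Qs j (lat_map (perm_lat \<pi>) f)" for j
    using lau_map[OF P.inverse, of "\<pi> j" j f] f inv by (simp add: uni_def perm_ebas)
  then show ?thesis by (simp add: uni_def)
qed

lemma cluster_map_eq:
  assumes "keys g \<subseteq> Lat_tilde Qs" "qmut_seq ks X7 (to_Frac X7 f) = to_Frac Qs g"
  shows "cluster_map X7 \<pi> ks f = lat_map (perm_lat \<pi>) g"
  unfolding cluster_map_def
proof (rule the_equality)
  have g: "keys (lat_map (perm_lat \<pi>) g) \<subseteq> Lat_tilde X7"
    by (rule P.map_closed[OF assms(1)])
  then show "lat_map (perm_lat \<pi>) g \<in> carrier (torus X7) \<and>
      to_Frac X7 (lat_map (perm_lat \<pi>) g) = perm_Frac \<pi> (qmut_seq ks X7 (to_Frac X7 f))"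
    by (simp add: assms(2) perm_Frac_to_Frac[OF assms(1)])
  fix h assume "h \<in> carrier (torus X7) \<and> to_Frac X7 h = perm_Frac \<pi> (qmut_seq ks X7 (to_Frac X7 f))"
  then show "h = lat_map (perm_lat \<pi>) g"
    using to_Frac_eq_iff[of h X7 "lat_map (perm_lat \<pi>) g"] g by (simp add: assms(2) perm_Frac_to_Frac[OF assms(1)])
qed

definition cm :: "qtorus \<Rightarrow> qtorus" where "cm = cluster_map X7 \<pi> ks"

lemma cm_ex:
  assumes "f \<in> L7"
  obtains g where "uni Qs g" "qmut_seq ks X7 (to_Frac X7 f) = to_Frac Qs g" "cm f = lat_map (perm_lat \<pi>) g"
proof -
  have f: "uni X7 f" using assms by (simp add: L7_iff)
  obtain g where g: "uni Qs g" "qmut_seq ks X7 (to_Frac X7 f) = to_Frac Qs g"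
    using qmut_seq_uni[OF skew_X7 f] .
  then show ?thesis using that cluster_map_eq[OF uni_keys[OF g(1)] g(2)] by (simp add: cm_def)
qed

lemma cm_eqI: "\<lbrakk>uni Qs g; qmut_seq ks X7 (to_Frac X7 f) = to_Frac Qs g\<rbrakk> \<Longrightarrow> cm f = lat_map (perm_lat \<pi>) g"
  using cluster_map_eq[OF uni_keys] by (simp add: cm_def)

text \<open>For surjectivity an element is traced back through the inverse mutations, each of which
  keeps it universally Laurent.\<close>

lemma cm_bij: "bij_betw cm L7 L7"
  unfolding bij_betw_def
proof
  show "inj_on cm L7"
  proof (rule inj_onI)
    fix x y assume x: "x \<in> L7" and y: "y \<in> L7" and xy: "cm x = cm y"
    obtain x' where x': "qmut_seq ks X7 (to_Frac X7 x) = to_Frac Qs x'" "cm x = lat_map (perm_lat \<pi>) x'"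
      by (rule cm_ex[OF x])
    obtain y' where y': "qmut_seq ks X7 (to_Frac X7 y) = to_Frac Qs y'" "cm y = lat_map (perm_lat \<pi>) y'"
      by (rule cm_ex[OF y])
    have "x' = y'" using P.map_inv xy x'(2) y'(2) by metis
    then have "to_Frac X7 x = to_Frac X7 y"
      using qmut_seq_inj[OF skew_X7 to_Frac_closed[OF L7_keys[OF x]] to_Frac_closed[OF L7_keys[OF y]], of ks] x'(1) y'(1) by simp
    then show "x = y" using to_Frac_eq_iff[OF L7_keys[OF x] L7_keys[OF y]] by simp
  qed
  show "cm ` L7 = L7"
  proof (intro equalityI subsetI)
    fix y assume "y \<in> cm ` L7"
    then obtain x where x: "x \<in> L7" "y = cm x" by blast
    obtain g where "uni Qs g" "cm x = lat_map (perm_lat \<pi>) g" by (rule cm_ex[OF x(1)])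
    then show "y \<in> L7" using uni_perm x(2) by (simp add: L7_iff)
  next
    fix y assume "y \<in> L7"
    then have "uni Qs (lat_map (perm_lat \<pi>) y)" using uni_perm' by (simp add: L7_iff)
    then obtain f where f: "uni X7 f" "qmut_seq ks X7 (to_Frac X7 f) = to_Frac Qs (lat_map (perm_lat \<pi>) y)"
      using qmut_seq_surj[OF skew_X7] by blast
    have "cm f = lat_map (perm_lat \<pi>) (lat_map (perm_lat \<pi>) y)"
      by (rule cm_eqI[OF uni_perm' f(2)]) (use \<open>y \<in> L7\<close> in \<open>simp add: L7_iff\<close>)
    then have "cm f = y" using P.inverse[THEN lat_iso.map_inv, of y] by simp
    then show "y \<in> cm ` L7" using f(1) by (auto simp: L7_iff)
  qed
qed

lemma cm_add: "f \<in> L7 \<Longrightarrow> g \<in> L7 \<Longrightarrow> cm (f + g) = cm f + cm g"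
proof -
  assume fg: "f \<in> L7" "g \<in> L7"
  obtain f' where f': "uni Qs f'" "qmut_seq ks X7 (to_Frac X7 f) = to_Frac Qs f'" "cm f = lat_map (perm_lat \<pi>) f'"
    by (rule cm_ex[OF fg(1)])
  obtain g' where g': "uni Qs g'" "qmut_seq ks X7 (to_Frac X7 g) = to_Frac Qs g'" "cm g = lat_map (perm_lat \<pi>) g'"
    by (rule cm_ex[OF fg(2)])
  have "qmut_seq ks X7 (to_Frac X7 (f + g)) = to_Frac Qs (f' + g')"
    using ring_hom_add[OF qmut_seq_hom[OF skew_X7, of ks]] f' g' fg L7_keys uni_keys by (simp add: to_Frac_add to_Frac_closed)
  from cm_eqI[OF uni_add[OF P.skew1 f'(1) g'(1)] this] show ?thesis
    by (simp add: lat_map_add f'(3) g'(3))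
qed

lemma cm_mult: "f \<in> L7 \<Longrightarrow> g \<in> L7 \<Longrightarrow> cm (f \<odot> g) = cm f \<odot> cm g"
proof -
  assume fg: "f \<in> L7" "g \<in> L7"
  obtain f' where f': "uni Qs f'" "qmut_seq ks X7 (to_Frac X7 f) = to_Frac Qs f'" "cm f = lat_map (perm_lat \<pi>) f'"
    by (rule cm_ex[OF fg(1)])
  obtain g' where g': "uni Qs g'" "qmut_seq ks X7 (to_Frac X7 g) = to_Frac Qs g'" "cm g = lat_map (perm_lat \<pi>) g'"
    by (rule cm_ex[OF fg(2)])
  have "qmut_seq ks X7 (to_Frac X7 (f \<odot> g)) = to_Frac Qs (qt_mult Qs f' g')"
    using ring_hom_mult[OF qmut_seq_hom[OF skew_X7, of ks]] f' g' fg L7_keys uni_keys by (simp add: to_Frac_mult to_Frac_closed)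
  from cm_eqI[OF uni_mult[OF P.skew1 f'(1) g'(1)] this] show ?thesis
    by (simp add: P.map_mult f'(3) g'(3))
qed

lemma cm_const: "cm (qt_const r) = qt_const r"
proof -
  have "qmut_seq ks Q (to_Frac Q (qt_const r)) = to_Frac (mutate_seq ks Q) (qt_const r)" if "skew Q" for Q
    using that
  proof (induction ks arbitrary: Q)
    case (Cons k ks)
    then show ?case using mut_rel_const[of Q k r] by (simp add: mut_rel_def mutate_skew)
  qed simp
  from cm_eqI[OF uni_const[OF P.skew1] this[OF skew_X7]] show ?thesis
    using P.zero by (simp add: qt_const_def)
qed

lemma cm_scl: "f \<in> L7 \<Longrightarrow> cm (scl r f) = scl r (cm f)"
  using cm_mult[OF L7_closed(4), of f r] by (simp add: qt_mult_const cm_const)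

lemma cm_seq_check:
  assumes "\<And>i. idx (\<pi> i) = p (idx i)" "seq_check p (map idx ks) f g" "ip f \<in> L7"
  shows "cm (ip f) = ip g"
proof -
  obtain h where h: "mut7_seq X7_mat (map idx ks) f = Some h" "equal7 (perm7 p h) g"
    using assms(2) by (auto simp: seq_check_def split: option.splits)
  note s = mut7_seq_sound[OF skew_X7 rep_X7 h(1) L7_keys[OF assms(3)]]
  then have "cm (ip f) = lat_map (perm_lat \<pi>) (ip h)"
    unfolding cm_def by (intro cluster_map_eq) auto
  then show ?thesis
    using lat_map_perm7[OF assms(1) inv] equal7_ip[OF h(2)] by simp
qed

end

lemma cluster_loopI:
  assumes "\<And>i. \<pi> (\<pi> i) = i" "\<And>i. idx (\<pi> i) = p (idx i)"
    "fold (\<lambda>k M. mutate7 M k) (map idx ks) X7_mat = mk7 (\<lambda>i. mk7 (\<lambda>j. nth7 (nth7 X7_mat (p i)) (p j)))"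
  shows "cluster_loop \<pi> ks"
proof
  show "mutate_seq ks X7 i j = X7 (\<pi> i) (\<pi> j)" for i j
    using repD[OF rep_mutate_seq[OF skew_X7 rep_X7, of ks], of i j] repD[OF rep_X7, of "\<pi> i" "\<pi> j"]
    by (simp add: assms(2,3))
qed (rule assms(1))

subsection \<open>Linear independence of characters\<close>

text \<open>Dedekind's argument for functions that are multiplicative on a set closed under
  \<open>m\<close>. It is used for shift operators on symmetric monomials, for joint eigenvalues of
  the family, and for exponentials in the indices; the last live on a translated orthant without
  neutral element.\<close>

lemma characters_independent:
  fixes ch :: "'i \<Rightarrow> 's \<Rightarrow> 'k::field"
  assumes "finite I"
    and closed: "\<And>x y. x \<in> S \<Longrightarrow> y \<in> S \<Longrightarrow> m x y \<in> S"
    and mult: "\<And>i x y. i \<in> I \<Longrightarrow> x \<in> S \<Longrightarrow> y \<in> S \<Longrightarrow> ch i (m x y) = ch i x * ch i y"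
    and distinct: "\<And>i j. i \<in> I \<Longrightarrow> j \<in> I \<Longrightarrow> i \<noteq> j \<Longrightarrow> \<exists>x\<in>S. ch i x \<noteq> ch j x"
    and nontrivial: "\<And>i. i \<in> I \<Longrightarrow> \<exists>x\<in>S. ch i x \<noteq> 0"
    and "\<And>x. x \<in> S \<Longrightarrow> (\<Sum>i\<in>I. g i * ch i x) = 0"
    and "i \<in> I"
  shows "g i = 0"
  using assms(1,3-)
proof (induction I arbitrary: g i rule: finite_induct)
  case (insert j I)
  have zero: "g i = 0" if i: "i \<in> I" for i
  proof -
    have ij: "i \<noteq> j" using i insert.hyps by auto
    obtain y where y: "y \<in> S" "ch i y \<noteq> ch j y"
      using insert.prems(2)[of i j] i ij by auto
    \<comment> \<open>The relation at the product of y and x minus \<open>ch j y\<close> times the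
      relation at x: the term of \<open>j\<close> drops out, while y is chosen so that the term of
      \<open>i\<close> stays.\<close>
    have "(\<Sum>i\<in>I. (g i * (ch i y - ch j y)) * ch i x) = 0" if x: "x \<in> S" for x
    proof -
      have 1: "(\<Sum>i\<in>I. g i * ch i y * ch i x) = - (g j * ch j y * ch j x)"
      proof -
        have "(\<Sum>i\<in>insert j I. g i * ch i (m y x)) = 0"
          using insert.prems(4) closed x y by blast
        moreover have "(\<Sum>i\<in>insert j I. g i * ch i (m y x)) = (\<Sum>i\<in>insert j I. g i * ch i y * ch i x)"
          using insert.prems(1) x y by (intro sum.cong refl) (simp add: mult.assoc)
        ultimately show ?thesis
          using insert.hyps by (simp add: eq_neg_iff_add_eq_0 add.commute)
      qed
      have 2: "(\<Sum>i\<in>I. g i * ch i x) = - (g j * ch j x)"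
        using insert.prems(4)[OF x] insert.hyps by (simp add: eq_neg_iff_add_eq_0 add.commute)
      have "(\<Sum>i\<in>I. (g i * (ch i y - ch j y)) * ch i x) =
        (\<Sum>i\<in>I. g i * ch i y * ch i x) - ch j y * (\<Sum>i\<in>I. g i * ch i x)"
        by (simp add: sum_distrib_left algebra_simps sum_subtractf)
      then show ?thesis unfolding 1 2 by simp
    qed
    then have "g i * (ch i y - ch j y) = 0"
      using insert.prems(1-3) i by (intro insert.IH[of "\<lambda>i. g i * (ch i y - ch j y)" i]) auto
    then show ?thesis using y by simp
  qed
  obtain x where x: "x \<in> S" "ch j x \<noteq> 0" using insert.prems(3)[of j] by auto
  have "g j * ch j x = 0"
    using insert.prems(4)[OF x(1)] insert.hyps zero by simp
  then have "g j = 0" using x by simp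
  then show ?case using zero insert.prems(5) by blast
qed simp

subsection \<open>The field of rational functions and its shifts\<close>

definition rhom :: "('a::comm_ring_1 \<Rightarrow> 'b::comm_ring_1) \<Rightarrow> bool" where
  "rhom h \<longleftrightarrow> h 1 = 1 \<and> (\<forall>a b. h (a + b) = h a + h b) \<and> (\<forall>a b. h (a * b) = h a * h b)"

lemma rhomD: "rhom h \<Longrightarrow> h 1 = 1" "rhom h \<Longrightarrow> h (a + b) = h a + h b" "rhom h \<Longrightarrow> h (a * b) = h a * h b"
  by (simp_all add: rhom_def)

lemma rhom_0: "rhom h \<Longrightarrow> h 0 = 0"
  using rhomD(2)[of h 0 0] by simp

lemma rhom_uminus: "rhom h \<Longrightarrow> h (- a) = - h a"
  using rhomD(2)[of h a "- a"] rhom_0[of h] by (simp add: eq_neg_iff_add_eq_0 add.commute)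

lemma rhom_diff: "rhom h \<Longrightarrow> h (a - b) = h a - h b"
  using rhomD(2)[of h a "- b"] rhom_uminus[of h b] by simp

lemma rhom_sum: "rhom h \<Longrightarrow> h (\<Sum>i\<in>I. f i) = (\<Sum>i\<in>I. h (f i))"
  by (induction I rule: infinite_finite_induct) (simp_all add: rhom_0 rhomD)

lemma rhom_of_nat: "rhom h \<Longrightarrow> h (of_nat n) = of_nat n"
  by (induction n) (simp_all add: rhom_0 rhomD)

lemma rhom_of_int: "rhom h \<Longrightarrow> h (of_int z) = of_int z"
  by (cases z) (simp_all add: rhom_of_nat rhom_uminus rhom_diff rhomD)

lemma rhom_field_nonzero:
  fixes h :: "'a::field \<Rightarrow> 'b::field"
  assumes "rhom h"
  shows "h a = 0 \<longleftrightarrow> a = 0"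
proof
  assume "h a = 0"
  show "a = 0"
  proof (rule ccontr)
    assume "a \<noteq> 0"
    then have "h a * h (inverse a) = 1" using rhomD[OF assms] by (metis right_inverse)
    then show False using \<open>h a = 0\<close> by simp
  qed
qed (simp add: rhom_0 assms)

lemma rhom_inverse:
  fixes h :: "'a::field \<Rightarrow> 'b::field"
  assumes "rhom h"
  shows "h (inverse a) = inverse (h a)"
proof (cases "a = 0")
  case False
  then have "h a * h (inverse a) = 1" using rhomD[OF assms] by (metis right_inverse)
  then show ?thesis by (metis inverse_unique)
qed (simp add: rhom_0 assms)

lemma rhom_divide:
  fixes h :: "'a::field \<Rightarrow> 'b::field"
  shows "rhom h \<Longrightarrow> h (a / b) = h a / h b"
  by (simp add: divide_inverse rhomD rhom_inverse)

text \<open>A trivial kernel keeps denominators nonzero, so that \<open>fract_extend\<close> is well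
  defined and again a homomorphism.\<close>

definition rinj :: "('a::comm_ring_1 \<Rightarrow> 'b::comm_ring_1) \<Rightarrow> bool" where
  "rinj h \<longleftrightarrow> rhom h \<and> (\<forall>a. h a = 0 \<longrightarrow> a = 0)"

lemma rinj_map_poly:
  assumes "rinj h"
  shows "rinj (map_poly h)"
proof -
  have h: "rhom h" and h0: "h 0 = 0" using assms rhom_0 by (auto simp: rinj_def)
  note c = coeff_map_poly[of h, OF h0]
  have "rhom (map_poly h)"
    unfolding rhom_def
    by (intro conjI allI poly_eqI)
      (auto simp: c rhomD[OF h] coeff_mult rhom_sum[OF h] coeff_1 h0)
  moreover have "p = 0" if "map_poly h p = 0" for p
  proof (rule poly_eqI)
    fix n
    have "h (coeff p n) = 0" using that c by (metis coeff_0)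
    then show "coeff p n = coeff 0 n" using assms by (simp add: rinj_def)
  qed
  ultimately show ?thesis by (simp add: rinj_def)
qed

lemma rinj_pcompose: "(c::'a::idom) \<noteq> 0 \<Longrightarrow> rinj (\<lambda>p. pcompose p [:0, c:])"
  unfolding rinj_def rhom_def by (auto simp: pcompose_add pcompose_mult pcompose_1 dest: pcompose_eq_0)

lemma rinj_poly_scale:
  assumes "c \<noteq> 0"
  shows "rinj (poly_scale i j c)"
proof -
  have 1: "rinj (map_poly (map_poly (\<lambda>p. pcompose p [:0, c:])))"
    by (intro rinj_map_poly rinj_pcompose assms)
  have 2: "rinj (map_poly (\<lambda>p. pcompose p [:0, [:c:]:]))"
    by (intro rinj_map_poly rinj_pcompose) (use assms in simp)
  have 3: "rinj (\<lambda>p. pcompose p [:0, [:[:c:]:]:])"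
    by (intro rinj_pcompose) (use assms in simp)
  show ?thesis
    unfolding poly_scale_def by (simp only: 1 2 3 split: if_split) simp
qed

lemma rhom_fract_extend:
  fixes h :: "'a::idom \<Rightarrow> 'a"
  assumes "rinj h"
  shows "rhom (fract_extend h)" and "fract_extend h (Fract a 1) = Fract (h a) 1"
proof -
  have h: "rhom h" and z: "h a = 0 \<longleftrightarrow> a = 0" for a
    using assms rhom_0[of h] by (auto simp: rinj_def)
  have F: "fract_extend h (Fract a b) = Fract (h a) (h b)" if "b \<noteq> 0" for a b
    by (rule fract_extend_Fract) (use z that in \<open>auto simp: rhomD[OF h]\<close>)
  show "fract_extend h (Fract a 1) = Fract (h a) 1"
    by (simp add: F rhomD[OF h])
  have "fract_extend h (x + y) = fract_extend h x + fract_extend h y"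
    "fract_extend h (x * y) = fract_extend h x * fract_extend h y" for x y
    by (cases x; cases y; simp add: F z rhomD[OF h])+
  moreover have "fract_extend h 1 = 1"
    by (simp add: One_fract_def F rhomD[OF h])
  ultimately show "rhom (fract_extend h)"
    by (simp add: rhom_def)
qed

definition x12 :: ratfun where "x12 = xvar 1 2"
definition x13 :: ratfun where "x13 = xvar 1 3"
definition x23 :: ratfun where "x23 = xvar 2 3"

lemma xvar_12: "x12 = Fract [:[:[:0, 1:]:]:] 1" and xvar_13: "x13 = Fract [:[:0, 1:]:] 1" and xvar_23: "x23 = Fract [:0, 1:] 1"
  by (simp_all add: x12_def x13_def x23_def xvar_def doubleton_eq_iff)

lemma xvar_sym: "xvar (Suc 0) 2 = x12" "xvar (Suc 0) 3 = x13" "xvar 2 3 = x23" "xvar 2 (Suc 0) = x12" "xvar 3 (Suc 0) = x13" "xvar 3 2 = x23"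
  by (simp_all add: x12_def x13_def x23_def xvar_def insert_commute)

lemma Tshift_sym: "Tshift 2 1 = Tshift 1 2" "Tshift 3 1 = Tshift 1 3" "Tshift 3 2 = Tshift 2 3"
  by (simp_all add: fun_eq_iff Tshift_def poly_scale_def insert_commute)

lemma Fract_one_add: "Fract (a + b) 1 = Fract a 1 + Fract (b::'a::idom) 1"
  by simp

lemma Fract_one_mult: "Fract (a * b) 1 = Fract a 1 * Fract (b::'a::idom) 1"
  by simp

lemma Fract_one_eq_iff: "Fract a 1 = Fract (b::'a::idom) 1 \<longleftrightarrow> a = b"
  by (simp add: eq_fract)

lemma rhom_const: "rhom const"
proof -
  have "const 1 = 1" unfolding const_def one_pCons[symmetric] by (simp add: One_fract_def)
  moreover have "const (a + b) = const a + const b" "const (a * b) = const a * const b" for a b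
    unfolding const_def Fract_one_add[symmetric] Fract_one_mult[symmetric] by (simp_all add: mult.commute)
  ultimately show ?thesis by (simp add: rhom_def)
qed

lemma const_eq_iff: "const a = const b \<longleftrightarrow> a = b"
  by (simp add: const_def eq_fract)

lemma qh_nonzero [simp]: "qh \<noteq> 0" and tt_nonzero [simp]: "tt \<noteq> 0"
  by (simp_all add: qh_def tt_def Zero_fract_def eq_fract)

lemma qq_nonzero [simp]: "qq \<noteq> 0"
  by (simp add: qq_def)

lemma x_nonzero [simp]: "x12 \<noteq> 0" "x13 \<noteq> 0" "x23 \<noteq> 0"
  unfolding xvar_12 xvar_13 xvar_23 Zero_fract_def[where 'a = "scalar poly poly poly"] Fract_one_eq_iff by simp_all

text \<open>Constants and variables generate the field. The three inductions follow the nesting of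
  the polynomial rings, with \<open>x12\<close> innermost.\<close>

lemma ratfun_closure:
  fixes S :: "ratfun set"
  assumes "\<And>c. const c \<in> S" "x12 \<in> S" "x13 \<in> S" "x23 \<in> S"
    and add: "\<And>f g. f \<in> S \<Longrightarrow> g \<in> S \<Longrightarrow> f + g \<in> S" and mult: "\<And>f g. f \<in> S \<Longrightarrow> g \<in> S \<Longrightarrow> f * g \<in> S"
    and inv: "\<And>f. f \<in> S \<Longrightarrow> inverse f \<in> S"
  shows "f \<in> S"
proof -
  have 0: "Fract 0 1 \<in> S"
    using assms(1)[of 0] by (simp add: const_def)
  have 1: "Fract [:[:p:]:] 1 \<in> S" for p :: "scalar poly"
  proof (induction p)
    case (pCons a p)
    have "Fract [:[:pCons a p:]:] 1 = const a + x12 * Fract [:[:p:]:] 1"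
      unfolding const_def xvar_12 Fract_one_mult[symmetric] Fract_one_add[symmetric] by (simp add: Fract_one_eq_iff)
    then show ?case using pCons add mult assms(1,2) by simp
  qed (use 0 in simp)
  have 2: "Fract [:p:] 1 \<in> S" for p :: "scalar poly poly"
  proof (induction p)
    case (pCons a p)
    have "Fract [:pCons a p:] 1 = Fract [:[:a:]:] 1 + x13 * Fract [:p:] 1"
      unfolding xvar_13 Fract_one_mult[symmetric] Fract_one_add[symmetric] by (simp add: Fract_one_eq_iff)
    then show ?case using pCons add mult assms(3) 1 by simp
  qed (use 0 in simp)
  have 3: "Fract p 1 \<in> S" for p :: "scalar poly poly poly"
  proof (induction p)
    case (pCons a p)
    have "Fract (pCons a p) 1 = Fract [:a:] 1 + x23 * Fract p 1"
      unfolding xvar_23 Fract_one_mult[symmetric] Fract_one_add[symmetric] by (simp add: Fract_one_eq_iff)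
    then show ?case using pCons add mult assms(4) 2 by simp
  qed (use 0 in simp)
  obtain a b where f: "f = Fract a b" "b \<noteq> 0" by (cases f) auto
  have "f = Fract a 1 * inverse (Fract b 1)" unfolding f by simp
  then show ?thesis using 3[of a] 3[of b] mult inv by metis
qed

text \<open>Field endomorphisms over \<open>K\<close> that scale each variable by a power of q. They
  are described by their values on the variables because two of them can be told apart
  there.\<close>

definition hset :: "qdop set" where
  "hset = {h. rhom h \<and> (\<forall>c. h (const c) = const c) \<and> (\<exists>a b c. h x12 = const (qq powi a) * x12 \<and>
     h x13 = const (qq powi b) * x13 \<and> h x23 = const (qq powi c) * x23)}"

lemma hset_eqI:
  assumes "h \<in> hset" "h' \<in> hset" "h x12 = h' x12" "h x13 = h' x13" "h x23 = h' x23"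
  shows "h = h'"
proof
  fix f
  have r: "rhom h" "rhom h'" using assms by (auto simp: hset_def)
  have "f \<in> {f. h f = h' f}"
    by (rule ratfun_closure) (use assms in \<open>auto simp: hset_def rhomD[OF r(1)] rhomD[OF r(2)] rhom_inverse[OF r(1)] rhom_inverse[OF r(2)]\<close>)
  then show "h f = h' f" by simp
qed

lemma Tshift_props:
  shows "rhom (Tshift i j a)" "Tshift i j a (const c) = const c"
    "Tshift 1 2 a x12 = const (qq powi a) * x12" "Tshift 1 2 a x13 = x13" "Tshift 1 2 a x23 = x23"
    "Tshift 1 3 a x12 = x12" "Tshift 1 3 a x13 = const (qq powi a) * x13" "Tshift 1 3 a x23 = x23"
    "Tshift 2 3 a x12 = x12" "Tshift 2 3 a x13 = x13" "Tshift 2 3 a x23 = const (qq powi a) * x23"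
proof -
  have nz: "qq powi a \<noteq> 0" by simp
  have T: "Tshift i j a (Fract p 1) = Fract (poly_scale i j (qq powi a) p) 1" for i j p
    unfolding Tshift_def by (rule rhom_fract_extend(2)[OF rinj_poly_scale[OF nz]])
  show "rhom (Tshift i j a)"
    unfolding Tshift_def by (rule rhom_fract_extend(1)[OF rinj_poly_scale[OF nz]])
  have mp: "map_poly f [:u:] = (if f u = 0 then 0 else [:f u:])" if "f 0 = 0" for f :: "'x::zero \<Rightarrow> 'y::zero" and u
    using that by (auto simp: map_poly_pCons)
  show "Tshift i j a (const c) = const c"
    unfolding const_def T by (auto simp: poly_scale_def mp map_poly_pCons pcompose_pCons)
  show "Tshift 1 2 a x12 = const (qq powi a) * x12" "Tshift 1 2 a x13 = x13" "Tshift 1 2 a x23 = x23"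
    "Tshift 1 3 a x12 = x12" "Tshift 1 3 a x13 = const (qq powi a) * x13" "Tshift 1 3 a x23 = x23"
    "Tshift 2 3 a x12 = x12" "Tshift 2 3 a x13 = x13" "Tshift 2 3 a x23 = const (qq powi a) * x23"
    unfolding xvar_12 xvar_13 xvar_23 T const_def
    by (simp_all add: poly_scale_def doubleton_eq_iff map_poly_pCons pcompose_pCons one_pCons)
qed

lemma hset_comp: "h \<in> hset \<Longrightarrow> h' \<in> hset \<Longrightarrow> h \<circ> h' \<in> hset"
proof -
  assume h: "h \<in> hset" and h': "h' \<in> hset"
  obtain a b c where a: "rhom h" "\<And>c. h (const c) = const c" "h x12 = const (qq powi a) * x12"
     "h x13 = const (qq powi b) * x13" "h x23 = const (qq powi c) * x23"
    using h by (auto simp: hset_def)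
  obtain a' b' c' where a': "rhom h'" "\<And>c. h' (const c) = const c" "h' x12 = const (qq powi a') * x12"
     "h' x13 = const (qq powi b') * x13" "h' x23 = const (qq powi c') * x23"
    using h' by (auto simp: hset_def)
  have p: "const (qq powi m) * (const (qq powi n) * y) = const (qq powi (n + m)) * y" for m n and y :: ratfun
    by (simp add: power_int_add rhomD(3)[OF rhom_const] mult_ac)
  have "rhom (h \<circ> h')" using a(1) a'(1) by (simp add: rhom_def)
  moreover have "(h \<circ> h') x12 = const (qq powi (a + a')) * x12" "(h \<circ> h') x13 = const (qq powi (b + b')) * x13"
    "(h \<circ> h') x23 = const (qq powi (c + c')) * x23"
    by (simp_all add: a a' rhomD[OF a(1)] p)
  ultimately show ?thesis
    using a(2) a'(2) unfolding hset_def by auto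
qed

lemma hset_id: "id \<in> hset"
proof -
  have "const (qq powi 0) = 1" by (simp add: rhomD(1)[OF rhom_const])
  then have "id x12 = const (qq powi 0) * x12 \<and> id x13 = const (qq powi 0) * x13 \<and> id x23 = const (qq powi 0) * x23"
    by simp
  moreover have "rhom (id :: qdop)" by (simp add: rhom_def)
  ultimately show ?thesis unfolding hset_def by (auto intro: exI[of _ 0])
qed

lemma Tshift_hset: "Tshift 1 2 a \<in> hset" "Tshift 1 3 a \<in> hset" "Tshift 2 3 a \<in> hset"
proof -
  have one: "const (qq powi 0) * y = y" for y by (simp add: rhomD(1)[OF rhom_const])
  have "Tshift 1 2 a x12 = const (qq powi a) * x12 \<and> Tshift 1 2 a x13 = const (qq powi 0) * x13 \<and> Tshift 1 2 a x23 = const (qq powi 0) * x23"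
    "Tshift 1 3 a x12 = const (qq powi 0) * x12 \<and> Tshift 1 3 a x13 = const (qq powi a) * x13 \<and> Tshift 1 3 a x23 = const (qq powi 0) * x23"
    "Tshift 2 3 a x12 = const (qq powi 0) * x12 \<and> Tshift 2 3 a x13 = const (qq powi 0) * x13 \<and> Tshift 2 3 a x23 = const (qq powi a) * x23"
    by (simp_all only: one Tshift_props simp_thms)
  then show "Tshift 1 2 a \<in> hset" "Tshift 1 3 a \<in> hset" "Tshift 2 3 a \<in> hset"
    unfolding hset_def using Tshift_props(1,2) by blast+
qed

lemma qh_power_inj: "qh ^ m = qh ^ n \<longleftrightarrow> m = n"
proof -
  have "qh ^ n = Fract [:monom 1 n:] 1" for n
  proof (induction n)
    case (Suc n)
    have "qh ^ Suc n = Fract ([:[:0, 1:]:] * [:monom 1 n:]) 1"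
      unfolding Fract_one_mult power_Suc Suc qh_def[symmetric] ..
    moreover have "[:[:0, 1:]:] * [:monom 1 n:] = [:monom (1::complex) (Suc n):]" by (simp add: monom_Suc)
    ultimately show ?case by (simp only:)
  qed (simp add: One_fract_def monom_0 one_pCons)
  then show ?thesis by (simp add: Fract_one_eq_iff monom_eq_iff')
qed

lemma qh_powi_inj: "qh powi m = qh powi n \<longleftrightarrow> m = n"
proof
  assume *: "qh powi m = qh powi n"
  define N where "N = \<bar>m\<bar> + \<bar>n\<bar>"
  have "qh powi (m + N) = qh powi (n + N)"
    using * by (simp add: power_int_add)
  moreover have "m + N = int (nat (m + N))" "n + N = int (nat (n + N))" by (auto simp: N_def)
  ultimately have "qh ^ nat (m + N) = qh ^ nat (n + N)"
    by (metis power_int_of_nat)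
  then have "nat (m + N) = nat (n + N)" by (simp add: qh_power_inj)
  then show "m = n" by (auto simp: N_def)
qed simp

lemma qq_powi: "qq powi n = qh powi (2 * n)"
  by (simp add: qq_def power_int_mult)

lemma qq_powi_inj: "qq powi m = qq powi n \<longleftrightarrow> m = n"
  by (simp add: qq_powi qh_powi_inj)

section \<open>Symmetric monomials and difference operators\<close>

abbreviation Xv :: "ratfun \<Rightarrow> ratfun" where
  "Xv x \<equiv> x + inverse x"

lemma x_square_not_const: "x \<in> {x12, x13, x23} \<Longrightarrow> x * x \<noteq> const c"
  by (auto simp: xvar_12 xvar_13 xvar_23 const_def Fract_one_eq_iff simp del: mult_fract simp flip: Fract_one_mult)

text \<open>The equation reduces to (u - v)(u v x^2 - 1) = 0, and x^2 is not constant. Shifts are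
  thus distinguished already by the elements x + x^-1, although these generate a smaller
  field.\<close>

lemma Xv_scaled_inj:
  assumes "x \<in> {x12, x13, x23}" "u \<noteq> 0" "v \<noteq> 0" "Xv (const u * x) = Xv (const v * x)"
  shows "u = v"
proof (rule ccontr)
  assume "u \<noteq> v"
  have x: "x \<noteq> 0" using assms(1) by auto
  note C = rhomD[OF rhom_const] rhom_diff[OF rhom_const] rhom_inverse[OF rhom_const]
  have uv: "const u \<noteq> 0" "const v \<noteq> 0" "const u \<noteq> const v"
    using assms \<open>u \<noteq> v\<close> rhom_field_nonzero[OF rhom_const] by (auto simp: const_eq_iff)
  have "(const u - const v) * (x * x * const u * const v - 1) = 0"
  proof -
    have "(Xv (const u * x) - Xv (const v * x)) * (const u * const v * x) = (const u - const v) * (x * x * const u * const v - 1)"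
      using x uv(1,2) by (simp add: divide_simps) (simp add: algebra_simps)
    then show ?thesis using assms(4) by simp
  qed
  then have "x * x * const u * const v = 1" using uv by simp
  then have "x * x = const (inverse (u * v))" using uv by (simp add: C inverse_mult_distrib) (simp add: field_simps)
  then show False using x_square_not_const[OF assms(1)] by blast
qed

text \<open>What the multiplication operators \<open>O_B\<close> produce from 1. It is closed under
  multiplication, hence a domain on which shifts act as characters.\<close>

inductive_set Xmono :: "ratfun set" where
  one: "1 \<in> Xmono"
| mult: "f \<in> Xmono \<Longrightarrow> x \<in> {x12, x13, x23} \<Longrightarrow> Xv x * f \<in> Xmono"

lemma Xmono_mult: "f \<in> Xmono \<Longrightarrow> g \<in> Xmono \<Longrightarrow> f * g \<in> Xmono"
  by (induction rule: Xmono.induct) (auto simp: mult.assoc intro: Xmono.mult)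

definition opsum :: "(qdop \<Rightarrow>\<^sub>0 ratfun) \<Rightarrow> qdop" where
  "opsum P f = pm_lin (\<lambda>h c. c * h f) P"

lemma opsum_simps: "opsum (P + P') f = opsum P f + opsum P' f" "opsum (single h c) f = c * h f" "opsum 0 f = 0"
  unfolding opsum_def by (subst pm_lin_add pm_lin_single; simp add: distrib_right)+ simp

lemma opsum_comp:
  assumes "keys P \<subseteq> hset" "keys P' \<subseteq> hset"
  shows "\<exists>R. keys R \<subseteq> hset \<and> (\<forall>f. opsum R f = opsum P (opsum P' f))"
  using assms(1)
proof (induction P rule: pm_induct_keys)
  case zero
  then show ?case by (intro exI[of _ 0]) (simp add: opsum_simps)
next
  case (add P1 P2)
  then obtain R1 R2 where "keys R1 \<subseteq> hset" "\<forall>f. opsum R1 f = opsum P1 (opsum P' f)"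
    "keys R2 \<subseteq> hset" "\<forall>f. opsum R2 f = opsum P2 (opsum P' f)" by blast
  then show ?case using keys_add[of R1 R2] by (intro exI[of _ "R1 + R2"]) (auto simp: opsum_simps)
next
  case (single h c)
  then have h: "rhom h" by (simp add: hset_def)
  show ?case using assms(2)
  proof (induction P' rule: pm_induct_keys)
    case zero
    then show ?case by (intro exI[of _ 0]) (simp add: opsum_simps rhom_0[OF h])
  next
    case (add P1 P2)
    then obtain R1 R2 where "keys R1 \<subseteq> hset" "\<forall>f. opsum R1 f = opsum (single h c) (opsum P1 f)"
      "keys R2 \<subseteq> hset" "\<forall>f. opsum R2 f = opsum (single h c) (opsum P2 f)" by blast
    then show ?case using keys_add[of R1 R2]
      by (intro exI[of _ "R1 + R2"]) (auto simp: opsum_simps rhomD[OF h] distrib_left)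
  next
    case (single h' c')
    then show ?case
      using hset_comp[OF \<open>h \<in> hset\<close>, of h']
      by (intro exI[of _ "single (h \<circ> h') (c * h c')"]) (auto simp: opsum_simps rhomD[OF h])
  qed
qed

definition diffops :: "qdop set" where
  "diffops = {D. \<exists>P. keys P \<subseteq> hset \<and> (\<forall>f. D f = opsum P f)}"

lemma diffops_single: "h \<in> hset \<Longrightarrow> (\<lambda>f. c * h f) \<in> diffops"
  unfolding diffops_def by (intro CollectI exI[of _ "single h c"]) (auto simp: opsum_simps)

lemma diffops_add: "D \<in> diffops \<Longrightarrow> E \<in> diffops \<Longrightarrow> (\<lambda>f. D f + E f) \<in> diffops"
proof -
  assume "D \<in> diffops" "E \<in> diffops"
  then obtain P P' where "keys P \<subseteq> hset" "\<forall>f. D f = opsum P f" "keys P' \<subseteq> hset" "\<forall>f. E f = opsum P' f"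
    by (auto simp: diffops_def)
  then show ?thesis
    unfolding diffops_def using keys_add[of P P'] by (intro CollectI exI[of _ "P + P'"]) (auto simp: opsum_simps)
qed

lemma diffops_comp: "D \<in> diffops \<Longrightarrow> E \<in> diffops \<Longrightarrow> D \<circ> E \<in> diffops"
proof -
  assume "D \<in> diffops" "E \<in> diffops"
  then obtain P P' where P: "keys P \<subseteq> hset" "\<forall>f. D f = opsum P f" "keys P' \<subseteq> hset" "\<forall>f. E f = opsum P' f"
    by (auto simp: diffops_def)
  obtain R where "keys R \<subseteq> hset" "\<forall>f. opsum R f = opsum P (opsum P' f)"
    using opsum_comp[OF P(1,3)] by blast
  then show ?thesis
    unfolding diffops_def using P(2,4) by (intro CollectI exI[of _ R]) auto
qed

text \<open>The shifts occurring in the operator are distinct characters of \<open>Xmono\<close>, so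
  a relation that holds on symmetric monomials already forces every rational coefficient to
  vanish.\<close>

lemma diffop_eq_zero:
  assumes "D \<in> diffops" "\<And>f. f \<in> Xmono \<Longrightarrow> D f = 0"
  shows "D f = 0"
proof -
  obtain P where P: "keys P \<subseteq> hset" "\<And>f. D f = opsum P f" using assms(1) by (auto simp: diffops_def)
  have "lookup P h = 0" if "h \<in> keys P" for h
  proof (rule characters_independent[where S = Xmono and m = "(*)" and ch = "\<lambda>h. h" and I = "keys P" and g = "lookup P" and i = h])
    show "\<exists>x\<in>Xmono. h x \<noteq> h' x" if h: "h \<in> keys P" "h' \<in> keys P" "h \<noteq> h'" for h h'
    proof (rule ccontr)
      assume "\<not> ?thesis"
      moreover have "Xv x \<in> Xmono" if "x \<in> {x12, x13, x23}" for x
        using Xmono.mult[OF Xmono.one that] by simp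
      ultimately have eq: "h (Xv x) = h' (Xv x)" if "x \<in> {x12, x13, x23}" for x using that by blast
      have hh: "h \<in> hset" "h' \<in> hset" using P h by auto
      have r: "rhom h" "rhom h'" using hh by (auto simp: hset_def)
      have "h x = h' x" if x: "x \<in> {x12, x13, x23}" for x
      proof -
        obtain a b where a: "h x = const (qq powi a) * x" and b: "h' x = const (qq powi b) * x"
          using hh x by (auto simp: hset_def)
        have "Xv (const (qq powi a) * x) = Xv (const (qq powi b) * x)"
          using eq[OF x] by (simp only: rhomD(2)[OF r(1)] rhomD(2)[OF r(2)] rhom_inverse[OF r(1)] rhom_inverse[OF r(2)] a b)
        from Xv_scaled_inj[OF x _ _ this] show ?thesis using a b by simp
      qed
      then have "h = h'" by (intro hset_eqI[OF hh]) auto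
      with h(3) show False by simp
    qed
    show "\<exists>x\<in>Xmono. h x \<noteq> 0" if "h \<in> keys P" for h
      using that P Xmono.one by (intro bexI[of _ 1]) (auto simp: hset_def rhomD(1))
    show "h (x * y) = h x * h y" if "h \<in> keys P" for h x y
      using that P by (auto simp: hset_def rhomD(3))
    show "(\<Sum>h\<in>keys P. lookup P h * h x) = 0" if "x \<in> Xmono" for x
      using assms(2)[OF that] by (simp add: P(2) opsum_def pm_lin_def)
  qed (use that Xmono_mult in auto)
  then have "P = 0" by (intro poly_mapping_eqI) (auto simp: in_keys_iff)
  then show ?thesis by (simp add: P(2) opsum_simps)
qed

subsection \<open>Continuous \<open>q\<close>-Hermite polynomials\<close>

abbreviation Qp :: "int \<Rightarrow> ratfun" where
  "Qp n \<equiv> const (qq powi n)"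

lemma const_simps [simp]: "const 0 = 0" "const 1 = 1"
  by (simp_all add: rhom_0[OF rhom_const] rhomD(1)[OF rhom_const])

lemma const_nonzero: "const c = 0 \<longleftrightarrow> c = 0"
  by (rule rhom_field_nonzero[OF rhom_const])

lemma Qp_add: "Qp (m + n) = Qp m * Qp n"
  by (simp add: power_int_add rhomD(3)[OF rhom_const])

lemma Qp_0: "Qp 0 = 1"
  by (simp add: rhomD(1)[OF rhom_const])

lemma Qp_nonzero: "Qp n \<noteq> 0"
  by (simp add: const_nonzero)

lemma Qp_eq_iff: "Qp m = Qp n \<longleftrightarrow> m = n"
  by (simp only: const_eq_iff qq_powi_inj)

text \<open>Rogers' continuous q-Hermite polynomials in base q^2, divided by (1 - q^2)(1 - q^4) ...
  (1 - q^(2n)). In this normalisation q^-n is the only n-dependent factor in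
  \<open>qherm_shift\<close>.\<close>

fun qherm_nat :: "nat \<Rightarrow> ratfun \<Rightarrow> ratfun" where
  "qherm_nat 0 x = 1"
| "qherm_nat (Suc 0) x = Xv x / (1 - Qp 2)"
| "qherm_nat (Suc (Suc n)) x = (Xv x * qherm_nat (Suc n) x - qherm_nat n x) / (1 - Qp (2 * (int n + 2)))"

definition qherm :: "int \<Rightarrow> ratfun \<Rightarrow> ratfun" where
  "qherm n x = (if n < 0 then 0 else qherm_nat (nat n) x)"

text \<open>At n = -1 the factor on the left is zero, which is what lets h_0 = 1 coexist with h_n =
  0 for negative n. The recurrence then holds for all integers and index shifts act without boundary
  terms.\<close>

lemma qherm_rec: "(1 - Qp (2 * (n + 1))) * qherm (n + 1) x = Xv x * qherm n x - qherm (n - 1) x"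
proof -
  have nz: "1 - Qp k \<noteq> 0" if "k \<noteq> 0" for k
    using Qp_eq_iff[of k 0] that by (simp add: Qp_0)
  consider "n \<le> -2" | "n = -1" | "n = 0" | "n \<ge> 1" by linarith
  then show ?thesis
  proof cases
    case 4
    define m where "m = nat (n - 1)"
    have n: "n = int m + 1" using 4 by (simp add: m_def)
    have "nat (int m + 2) = Suc (Suc m)" "nat (int m + 1) = Suc m" by auto
    then show ?thesis
      unfolding n using nz[of "2 * (int m + 2)"] by (simp add: qherm_def add.commute[of 4 "2 * int m"] add.commute[of 2 "int m"])
  next
    case 2
    then show ?thesis using Qp_0 by (simp add: qherm_def)
  next
    case 3
    then show ?thesis using nz[of 2] by (simp add: qherm_def)
  qed (simp add: qherm_def)
qed

lemma qherm_inverse: "qherm n (inverse x) = qherm n x"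
proof -
  have "qherm_nat k (inverse x) = qherm_nat k x" for k
    by (induction k x rule: qherm_nat.induct) (simp_all add: add.commute)
  then show ?thesis by (simp add: qherm_def)
qed

lemma qherm_fixed:
  assumes T: "rhom T" "\<And>c. T (const c) = const c" and "T x = x"
  shows "T (qherm n x) = qherm n x"
proof -
  have "T (qherm_nat k x) = qherm_nat k x" for k
    using assms(3) by (induction k x rule: qherm_nat.induct)
      (simp_all add: rhomD[OF T(1)] rhom_diff[OF T(1)] rhom_divide[OF T(1)] rhom_inverse[OF T(1)] T(2))
  then show ?thesis by (simp add: qherm_def rhom_0[OF T(1)])
qed

text \<open>Let G(z) be the product of 1/((1 - q^(2m) x z)(1 - q^(2m) z/x)) over m >= 0, the
  generating function of the h_n. The identity is the coefficient of z^n in T G(z) = (1 - x z/q)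
  G(z/q). The induction applies \<open>T\<close> to the recurrence and uses the two preceding
  indices.\<close>

lemma qherm_shift:
  assumes T: "rhom T" "\<And>c. T (const c) = const c" and x: "T x = Qp 1 * x" "x \<noteq> 0"
  shows "T (qherm n x) = Qp (- n) * (qherm n x - x * qherm (n - 1) x)"
proof -
  have "T (qherm (int k) x) = Qp (- int k) * (qherm (int k) x - x * qherm (int k - 1) x)" for k
  proof (induction k rule: less_induct)
    case (less k)
    show ?case
    proof (cases k)
      case 0
      then show ?thesis using Qp_0 by (simp add: qherm_def rhomD(1)[OF T(1)])
    next
      case (Suc m)
      define n where "n = int m"
      define u where "u = Qp (- n)"
      define q where "q = Qp 1"
      define v where "v = Qp (2 * n)"
      have q: "q \<noteq> 0" "u \<noteq> 0" "Qp (- (n + 1)) = u / q" "Qp (- (n - 1)) = u * q"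
        using Qp_add[of "- n" "- 1"] Qp_add[of "- n" 1]
        by (simp_all add: q_def u_def Qp_nonzero const_nonzero rhom_inverse[OF rhom_const] divide_inverse)
      have Q2: "Qp (2 * (n + 1)) = v * (q * q)" "Qp (2 * n) = v"
        using Qp_add[of "2 * n" 2] Qp_add[of 1 1] by (simp_all add: q_def v_def algebra_simps)
      have IH: "T (qherm n x) = u * (qherm n x - x * qherm (n - 1) x)"
        using less[of m] Suc by (simp add: n_def u_def)
      have IH': "T (qherm (n - 1) x) = u * q * (qherm (n - 1) x - x * qherm (n - 2) x)"
      proof (cases m)
        case 0
        then show ?thesis by (simp add: n_def qherm_def rhom_0[OF T(1)])
      next
        case (Suc j)
        then have "int j = n - 1" "j < k" using \<open>k = Suc m\<close> by (auto simp: n_def)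
        then show ?thesis using less[of j] q by simp
      qed
      have TX: "T (Xv x) = q * x + inverse x / q"
        using x q by (simp add: rhomD[OF T(1)] rhom_inverse[OF T(1)] q_def divide_inverse mult.commute)
      have r1: "(1 - v * (q * q)) * qherm (n + 1) x = Xv x * qherm n x - qherm (n - 1) x"
        using qherm_rec[of n x] by (simp only: Q2)
      have r0: "(1 - v) * qherm n x = Xv x * qherm (n - 1) x - qherm (n - 2) x"
        using qherm_rec[of "n - 1" x] by (simp add: Q2)
      have nz: "1 - v * (q * q) \<noteq> 0"
        using Qp_eq_iff[of "2 * (n + 1)" 0] unfolding Qp_0 Q2 by (simp add: n_def)
      have "(1 - v * (q * q)) * T (qherm (n + 1) x) = T ((1 - Qp (2 * (n + 1))) * qherm (n + 1) x)"
        by (simp only: rhomD(1,3)[OF T(1)] rhom_diff[OF T(1)] T(2) Q2(1)[symmetric])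
      also have "\<dots> = T (Xv x) * T (qherm n x) - T (qherm (n - 1) x)"
        by (simp only: qherm_rec rhomD[OF T(1)] rhom_diff[OF T(1)])
      also have "\<dots> = (q * x + inverse x / q) * (u * (qherm n x - x * qherm (n - 1) x))
          - u * q * (qherm (n - 1) x - x * qherm (n - 2) x)"
        by (simp only: TX IH IH')
      also have "\<dots> = u / q * ((1 - v * (q * q)) * qherm (n + 1) x - x * (1 - v * (q * q)) * qherm n x)"
      proof -
        have e: "qherm (n - 2) x = Xv x * qherm (n - 1) x - (1 - v) * qherm n x"
          using r0 by simp
        show ?thesis unfolding r1 e using q x(2) by (simp add: divide_simps) (simp add: algebra_simps)
      qed
      also have "\<dots> = (1 - v * (q * q)) * (u / q * (qherm (n + 1) x - x * qherm n x))"
      proof -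
        have "a * (k * r - x * k * s) = k * (a * (r - x * s))" for a k r s :: ratfun
          by (simp add: algebra_simps)
        then show ?thesis .
      qed
      finally have "T (qherm (n + 1) x) = u / q * (qherm (n + 1) x - x * qherm n x)"
        unfolding mult_cancel_left using nz by blast
      then show ?thesis using Suc q(3) by (simp add: n_def add.commute)
    qed
  qed
  from this[of "nat n"] show ?thesis
    by (cases "n < 0") (simp_all add: qherm_def rhom_0[OF T(1)])
qed

lemma qherm_shift_inverse:
  assumes T: "rhom T" "\<And>c. T (const c) = const c" and x: "T x = Qp (- 1) * x" "x \<noteq> 0"
  shows "T (qherm n x) = Qp (- n) * (qherm n x - inverse x * qherm (n - 1) x)"
proof -
  have "T (inverse x) = Qp 1 * inverse x"
    using x by (simp add: rhom_inverse[OF T(1)] rhom_inverse[OF rhom_const])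
  from qherm_shift[OF T this] show ?thesis using x by (simp add: qherm_inverse)
qed

text \<open>If h_(n+1) were zero, so would be its shift, and \<open>qherm_shift\<close> would force
  h_n to vanish.\<close>

lemma qherm_nonzero:
  assumes T: "rhom T" "\<And>c. T (const c) = const c" and x: "T x = Qp 1 * x" "x \<noteq> 0"
  shows "n \<ge> 0 \<Longrightarrow> qherm n x \<noteq> 0"
proof (induction n rule: int_ge_induct)
  case (step n)
  show ?case
  proof
    assume "qherm (n + 1) x = 0"
    then have "Qp (- (n + 1)) * (x * qherm n x) = 0"
      using qherm_shift[OF T x, of "n + 1"] by (simp add: rhom_0[OF T(1)])
    then show False using step Qp_nonzero[of "- (n + 1)"] x(2) by simp
  qed
qed (simp add: qherm_def)

lemma x_inverse_noteq: "x \<in> {x12, x13, x23} \<Longrightarrow> x - inverse x \<noteq> 0"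
  using x_square_not_const[of x 1] by (auto simp: rhomD(1)[OF rhom_const] field_simps)

text \<open>The four summands combine into products of antisymmetrised expressions in x and in x',
  such as \<open>Ap - Am\<close>, in which the denominators x - x^-1 cancel. What remains involves
  h_n, h_(n-1) and (x + x^-1) h_(n-1), to which the recurrence applies.\<close>

lemma O_A_formula_qherm:
  assumes x: "x \<in> {x12, x13, x23}" "x' \<in> {x12, x13, x23}" "z \<in> {x12, x13, x23}"
    and xv: "xvar k i = x" "xvar k j = x'" "xvar i j = z"
    and T: "\<And>a. Tshift k i a x = Qp a * x" "\<And>a. Tshift k i a x' = x'" "\<And>a. Tshift k i a z = z"
    and T': "\<And>a. Tshift k j a x' = Qp a * x'" "\<And>a. Tshift k j a x = x" "\<And>a. Tshift k j a z = z"
  shows "O_A_formula k i j (qherm n x * qherm m x' * qherm l z) =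
    const (inverse tt) * Qp (- n - m) * (qherm n x * qherm m x' * qherm l z)
    + const tt * Qp (n + m) * (qherm n x * qherm m x' * qherm l z)
    - const tt * Qp (n - m) * (qherm n x * qherm (m - 2) x' * qherm l z)
    - const tt * Qp (m - n) * (qherm (n - 2) x * qherm m x' * qherm l z)
    + const tt * Qp (- n - m) * (qherm (n - 2) x * qherm (m - 2) x' * qherm l z)
    - Qp (- n - m) * (qherm (n - 1) x * qherm (m - 1) x' * qherm (l + 1) z)
    + Qp (2 * l + 2 - n - m) * (qherm (n - 1) x * qherm (m - 1) x' * qherm (l + 1) z)
    - Qp (- n - m) * (qherm (n - 1) x * qherm (m - 1) x' * qherm (l - 1) z)"
proof -
  have nz: "x \<noteq> 0" "x' \<noteq> 0" "z \<noteq> 0" using x by auto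
  define t where "t = const tt"
  have t: "t \<noteq> 0" "const (inverse tt) = inverse t"
    by (simp_all add: t_def const_nonzero rhom_inverse[OF rhom_const])
  define d d' where "d = x - inverse x" and "d' = x' - inverse x'"
  have d: "d \<noteq> 0" "d' \<noteq> 0" unfolding d_def d'_def by (rule x_inverse_noteq[OF x(1)] x_inverse_noteq[OF x(2)])+
  define h0 h1 g0 g1 w where "h0 = qherm n x" and "h1 = qherm (n - 1) x"
    and "g0 = qherm m x'" and "g1 = qherm (m - 1) x'" and "w = qherm l z"
  define Ap Am where "Ap = (h0 - x * h1) / d" and "Am = (h0 - inverse x * h1) / d"
  define Bp Bm where "Bp = (g0 - x' * g1) / d'" and "Bm = (g0 - inverse x' * g1) / d'"
  define P R where "P = Qp (- n)" and "R = Qp (- m)"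
  define u where "u = P * R"
  have A: "Ap - Am = - h1" "inverse x * Ap - x * Am = - h0" "x * Ap - inverse x * Am = h0 - Xv x * h1"
    unfolding Ap_def Am_def using d nz by (simp_all add: divide_simps) (simp_all add: d_def field_simps)
  have B: "Bp - Bm = - g1" "inverse x' * Bp - x' * Bm = - g0" "x' * Bp - inverse x' * Bm = g0 - Xv x' * g1"
    unfolding Bp_def Bm_def using d nz by (simp_all add: divide_simps) (simp_all add: d'_def field_simps)
  note TR = Tshift_props(1,2)
  have f: "Tshift k j b h0 = h0" "Tshift k j b w = w" "Tshift k i b w = w" "Tshift k i b g0 = g0" "Tshift k i b g1 = g1" for b
    unfolding h0_def g0_def g1_def w_def
    by (rule qherm_fixed[OF TR]; simp add: T T')+
  have g': "Tshift k j 1 g0 = Qp (- m) * (g0 - x' * g1)" "Tshift k j (- 1) g0 = Qp (- m) * (g0 - inverse x' * g1)"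
    using qherm_shift[OF TR T'(1) nz(2), of m] qherm_shift_inverse[OF TR T'(1) nz(2), of m]
    by (simp_all add: g0_def g1_def)
  have fg: "Tshift k i a (Tshift k j b g0) = Tshift k j b g0" if "b = 1 \<or> b = - 1" for a b
    using that unfolding g' by (auto simp only: g' rhomD[OF TR(1)] rhom_diff[OF TR(1)] rhom_inverse[OF TR(1)] TR(2) T(2) f)
  have S: "Tshift k i a (Tshift k j b (h0 * g0 * w)) = Tshift k i a h0 * Tshift k j b g0 * w" if "b = 1 \<or> b = - 1" for a b
    by (simp only: rhomD(3)[OF TR(1)] f fg[OF that])
  have h: "Tshift k i 1 h0 = P * d * Ap" "Tshift k i (- 1) h0 = P * d * Am"
    using qherm_shift[OF TR T(1) nz(1), of n] qherm_shift_inverse[OF TR T(1) nz(1), of n] d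
    by (simp_all add: h0_def h1_def Ap_def Am_def P_def)
  have g: "Tshift k j 1 g0 = R * d' * Bp" "Tshift k j (- 1) g0 = R * d' * Bm"
    using d by (simp_all add: g' Bp_def Bm_def R_def)
  \<comment> \<open>The core is (1 - t y y' z)(1 - t y y'/z)/(t y y') = 1/(t y y') + t y y' - (z +
    1/z); the factors \<open>d\<close> and \<open>d'\<close> cancel against those of the shifted
    polynomials.\<close>
  have term_eq: "s * ((1 - t * y * y' * z) * (1 - t * y * y' * inverse z) / (t * y * y' * d * d')) * (P * d * a * (R * d' * b) * w)
    = s * (u * w * (inverse t * (inverse y * a) * (inverse y' * b) + t * (y * a) * (y' * b) - Xv z * a * b))"
    if "y \<noteq> 0" "y' \<noteq> 0" for y y' a b s
    unfolding u_def using that t d nz by (simp add: divide_simps) (simp add: algebra_simps)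
  have "O_A_formula k i j (h0 * g0 * w) =
    u * w * (inverse t * (inverse x * Ap) * (inverse x' * Bp) + t * (x * Ap) * (x' * Bp) - Xv z * Ap * Bp)
    - u * w * (inverse t * (inverse x * Ap) * (x' * Bm) + t * (x * Ap) * (inverse x' * Bm) - Xv z * Ap * Bm)
    - u * w * (inverse t * (x * Am) * (inverse x' * Bp) + t * (inverse x * Am) * (x' * Bp) - Xv z * Am * Bp)
    + u * w * (inverse t * (x * Am) * (x' * Bm) + t * (inverse x * Am) * (inverse x' * Bm) - Xv z * Am * Bm)"
  proof -
    have sum4: "(\<Sum>a\<in>{1, -1::int}. \<Sum>b\<in>{1, -1::int}. F a b) = F 1 1 + F 1 (- 1) + F (- 1) 1 + F (- 1) (- 1)" for F :: "int \<Rightarrow> int \<Rightarrow> ratfun"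
      by simp
    have nzi: "inverse x \<noteq> 0" "inverse x' \<noteq> 0" using nz by simp_all
    show ?thesis
      unfolding O_A_formula_def xv t_def[symmetric] d_def[symmetric] d'_def[symmetric] sum4
        S[OF disjI1[OF refl]] S[OF disjI2[OF refl]] h g power_int_1_right power_int_minus1_right
        term_eq[OF nz(1,2)] term_eq[OF nz(1) nzi(2)] term_eq[OF nzi(1) nz(2)] term_eq[OF nzi]
      by simp
  qed
  also have "\<dots> = u * w * (inverse t * (inverse x * Ap - x * Am) * (inverse x' * Bp - x' * Bm)
      + t * (x * Ap - inverse x * Am) * (x' * Bp - inverse x' * Bm) - Xv z * (Ap - Am) * (Bp - Bm))"
    by (simp add: algebra_simps)
  also have "\<dots> = u * w * (inverse t * h0 * g0 + t * (h0 - Xv x * h1) * (g0 - Xv x' * g1) - Xv z * h1 * g1)"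
    unfolding A B by simp
  also have "\<dots> = inverse t * u * (h0 * g0 * w) + t * u * ((h0 - Xv x * h1) * (g0 - Xv x' * g1) * w) - u * (h1 * g1 * (Xv z * w))"
    by (simp add: algebra_simps)
  also have "h0 - Xv x * h1 = Qp (2 * n) * qherm n x - qherm (n - 2) x"
    using qherm_rec[of "n - 1" x] by (simp add: h0_def h1_def algebra_simps)
  also have "g0 - Xv x' * g1 = Qp (2 * m) * qherm m x' - qherm (m - 2) x'"
    using qherm_rec[of "m - 1" x'] by (simp add: g0_def g1_def algebra_simps)
  also have "Xv z * w = (1 - Qp (2 * (l + 1))) * qherm (l + 1) z + qherm (l - 1) z"
    using qherm_rec[of l z] by (simp add: w_def)
  finally have "O_A_formula k i j (h0 * g0 * w) = inverse t * u * (h0 * g0 * w)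
      + t * u * ((Qp (2 * n) * qherm n x - qherm (n - 2) x) * (Qp (2 * m) * qherm m x' - qherm (m - 2) x') * w)
      - u * (h1 * g1 * ((1 - Qp (2 * (l + 1))) * qherm (l + 1) z + qherm (l - 1) z))" .
  moreover have "Qp (- n - m) = u"
    using Qp_add[of "- n" "- m"] by (simp add: u_def P_def R_def)
  moreover have "Qp (n + m) = u * Qp (2 * n) * Qp (2 * m)" "Qp (n - m) = u * Qp (2 * n)" "Qp (m - n) = u * Qp (2 * m)"
    "Qp (2 * l + 2 - n - m) = u * Qp (2 * (l + 1))"
    by (simp_all only: u_def P_def R_def Qp_add[symmetric]) (simp_all add: algebra_simps)
  ultimately show ?thesis
    unfolding t t_def[symmetric] h0_def h1_def g0_def g1_def w_def by (simp add: algebra_simps)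
qed

subsection \<open>The quantum torus acting on families indexed by \<open>\<int>\<^sup>3\<close>\<close>

lemma qlaurent_to_K_eq: "qlaurent_to_K r = pm_lin (\<lambda>n z. of_int z * qh powi n) r"
  by (simp add: qlaurent_to_K_def pm_lin_def)

lemma qlaurent_to_K_add: "qlaurent_to_K (r + s) = qlaurent_to_K r + qlaurent_to_K s"
  unfolding qlaurent_to_K_eq by (rule pm_lin_add) (simp_all add: distrib_right)

lemma qlaurent_to_K_single: "qlaurent_to_K (single n z) = of_int z * qh powi n"
  unfolding qlaurent_to_K_eq by (rule pm_lin_single) simp

lemma qlaurent_to_K_0 [simp]: "qlaurent_to_K 0 = 0"
  by (simp add: qlaurent_to_K_def)

lemma qlaurent_to_K_1 [simp]: "qlaurent_to_K 1 = 1"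
  using qlaurent_to_K_single[of 0 1] by simp

lemma qlaurent_to_K_mult: "qlaurent_to_K (r * s) = qlaurent_to_K r * qlaurent_to_K s"
proof (induction r rule: pm_induct)
  case (single n z)
  show ?case
  proof (induction s rule: pm_induct)
    case (single m w)
    show ?case
      by (simp add: mult_single qlaurent_to_K_single power_int_add)
  qed (simp_all add: distrib_left qlaurent_to_K_add)
qed (simp_all add: distrib_right qlaurent_to_K_add)

lemma qlaurent_to_K_qpow: "qlaurent_to_K (qpow r) = qh powi \<lfloor>2 * r\<rfloor>"
  by (simp add: qpow_def qlaurent_to_K_single)

text \<open>
  Modulo the central direction \<open>c7\<close>, a weight \<open>v\<close> is given by the integers \<open>\<alpha>\<^sub>i = 2 v\<^sub>i - v\<^sub>7\<close>. The monomial
  \<open>Y\<^sub>v\<close> shifts the three indices by \<open>\<alpha>\<^sub>1, \<alpha>\<^sub>3, \<alpha>\<^sub>5\<close>, and its coefficient \<open>coef v\<close> is such that \<open>Y\<^sub>c\<close> is \<open>-q/t\<close>.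
\<close>

definition ai :: "7 \<Rightarrow> weight \<Rightarrow> int" where
  "ai i v = \<lfloor>2 * v $ i - v $ 7\<rfloor>"

definition dwt :: "weight \<Rightarrow> int" where
  "dwt v = (ai 2 v - ai 1 v) + (ai 4 v - ai 3 v) + (ai 6 v - ai 5 v)"

definition qexp :: "weight \<Rightarrow> int \<Rightarrow> int \<Rightarrow> int \<Rightarrow> int" where
  "qexp v a b c = dwt v + 2 * \<lfloor>v $ 7\<rfloor>
     + (ai 2 v - ai 1 v) * (2 * a - ai 1 v) + (ai 4 v - ai 3 v) * (2 * b - ai 3 v) + (ai 6 v - ai 5 v) * (2 * c - ai 5 v)"

definition monoK :: "int \<Rightarrow> int \<Rightarrow> int \<Rightarrow> scalar" where
  "monoK s m n = of_int s * qh powi m * tt powi n"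

definition coef :: "weight \<Rightarrow> int \<Rightarrow> int \<Rightarrow> int \<Rightarrow> scalar" where
  "coef v a b c = monoK (if even (dwt v div 2 + \<lfloor>v $ 7\<rfloor>) then 1 else - 1) (qexp v a b c) (- \<lfloor>v $ 7\<rfloor>)"

lemma monoK_mult: "monoK s m n * monoK s' m' n' = monoK (s * s') (m + m') (n + n')"
  by (simp add: monoK_def power_int_add)

text \<open>Pairing with e_1 makes \<open>v $ 7\<close> - 2 \<open>v $ 2\<close> integral, hence
  also \<open>v $ 7\<close>; pairing with e_7 makes \<open>dwt v\<close> even. The floors and the
  halving in \<open>coef\<close> therefore lose nothing.\<close>

lemma Lat_tilde_X7:
  assumes "v \<in> Lat_tilde X7"
  shows "v $ 7 = of_int \<lfloor>v $ 7\<rfloor>" "2 * v $ i - v $ 7 = of_int (ai i v)" "even (dwt v)"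
proof -
  have fm: "form X7 (ebas i) v \<in> \<int>" for i
    using assms by (auto simp: Lat_tilde_def Lat_def ebas_def axis_def)
  have two: "2 * v $ i \<in> \<int>" for i
    using assms by (auto simp: Lat_tilde_def Lat_def)
  have "form X7 (ebas 1) v = v $ 7 - 2 * v $ 2"
    by (simp add: form_def sum_7 ebas_def axis_def repD[OF rep_X7] X7_mat_def)
  then have "v $ 7 = form X7 (ebas 1) v + 2 * v $ 2" by simp
  then have v7: "v $ 7 \<in> \<int>" using fm[of 1] two[of 2] by (metis Ints_add)
  then show "v $ 7 = of_int \<lfloor>v $ 7\<rfloor>" by (auto elim: Ints_cases)
  have ai: "2 * v $ i - v $ 7 = of_int (ai i v)" for i
    using Ints_diff[OF two[of i] v7] unfolding ai_def by (auto elim: Ints_cases)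
  then show "2 * v $ i - v $ 7 = of_int (ai i v)" .
  have "2 * form X7 (ebas 7) v = of_int (dwt v)"
    unfolding dwt_def of_int_add of_int_diff ai[symmetric]
    by (simp add: form_def sum_7 ebas_def axis_def repD[OF rep_X7] X7_mat_def)
  moreover obtain z where "form X7 (ebas 7) v = of_int z" using fm[of 7] by (auto elim: Ints_cases)
  ultimately have "of_int (dwt v) = (of_int (2 * z) :: rat)" by simp
  then show "even (dwt v)" unfolding of_int_eq_iff by simp
qed

lemma Lat_tilde_X7_add:
  assumes "v \<in> Lat_tilde X7" "w \<in> Lat_tilde X7"
  shows "\<lfloor>v $ 7 + w $ 7\<rfloor> = \<lfloor>v $ 7\<rfloor> + \<lfloor>w $ 7\<rfloor>" "ai i (v + w) = ai i v + ai i w"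
    "dwt (v + w) = dwt v + dwt w"
proof -
  note L = Lat_tilde_X7[OF Lat_tilde_add[OF assms]] Lat_tilde_X7[OF assms(1)] Lat_tilde_X7[OF assms(2)]
  have "of_int \<lfloor>(v + w) $ 7\<rfloor> = (of_int (\<lfloor>v $ 7\<rfloor> + \<lfloor>w $ 7\<rfloor>) :: rat)"
    unfolding of_int_add L(1)[symmetric] L(4)[symmetric] L(7)[symmetric] by simp
  then have "\<lfloor>(v + w) $ 7\<rfloor> = \<lfloor>v $ 7\<rfloor> + \<lfloor>w $ 7\<rfloor>" unfolding of_int_eq_iff .
  then show "\<lfloor>v $ 7 + w $ 7\<rfloor> = \<lfloor>v $ 7\<rfloor> + \<lfloor>w $ 7\<rfloor>" by simp
  have a: "ai i (v + w) = ai i v + ai i w" for i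
  proof -
    have "of_int (ai i (v + w)) = (of_int (ai i v + ai i w) :: rat)"
      unfolding of_int_add L(2)[symmetric] L(5)[symmetric] L(8)[symmetric] by simp
    then show ?thesis unfolding of_int_eq_iff .
  qed
  then show "ai i (v + w) = ai i v + ai i w" .
  show "dwt (v + w) = dwt v + dwt w" by (simp add: dwt_def a)
qed

lemma sign_mult: "(if even x then 1 else - 1) * (if even y then 1 else - 1) = (if even (x + y) then 1 else - 1 :: int)" for x y :: int
  by auto

text \<open>The cocycle identity of a right action: the coefficient of \<open>w\<close> comes first,
  then that of \<open>v\<close> at indices moved by \<open>w\<close>. The quadratic exponents
  \<open>qexp\<close> fail to be additive by exactly -2 (v, w), counted in powers of
  q^(1/2).\<close>

lemma coef_mult:
  assumes v: "v \<in> Lat_tilde X7" and w: "w \<in> Lat_tilde X7"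
  shows "coef w a b c * coef v (a - ai 1 w) (b - ai 3 w) (c - ai 5 w) =
    qh powi \<lfloor>2 * - form X7 v w\<rfloor> * coef (v + w) a b c"
proof -
  note A = Lat_tilde_X7_add[OF v w]
  define E where "E = (ai 1 v * ai 2 w - ai 1 w * ai 2 v) + (ai 3 v * ai 4 w - ai 3 w * ai 4 v) + (ai 5 v * ai 6 w - ai 5 w * ai 6 v)"
  have "2 * - form X7 v w = of_int E"
    unfolding E_def of_int_add of_int_diff of_int_mult Lat_tilde_X7(2)[OF v, symmetric] Lat_tilde_X7(2)[OF w, symmetric]
    by (simp add: form_def sum_7 repD[OF rep_X7] X7_mat_def algebra_simps)
  then have "\<lfloor>2 * - form X7 v w\<rfloor> = E" by (simp only: floor_of_int)
  then have "qh powi \<lfloor>2 * - form X7 v w\<rfloor> = monoK 1 E 0" by (simp add: monoK_def)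
  moreover have "qexp w a b c + qexp v (a - ai 1 w) (b - ai 3 w) (c - ai 5 w) = E + qexp (v + w) a b c"
    unfolding qexp_def vector_add_component A dwt_def E_def by (simp add: algebra_simps)
  moreover have "(dwt v + dwt w) div 2 = dwt v div 2 + dwt w div 2"
    using Lat_tilde_X7(3)[OF v] by (simp add: div_plus_div_distrib_dvd_left)
  ultimately show ?thesis
    unfolding coef_def vector_add_component A
    by (simp only: monoK_mult sign_mult) (simp add: add_ac)
qed

type_synonym family = "int \<Rightarrow> int \<Rightarrow> int \<Rightarrow> ratfun"

definition actT :: "family \<Rightarrow> qtorus \<Rightarrow> family" where
  "actT H f a b c = pm_lin (\<lambda>v r. const (qlaurent_to_K r * coef v a b c) * H (a - ai 1 v) (b - ai 3 v) (c - ai 5 v)) f"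

lemma actT_add: "actT H (f + g) a b c = actT H f a b c + actT H g a b c"
  unfolding actT_def
  by (rule pm_lin_add) (simp_all add: qlaurent_to_K_add rhomD[OF rhom_const] distrib_right)

lemma actT_0 [simp]: "actT H 0 a b c = 0"
  by (simp add: actT_def pm_lin_def)

lemma actT_single: "actT H (single v r) a b c =
    const (qlaurent_to_K r * coef v a b c) * H (a - ai 1 v) (b - ai 3 v) (c - ai 5 v)"
  unfolding actT_def by (rule pm_lin_single) simp

definition klin :: "qdop \<Rightarrow> bool" where
  "klin D \<longleftrightarrow> (\<forall>f g. D (f + g) = D f + D g) \<and> (\<forall>c f. D (const c * f) = const c * D f)"

lemma klinD: "klin D \<Longrightarrow> D (f + g) = D f + D g" "klin D \<Longrightarrow> D (const c * f) = const c * D f"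
  by (auto simp: klin_def)

lemma klin_0: "klin D \<Longrightarrow> D 0 = 0"
  using klinD(2)[of D 0 0] by simp

lemma klin_of_int: "klin D \<Longrightarrow> D (of_int z * f) = of_int z * D f"
  using klinD(2)[of D "of_int z" f] by (simp add: rhom_of_int[OF rhom_const])

lemma klin_actT:
  assumes "klin D"
  shows "D (actT H f a b c) = actT (\<lambda>a b c. D (H a b c)) f a b c"
  by (induction f rule: pm_induct)
    (simp_all add: klin_0[OF assms] actT_add klinD[OF assms] actT_single)

lemma actT_family_add: "actT (\<lambda>a b c. H a b c + H' a b c) f a b c = actT H f a b c + actT H' f a b c"
  by (induction f rule: pm_induct) (simp_all add: actT_add actT_single distrib_left)

lemma actT_family_scale: "actT (\<lambda>a b c. const k * H a b c) f a b c = const k * actT H f a b c"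
  by (induction f rule: pm_induct) (simp_all add: actT_add actT_single distrib_left)

text \<open>A right action on the indices. If D and E act on the family as \<open>f\<close> and
  \<open>g\<close>, then D E acts by applying \<open>g\<close> to the family already moved by
  \<open>f\<close>, because D passes through the index action of \<open>g\<close>. The product of
  operators thus corresponds to \<open>f \<odot> g\<close> in this order.\<close>

lemma actT_mult:
  assumes f: "keys f \<subseteq> Lat_tilde X7" and g: "keys g \<subseteq> Lat_tilde X7"
  shows "actT H (f \<odot> g) a b c = actT (actT H f) g a b c"
  using f
proof (induction f rule: pm_induct_keys)
  case zero
  have "actT (actT H 0) g a b c = actT (\<lambda>a b c. const 0 * 0) g a b c"
    by (rule arg_cong[where f = "\<lambda>F. actT F g a b c"]) (simp add: fun_eq_iff)
  then show ?case by (simp only: actT_family_scale) simp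
next
  case (add f1 f2)
  have "actT H (f1 + f2) = (\<lambda>a b c. actT H f1 a b c + actT H f2 a b c)"
    by (simp add: fun_eq_iff actT_add)
  then show ?case using add by (simp add: qt_mult_add_left actT_add actT_family_add)
next
  case (single v r)
  show ?case using g
  proof (induction g rule: pm_induct_keys)
    case (single w s)
    have "qlaurent_to_K (qpow (- form X7 v w) * r * s) * coef (v + w) a b c =
      (qlaurent_to_K s * coef w a b c) * (qlaurent_to_K r * coef v (a - ai 1 w) (b - ai 3 w) (c - ai 5 w))"
      using coef_mult[OF \<open>v \<in> Lat_tilde X7\<close> \<open>w \<in> Lat_tilde X7\<close>, of a b c]
      by (simp add: qlaurent_to_K_mult qlaurent_to_K_qpow mult_ac)
    then show ?case
      using Lat_tilde_X7_add(2)[OF \<open>v \<in> Lat_tilde X7\<close> \<open>w \<in> Lat_tilde X7\<close>]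
      by (simp add: actT_single qt_mult_single rhomD(3)[OF rhom_const] algebra_simps)
  qed (simp_all add: qt_mult_add_right actT_add)
qed

definition Hfam :: family where
  "Hfam a b c = qherm a x23 * qherm b x13 * qherm c x12"

lemma actT_tm: "actT H (tm (v, s, z)) a b c = const (monoK (z * (if even (dwt (wt v) div 2 + \<lfloor>wt v $ 7\<rfloor>) then 1 else - 1))
    (s + qexp (wt v) a b c) (- \<lfloor>wt v $ 7\<rfloor>)) * H (a - ai 1 (wt v)) (b - ai 3 (wt v)) (c - ai 5 (wt v))"
  by (simp add: tm_def actT_single qlaurent_to_K_single coef_def monoK_def power_int_add mult_ac)

lemma monoK_Qp: "const (inverse tt) * Qp n = const (monoK 1 (2 * n) (- 1))" "const tt * Qp n = const (monoK 1 (2 * n) 1)"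
  "Qp n = const (monoK 1 (2 * n) 0)"
  by (simp_all add: monoK_def qq_powi rhomD[OF rhom_const] mult.commute)

lemma monoK_uminus: "const (monoK (- s) m n) = - const (monoK s m n)"
  by (simp add: monoK_def rhom_uminus[OF rhom_const])

lemma floor_minus_one: "\<lfloor>- 1 :: rat\<rfloor> = - 1"
  using floor_of_int[where 'a = rat, of "- 1"] by simp

lemmas actT_simps = floor_minus_one actT_tm actT_add monoK_uminus ai_def dwt_def qexp_def

lemma O_B_Hfam:
  "O_B 1 2 (Hfam a b c) = actT Hfam (ip LB12) a b c"
  "O_B 1 3 (Hfam a b c) = actT Hfam (ip LB13) a b c"
  "O_B 2 3 (Hfam a b c) = actT Hfam (ip LB23) a b c"
proof -
  have X: "Xv x * qherm n x = qherm (n + 1) x - const (monoK 1 (4 * n + 4) 0) * qherm (n + 1) x + qherm (n - 1) x" for n x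
    using qherm_rec[of n x] by (simp only: monoK_Qp(3)) (simp add: algebra_simps)
  have one: "const (monoK 1 0 0) = 1" by (simp add: monoK_def)
  have e: "O_B 1 2 (Hfam a b c) = qherm a x23 * qherm b x13 * (Xv x12 * qherm c x12)"
    "O_B 1 3 (Hfam a b c) = qherm a x23 * (Xv x13 * qherm b x13) * qherm c x12"
    "O_B 2 3 (Hfam a b c) = (Xv x23 * qherm a x23) * qherm b x13 * qherm c x12"
    unfolding O_B_def Hfam_def by (simp_all add: xvar_sym algebra_simps)
  show "O_B 1 2 (Hfam a b c) = actT Hfam (ip LB12) a b c"
    "O_B 1 3 (Hfam a b c) = actT Hfam (ip LB13) a b c"
    "O_B 2 3 (Hfam a b c) = actT Hfam (ip LB23) a b c"
    unfolding e X LB12_def LB13_def LB23_def by (simp_all add: actT_simps Hfam_def one algebra_simps)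
qed

text \<open>\<open>L_A\<close> consists of eight monomials: one alone, three from its factor
  \<open>L_B\<close>, and four from the last product. They match the eight terms of
  \<open>O_A_formula_qherm\<close>.\<close>

lemma O_A_Hfam:
  "O_A 1 (Hfam a b c) = actT Hfam (ip LA1) a b c"
  "O_A 2 (Hfam a b c) = actT Hfam (ip LA2) a b c"
  "O_A 3 (Hfam a b c) = actT Hfam (ip LA3) a b c"
proof -
  have m: "x12 \<in> {x12, x13, x23}" "x13 \<in> {x12, x13, x23}" "x23 \<in> {x12, x13, x23}" by simp_all
  have xv: "xvar 1 2 = x12" "xvar 1 3 = x13" "xvar 2 3 = x23" "xvar 2 1 = x12" "xvar 3 1 = x13" "xvar 3 2 = x23"
    by (simp_all add: xvar_sym)
  note P = Tshift_props and P' = Tshift_props[folded Tshift_sym]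
  have "O_A 1 (Hfam a b c) = O_A_formula 1 2 3 (qherm c x12 * qherm b x13 * qherm a x23)"
    "O_A 2 (Hfam a b c) = O_A_formula 2 1 3 (qherm c x12 * qherm a x23 * qherm b x13)"
    "O_A 3 (Hfam a b c) = O_A_formula 3 1 2 (qherm b x13 * qherm a x23 * qherm c x12)"
    by (simp_all add: O_A_def Hfam_def mult_ac)
  note E = this(1)[unfolded O_A_formula_qherm[OF m(1) m(2) m(3) xv(1) xv(2) xv(3) P(3) P(4) P(5) P(7) P(6) P(8)]]
    this(2)[unfolded O_A_formula_qherm[OF m(1) m(3) m(2) xv(4) xv(3) xv(2) P'(3) P'(5) P'(4) P(11) P(9) P(10)]]
    this(3)[unfolded O_A_formula_qherm[OF m(2) m(3) m(1) xv(5) xv(6) xv(1) P'(7) P'(8) P'(6) P'(11) P'(10) P'(9)]]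
  have comm: "- (c * 2) - b * 2 = - (b * 2) - c * 2" "- (c * 2) - a * 2 = - (a * 2) - c * 2" "- (b * 2) - a * 2 = - (a * 2) - b * 2" by simp_all
  note L = LA1_def LA2_def LA3_def LB12_def LB13_def LB23_def one_q7_def mk7_def unit7_def X7_mat_def
  show "O_A 1 (Hfam a b c) = actT Hfam (ip LA1) a b c"
    unfolding E monoK_Qp(1,2) unfolding monoK_Qp(3) L by (simp add: actT_simps Hfam_def comm algebra_simps)
  show "O_A 2 (Hfam a b c) = actT Hfam (ip LA2) a b c"
    unfolding E monoK_Qp(1,2) unfolding monoK_Qp(3) L by (simp add: actT_simps Hfam_def comm algebra_simps)
  show "O_A 3 (Hfam a b c) = actT Hfam (ip LA3) a b c"
    unfolding E monoK_Qp(1,2) unfolding monoK_Qp(3) L by (simp add: actT_simps Hfam_def comm algebra_simps)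
qed

subsection \<open>Faithfulness\<close>

lemma klin_sum: "klin D \<Longrightarrow> D (\<Sum>i\<in>I. f i) = (\<Sum>i\<in>I. D (f i))"
  by (induction I rule: infinite_finite_induct) (simp_all add: klin_0 klinD)

text \<open>In this combination of two opposite shifts the terms with h_(n-1) cancel, which leaves
  the eigenvalue q^-n.\<close>

lemma qherm_eigen:
  assumes T: "rhom T" "\<And>c. T (const c) = const c" "T x = Qp 1 * x" "T g = g"
    and T': "rhom T'" "\<And>c. T' (const c) = const c" "T' x = Qp (- 1) * x" "T' g = g"
    and x: "x \<in> {x12, x13, x23}"
  shows "(inverse x * T (qherm n x * g) - x * T' (qherm n x * g)) / (inverse x - x) = Qp (- n) * (qherm n x * g)"
proof -
  have nz: "x \<noteq> 0" "inverse x - x \<noteq> 0" using x x_inverse_noteq[OF x] by auto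
  have 1: "T (qherm n x * g) = Qp (- n) * (qherm n x - x * qherm (n - 1) x) * g"
    using qherm_shift[OF T(1-3) nz(1)] by (simp only: rhomD(3)[OF T(1)] T(4))
  have 2: "T' (qherm n x * g) = Qp (- n) * (qherm n x - inverse x * qherm (n - 1) x) * g"
    using qherm_shift_inverse[OF T'(1-3) nz(1)] by (simp only: rhomD(3)[OF T'(1)] T'(4))
  define u where "u = Qp (- n)"
  have "inverse x * (u * (qherm n x - x * qherm (n - 1) x) * g) - x * (u * (qherm n x - inverse x * qherm (n - 1) x) * g)
    = u * (qherm n x * g) * (inverse x - x)"
    using nz(1) by (simp add: algebra_simps)
  then show ?thesis unfolding 1 2 u_def using nz(2) by simp
qed

definition eigop :: "nat \<Rightarrow> nat \<Rightarrow> ratfun \<Rightarrow> qdop" where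
  "eigop i j x f = (inverse x * Tshift i j 1 f - x * Tshift i j (- 1) f) / (inverse x - x)"

lemma klin_eigop: "klin (eigop i j x)"
proof -
  note R = Tshift_props(1,2)
  have "eigop i j x (f + g) = eigop i j x f + eigop i j x g" for f g
    unfolding eigop_def by (simp only: rhomD(2)[OF R(1)] distrib_left add_diff_add add_divide_distrib)
  moreover have "eigop i j x (const c * f) = const c * eigop i j x f" for c f
    unfolding eigop_def by (simp only: rhomD(3)[OF R(1)] R(2) mult.left_commute[of _ "const c"] right_diff_distrib[symmetric] times_divide_eq_right)
  ultimately show ?thesis by (simp add: klin_def)
qed

lemma eigop_Hfam:
  "eigop 1 2 x12 (Hfam a b c) = Qp (- c) * Hfam a b c"
  "eigop 1 3 x13 (Hfam a b c) = Qp (- b) * Hfam a b c"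
  "eigop 2 3 x23 (Hfam a b c) = Qp (- a) * Hfam a b c"
proof -
  note P = Tshift_props(3-)
  note R = Tshift_props(1,2)
  have H: "Hfam a b c = qherm c x12 * (qherm a x23 * qherm b x13)" "Hfam a b c = qherm b x13 * (qherm a x23 * qherm c x12)"
    "Hfam a b c = qherm a x23 * (qherm b x13 * qherm c x12)"
    by (simp_all add: Hfam_def mult_ac)
  show "eigop 1 2 x12 (Hfam a b c) = Qp (- c) * Hfam a b c"
    unfolding H(1) eigop_def by (rule qherm_eigen[OF R P(1) _ R P(1)]) (simp_all only: rhomD(3)[OF R(1)] qherm_fixed[OF R P(2)] qherm_fixed[OF R P(3)], simp)
  show "eigop 1 3 x13 (Hfam a b c) = Qp (- b) * Hfam a b c"
    unfolding H(2) eigop_def by (rule qherm_eigen[OF R P(5) _ R P(5)]) (simp_all only: rhomD(3)[OF R(1)] qherm_fixed[OF R P(4)] qherm_fixed[OF R P(6)], simp)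
  show "eigop 2 3 x23 (Hfam a b c) = Qp (- a) * Hfam a b c"
    unfolding H(3) eigop_def by (rule qherm_eigen[OF R P(9) _ R P(9)]) (simp_all only: rhomD(3)[OF R(1)] qherm_fixed[OF R P(7)] qherm_fixed[OF R P(8)], simp)
qed

lemma Hfam_nonzero: "0 \<le> a \<Longrightarrow> 0 \<le> b \<Longrightarrow> 0 \<le> c \<Longrightarrow> Hfam a b c \<noteq> 0"
  unfolding Hfam_def
  using qherm_nonzero[OF Tshift_props(1,2) Tshift_props(3), of c] qherm_nonzero[OF Tshift_props(1,2) Tshift_props(7), of b]
    qherm_nonzero[OF Tshift_props(1,2) Tshift_props(11), of a] by simp

lemma Hfam_independent:
  assumes "finite I" and nonneg: "\<And>a b c. (a, b, c) \<in> I \<Longrightarrow> 0 \<le> a \<and> 0 \<le> b \<and> 0 \<le> c"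
    and sum0: "(\<Sum>(a, b, c)\<in>I. const (g (a, b, c)) * Hfam a b c) = 0" and i: "i \<in> I"
  shows "g i = 0"
proof -
  define Z where "Z g \<longleftrightarrow> (\<Sum>(a, b, c)\<in>I. const (g (a, b, c)) * Hfam a b c) = 0" for g :: "int \<times> int \<times> int \<Rightarrow> scalar"
  \<comment> \<open>Multipliers that turn vanishing combinations into vanishing ones. Applying the
    diagonal operators puts their eigenvalues into \<open>S\<close>, and \<open>S\<close> is closed
    under products.\<close>
  define S where "S = {x. \<forall>g. Z g \<longrightarrow> Z (\<lambda>i. g i * x i)}"
  have step: "(\<lambda>(a, b, c). qq powi (- e a b c)) \<in> S" if D: "klin D" "\<And>a b c. D (Hfam a b c) = Qp (- e a b c) * Hfam a b c" for D e
  proof -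
    have "Z (\<lambda>i. g i * (\<lambda>(a, b, c). qq powi (- e a b c)) i)" if "Z g" for g
    proof -
      have "D (\<Sum>(a, b, c)\<in>I. const (g (a, b, c)) * Hfam a b c) = 0"
        using that klin_0[OF D(1)] by (simp add: Z_def)
      then show ?thesis
        unfolding Z_def klin_sum[OF D(1)]
        by (simp add: case_prod_unfold klinD(2)[OF D(1)] D(2) rhomD(3)[OF rhom_const] mult.assoc)
    qed
    then show ?thesis by (simp add: S_def)
  qed
  have "const (g i) * (\<lambda>(a, b, c). Hfam a b c) i = 0"
  proof (rule characters_independent[where S = S and m = "\<lambda>x y i. x i * y i" and ch = "\<lambda>i x. const (x i)" and I = I
        and g = "\<lambda>i. const (g i) * (\<lambda>(a, b, c). Hfam a b c) i"])
    show "(\<lambda>i. x i * y i) \<in> S" if "x \<in> S" "y \<in> S" for x y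
      using that by (simp add: S_def mult.assoc[symmetric])
    show "\<exists>x\<in>S. const (x j) \<noteq> const (x k)" if jk: "j \<in> I" "k \<in> I" "j \<noteq> k" for j k
    proof -
      obtain a b c a' b' c' where e: "j = (a, b, c)" "k = (a', b', c')" by (cases j, cases k) auto
      note st = step[OF klin_eigop eigop_Hfam(1)] step[OF klin_eigop eigop_Hfam(2)] step[OF klin_eigop eigop_Hfam(3)]
      show ?thesis
      proof (rule ccontr)
        assume *: "\<not> ?thesis"
        have "- c = - c'" "- b = - b'" "- a = - a'"
          unfolding qq_powi_inj[symmetric] using * st unfolding e const_eq_iff by fastforce+
        then show False using jk e by simp
      qed
    qed
    show "\<exists>x\<in>S. const (x j) \<noteq> 0" for j
      by (intro bexI[of _ "\<lambda>_. 1"]) (simp_all add: S_def)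
    show "(\<Sum>i\<in>I. const (g i) * (case i of (a, b, c) \<Rightarrow> Hfam a b c) * const (x i)) = 0" if "x \<in> S" for x
    proof -
      have "Z (\<lambda>i. g i * x i)" using that sum0 by (simp add: S_def Z_def)
      then show ?thesis by (simp add: Z_def case_prod_unfold rhomD(3)[OF rhom_const] mult_ac)
    qed
  qed (use assms in \<open>auto simp: rhomD[OF rhom_const]\<close>)
  then show ?thesis using nonneg i Hfam_nonzero by (cases i) (auto simp: const_nonzero)
qed

section \<open>Weights modulo the central direction\<close>

type_synonym int6 = "int \<times> int \<times> int \<times> int \<times> int \<times> int"

definition coords :: "weight \<Rightarrow> int6" where
  "coords v = (ai 1 v, ai 2 v, ai 3 v, ai 4 v, ai 5 v, ai 6 v)"

text \<open>This is -q/t raised to the power \<open>v $ 7\<close>: the share of the central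
  direction in \<open>coef\<close>.\<close>

definition zeta :: "weight \<Rightarrow> scalar" where
  "zeta v = monoK (if even \<lfloor>v $ 7\<rfloor> then 1 else - 1) (2 * \<lfloor>v $ 7\<rfloor>) (- \<lfloor>v $ 7\<rfloor>)"

fun coefM :: "int6 \<Rightarrow> int \<Rightarrow> int \<Rightarrow> int \<Rightarrow> scalar" where
  "coefM (a1, b1, a2, b2, a3, b3) a b c =
     (let d = (b1 - a1) + (b2 - a2) + (b3 - a3) in
      monoK (if even (d div 2) then 1 else - 1) (d + (b1 - a1) * (2 * a - a1) + (b2 - a2) * (2 * b - a2) + (b3 - a3) * (2 * c - a3)) 0)"

fun shiftM :: "family \<Rightarrow> int6 \<Rightarrow> family" where
  "shiftM H (a1, b1, a2, b2, a3, b3) a b c = H (a - a1) (b - a2) (c - a3)"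

lemma coef_coefM: "coef v a b c = zeta v * coefM (coords v) a b c"
  unfolding coef_def zeta_def coords_def coefM.simps Let_def monoK_mult dwt_def[symmetric]
  by (auto simp: qexp_def algebra_simps)

text \<open>The coefficient at a class \<open>M\<close> of weights modulo the central direction once
  Y_c has been set to -q/t.\<close>

definition phi :: "int6 \<Rightarrow> qtorus \<Rightarrow> scalar" where
  "phi M f = pm_lin (\<lambda>v r. if coords v = M then qlaurent_to_K r * zeta v else 0) f"

lemma phi_add: "phi M (f + g) = phi M f + phi M g"
  unfolding phi_def by (rule pm_lin_add) (simp_all add: qlaurent_to_K_add distrib_right)

lemma phi_0 [simp]: "phi M 0 = 0"
  by (simp add: phi_def pm_lin_def)

lemma phi_single: "phi M (single v r) = (if coords v = M then qlaurent_to_K r * zeta v else 0)"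
  unfolding phi_def by (rule pm_lin_single) simp

lemma actT_phi:
  assumes "finite J" "coords ` keys f \<subseteq> J"
  shows "actT H f a b c = (\<Sum>M\<in>J. const (phi M f * coefM M a b c) * shiftM H M a b c)"
proof -
  have "keys f \<subseteq> {v. coords v \<in> J}" using assms(2) by auto
  then show ?thesis
  proof (induction f rule: pm_induct_keys)
    case (add f g)
    then show ?case by (simp add: actT_add phi_add distrib_right rhomD[OF rhom_const] sum.distrib)
  next
    case (single v r)
    have "(\<Sum>M\<in>J. const (phi M (single v r) * coefM M a b c) * shiftM H M a b c)
      = (\<Sum>M\<in>J. if M = coords v then const (qlaurent_to_K r * zeta v * coefM M a b c) * shiftM H M a b c else 0)"
      by (intro sum.cong refl) (auto simp: phi_single)
    also have "\<dots> = const (qlaurent_to_K r * zeta v * coefM (coords v) a b c) * shiftM H (coords v) a b c"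
      using single assms(1) by simp
    finally show ?case by (simp add: actT_single coef_coefM mult.assoc) (simp add: coords_def)
  qed simp
qed

text \<open>Two separations. Members of the family with different nonnegative indices are
  independent, which groups the terms by their shift; within a group the coefficients are distinct
  exponentials in (a, b, c) and independent again.\<close>

lemma coefM_independent:
  assumes "finite J" and sum0: "\<And>a b c. (\<Sum>M\<in>J. const (d M * coefM M a b c) * shiftM Hfam M a b c) = 0" and "M \<in> J"
  shows "d M = 0"
proof -
  define al :: "int6 \<Rightarrow> int \<times> int \<times> int" where "al = (\<lambda>(a1, b1, a2, b2, a3, b3). (a1, a2, a3))"
  \<comment> \<open>From N on all shifted indices are nonnegative, where the members of the family
    are nonzero and independent.\<close>
  define N where "N = (\<Sum>(a1, b1, a2, b2, a3, b3)\<in>J. \<bar>a1\<bar> + \<bar>a2\<bar> + \<bar>a3\<bar>)"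
  have N: "a1 \<le> N \<and> a2 \<le> N \<and> a3 \<le> N" if "(a1, b1, a2, b2, a3, b3) \<in> J" for a1 b1 a2 b2 a3 b3
  proof -
    have "(\<lambda>(a1, b1, a2, b2, a3, b3). \<bar>a1\<bar> + \<bar>a2\<bar> + \<bar>a3\<bar>) (a1, b1, a2, b2, a3, b3) \<le> N"
      unfolding N_def by (rule member_le_sum[OF that _ assms(1)]) auto
    then show ?thesis by auto
  qed
  have N0: "0 \<le> N" unfolding N_def by (rule sum_nonneg) auto
  define J0 where "J0 = {M' \<in> J. al M' = al M}"
  have fin: "finite J0" "M \<in> J0" using assms by (auto simp: J0_def)
  have part: "(\<Sum>M'\<in>J0. d M' * coefM M' a b c) = 0" if abc: "N \<le> a" "N \<le> b" "N \<le> c" for a b c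
  proof -
    define i where "i = (\<lambda>(x, y, z). (a - x, b - y, c - z))"
    have inj: "i u = i v \<longleftrightarrow> u = v" for u v by (cases u; cases v) (simp add: i_def)
    define I where "I = i ` al ` J"
    define g where "g u = (\<Sum>M'\<in>{M'\<in>J. i (al M') = u}. d M' * coefM M' a b c)" for u
    have "g (i (al M)) = 0"
    proof (rule Hfam_independent[of I g])
      show "finite I" using assms(1) by (simp add: I_def)
      show "0 \<le> x \<and> 0 \<le> y \<and> 0 \<le> z" if "(x, y, z) \<in> I" for x y z
        using that N abc by (fastforce simp: I_def i_def al_def)
      show "i (al M) \<in> I" using assms(3) by (simp add: I_def)
      have "(\<Sum>(x, y, z)\<in>I. const (g (x, y, z)) * Hfam x y z) =
        (\<Sum>u\<in>I. \<Sum>M'\<in>{M'\<in>J. i (al M') = u}. const (d M' * coefM M' a b c) * (\<lambda>(x, y, z). Hfam x y z) (i (al M')))"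
        by (intro sum.cong refl) (auto simp: g_def rhom_sum[OF rhom_const] sum_distrib_right intro!: sum.cong)
      also have "\<dots> = (\<Sum>M'\<in>J. const (d M' * coefM M' a b c) * (\<lambda>(x, y, z). Hfam x y z) (i (al M')))"
        using assms(1) by (intro sum.group) (auto simp: I_def)
      also have "\<dots> = (\<Sum>M'\<in>J. const (d M' * coefM M' a b c) * shiftM Hfam M' a b c)"
        by (intro sum.cong refl) (auto simp: i_def al_def)
      finally show "(\<Sum>(x, y, z)\<in>I. const (g (x, y, z)) * Hfam x y z) = 0" using sum0 by simp
    qed
    moreover have "{M'\<in>J. i (al M') = i (al M)} = J0"
      by (simp add: J0_def inj)
    ultimately show ?thesis by (simp add: g_def)
  qed
  define ch :: "int6 \<Rightarrow> int \<times> int \<times> int \<Rightarrow> scalar" where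
    "ch = (\<lambda>(a1, b1, a2, b2, a3, b3) (a, b, c). qh powi (2 * ((b1 - a1) * a + (b2 - a2) * b + (b3 - a3) * c)))"
  define k where "k M' = coefM M' 0 0 0" for M'
  have coefM: "coefM M' a b c = k M' * ch M' (a, b, c)" for M' a b c
    by (cases M') (simp add: k_def ch_def Let_def monoK_def power_int_add[symmetric] algebra_simps)
  have k: "k M' \<noteq> 0" for M'
    by (cases M') (simp add: k_def Let_def monoK_def)
  have "d M * k M = 0"
  proof (rule characters_independent[where S = "{(a, b, c). N \<le> a \<and> N \<le> b \<and> N \<le> c}" and ch = ch and I = J0
        and g = "\<lambda>M. d M * k M" and m = "\<lambda>(a, b, c) (a', b', c'). (a + a', b + b', c + c')"])
    show "\<exists>x\<in>{(a, b, c). N \<le> a \<and> N \<le> b \<and> N \<le> c}. ch M1 x \<noteq> ch M2 x" if M: "M1 \<in> J0" "M2 \<in> J0" "M1 \<noteq> M2" for M1 M2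
    proof (rule ccontr)
      assume "\<not> ?thesis"
      then have eq: "ch M1 (a, b, c) = ch M2 (a, b, c)" if "N \<le> a" "N \<le> b" "N \<le> c" for a b c using that by auto
      obtain a1 b1 a2 b2 a3 b3 where M1: "M1 = (a1, b1, a2, b2, a3, b3)" by (cases M1)
      moreover have "al M1 = al M2" using M by (simp add: J0_def)
      ultimately obtain b1' b2' b3' where M2: "M2 = (a1, b1', a2, b2', a3, b3')" by (cases M2) (auto simp: al_def)
      have "ch M1 (N, N, N) = ch M2 (N, N, N)" "ch M1 (N + 1, N, N) = ch M2 (N + 1, N, N)"
        "ch M1 (N, N + 1, N) = ch M2 (N, N + 1, N)" "ch M1 (N, N, N + 1) = ch M2 (N, N, N + 1)"
        by (auto intro: eq)
      then have "b1 = b1'" "b2 = b2'" "b3 = b3'"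
        unfolding M1 M2 ch_def by (auto simp: qh_powi_inj algebra_simps)
      then show False using M(3) M1 M2 by simp
    qed
    show "\<exists>x\<in>{(a, b, c). N \<le> a \<and> N \<le> b \<and> N \<le> c}. ch M1 x \<noteq> 0" for M1
      by (intro bexI[of _ "(N, N, N)"]) (cases M1; simp add: ch_def)+
    show "ch M1 ((\<lambda>(a, b, c) (a', b', c'). (a + a', b + b', c + c')) x y) = ch M1 x * ch M1 y" for M1 x y
      by (cases M1; cases x; cases y) (simp add: ch_def power_int_add[symmetric] algebra_simps)
    show "(\<Sum>M\<in>J0. d M * k M * ch M x) = 0" if "x \<in> {(a, b, c). N \<le> a \<and> N \<le> b \<and> N \<le> c}" for x
      using that part by (cases x) (auto simp: coefM mult.assoc)
  qed (use fin N0 in auto)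
  then show ?thesis using k by simp
qed

section \<open>The Laurent ring inside the field of scalars\<close>

lemma qtlaurent_to_K_eq: "qtlaurent_to_K r = pm_lin (\<lambda>n s. qlaurent_to_K s * tt powi n) r"
  by (simp add: qtlaurent_to_K_def pm_lin_def)

lemma qtlaurent_to_K_add: "qtlaurent_to_K (r + s) = qtlaurent_to_K r + qtlaurent_to_K s"
  unfolding qtlaurent_to_K_eq by (rule pm_lin_add) (simp_all add: qlaurent_to_K_add distrib_right)

lemma qtlaurent_to_K_single: "qtlaurent_to_K (single n s) = qlaurent_to_K s * tt powi n"
  unfolding qtlaurent_to_K_eq by (rule pm_lin_single) simp

lemma qtlaurent_to_K_0 [simp]: "qtlaurent_to_K 0 = 0"
  by (simp add: qtlaurent_to_K_def)

lemma Fract_monom: "of_int z * qh ^ i * tt ^ j = Fract (monom (monom (of_int z) i) j) 1"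
proof -
  have z: "of_int z = (Fract [:[:of_int z:]:] 1 :: scalar)"
  proof -
    have h: "rhom (\<lambda>c::complex. Fract [:[:c:]:] 1)"
      unfolding rhom_def Fract_one_add[symmetric] Fract_one_mult[symmetric]
      by (simp add: One_fract_def mult.commute flip: one_pCons)
    show ?thesis using rhom_of_int[OF h, of z] by simp
  qed
  have q: "qh ^ i = Fract [:monom 1 i:] 1"
  proof (induction i)
    case (Suc i)
    have "[:[:0, 1:]:] * [:monom 1 i:] = [:monom (1::complex) (Suc i):]" by (simp add: monom_Suc)
    moreover have "qh ^ Suc i = Fract [:[:0, 1:]:] 1 * Fract [:monom 1 i:] 1" by (simp only: power_Suc Suc) (simp only: qh_def)
    ultimately show ?case by (simp only: Fract_one_mult[symmetric])
  qed (simp add: One_fract_def monom_0 flip: one_pCons)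
  have t: "tt ^ j = Fract (monom 1 j) 1"
  proof (induction j)
    case (Suc j)
    have "[:0, 1:] * monom 1 j = monom (1::complex poly) (Suc j)" by (simp add: monom_Suc)
    moreover have "tt ^ Suc j = Fract [:0, 1:] 1 * Fract (monom 1 j) 1" by (simp only: power_Suc Suc) (simp only: tt_def)
    ultimately show ?case by (simp only: Fract_one_mult[symmetric])
  qed (simp add: One_fract_def monom_0 flip: one_pCons)
  have "[:[:of_int z:]:] * [:monom 1 i:] * monom 1 j = monom (monom (of_int z :: complex) i) j"
    by (simp add: smult_monom flip: monom_0) (simp add: monom_0 smult_monom)
  then show ?thesis unfolding z q t Fract_one_mult[symmetric] by (simp only:)
qed

text \<open>Multiplication by the N-th powers of q^(1/2) and t clears all negative exponents; the
  relation then becomes a polynomial in two variables whose coefficients can be read off.\<close>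

lemma qh_tt_independent:
  assumes "finite I" "(\<Sum>(m, n)\<in>I. of_int (g (m, n)) * qh powi m * tt powi n) = 0" "(m0, n0) \<in> I"
  shows "g (m0, n0) = 0"
proof -
  define N where "N = (\<Sum>(m, n)\<in>I. \<bar>m\<bar> + \<bar>n\<bar>)"
  have N: "0 \<le> m + N \<and> 0 \<le> n + N" if "(m, n) \<in> I" for m n
  proof -
    have "(\<lambda>(m, n). \<bar>m\<bar> + \<bar>n\<bar>) (m, n) \<le> N"
      unfolding N_def by (rule member_le_sum[OF that _ assms(1)]) auto
    then show ?thesis by auto
  qed
  define P where "P = (\<Sum>(m, n)\<in>I. monom (monom (of_int (g (m, n)) :: complex) (nat (m + N))) (nat (n + N)))"
  have "Fract P 1 = (\<Sum>(m, n)\<in>I. Fract (monom (monom (of_int (g (m, n))) (nat (m + N))) (nat (n + N))) 1)"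
  proof -
    have "Fract (sum f I) 1 = (\<Sum>i\<in>I. Fract (f i) 1)" for f :: "int \<times> int \<Rightarrow> complex poly poly"
    proof (induction I rule: infinite_finite_induct)
      case (insert i I)
      then show ?case by (simp only: sum.insert Fract_one_add not_False_eq_True)
    qed (simp_all add: Zero_fract_def)
    then show ?thesis by (simp add: P_def case_prod_unfold)
  qed
  also have "\<dots> = (\<Sum>(m, n)\<in>I. (qh powi N * tt powi N) * (of_int (g (m, n)) * qh powi m * tt powi n))"
  proof (intro sum.cong refl, clarify)
    fix m n assume "(m, n) \<in> I"
    then have "qh ^ nat (m + N) = qh powi (m + N)" "tt ^ nat (n + N) = tt powi (n + N)"
      using N by (auto simp: power_int_def)
    then show "Fract (monom (monom (of_int (g (m, n))) (nat (m + N))) (nat (n + N))) 1 =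
        (qh powi N * tt powi N) * (of_int (g (m, n)) * qh powi m * tt powi n)"
      by (simp add: Fract_monom[symmetric] power_int_add)
  qed
  also have "\<dots> = 0" using assms(2) by (simp add: case_prod_unfold sum_distrib_left[symmetric])
  finally have "P = 0" by (simp add: Zero_fract_def Fract_one_eq_iff)
  then have "0 = coeff (coeff P (nat (n0 + N))) (nat (m0 + N))" by simp
  also have "\<dots> = (\<Sum>(m, n)\<in>I. if (m, n) = (m0, n0) then of_int (g (m, n)) else 0)"
    unfolding P_def coeff_sum
  proof (intro sum.cong refl, clarify)
    fix m n assume "(m, n) \<in> I"
    then have "nat (m + N) = nat (m0 + N) \<longleftrightarrow> m = m0" "nat (n + N) = nat (n0 + N) \<longleftrightarrow> n = n0"
      using N[of m n] N[OF assms(3)] by auto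
    then show "coeff (coeff (monom (monom (of_int (g (m, n)) :: complex) (nat (m + N))) (nat (n + N))) (nat (n0 + N))) (nat (m0 + N))
        = (if (m, n) = (m0, n0) then of_int (g (m, n)) else 0)"
      by auto
  qed
  also have "\<dots> = (\<Sum>i\<in>I. if i = (m0, n0) then of_int (g i) else 0)"
    by (intro sum.cong refl) (force simp: case_prod_unfold prod_eq_iff)
  also have "\<dots> = of_int (g (m0, n0))" using assms(1,3) by simp
  finally show ?thesis by simp
qed

lemma qtlaurent_to_K_inj:
  assumes "qtlaurent_to_K r = 0"
  shows "r = 0"
proof (rule ccontr)
  assume "r \<noteq> 0"
  then obtain n where n: "n \<in> keys r" by fastforce
  then have "lookup r n \<noteq> 0" by (simp add: in_keys_iff)
  then obtain m where m: "m \<in> keys (lookup r n)" by fastforce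
  define I where "I = (\<lambda>(n, m). (m, n)) ` (SIGMA n:keys r. keys (lookup r n))"
  have "(\<lambda>(m, n). lookup (lookup r n) m) (m, n) = 0"
  proof (rule qh_tt_independent)
    show "finite I" "(m, n) \<in> I" using n m by (auto simp: I_def)
    have "(\<Sum>(m, n)\<in>I. of_int ((\<lambda>(m, n). lookup (lookup r n) m) (m, n)) * qh powi m * tt powi n)
      = (\<Sum>(n, m)\<in>(SIGMA n:keys r. keys (lookup r n)).
          of_int (lookup (lookup r n) m) * qh powi m * tt powi n)"
      unfolding I_def by (subst sum.reindex) (auto simp: inj_on_def case_prod_unfold)
    also have "\<dots> = qtlaurent_to_K r"
      unfolding qtlaurent_to_K_def qlaurent_to_K_def
      by (subst sum.Sigma[symmetric]) (simp_all add: sum_distrib_right)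
    finally show "(\<Sum>(m, n)\<in>I. of_int ((\<lambda>(m, n). lookup (lookup r n) m) (m, n)) * qh powi m * tt powi n) = 0"
      using assms by simp
  qed
  then show False using m by (simp add: in_keys_iff)
qed

text \<open>A weight in \<open>Lat_tilde X7\<close> is determined by \<open>coords\<close> and
  \<open>v $ 7\<close>, so within one class the powers of t keep the terms apart and nothing
  cancels. Having these coefficients in the Laurent ring is what permits the elimination in
  \<open>lst_faithful\<close>.\<close>

lemma phi_qtlaurent:
  obtains r where "phi M f = qtlaurent_to_K r"
    and "\<And>v. keys f \<subseteq> Lat_tilde X7 \<Longrightarrow> v \<in> keys f \<Longrightarrow> coords v = M \<Longrightarrow> r \<noteq> 0"
proof -
  define z where "z v = single (2 * \<lfloor>v $ 7\<rfloor>) (if even \<lfloor>v $ 7\<rfloor> then 1 else - 1 :: int)" for v :: weight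
  define R where "R f = pm_lin (\<lambda>v r. if coords v = M then single (- \<lfloor>v $ 7\<rfloor>) (r * z v) else 0) f" for f :: qtorus
  have zeta: "zeta v = qlaurent_to_K (z v) * tt powi (- \<lfloor>v $ 7\<rfloor>)" for v
    by (simp add: zeta_def z_def qlaurent_to_K_single monoK_def)
  have "phi M f = qtlaurent_to_K (R f)"
  proof (induction f rule: pm_induct)
    case (add f g)
    have "R (f + g) = R f + R g"
      unfolding R_def by (rule pm_lin_add) (simp_all add: distrib_right single_add)
    then show ?case using add by (simp add: phi_add qtlaurent_to_K_add)
  next
    case (single v r)
    have "R (single v r) = (if coords v = M then single (- \<lfloor>v $ 7\<rfloor>) (r * z v) else 0)"
      unfolding R_def by (rule pm_lin_single) simp
    then show ?case by (simp add: phi_single qtlaurent_to_K_single zeta qlaurent_to_K_mult)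
  qed (simp add: R_def)
  moreover have "R f \<noteq> 0" if f: "keys f \<subseteq> Lat_tilde X7" and v: "v \<in> keys f" "coords v = M" for v
  proof -
    have inj: "w = v" if w: "w \<in> keys f" "coords w = M" "\<lfloor>w $ 7\<rfloor> = \<lfloor>v $ 7\<rfloor>" for w
    proof -
      have wv: "w \<in> Lat_tilde X7" "v \<in> Lat_tilde X7" using f v w by auto
      have 7: "w $ 7 = v $ 7" using Lat_tilde_X7(1)[OF wv(1)] Lat_tilde_X7(1)[OF wv(2)] w(3) by simp
      have "ai i w = ai i v \<Longrightarrow> w $ i = v $ i" for i
        using Lat_tilde_X7(2)[OF wv(1), of i] Lat_tilde_X7(2)[OF wv(2), of i] 7 by simp
      moreover have "coords w = coords v" using v w by simp
      ultimately have "\<forall>i. w $ i = v $ i" unfolding forall_7 using 7 by (simp add: coords_def)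
      then show ?thesis by (simp add: vec_eq_iff)
    qed
    have "lookup (R f) (- \<lfloor>v $ 7\<rfloor>) =
      (\<Sum>w\<in>keys f. if w = v then lookup f w * z w else 0)"
      unfolding R_def pm_lin_def lookup_sum
      by (intro sum.cong refl) (use inj v in \<open>auto simp: lookup_single when_def\<close>)
    also have "\<dots> = lookup f v * z v" using v by simp
    finally have L: "lookup (R f) (- \<lfloor>v $ 7\<rfloor>) = lookup f v * z v" .
    obtain m where m: "z v * single m (if even \<lfloor>v $ 7\<rfloor> then 1 else - 1) = 1"
    proof
      show "z v * single (- 2 * \<lfloor>v $ 7\<rfloor>) (if even \<lfloor>v $ 7\<rfloor> then 1 else - 1) = 1"
        by (simp add: z_def mult_single)
    qed
    have "lookup f v * z v \<noteq> 0"
    proof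
      assume "lookup f v * z v = 0"
      then have "lookup f v * (z v * single m (if even \<lfloor>v $ 7\<rfloor> then 1 else - 1)) = 0"
        by (simp add: mult.assoc[symmetric])
      then show False using v unfolding m by (simp add: in_keys_iff)
    qed
    then show ?thesis using L by auto
  qed
  ultimately show ?thesis using that by blast
qed

subsection \<open>The action of \<open>t\<close>\<close>

definition tpow :: "int \<Rightarrow> qtorus" where
  "tpow n = single (- (of_int n) *s c7) (single (2 * n) (if even n then 1 else - 1))"

lemma c7_nth: "c7 $ 7 = 1" "i \<noteq> 7 \<Longrightarrow> c7 $ i = 1 / 2"
proof -
  show "c7 $ 7 = 1" by (simp add: c7_def ebas_def axis_def)
  show "i \<noteq> 7 \<Longrightarrow> c7 $ i = 1 / 2"
    using exhaust_7[of i] by (auto simp: c7_def ebas_def axis_def)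
qed

lemma form_c7: "form X7 (x *s c7) v = 0" "form X7 v (x *s c7) = 0"
proof -
  have n: "c7 $ 7 = 1" "c7 $ 1 = 1/2" "c7 $ 2 = 1/2" "c7 $ 3 = 1/2" "c7 $ 4 = 1/2" "c7 $ 5 = 1/2" "c7 $ 6 = 1/2"
    using c7_nth(1) c7_nth(2)[of 1] c7_nth(2)[of 2] c7_nth(2)[of 3] c7_nth(2)[of 4] c7_nth(2)[of 5] c7_nth(2)[of 6] by simp_all
  show "form X7 (x *s c7) v = 0" by (simp add: form_def sum_7 repD[OF rep_X7] X7_mat_def n)
  then show "form X7 v (x *s c7) = 0" using form_skew[OF skew_X7, of v "x *s c7"] by simp
qed

lemma tpow_mult: "tpow m \<odot> tpow n = tpow (m + n)"
  unfolding tpow_def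
  by (simp add: qt_mult_single form_c7 mult_single qpow_def vector_sadd_rdistrib[symmetric] algebra_simps)

lemma tpow_0: "tpow 0 = Y 0"
  by (simp add: tpow_def Y_def)

lemma tpow_central: "tpow n \<odot> f = f \<odot> tpow n"
  by (induction f rule: pm_induct)
    (simp_all add: qt_mult_add_left qt_mult_add_right tpow_def qt_mult_single form_c7 mult_ac add_ac)

lemma t_image_eq: "t_image = tpow 1"
  by (simp add: t_image_def qt_mult_const tpow_def Y_def qpow_def single_uminus)

text \<open>Both Y_(-c) and Y_c passed the Laurent check, so the induction can run in either
  direction.\<close>

lemma tpow_L7: "tpow n \<in> L7"
proof -
  have wt: "wt (- 1, - 1, - 1, - 1, - 1, - 1, - 2) = - c7" "wt (1, 1, 1, 1, 1, 1, 2) = c7"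
    unfolding vec_eq_iff forall_7 by (simp_all add: c7_def ebas_def axis_def)
  have Yc: "Y (- c7) \<in> L7" "Y c7 \<in> L7"
    using laurent_check_sound[OF laurent_checks(7)] laurent_check_sound[OF laurent_checks(8)]
    by (simp_all add: C7_def C7_inv_def tm_def wt Y_def)
  have "tpow 1 = scl (single 2 (- 1)) (Y (- c7))" "tpow (- 1) = scl (single (- 2) (- 1)) (Y c7)"
    by (simp_all add: tpow_def Y_def)
  then have 1: "tpow 1 \<in> L7" "tpow (- 1) \<in> L7" using Yc L7_closed(3) by auto
  show ?thesis
  proof (induction n rule: int_induct[where k = 0])
    case base
    then show ?case using L7_closed(5) by (simp only: tpow_0)
  next
    case (step1 i)
    then show ?case using L7_closed(2)[OF step1(2) 1(1)] by (simp add: tpow_mult)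
  next
    case (step2 i)
    then show ?case using L7_closed(2)[OF step2(2) 1(2)] by (simp add: tpow_mult)
  qed
qed

lemma t_image_pow: "t_image [^]\<^bsub>torus X7\<^esub> (n::int) = tpow n"
proof -
  interpret ring "torus X7" by (rule torus_ring)
  have c: "tpow n \<in> carrier (torus X7)" for n using L7_keys[OF tpow_L7] by simp
  have nat: "t_image [^]\<^bsub>torus X7\<^esub> (k::nat) = tpow (int k)" for k
    by (induction k) (simp_all add: t_image_eq tpow_0 tpow_mult add.commute)
  have "inv\<^bsub>torus X7\<^esub> (tpow n) = tpow (- n)" for n
    by (rule inv_char[OF c c]) (simp_all add: tpow_mult tpow_0)
  then show ?thesis by (simp add: int_pow_def2 nat)
qed

definition embt :: "qtlaurent \<Rightarrow> qtorus" where
  "embt r = pm_lin (\<lambda>n s. scl s (tpow n)) r"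

lemma qtlaurent_act_eq: "qtlaurent_act r f = embt r \<odot> f"
  unfolding qtlaurent_act_def embt_def pm_lin_def t_image_pow qt_mult_const ..

lemma embt_add: "embt (r + s) = embt r + embt s"
  unfolding embt_def by (rule pm_lin_add) (simp_all add: scl_add_left)

lemma embt_single: "embt (single n s) = scl s (tpow n)"
  unfolding embt_def by (rule pm_lin_single) simp

lemma embt_0 [simp]: "embt 0 = 0"
  by (simp add: embt_def)

lemma embt_L7: "embt r \<in> L7"
  by (induction r rule: pm_induct) (simp_all add: embt_add embt_single L7_closed tpow_L7)

lemma embt_central: "embt r \<odot> f = f \<odot> embt r"
  by (induction r rule: pm_induct)
    (simp_all add: embt_add embt_single qt_mult_add_left qt_mult_add_right scl_qt_mult tpow_central)

lemma actT_scl: "actT H (scl s f) a b c = const (qlaurent_to_K s) * actT H f a b c"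
  by (induction f rule: pm_induct)
    (simp_all add: scl_add actT_add distrib_left actT_single qlaurent_to_K_mult rhomD[OF rhom_const] mult_ac)

lemma actT_tpow: "actT H (tpow n) a b c = const (tt powi n) * H a b c"
proof -
  have "ai i (- (of_int n) *s c7) = 0" if "i \<noteq> 7" for i
    using that by (simp add: ai_def c7_nth)
  then have ai: "ai 1 (- (of_int n) *s c7) = 0" "ai 2 (- (of_int n) *s c7) = 0" "ai 3 (- (of_int n) *s c7) = 0"
    "ai 4 (- (of_int n) *s c7) = 0" "ai 5 (- (of_int n) *s c7) = 0" "ai 6 (- (of_int n) *s c7) = 0"
    by simp_all
  have "(- (of_int n) *s c7) $ 7 = of_int (- n)" by (simp add: c7_nth)
  then have 7: "\<lfloor>(- (of_int n) *s c7) $ 7\<rfloor> = - n" by (simp only: floor_of_int)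
  have "qlaurent_to_K (single (2 * n) (if even n then 1 else - 1)) * coef (- (of_int n) *s c7) a b c = tt powi n"
    unfolding coef_def dwt_def qexp_def ai 7
    by (simp add: qlaurent_to_K_single monoK_def power_int_add[symmetric] mult.assoc[symmetric])
  then show ?thesis unfolding tpow_def actT_single ai by simp
qed

lemma actT_embt: "actT H (embt r) a b c = const (qtlaurent_to_K r) * H a b c"
  by (induction r rule: pm_induct)
    (simp_all add: embt_add embt_single actT_add actT_scl actT_tpow qtlaurent_to_K_add qtlaurent_to_K_single rhomD[OF rhom_const] algebra_simps)

lemma actT_act:
  assumes "f \<in> L7"
  shows "qtlaurent_act r f \<in> L7" "actT H (qtlaurent_act r f) a b c = const (qtlaurent_to_K r) * actT H f a b c"
proof -
  show "qtlaurent_act r f \<in> L7" by (simp add: qtlaurent_act_eq L7_closed embt_L7 assms)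
  have "actT H (embt r) = (\<lambda>a b c. const (qtlaurent_to_K r) * H a b c)"
    by (simp add: fun_eq_iff actT_embt)
  then show "actT H (qtlaurent_act r f) a b c = const (qtlaurent_to_K r) * actT H f a b c"
    unfolding qtlaurent_act_eq actT_mult[OF L7_keys[OF embt_L7] L7_keys[OF assms]] by (simp add: actT_family_scale)
qed

subsection \<open>The base change\<close>

type_synonym LKfree = "(scalar \<times> qtorus) \<Rightarrow>\<^sub>0 int"

abbreviation LKc :: "LKfree set" where
  "LKc \<equiv> {F. keys F \<subseteq> UNIV \<times> L7}"

definition tm2 :: "scalar \<times> qtorus \<Rightarrow> scalar \<times> qtorus \<Rightarrow> scalar \<times> qtorus" where
  "tm2 u v = (fst u * fst v, snd u \<odot> snd v)"

definition tmul :: "LKfree \<Rightarrow> LKfree \<Rightarrow> LKfree" where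
  "tmul F G = pm_lin (\<lambda>u z. pm_lin (\<lambda>v w. single (tm2 u v) (z * w)) G) F"

lemma Lhat_sel: "carrier Lhat = L7" "mult Lhat = qt_mult X7" "one Lhat = Y 0" "add Lhat = (+)"
  by (simp_all add: Lhat_def torus_def)

lemma LK_sel: "carrier LK_free = LKc" "mult LK_free = tmul" "one LK_free = single (1, Y 0) 1"
  "zero LK_free = 0" "add LK_free = (+)"
  by (simp_all add: fun_eq_iff LK_free_def tensor_free_def Lhat_sel tmul_def pm_lin_def tm2_def case_prod_unfold)

lemma tmul_add_right: "tmul F (G + G') = tmul F G + tmul F G'"
proof -
  have "pm_lin (\<lambda>v w. single (tm2 u v) (z * w)) (G + G') =
    pm_lin (\<lambda>v w. single (tm2 u v) (z * w)) G + pm_lin (\<lambda>v w. single (tm2 u v) (z * w)) G'" for u and z :: int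
    by (rule pm_lin_add) (simp_all add: distrib_left single_add)
  then show ?thesis unfolding tmul_def by (simp add: pm_lin_fun_add)
qed

lemma tmul_add_left: "tmul (F + F') G = tmul F G + tmul F' G"
  unfolding tmul_def by (rule pm_lin_add) (simp_all add: distrib_right single_add pm_lin_fun_add)

lemma tmul_zero [simp]: "tmul 0 G = 0" "tmul F 0 = 0"
  by (simp_all add: tmul_def)

lemma tmul_diff_right: "tmul F (G - G') = tmul F G - tmul F G'"
  using tmul_add_right[of F "G - G'" G'] by (simp add: eq_diff_eq)

lemma tmul_diff_left: "tmul (F - F') G = tmul F G - tmul F' G"
  using tmul_add_left[of "F - F'" F' G] by (simp add: eq_diff_eq)

lemma tmul_single: "tmul (single u z) (single v w) = single (tm2 u v) (z * w)"
  unfolding tmul_def by (subst pm_lin_single, simp, rule pm_lin_single, simp)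

lemma LKc_add: "F \<in> LKc \<Longrightarrow> G \<in> LKc \<Longrightarrow> F + G \<in> LKc"
  using Poly_Mapping.keys_add[of F G] by auto

lemma LKc_diff: "F \<in> LKc \<Longrightarrow> G \<in> LKc \<Longrightarrow> F - G \<in> LKc"
  using keys_diff[of F G] by auto

lemma LKc_single: "snd u \<in> L7 \<Longrightarrow> single u z \<in> LKc"
  by (cases u) simp

lemma LKc_0: "0 \<in> LKc"
  by simp

lemma tmul_closed:
  assumes "F \<in> LKc" "G \<in> LKc"
  shows "tmul F G \<in> LKc"
proof -
  have "keys F \<subseteq> UNIV \<times> L7" using assms(1) by simp
  then show ?thesis
  proof (induction F rule: pm_induct_keys)
    case (single u z)
    have "keys G \<subseteq> UNIV \<times> L7" using assms(2) by simp
    then show ?case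
    proof (induction G rule: pm_induct_keys)
      case (single v w)
      then show ?case unfolding tmul_single using \<open>u \<in> UNIV \<times> L7\<close>
        by (intro LKc_single) (auto simp: tm2_def L7_closed)
    qed (simp_all only: tmul_zero LKc_0 tmul_add_right LKc_add)
  qed (simp_all only: tmul_zero LKc_0 tmul_add_left LKc_add)
qed

lemma tmul_assoc:
  assumes "F \<in> LKc" "G \<in> LKc" "H \<in> LKc"
  shows "tmul (tmul F G) H = tmul F (tmul G H)"
proof -
  have k: "keys F \<subseteq> UNIV \<times> L7" "keys G \<subseteq> UNIV \<times> L7" "keys H \<subseteq> UNIV \<times> L7"
    using assms by simp_all
  from k(1) show ?thesis
  proof (induction F rule: pm_induct_keys)
    case (single u z)
    from k(2) show ?case
    proof (induction G rule: pm_induct_keys)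
      case (single v w)
      from k(3) show ?case
      proof (induction H rule: pm_induct_keys)
        case (single x y)
        have "tm2 (tm2 u v) x = tm2 u (tm2 v x)"
          unfolding tm2_def using qt_mult_assoc[OF L7_keys L7_keys L7_keys, of "snd u" "snd v" "snd x"]
          \<open>u \<in> UNIV \<times> L7\<close> \<open>v \<in> UNIV \<times> L7\<close> \<open>x \<in> UNIV \<times> L7\<close> by (auto simp: mult.assoc)
        then show ?case by (simp add: tmul_single mult.assoc)
      qed (simp_all add: tmul_add_right)
    qed (simp_all add: tmul_add_right tmul_add_left)
  qed (simp_all add: tmul_add_left)
qed

lemma tmul_one: "tmul (single (1, Y 0) 1) F = F" "tmul F (single (1, Y 0) 1) = F"
  by (induction F rule: pm_induct; simp add: tmul_add_right tmul_add_left tmul_single tm2_def)+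

lemma ring_LK_free: "ring LK_free"
proof (rule ringI)
  show "abelian_group LK_free"
  proof (rule abelian_groupI; unfold LK_sel)
    show "\<exists>y\<in>LKc. y + x = 0" if "x \<in> LKc" for x
      using LKc_diff[OF LKc_0 that] by (intro bexI[of _ "0 - x"]) simp_all
  qed (simp_all only: LKc_add LKc_0 add_ac add_0_left add_0_right)
  show "monoid LK_free"
    by (rule monoidI; unfold LK_sel) (simp_all only: tmul_closed tmul_assoc tmul_one, intro LKc_single, simp add: L7_closed)
qed (simp_all only: LK_sel tmul_add_left tmul_add_right)

lemma LKr_zero: "0 \<in> LK_rel" and LKr_diff: "F \<in> LK_rel \<Longrightarrow> G \<in> LK_rel \<Longrightarrow> F - G \<in> LK_rel"
  and LKr_add_left: "m \<in> L7 \<Longrightarrow> single (k + k', m) 1 - single (k, m) 1 - single (k', m) 1 \<in> LK_rel"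
  and LKr_add_right: "m \<in> L7 \<Longrightarrow> m' \<in> L7 \<Longrightarrow> single (k, m + m') 1 - single (k, m) 1 - single (k, m') 1 \<in> LK_rel"
  and LKr_balanced: "m \<in> L7 \<Longrightarrow> single (k * qtlaurent_to_K r, m) 1 - single (k, qtlaurent_act r m) 1 \<in> LK_rel"
  unfolding LK_rel_def using tensor_rel.intros[where M = Lhat and \<phi> = qtlaurent_to_K and act = qtlaurent_act] by (auto simp: Lhat_sel)

lemma LKr_uminus: "F \<in> LK_rel \<Longrightarrow> - F \<in> LK_rel"
  using LKr_diff[OF LKr_zero, of F] by simp

lemma LKr_add: "F \<in> LK_rel \<Longrightarrow> G \<in> LK_rel \<Longrightarrow> F + G \<in> LK_rel"
  using LKr_diff[OF _ LKr_uminus, of F G] by simp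

lemma LK_rel_induct [consumes 1, case_names zero diff add_left add_right balanced]:
  assumes "F \<in> LK_rel" "P 0" "\<And>F G. F \<in> LK_rel \<Longrightarrow> G \<in> LK_rel \<Longrightarrow> P F \<Longrightarrow> P G \<Longrightarrow> P (F - G)"
    "\<And>m k k'. m \<in> L7 \<Longrightarrow> P (single (k + k', m) 1 - single (k, m) 1 - single (k', m) 1)"
    "\<And>m m' k. m \<in> L7 \<Longrightarrow> m' \<in> L7 \<Longrightarrow> P (single (k, m + m') 1 - single (k, m) 1 - single (k, m') 1)"
    "\<And>m k r. m \<in> L7 \<Longrightarrow> P (single (k * qtlaurent_to_K r, m) 1 - single (k, qtlaurent_act r m) 1)"
  shows "P F"
  using assms(1) unfolding LK_rel_def
proof (induction rule: tensor_rel.induct)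
  case (diff F G)
  then show ?case using assms(3) by (simp add: LK_rel_def)
qed (use assms in \<open>simp_all add: Lhat_sel\<close>)

lemma LKr_subset: "F \<in> LK_rel \<Longrightarrow> F \<in> LKc"
  by (induction rule: LK_rel_induct)
    (intro LKc_diff LKc_0 LKc_single; simp add: L7_closed actT_act)+

lemma LKr_single_mult:
  assumes "F \<in> LK_rel" "g \<in> L7"
  shows "tmul (single (l, g) 1) F \<in> LK_rel \<and> tmul F (single (l, g) 1) \<in> LK_rel"
  using assms(1)
proof (induction rule: LK_rel_induct)
  case (add_left m k k')
  then show ?case
    using LKr_add_left[OF L7_closed(2)[OF assms(2) add_left], of "l * k" "l * k'"] LKr_add_left[OF L7_closed(2)[OF add_left assms(2)], of "k * l" "k' * l"]
    by (simp add: tmul_diff_right tmul_diff_left tmul_add_left tmul_add_right tmul_single tm2_def algebra_simps)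
next
  case (add_right m m' k)
  then show ?case
    using LKr_add_right[OF L7_closed(2)[OF assms(2) add_right(1)] L7_closed(2)[OF assms(2) add_right(2)], of "l * k"]
      LKr_add_right[OF L7_closed(2)[OF add_right(1) assms(2)] L7_closed(2)[OF add_right(2) assms(2)], of "k * l"]
    by (simp add: tmul_diff_right tmul_diff_left tmul_single tm2_def qt_mult_add_left qt_mult_add_right)
next
  case (balanced m k r)
  note a = qt_mult_assoc[OF L7_keys L7_keys L7_keys]
  have "g \<odot> qtlaurent_act r m = qtlaurent_act r (g \<odot> m)" "qtlaurent_act r m \<odot> g = qtlaurent_act r (m \<odot> g)"
    unfolding qtlaurent_act_eq using a[OF assms(2) embt_L7 balanced] a[OF embt_L7 assms(2) balanced] a[OF embt_L7 balanced assms(2)]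
    by (simp_all add: embt_central)
  then show ?case
    using LKr_balanced[OF L7_closed(2)[OF assms(2) balanced], of "l * k" r] LKr_balanced[OF L7_closed(2)[OF balanced assms(2)], of "k * l" r]
    by (simp add: tmul_diff_right tmul_diff_left tmul_single tm2_def mult_ac)
qed (simp_all add: tmul_diff_right tmul_diff_left LKr_zero LKr_diff)

lemma single_int_induct:
  fixes P :: "LKfree \<Rightarrow> bool"
  assumes "P 0" "\<And>F G. P F \<Longrightarrow> P G \<Longrightarrow> P (F + G)" "\<And>F G. P F \<Longrightarrow> P G \<Longrightarrow> P (F - G)" "P (single u 1)"
  shows "P (single u z)"
proof (induction z rule: int_induct[where k = 0])
  case (step1 i)
  then show ?case using assms(2)[OF step1(2) assms(4)] by (simp add: single_add)
next
  case (step2 i)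
  then show ?case using assms(3)[OF step2(2) assms(4)] by (simp add: single_diff)
qed (use assms in simp)

lemma LKr_mult:
  assumes "F \<in> LK_rel" "G \<in> LKc"
  shows "tmul G F \<in> LK_rel \<and> tmul F G \<in> LK_rel"
proof -
  have "keys G \<subseteq> UNIV \<times> L7" using assms(2) by simp
  then show ?thesis
  proof (induction G rule: pm_induct_keys)
    case (single u z)
    then obtain l g where u: "u = (l, g)" "g \<in> L7" by auto
    show ?case unfolding u(1)
      by (rule single_int_induct)
        (use LKr_single_mult[OF assms(1) u(2)] in \<open>simp_all add: LKr_zero tmul_add_left tmul_add_right tmul_diff_left tmul_diff_right LKr_add LKr_diff\<close>)
  qed (simp_all add: tmul_add_left tmul_add_right LKr_zero LKr_add)
qed

lemma ideal_LK_rel: "ideal LK_rel LK_free"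
proof (rule idealI[OF ring_LK_free])
  interpret ring LK_free by (rule ring_LK_free)
  show "subgroup LK_rel (add_monoid LK_free)"
  proof (rule subgroup.intro)
    show "LK_rel \<subseteq> carrier (add_monoid LK_free)" using LKr_subset by (auto simp: LK_sel)
    show "x \<otimes>\<^bsub>add_monoid LK_free\<^esub> y \<in> LK_rel" if "x \<in> LK_rel" "y \<in> LK_rel" for x y
      using LKr_add[OF that] by (simp add: LK_sel)
    show "\<one>\<^bsub>add_monoid LK_free\<^esub> \<in> LK_rel" by (simp add: LK_sel LKr_zero)
    show "inv\<^bsub>add_monoid LK_free\<^esub> x \<in> LK_rel" if x: "x \<in> LK_rel" for x
    proof -
      have "\<ominus>\<^bsub>LK_free\<^esub> x = - x"
        by (rule minus_equality) (use LKr_subset[OF x] LKr_subset[OF LKr_uminus[OF x]] in \<open>simp_all only: LK_sel ab_left_minus\<close>)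
      then show ?thesis using LKr_uminus[OF x] by (simp add: a_inv_def)
    qed
  qed
qed (use LKr_mult in \<open>auto simp: LK_sel\<close>)

lemma coset_eq: "LK_rel +>\<^bsub>LK_free\<^esub> F = {X + F |X. X \<in> LK_rel}"
  by (auto simp: a_r_coset_def r_coset_def LK_sel)

section \<open>The base change acting on families\<close>

definition actK :: "family \<Rightarrow> LKfree \<Rightarrow> family" where
  "actK H F a b c = pm_lin (\<lambda>u z. of_int z * (const (fst u) * actT H (snd u) a b c)) F"

lemma actK_add: "actK H (F + G) a b c = actK H F a b c + actK H G a b c"
  unfolding actK_def by (rule pm_lin_add) (simp_all add: distrib_right)

lemma actK_single: "actK H (single u z) a b c = of_int z * (const (fst u) * actT H (snd u) a b c)"
  unfolding actK_def by (rule pm_lin_single) simp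

lemma actK_0 [simp]: "actK H 0 a b c = 0"
  by (simp add: actK_def)

lemma actK_diff: "actK H (F - G) a b c = actK H F a b c - actK H G a b c"
  using actK_add[of H "F - G" G] by (simp add: eq_diff_eq)

lemma klin_actK:
  assumes "klin D"
  shows "D (actK H F a b c) = actK (\<lambda>a b c. D (H a b c)) F a b c"
  by (induction F rule: pm_induct)
    (simp_all add: klin_0[OF assms] actK_add klinD[OF assms] klin_of_int[OF assms] actK_single klin_actT[OF assms])

lemma actT_0_family: "actT (\<lambda>a b c. 0) f a b c = 0"
  using actT_family_scale[of 0 "\<lambda>a b c. 0" f a b c] by simp

lemma actK_0_family: "actK (\<lambda>a b c. 0) F a b c = 0"
  by (induction F rule: pm_induct) (simp_all add: actK_add actK_single actT_0_family)

lemma actT_actK: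
  assumes "F \<in> LKc" "g \<in> L7"
  shows "actT (actK H F) g a b c = actK H (tmul F (single (1, g) 1)) a b c"
proof -
  have "keys F \<subseteq> UNIV \<times> L7" using assms(1) by simp
  then show ?thesis
  proof (induction F rule: pm_induct_keys)
    case zero
    have "actK H 0 = (\<lambda>a b c. 0)" by (simp add: fun_eq_iff)
    then show ?case by (simp add: actT_0_family)
  next
    case (add F G)
    have "actK H (F + G) = (\<lambda>a b c. actK H F a b c + actK H G a b c)" by (simp add: fun_eq_iff actK_add)
    then show ?case using add by (simp add: actT_family_add tmul_add_left actK_add)
  next
    case (single u z)
    have "actK H (single u z) = (\<lambda>a b c. const (of_int z * fst u) * actT H (snd u) a b c)"
      by (simp add: fun_eq_iff actK_single rhomD[OF rhom_const] rhom_of_int[OF rhom_const])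
    moreover have "actT (actT H (snd u)) g a b c = actT H (snd u \<odot> g) a b c"
      using single assms(2) by (intro actT_mult[symmetric] L7_keys) auto
    ultimately show ?case
      using actT_family_scale[of "of_int z * fst u" "actT H (snd u)" g a b c]
      by (simp add: tmul_single tm2_def actK_single rhomD[OF rhom_const] rhom_of_int[OF rhom_const] mult.assoc)
  qed
qed

lemma actK_mult:
  assumes "F \<in> LKc" "G \<in> LKc"
  shows "actK H (tmul F G) a b c = actK (actK H F) G a b c"
proof -
  have "keys G \<subseteq> UNIV \<times> L7" using assms(2) by simp
  then show ?thesis
  proof (induction G rule: pm_induct_keys)
    case (single u z)
    have "actK H (tmul F (single u z)) a b c = of_int z * (const (fst u) * actK H (tmul F (single (1, snd u) 1)) a b c)"
      by (induction F rule: pm_induct)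
        (simp_all add: tmul_add_left actK_add distrib_left tmul_single tm2_def actK_single rhomD[OF rhom_const] mult_ac)
    then show ?case using actT_actK[OF assms(1), of "snd u"] single by (auto simp: actK_single)
  qed (simp_all add: tmul_add_right actK_add)
qed

lemma actK_LK_rel: "F \<in> LK_rel \<Longrightarrow> actK H F a b c = 0"
  by (induction rule: LK_rel_induct)
    (simp_all add: actK_diff actK_single rhomD[OF rhom_const] distrib_right distrib_left actT_add actT_act)

text \<open>All coefficients are 1 and repetitions are allowed, so the length of the list can serve
  as the measure for the elimination.\<close>

definition lst :: "(scalar \<times> qtorus) list \<Rightarrow> LKfree" where
  "lst L = sum_list (map (\<lambda>u. single u 1) L)"

lemma lst_simps [simp]: "lst [] = 0" "lst (u # L) = single u 1 + lst L" "lst (L @ L') = lst L + lst L'"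
  by (simp_all add: lst_def)

lemma actK_lst: "actK H (lst L) a b c = (\<Sum>u\<leftarrow>L. const (fst u) * actT H (snd u) a b c)"
  by (induction L) (simp_all add: actK_add actK_single)

lemma LKr_single_zero: "single (k, 0) 1 \<in> LK_rel"
  using LKr_uminus[OF LKr_add_right[of 0 0 k]] L7_closed(6) by simp

lemma LKr_zero_single: "m \<in> L7 \<Longrightarrow> single (0, m) 1 \<in> LK_rel"
  using LKr_uminus[OF LKr_add_left[of m 0 0]] by simp

lemma L7_diff: "f \<in> L7 \<Longrightarrow> g \<in> L7 \<Longrightarrow> f - g \<in> L7"
proof -
  assume *: "f \<in> L7" "g \<in> L7"
  have "scl (- 1) g = - g" by (rule poly_mapping_eqI) simp
  then show ?thesis using L7_closed(1)[OF *(1) L7_closed(3)[OF *(2), of "- 1"]] by simp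
qed

text \<open>Modulo the relations, an integral coefficient is absorbed into the scalar factor of its
  tensor.\<close>

lemma lst_normal_form:
  assumes "F \<in> LKc"
  obtains L where "set L \<subseteq> UNIV \<times> L7" "F - lst L \<in> LK_rel"
proof -
  have "keys F \<subseteq> UNIV \<times> L7" using assms by simp
  then have "\<exists>L. set L \<subseteq> UNIV \<times> L7 \<and> F - lst L \<in> LK_rel"
  proof (induction F rule: pm_induct_keys)
    case zero
    show ?case by (rule exI[of _ "[]"]) (simp add: LKr_zero)
  next
    case (add F G)
    then obtain L L' where "set L \<subseteq> UNIV \<times> L7" "F - lst L \<in> LK_rel" "set L' \<subseteq> UNIV \<times> L7" "G - lst L' \<in> LK_rel" by blast
    then show ?case using LKr_add[of "F - lst L" "G - lst L'"]
      by (intro exI[of _ "L @ L'"]) (simp add: algebra_simps)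
  next
    case (single u z)
    then obtain k m where u: "u = (k, m)" "m \<in> L7" by auto
    have "single (k, m) z - single (of_int z * k, m) 1 \<in> LK_rel"
    proof (induction z rule: int_induct[where k = 0])
      case base
      show ?case using LKr_uminus[OF LKr_zero_single[OF u(2)]] by simp
    next
      case (step1 i)
      have "single (k, m) (i + 1) - single (of_int (i + 1) * k, m) (1::int) =
        (single (k, m) i - single (of_int i * k, m) 1)
        - (single (of_int i * k + k, m) 1 - single (of_int i * k, m) 1 - single (k, m) 1)"
        by (simp add: single_add algebra_simps)
      then show ?case using LKr_diff[OF step1(2) LKr_add_left[OF u(2), of "of_int i * k" k]] by (simp only:)
    next
      case (step2 i)
      have "single (k, m) (i - 1) - single (of_int (i - 1) * k, m) (1::int) =
        (single (k, m) i - single (of_int i * k, m) 1)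
        + (single (of_int (i - 1) * k + k, m) 1 - single (of_int (i - 1) * k, m) 1 - single (k, m) 1)"
        by (simp add: single_diff algebra_simps)
      then show ?case using LKr_add[OF step2(2) LKr_add_left[OF u(2), of "of_int (i - 1) * k" k]] by (simp only:)
    qed
    then show ?case using u by (intro exI[of _ "[(of_int z * k, m)]"]) auto
  qed
  then show ?thesis using that by blast
qed

lemma lst_phi:
  assumes "\<And>a b c. (\<Sum>u\<leftarrow>L. const (fst u) * actT Hfam (snd u) a b c) = 0"
  shows "(\<Sum>u\<leftarrow>L. fst u * phi M (snd u)) = 0"
proof (rule coefM_independent)
  define J where "J = insert M (\<Union>u\<in>set L. coords ` keys (snd u))"
  show "finite J" "M \<in> J" by (auto simp: J_def)
  have "(\<Sum>u\<leftarrow>L'. const (fst u) * actT Hfam (snd u) a b c) =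
    (\<Sum>M\<in>J. const ((\<Sum>u\<leftarrow>L'. fst u * phi M (snd u)) * coefM M a b c) * shiftM Hfam M a b c)"
    if "set L' \<subseteq> set L" for L' a b c
    using that
  proof (induction L')
    case (Cons u L')
    then have "coords ` keys (snd u) \<subseteq> J" by (auto simp: J_def)
    from actT_phi[OF \<open>finite J\<close> this] Cons show ?case
      by (simp add: rhomD[OF rhom_const] distrib_right sum.distrib sum_distrib_left mult.assoc)
  qed simp
  from this[of L] assms show "(\<Sum>M\<in>J. const ((\<Sum>u\<leftarrow>L. fst u * phi M (snd u)) * coefM M a b c) * shiftM Hfam M a b c) = 0" for a b c
    by simp
qed

text \<open>
  Gaussian elimination: a family of relations among the \<open>k\<^sub>i \<otimes> f\<^sub>i\<close> has coefficients in the image of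
  \<open>\<int>[q\<^sup>\<plusminus>\<^sup>1\<^sup>/\<^sup>2, t\<^sup>\<plusminus>\<^sup>1]\<close>, so one of the \<open>f\<^sub>i\<close> can be eliminated after clearing denominators.
\<close>

lemma lst_faithful:
  assumes "set L \<subseteq> UNIV \<times> L7" "\<And>a b c. (\<Sum>u\<leftarrow>L. const (fst u) * actT Hfam (snd u) a b c) = 0"
  shows "lst L \<in> LK_rel"
  using assms
proof (induction "length L" arbitrary: L rule: less_induct)
  case less
  show ?case
  proof (cases L)
    case Nil
    then show ?thesis by (simp add: LKr_zero)
  next
    case (Cons u L')
    then obtain k f where u: "u = (k, f)" "f \<in> L7" using less.prems(1) by (cases u) auto
    show ?thesis
    proof (cases "f = 0")
      case True
      then have "lst L' \<in> LK_rel" using less Cons u by simp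
      then show ?thesis using LKr_add[OF LKr_single_zero] by (simp add: Cons u True)
    next
      case False
      then obtain v where v: "v \<in> keys f" by fastforce
      define M where "M = coords v"
      obtain r where r: "\<And>g. phi M g = qtlaurent_to_K (r g)"
        "\<And>g v. keys g \<subseteq> Lat_tilde X7 \<Longrightarrow> v \<in> keys g \<Longrightarrow> coords v = M \<Longrightarrow> r g \<noteq> 0"
      proof -
        have "\<forall>g. \<exists>r. phi M g = qtlaurent_to_K r \<and>
          (\<forall>v. keys g \<subseteq> Lat_tilde X7 \<longrightarrow> v \<in> keys g \<longrightarrow> coords v = M \<longrightarrow> r \<noteq> 0)"
          using phi_qtlaurent[of M] by metis
        then show ?thesis using that by metis
      qed
      define e where "e = qtlaurent_to_K (r f)"
      have e: "e \<noteq> 0"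
        using r(2)[OF L7_keys[OF u(2)] v] qtlaurent_to_K_inj by (auto simp: e_def M_def)
      \<comment> \<open>Modulo the relations, k' tensor g is rewritten as k'/e tensor (r(f) g - r(g)
        f) plus a scalar multiple of 1 tensor f. The balanced relation moves r(f) across the tensor
        sign, which is why it has to lie in the Laurent ring.\<close>
      define h where "h w = (fst w / e, qtlaurent_act (r f) (snd w) - qtlaurent_act (r (snd w)) f)" for w :: "scalar \<times> qtorus"
      have el: "single w 1 - single (h w) 1 - single (fst w * qtlaurent_to_K (r (snd w)) / e, f) 1 \<in> LK_rel"
        if w: "w \<in> UNIV \<times> L7" for w
      proof -
        obtain k' g where wk: "w = (k', g)" "g \<in> L7" using w by auto
        define X Y where "X = qtlaurent_act (r f) g" and "Y = qtlaurent_act (r g) f"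
        have XY: "X \<in> L7" "Y \<in> L7" by (simp_all add: X_def Y_def actT_act wk u)
        have 1: "single (k', g) 1 - single (k' / e, X) 1 \<in> LK_rel"
          using LKr_balanced[OF wk(2), of "k' / e" "r f"] e by (simp add: e_def X_def)
        have 2: "single (k' / e, X) 1 - single (k' / e, X - Y) 1 - single (k' / e, Y) 1 \<in> LK_rel"
          using LKr_add_right[OF L7_diff[OF XY] XY(2), of "k' / e"] by simp
        have 3: "single (k' * qtlaurent_to_K (r g) / e, f) 1 - single (k' / e, Y) 1 \<in> LK_rel"
          using LKr_balanced[OF u(2), of "k' / e" "r g"] by (simp add: Y_def)
        have "single w 1 - single (h w) 1 - single (fst w * qtlaurent_to_K (r (snd w)) / e, f) (1::int)
          = (single (k', g) 1 - single (k' / e, X) 1)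
          + (single (k' / e, X) 1 - single (k' / e, X - Y) 1 - single (k' / e, Y) 1)
          - (single (k' * qtlaurent_to_K (r g) / e, f) 1 - single (k' / e, Y) 1)"
          by (simp add: h_def wk X_def Y_def)
        then show ?thesis using LKr_diff[OF LKr_add[OF 1 2] 3] by simp
      qed
      define s where "s N = (\<Sum>w\<leftarrow>N. fst w * qtlaurent_to_K (r (snd w)) / e)" for N :: "(scalar \<times> qtorus) list"
      have sl: "lst N - lst (map h N) - single (s N, f) 1 \<in> LK_rel" if "set N \<subseteq> UNIV \<times> L7" for N
        using that
      proof (induction N)
        case Nil
        show ?case using LKr_uminus[OF LKr_zero_single[OF u(2)]] by (simp add: s_def)
      next
        case (Cons w N)
        have "lst (w # N) - lst (map h (w # N)) - single (s (w # N), f) 1 =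
          (lst N - lst (map h N) - single (s N, f) 1)
          + (single w 1 - single (h w) 1 - single (fst w * qtlaurent_to_K (r (snd w)) / e, f) 1)
          - (single (fst w * qtlaurent_to_K (r (snd w)) / e + s N, f) 1 - single (fst w * qtlaurent_to_K (r (snd w)) / e, f) 1 - single (s N, f) 1)"
          by (simp add: s_def)
        moreover have "w \<in> UNIV \<times> L7" "set N \<subseteq> UNIV \<times> L7" using Cons.prems by auto
        ultimately show ?case using LKr_diff[OF LKr_add[OF Cons.IH el] LKr_add_left[OF u(2)]] by metis
      qed
      have L': "set L' \<subseteq> UNIV \<times> L7" using less.prems(1) Cons by auto
      \<comment> \<open>Read at the class \<open>M\<close>, the relation says that the collected
        multiples of \<open>f\<close> cancel, so the list becomes shorter by one entry.\<close>
      have "(\<Sum>w\<leftarrow>L. fst w * phi M (snd w)) = 0" by (rule lst_phi[OF less.prems(2)])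
      then have "k * e + (\<Sum>w\<leftarrow>L'. fst w * qtlaurent_to_K (r (snd w))) = 0"
        by (simp add: Cons u r(1) e_def)
      moreover have "(\<Sum>w\<leftarrow>N. fst w * qtlaurent_to_K (r (snd w))) = s N * e" for N
        using e by (induction N) (simp_all add: s_def distrib_right)
      ultimately have "(k + s L') * e = 0" by (simp add: distrib_right)
      then have ks: "k + s L' = 0" using e by simp
      have "lst (map h L') \<in> LK_rel"
      proof (rule less.hyps)
        show "length (map h L') < length L" by (simp add: Cons)
        show "set (map h L') \<subseteq> UNIV \<times> L7"
          using L' u(2) by (auto simp: h_def intro!: L7_diff actT_act)
        fix a b c
        have hw: "const (fst (h w)) * actT Hfam (snd (h w)) a b c = const (fst w) * actT Hfam (snd w) a b c
            - const (fst w * qtlaurent_to_K (r (snd w)) / e) * actT Hfam f a b c" if "w \<in> UNIV \<times> L7" for w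
        proof -
          have w: "snd w \<in> L7" using that by auto
          have d: "actT Hfam (f' - g') a b c = actT Hfam f' a b c - actT Hfam g' a b c" for f' g'
            using actT_add[of Hfam "f' - g'" g' a b c] by (simp add: eq_diff_eq)
          have "const e \<noteq> 0" using e by (simp add: const_nonzero)
          then show ?thesis
            by (simp add: h_def d actT_act w u(2) right_diff_distrib e_def[symmetric] rhomD(3)[OF rhom_const] rhom_divide[OF rhom_const] mult.assoc)
        qed
        have "(\<Sum>w\<leftarrow>map h N. const (fst w) * actT Hfam (snd w) a b c) =
          (\<Sum>w\<leftarrow>N. const (fst w) * actT Hfam (snd w) a b c) - const (s N) * actT Hfam f a b c" if "set N \<subseteq> UNIV \<times> L7" for N
          using that
        proof (induction N)
          case (Cons w N)
          have "s (w # N) = fst w * qtlaurent_to_K (r (snd w)) / e + s N" by (simp add: s_def)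
          then show ?case using Cons hw[of w] by (simp add: rhomD(2)[OF rhom_const] distrib_right)
        qed (simp add: s_def)
        from this[OF L'] have "(\<Sum>w\<leftarrow>map h L'. const (fst w) * actT Hfam (snd w) a b c) =
          (\<Sum>w\<leftarrow>L. const (fst w) * actT Hfam (snd w) a b c) - const (k + s L') * actT Hfam f a b c"
          by (simp add: Cons u rhomD(2)[OF rhom_const] distrib_right)
        then show "(\<Sum>w\<leftarrow>map h L'. const (fst w) * actT Hfam (snd w) a b c) = 0"
          using less.prems(2) ks by simp
      qed
      moreover have "lst L = lst (map h L') + (lst L' - lst (map h L') - single (s L', f) 1)
        - (single (k + s L', f) 1 - single (k, f) 1 - single (s L', f) 1) + single (k + s L', f) 1"
        by (simp add: Cons u)
      moreover have "single (k + s L', f) 1 \<in> LK_rel" unfolding ks by (rule LKr_zero_single[OF u(2)])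
      ultimately show ?thesis
        using LKr_add[OF LKr_diff[OF LKr_add[OF _ sl[OF L']] LKr_add_left[OF u(2)]]] by metis
    qed
  qed
qed

lemma actK_faithful:
  assumes "F \<in> LKc" "\<And>a b c. actK Hfam F a b c = 0"
  shows "F \<in> LK_rel"
proof -
  obtain L where L: "set L \<subseteq> UNIV \<times> L7" "F - lst L \<in> LK_rel" using lst_normal_form[OF assms(1)] .
  have "actK Hfam (lst L) a b c = 0" for a b c
    using actK_LK_rel[OF L(2), of Hfam a b c] assms(2) by (simp add: actK_diff)
  then have "lst L \<in> LK_rel" by (intro lst_faithful[OF L(1)]) (simp add: actK_lst)
  from LKr_add[OF L(2) this] show ?thesis by simp
qed

subsection \<open>The homomorphism\<close>

lemma klin_diffops:
  assumes "D \<in> diffops"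
  shows "klin D"
proof -
  obtain P where P: "keys P \<subseteq> hset" "\<And>f. D f = opsum P f" using assms by (auto simp: diffops_def)
  have "klin (opsum P)"
    using P(1)
  proof (induction P rule: pm_induct_keys)
    case (single h c)
    then have "rhom h" "\<And>c. h (const c) = const c" by (auto simp: hset_def)
    then show ?case by (simp add: klin_def opsum_simps rhomD distrib_left mult_ac)
  qed (simp_all add: klin_def opsum_simps distrib_left)
  then show ?thesis by (simp add: klin_def P(2))
qed

lemma O_A_formula_diffops:
  assumes "\<And>a. Tshift k i a \<in> hset" "\<And>a. Tshift k j a \<in> hset"
  shows "O_A_formula k i j \<in> diffops"
proof -
  have sum4: "(\<Sum>a\<in>{1, -1::int}. \<Sum>b\<in>{1, -1::int}. F a b) = F 1 1 + F 1 (- 1) + F (- 1) 1 + F (- 1) (- 1)" for F :: "int \<Rightarrow> int \<Rightarrow> ratfun"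
    by simp
  have 1: "(\<lambda>f. c * Tshift k i a (Tshift k j b f)) \<in> diffops" for a b c
    using diffops_single[OF hset_comp[OF assms], of c a b] by simp
  show ?thesis unfolding O_A_formula_def sum4 by (intro diffops_add 1)
qed

lemma SH_diffops: "D \<in> SH_set \<Longrightarrow> D \<in> diffops"
proof (induction rule: SH_set.induct)
  case (scalar c)
  show ?case unfolding scal_op_def using diffops_single[OF hset_id, of "const c"] by simp
next
  case (O_A k)
  have T: "Tshift 1 2 a \<in> hset" "Tshift 1 3 a \<in> hset" "Tshift 2 1 a \<in> hset" "Tshift 2 3 a \<in> hset" "Tshift 3 1 a \<in> hset" "Tshift 3 2 a \<in> hset" for a
    using Tshift_hset unfolding Tshift_sym by blast+
  then show ?case using O_A O_A_formula_diffops unfolding O_A_def by (auto simp del: One_nat_def)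
next
  case (O_B i j)
  show ?case unfolding O_B_def using diffops_single[OF hset_id] by simp
next
  case (add D E)
  then show ?case by (intro diffops_add)
next
  case (mult D E)
  then show ?case by (intro diffops_comp)
qed

definition iota :: "qdop \<Rightarrow> LKfree set" where
  "iota D = {F \<in> LKc. \<forall>a b c. D (Hfam a b c) = actK Hfam F a b c}"

lemma iota_add: "F \<in> iota D \<Longrightarrow> G \<in> iota E \<Longrightarrow> F + G \<in> iota (\<lambda>f. D f + E f)"
  unfolding iota_def using LKc_add[of F G] by (auto simp: actK_add)

lemma iota_mult:
  assumes "klin D" "F \<in> iota D" "G \<in> iota E"
  shows "tmul F G \<in> iota (D \<circ> E)"
proof -
  have FG: "F \<in> LKc" "G \<in> LKc" "(\<lambda>a b c. D (Hfam a b c)) = actK Hfam F" "\<And>a b c. E (Hfam a b c) = actK Hfam G a b c"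
    using assms by (auto simp: iota_def fun_eq_iff)
  have "D (E (Hfam a b c)) = actK Hfam (tmul F G) a b c" for a b c
    unfolding FG(4) klin_actK[OF assms(1)] FG(3) actK_mult[OF FG(1,2)] ..
  then show ?thesis using tmul_closed[OF FG(1,2)] by (simp add: iota_def)
qed

lemma iota_scal: "single (c, Y 0) 1 \<in> iota (scal_op c)"
proof -
  have "actT H (Y 0) a b c = H a b c" for H a b c
    using actT_tpow[of H 0 a b c] by (simp add: tpow_0)
  then show ?thesis using LKc_single[of "(c, Y 0)" 1] L7_closed(5) by (simp add: iota_def scal_op_def actK_single)
qed

lemma L_B_ip: "L_B 1 2 = ip LB12" "L_B 1 3 = ip LB13" "L_B 2 3 = ip LB23"
proof -
  have e: "- (1/2) *s (ebas 5 + ebas 6) = wt (0, 0, 0, 0, - 1, - 1, 0)" "(1/2) *s (ebas 6 - ebas 5) = wt (0, 0, 0, 0, - 1, 1, 0)"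
    "(1/2) *s (ebas 5 + ebas 6) = wt (0, 0, 0, 0, 1, 1, 0)"
    "- (1/2) *s (ebas 3 + ebas 4) = wt (0, 0, - 1, - 1, 0, 0, 0)" "(1/2) *s (ebas 4 - ebas 3) = wt (0, 0, - 1, 1, 0, 0, 0)"
    "(1/2) *s (ebas 3 + ebas 4) = wt (0, 0, 1, 1, 0, 0, 0)"
    "- (1/2) *s (ebas 1 + ebas 2) = wt (- 1, - 1, 0, 0, 0, 0, 0)" "(1/2) *s (ebas 2 - ebas 1) = wt (- 1, 1, 0, 0, 0, 0, 0)"
    "(1/2) *s (ebas 1 + ebas 2) = wt (1, 1, 0, 0, 0, 0, 0)"
    unfolding vec_eq_iff forall_7 by (simp_all add: ebas_def axis_def)
  have t: "Y (wt v) = tm (v, 0, 1)" for v by (simp add: Y_def tm_def)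
  show "L_B 1 2 = ip LB12" "L_B 1 3 = ip LB13" "L_B 2 3 = ip LB23"
    unfolding L_B_def e t by (simp_all add: doubleton_eq_iff LB12_def LB13_def LB23_def add.assoc)
qed

lemma L_A_ip: "L_A 1 = ip LA1" "L_A 2 = ip LA2" "L_A 3 = ip LA3"
proof -
  have e: "ebas 7 + (1/2) *s (ebas 2 + ebas 1 + ebas 3 + ebas 5) = wt (1, 1, 1, 0, 1, 0, 2)"
    "- ebas 7 - (1/2) *s (ebas 2 + ebas 1 + ebas 3 + ebas 5) = wt (- 1, - 1, - 1, 0, - 1, 0, - 2)"
    "(1/2) *s (ebas 3 + ebas 5) = wt (0, 0, 1, 0, 1, 0, 0)"
    "ebas 7 + (1/2) *s (ebas 4 + ebas 1 + ebas 3 + ebas 5) = wt (1, 0, 1, 1, 1, 0, 2)"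
    "- ebas 7 - (1/2) *s (ebas 4 + ebas 1 + ebas 3 + ebas 5) = wt (- 1, 0, - 1, - 1, - 1, 0, - 2)"
    "(1/2) *s (ebas 1 + ebas 5) = wt (1, 0, 0, 0, 1, 0, 0)"
    "ebas 7 + (1/2) *s (ebas 6 + ebas 1 + ebas 3 + ebas 5) = wt (1, 0, 1, 0, 1, 1, 2)"
    "- ebas 7 - (1/2) *s (ebas 6 + ebas 1 + ebas 3 + ebas 5) = wt (- 1, 0, - 1, 0, - 1, - 1, - 2)"
    "(1/2) *s (ebas 1 + ebas 3) = wt (1, 0, 1, 0, 0, 0, 0)"
    unfolding vec_eq_iff forall_7 by (simp_all add: ebas_def axis_def)
  have t: "Y (wt v) = ip [(v, 0, 1)]" for v by (simp add: Y_def tm_def)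
  have w: "ebas 1 = wt (2, 0, 0, 0, 0, 0, 0)" "ebas 3 = wt (0, 0, 2, 0, 0, 0, 0)" "ebas 5 = wt (0, 0, 0, 0, 2, 0, 0)" "0 = wt (0, 0, 0, 0, 0, 0, 0)"
    unfolding vec_eq_iff forall_7 by (simp_all add: ebas_def axis_def)
  have o: "one_qY 1 = ip (one_q7 1)" "one_qY 3 = ip (one_q7 3)" "one_qY 5 = ip (one_q7 5)"
    unfolding one_qY_def qt_mult_const one_q7_def
    by (simp_all add: mk7_def unit7_def tm_def Y_def qpow_def w(1-3) flip: w(4))
  note m = ip_mul7[OF rep_X7]
  show "L_A 1 = ip LA1" "L_A 2 = ip LA2" "L_A 3 = ip LA3"
    unfolding L_A_def e LA1_def LA2_def LA3_def ip_simps m L_B_ip o t by (simp_all add: add.assoc)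
qed

lemma L7_gens: "L_B 1 2 \<in> L7" "L_B 1 3 \<in> L7" "L_B 2 3 \<in> L7" "L_A 1 \<in> L7" "L_A 2 \<in> L7" "L_A 3 \<in> L7"
  unfolding L_B_ip L_A_ip by (intro laurent_check_sound laurent_checks)+

lemma iota_gens:
  "single (1, L_B 1 2) 1 \<in> iota (O_B 1 2)" "single (1, L_B 1 3) 1 \<in> iota (O_B 1 3)"
  "single (1, L_B 2 3) 1 \<in> iota (O_B 2 3)" "single (1, L_A 1) 1 \<in> iota (O_A 1)"
  "single (1, L_A 2) 1 \<in> iota (O_A 2)" "single (1, L_A 3) 1 \<in> iota (O_A 3)"
  using L7_gens unfolding iota_def
  by (auto simp del: One_nat_def simp: actK_single O_B_Hfam O_A_Hfam L_B_ip L_A_ip intro!: LKc_single)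

lemma O_B_cases: "1 \<le> i \<Longrightarrow> i < j \<Longrightarrow> j \<le> 3 \<Longrightarrow> (i, j) \<in> {(1, 2), (1, 3), (2, 3)}" for i j :: nat
  by auto

lemma iota_nonempty: "D \<in> SH_set \<Longrightarrow> iota D \<noteq> {}"
proof (induction rule: SH_set.induct)
  case (scalar c)
  show ?case using iota_scal by blast
next
  case (O_A k)
  then show ?case using iota_gens(4-6) by auto
next
  case (O_B i j)
  then show ?case using O_B_cases[OF O_B] iota_gens(1-3) by auto
next
  case (add D E)
  then show ?case using iota_add by blast
next
  case (mult D E)
  then show ?case using iota_mult[OF klin_diffops[OF SH_diffops[OF mult(1)]]] by blast
qed

text \<open>A symmetric monomial is E applied to H_000 = 1 for some E in the source algebra. As
  \<open>D\<close> passes through the index action that represents E, the value is obtained from the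
  family D H, which vanishes.\<close>

lemma iota_eq_zero:
  assumes "D \<in> SH_set" "\<And>a b c. D (Hfam a b c) = 0"
  shows "D f = 0"
proof (rule diffop_eq_zero[OF SH_diffops[OF assms(1)]])
  fix f assume "f \<in> Xmono"
  then have "\<exists>E\<in>SH_set. f = E (Hfam 0 0 0)"
  proof (induction rule: Xmono.induct)
    case one
    show ?case by (rule bexI[OF _ SH_set.scalar[of 1]]) (simp add: scal_op_def Hfam_def qherm_def)
  next
    case (mult f x)
    then obtain E where E: "E \<in> SH_set" "f = E (Hfam 0 0 0)" by blast
    have B: "O_B 1 2 \<in> SH_set" "O_B 1 3 \<in> SH_set" "O_B 2 3 \<in> SH_set" by (rule SH_set.O_B; simp)+
    have "O_B 1 2 f = Xv x12 * f" "O_B 1 3 f = Xv x13 * f" "O_B 2 3 f = Xv x23 * f"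
      by (simp_all add: O_B_def xvar_sym)
    then show ?case
      using mult(2) B SH_set.mult[OF _ E(1)] E(2) by (metis comp_apply insertE singletonD)
  qed
  then obtain E where E: "E \<in> SH_set" "f = E (Hfam 0 0 0)" by blast
  obtain F where F: "F \<in> iota E" using iota_nonempty[OF E(1)] by blast
  have "D f = actK (\<lambda>a b c. D (Hfam a b c)) F 0 0 0"
    using F E(2) klin_actK[OF klin_diffops[OF SH_diffops[OF assms(1)]], of Hfam F 0 0 0] by (simp add: iota_def)
  then show "D f = 0" by (simp add: assms(2) actK_0_family)
qed

lemma iota_coset:
  assumes "F \<in> iota D"
  shows "iota D = LK_rel +>\<^bsub>LK_free\<^esub> F"
proof (intro equalityI subsetI)
  fix G assume G: "G \<in> iota D"
  have "G - F \<in> LK_rel"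
    by (rule actK_faithful) (use G assms LKc_diff[of G F] in \<open>auto simp: iota_def actK_diff\<close>)
  then show "G \<in> LK_rel +>\<^bsub>LK_free\<^esub> F"
    unfolding coset_eq by (intro CollectI exI[of _ "G - F"]) simp
next
  fix G assume "G \<in> LK_rel +>\<^bsub>LK_free\<^esub> F"
  then obtain X where X: "X \<in> LK_rel" "G = X + F" unfolding coset_eq by blast
  show "G \<in> iota D"
    using assms LKc_add[OF LKr_subset[OF X(1)], of F] by (simp add: X(2) iota_def actK_add actK_LK_rel[OF X(1)])
qed

lemma SH_diff: "D \<in> SH_set \<Longrightarrow> E \<in> SH_set \<Longrightarrow> (\<lambda>f. D f - E f) \<in> SH_set"
  using SH_set.add[OF _ SH_set.mult[OF SH_set.scalar[of "- 1"]], of D E]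
  by (simp add: scal_op_def rhom_uminus[OF rhom_const])

lemma iota_inj:
  assumes "D \<in> SH_set" "E \<in> SH_set" "F \<in> iota D" "F \<in> iota E"
  shows "D = E"
proof
  fix f
  have "(\<lambda>f. D f - E f) f = 0"
    by (rule iota_eq_zero[OF SH_diff[OF assms(1,2)]]) (use assms in \<open>simp add: iota_def\<close>)
  then show "D f = E f" by simp
qed

lemma SH_sel: "carrier SH = SH_set" "mult SH = (\<circ>)" "add SH = (\<lambda>D E f. D f + E f)" "one SH = id"
  by (simp_all add: SH_def)

lemma iota_hom: "iota \<in> K_alg_hom SH scal_op Lhat_K (\<lambda>c. tensor c \<one>\<^bsub>Lhat\<^esub>)"
proof -
  interpret I: ideal LK_rel LK_free by (rule ideal_LK_rel)
  have sc: "iota (scal_op c) = tensor c (Y 0)" for c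
    unfolding tensor_def by (rule iota_coset[OF iota_scal])
  have id: "scal_op 1 = id" by (simp add: fun_eq_iff scal_op_def)
  have rep: "\<exists>F\<in>iota D. F \<in> carrier LK_free \<and> iota D = LK_rel +>\<^bsub>LK_free\<^esub> F" if D: "D \<in> SH_set" for D
  proof -
    obtain F where F: "F \<in> iota D" using iota_nonempty[OF D] by blast
    moreover have "F \<in> carrier LK_free" using F by (simp add: LK_sel iota_def)
    ultimately show ?thesis using iota_coset[OF F] by blast
  qed
  have "iota \<in> ring_hom SH Lhat_K"
  proof (rule ring_hom_memI)
    fix D E assume "D \<in> carrier SH" "E \<in> carrier SH"
    then have DE: "D \<in> SH_set" "E \<in> SH_set" by (simp_all add: SH_sel)
    obtain F where F: "F \<in> iota D" "F \<in> carrier LK_free" "iota D = LK_rel +>\<^bsub>LK_free\<^esub> F" using rep[OF DE(1)] by blast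
    obtain G where G: "G \<in> iota E" "G \<in> carrier LK_free" "iota E = LK_rel +>\<^bsub>LK_free\<^esub> G" using rep[OF DE(2)] by blast
    have "iota (D \<circ> E) = LK_rel +>\<^bsub>LK_free\<^esub> (F \<otimes>\<^bsub>LK_free\<^esub> G)"
      using iota_coset[OF iota_mult[OF klin_diffops[OF SH_diffops[OF DE(1)]] F(1) G(1)]] by (simp add: LK_sel)
    then show "iota (D \<otimes>\<^bsub>SH\<^esub> E) = iota D \<otimes>\<^bsub>Lhat_K\<^esub> iota E"
      using F G by (simp add: SH_sel Lhat_K_def FactRing_def I.rcoset_mult_add)
    have "iota (\<lambda>f. D f + E f) = LK_rel +>\<^bsub>LK_free\<^esub> (F \<oplus>\<^bsub>LK_free\<^esub> G)"
      using iota_coset[OF iota_add[OF F(1) G(1)]] by (simp add: LK_sel)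
    then show "iota (D \<oplus>\<^bsub>SH\<^esub> E) = iota D \<oplus>\<^bsub>Lhat_K\<^esub> iota E"
      using F G by (simp add: SH_sel Lhat_K_def FactRing_def I.a_rcos_sum)
  next
    fix D assume "D \<in> carrier SH"
    then show "iota D \<in> carrier Lhat_K"
      using rep[of D] by (auto simp: SH_sel Lhat_K_def FactRing_def A_RCOSETS_def')
  next
    show "iota \<one>\<^bsub>SH\<^esub> = \<one>\<^bsub>Lhat_K\<^esub>"
      using sc[of 1] by (simp add: SH_sel id Lhat_K_def FactRing_def tensor_def LK_sel)
  qed
  then show ?thesis by (simp add: K_alg_hom_def sc Lhat_sel)
qed

lemma iota_inj_on: "inj_on iota (carrier SH)"
proof (rule inj_onI)
  fix D E assume *: "D \<in> carrier SH" "E \<in> carrier SH" "iota D = iota E"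
  then show "D = E" using iota_nonempty[of D] iota_inj[of D E] by (auto simp: SH_sel)
qed

lemma iota_tensor: "single (1, f) 1 \<in> iota D \<Longrightarrow> iota D = tensor 1 f"
  unfolding tensor_def by (rule iota_coset)

subsection \<open>Equivariance\<close>

definition tstar :: "(qtorus \<Rightarrow> qtorus) \<Rightarrow> LKfree \<Rightarrow> LKfree" where
  "tstar \<tau> F = pm_lin (\<lambda>u z. single (fst u, \<tau> (snd u)) z) F"

lemma K_extend_eq: "K_extend \<tau> S = (\<Union>F\<in>S. LK_rel +>\<^bsub>LK_free\<^esub> tstar \<tau> F)"
  by (simp add: K_extend_def tstar_def pm_lin_def case_prod_unfold)

lemma tstar_add: "tstar \<tau> (F + G) = tstar \<tau> F + tstar \<tau> G"
  unfolding tstar_def by (rule pm_lin_add) (simp_all add: single_add)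

lemma tstar_single: "tstar \<tau> (single u z) = single (fst u, \<tau> (snd u)) z"
  unfolding tstar_def by (rule pm_lin_single) simp

lemma tstar_0 [simp]: "tstar \<tau> 0 = 0"
  by (simp add: tstar_def)

lemma tstar_diff: "tstar \<tau> (F - G) = tstar \<tau> F - tstar \<tau> G"
  using tstar_add[of \<tau> "F - G" G] by (simp add: eq_diff_eq)

text \<open>Constants and t are fixed, so such maps are linear over the Laurent ring and pass to the
  base change. Bijectivity on \<open>L7\<close> provides the inverses that enter the twists.\<close>

definition aut7 :: "(qtorus \<Rightarrow> qtorus) \<Rightarrow> bool" where
  "aut7 \<tau> \<longleftrightarrow> bij_betw \<tau> L7 L7 \<and> (\<forall>f\<in>L7. \<forall>g\<in>L7. \<tau> (f + g) = \<tau> f + \<tau> g \<and> \<tau> (f \<odot> g) = \<tau> f \<odot> \<tau> g) \<and>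
    (\<forall>r. \<tau> (qt_const r) = qt_const r) \<and> \<tau> (tpow 1) = tpow 1"

lemma aut7D:
  assumes "aut7 \<tau>"
  shows "bij_betw \<tau> L7 L7" "f \<in> L7 \<Longrightarrow> \<tau> f \<in> L7" "f \<in> L7 \<Longrightarrow> g \<in> L7 \<Longrightarrow> \<tau> (f + g) = \<tau> f + \<tau> g"
    "f \<in> L7 \<Longrightarrow> g \<in> L7 \<Longrightarrow> \<tau> (f \<odot> g) = \<tau> f \<odot> \<tau> g" "\<tau> (qt_const r) = qt_const r" "\<tau> (tpow 1) = tpow 1"
  using assms by (auto simp: aut7_def bij_betw_def)

lemma aut7_one: "aut7 \<tau> \<Longrightarrow> \<tau> (Y 0) = Y 0"
  using aut7D(5)[of \<tau> 1] by (simp add: qt_const_def Y_def)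

text \<open>Fixing t also fixes its negative powers: multiply by t and cancel it on the
  right.\<close>

lemma aut7_act:
  assumes "aut7 \<tau>" "f \<in> L7"
  shows "\<tau> (qtlaurent_act r f) = qtlaurent_act r (\<tau> f)"
proof -
  note A = aut7D[OF assms(1)]
  have t: "\<tau> (tpow n) = tpow n" for n
  proof (induction n rule: int_induct[where k = 0])
    case base
    then show ?case by (simp only: tpow_0 aut7_one[OF assms(1)])
  next
    case (step1 i)
    then show ?case using A(4)[OF tpow_L7 tpow_L7, of i 1] A(6) by (simp add: tpow_mult)
  next
    case (step2 i)
    have "\<tau> (tpow (i - 1)) \<odot> tpow 1 = tpow i"
      using A(4)[OF tpow_L7 tpow_L7, of "i - 1" 1] A(6) step2 by (simp add: tpow_mult)
    then have "tpow i \<odot> tpow (- 1) = \<tau> (tpow (i - 1)) \<odot> (tpow 1 \<odot> tpow (- 1))"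
      using qt_mult_assoc[OF L7_keys[OF A(2)[OF tpow_L7]] L7_keys[OF tpow_L7] L7_keys[OF tpow_L7], of "i - 1" 1 "- 1"] by simp
    then show ?case by (simp add: tpow_mult tpow_0)
  qed
  have "\<tau> (embt r) = embt r"
  proof (induction r rule: pm_induct)
    case zero
    then show ?case using A(5)[of 0] by (simp add: qt_const_def)
  next
    case (add r s)
    then show ?case by (simp add: embt_add A(3) embt_L7)
  next
    case (single n s)
    then show ?case using A(4)[OF L7_closed(4) tpow_L7, of s n] by (simp add: embt_single qt_mult_const A(5) t)
  qed
  then show ?thesis using A(4)[OF embt_L7 assms(2)] by (simp add: qtlaurent_act_eq)
qed

lemma aut7_comp:
  assumes "aut7 \<sigma>" "aut7 \<tau>"
  shows "aut7 (\<sigma> \<circ> \<tau>)"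
  unfolding aut7_def
  using bij_betw_trans[OF aut7D(1)[OF assms(2)] aut7D(1)[OF assms(1)]] by (simp add: aut7D[OF assms(1)] aut7D[OF assms(2)])

lemma aut7_inv:
  assumes "aut7 \<tau>"
  shows "aut7 (inv_into L7 \<tau>)"
proof -
  note A = aut7D[OF assms]
  have b: "bij_betw (inv_into L7 \<tau>) L7 L7" by (rule bij_betw_inv_into[OF A(1)])
  then have c: "inv_into L7 \<tau> f \<in> L7" if "f \<in> L7" for f using that by (auto simp: bij_betw_def)
  have r: "\<tau> (inv_into L7 \<tau> f) = f" if "f \<in> L7" for f by (rule bij_betw_inv_into_right[OF A(1) that])
  have l: "inv_into L7 \<tau> (\<tau> f) = f" if "f \<in> L7" for f by (rule bij_betw_inv_into_left[OF A(1) that])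
  have e: "inv_into L7 \<tau> f = g" if "g \<in> L7" "\<tau> g = f" for f g using l[OF that(1)] that(2) by simp
  show ?thesis
    unfolding aut7_def using b by (auto intro!: e simp: c r A L7_closed tpow_L7)
qed

lemma tstar_LKr:
  assumes "aut7 \<tau>" "F \<in> LK_rel"
  shows "tstar \<tau> F \<in> LK_rel"
  using assms(2)
proof (induction rule: LK_rel_induct)
  case (add_left m k k')
  then show ?case using LKr_add_left[OF aut7D(2)[OF assms(1) add_left], of k k'] by (simp only: tstar_diff tstar_single fst_conv snd_conv)
next
  case (add_right m m' k)
  then show ?case
    using LKr_add_right[OF aut7D(2)[OF assms(1) add_right(1)] aut7D(2)[OF assms(1) add_right(2)], of k]
    by (simp only: tstar_diff tstar_single fst_conv snd_conv aut7D(3)[OF assms(1)])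
next
  case (balanced m k r)
  then show ?case
    using LKr_balanced[OF aut7D(2)[OF assms(1) balanced], of k r]
    by (simp only: tstar_diff tstar_single fst_conv snd_conv aut7_act[OF assms(1)])
qed (simp_all add: tstar_diff LKr_zero LKr_diff)

lemma tstar_mult:
  assumes "aut7 \<tau>" "F \<in> LKc" "G \<in> LKc"
  shows "tstar \<tau> (tmul F G) = tmul (tstar \<tau> F) (tstar \<tau> G)"
proof -
  have k: "keys F \<subseteq> UNIV \<times> L7" "keys G \<subseteq> UNIV \<times> L7" using assms by simp_all
  from k(1) show ?thesis
  proof (induction F rule: pm_induct_keys)
    case (single u z)
    from k(2) show ?case
    proof (induction G rule: pm_induct_keys)
      case (single v w)
      then show ?case using \<open>u \<in> UNIV \<times> L7\<close> aut7D(4)[OF assms(1), of "snd u" "snd v"]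
        by (auto simp: tmul_single tstar_single tm2_def)
    qed (simp_all add: tmul_add_right tstar_add)
  qed (simp_all add: tmul_add_left tstar_add)
qed

lemma tstar_inverse:
  assumes "aut7 \<tau>" "F \<in> LKc"
  shows "tstar (inv_into L7 \<tau>) (tstar \<tau> F) = F"
proof -
  have "keys F \<subseteq> UNIV \<times> L7" using assms(2) by simp
  then show ?thesis
    by (induction F rule: pm_induct_keys)
      (auto simp: tstar_add tstar_single bij_betw_inv_into_left[OF aut7D(1)[OF assms(1)]])
qed

lemma tstar_comp: "tstar \<sigma> (tstar \<tau> F) = tstar (\<sigma> \<circ> \<tau>) F"
  by (induction F rule: pm_induct) (simp_all add: tstar_add tstar_single)

text \<open>A relation instead of a map, because it is not known beforehand that \<tau> preserves
  the image of \<open>iota\<close>. It is stable under sums, products, brackets, composition and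
  inversion, so that generators settle everything.\<close>

definition tw :: "(qtorus \<Rightarrow> qtorus) \<Rightarrow> qdop \<Rightarrow> qdop \<Rightarrow> bool" where
  "tw \<tau> D E \<longleftrightarrow> aut7 \<tau> \<and> D \<in> SH_set \<and> E \<in> SH_set \<and> (\<forall>F\<in>iota D. tstar \<tau> F \<in> iota E)"

lemma iota_LKc: "F \<in> iota D \<Longrightarrow> F \<in> LKc"
  by (simp add: iota_def)

text \<open>A single representative suffices, since \<open>tstar\<close> preserves the relations of
  the base change.\<close>

lemma twI:
  assumes "aut7 \<tau>" "D \<in> SH_set" "E \<in> SH_set" "F \<in> iota D" "tstar \<tau> F \<in> iota E"
  shows "tw \<tau> D E"
  unfolding tw_def
proof (intro conjI ballI assms(1-3))
  fix G assume "G \<in> iota D"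
  then obtain X where X: "X \<in> LK_rel" "G = X + F" unfolding iota_coset[OF assms(4)] coset_eq by blast
  show "tstar \<tau> G \<in> iota E"
    unfolding iota_coset[OF assms(5)] coset_eq X(2) tstar_add using tstar_LKr[OF assms(1) X(1)] by blast
qed

lemma tw_iota:
  assumes "tw \<tau> D E"
  shows "iota E = K_extend \<tau> (iota D)"
proof -
  have "LK_rel +>\<^bsub>LK_free\<^esub> tstar \<tau> F = iota E" if "F \<in> iota D" for F
    using assms that iota_coset by (auto simp: tw_def)
  moreover have "iota D \<noteq> {}" using assms iota_nonempty by (simp add: tw_def)
  ultimately show ?thesis by (simp add: K_extend_eq)
qed

lemma tw_unique: "tw \<tau> D E \<Longrightarrow> tw \<tau> D E' \<Longrightarrow> E = E'"
  using iota_nonempty[of D] iota_inj[of E E'] by (fastforce simp: tw_def)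

lemma tw_scal: "aut7 \<tau> \<Longrightarrow> tw \<tau> (scal_op c) (scal_op c)"
  by (rule twI[OF _ _ _ iota_scal]) (simp_all add: SH_set.scalar tstar_single aut7_one iota_scal)

lemma tw_add:
  assumes "tw \<tau> D E" "tw \<tau> D' E'"
  shows "tw \<tau> (\<lambda>f. D f + D' f) (\<lambda>f. E f + E' f)"
proof -
  obtain F F' where F: "F \<in> iota D" "F' \<in> iota D'" using assms iota_nonempty by (fastforce simp: tw_def)
  show ?thesis
    by (rule twI[OF _ _ _ iota_add[OF F]]) (use assms F in \<open>auto simp: tw_def tstar_add intro: SH_set.add iota_add\<close>)
qed

lemma klin_SH: "D \<in> SH_set \<Longrightarrow> klin D"
  by (rule klin_diffops[OF SH_diffops])

lemma tw_mult:
  assumes "tw \<tau> D E" "tw \<tau> D' E'"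
  shows "tw \<tau> (D \<circ> D') (E \<circ> E')"
proof -
  obtain F F' where F: "F \<in> iota D" "F' \<in> iota D'" using assms iota_nonempty by (fastforce simp: tw_def)
  have k: "klin D" "klin E" using assms klin_SH by (auto simp: tw_def)
  have "tstar \<tau> (tmul F F') = tmul (tstar \<tau> F) (tstar \<tau> F')"
    using assms F by (intro tstar_mult iota_LKc) (auto simp: tw_def)
  then show ?thesis
    by (intro twI[OF _ _ _ iota_mult[OF k(1) F]]) (use assms F k in \<open>auto simp: tw_def intro: SH_set.mult iota_mult\<close>)
qed

lemma tw_inverse:
  assumes "tw \<tau> D E"
  shows "tw (inv_into L7 \<tau>) E D"
proof -
  obtain F where F: "F \<in> iota D" using assms iota_nonempty by (fastforce simp: tw_def)
  show ?thesis
    by (rule twI[of _ _ _ "tstar \<tau> F"]) (use assms F tstar_inverse[OF _ iota_LKc[OF F]] in \<open>auto simp: tw_def aut7_inv\<close>)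
qed

lemma tw_comp: "tw \<tau> D E \<Longrightarrow> tw \<sigma> E E' \<Longrightarrow> tw (\<sigma> \<circ> \<tau>) D E'"
  unfolding tw_def by (auto simp: aut7_comp tstar_comp[symmetric])

lemma q_bracket_eq: "q_bracket P Q = scal_op (inverse (qq - inverse qq)) \<circ>
    (\<lambda>f. (scal_op qh \<circ> (P \<circ> Q)) f + (scal_op (- inverse qh) \<circ> (Q \<circ> P)) f)"
  by (simp add: fun_eq_iff q_bracket_def scal_op_def rhom_uminus[OF rhom_const])

lemma q_bracket_SH: "P \<in> SH_set \<Longrightarrow> Q \<in> SH_set \<Longrightarrow> q_bracket P Q \<in> SH_set"
  unfolding q_bracket_eq by (intro SH_set.mult SH_set.add SH_set.scalar)

lemma tw_bracket:
  assumes "tw \<tau> P P'" "tw \<tau> Q Q'"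
  shows "tw \<tau> (q_bracket P Q) (q_bracket P' Q')"
proof -
  have "aut7 \<tau>" using assms by (simp add: tw_def)
  then show ?thesis unfolding q_bracket_eq by (intro tw_mult tw_add tw_scal assms)
qed

text \<open>The curve disjoint from \<open>A\<^sub>k\<close>.\<close>

definition Bc :: "nat \<Rightarrow> qdop" where
  "Bc k = (if k = 1 then O_B 2 3 else if k = 2 then O_B 1 3 else O_B 1 2)"

definition LBc :: "nat \<Rightarrow> terms" where
  "LBc k = (if k = 1 then LB23 else if k = 2 then LB13 else LB12)"

definition LAc :: "nat \<Rightarrow> terms" where
  "LAc k = (if k = 1 then LA1 else if k = 2 then LA2 else LA3)"

abbreviation (input) ks3 :: "nat set" where "ks3 \<equiv> {1, 2, 3}"

lemma SH_gens: "k \<in> ks3 \<Longrightarrow> O_A k \<in> SH_set" "Bc k \<in> SH_set"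
  unfolding Bc_def by (auto intro: SH_set.O_A SH_set.O_B)

lemma gens_Hfam: "k \<in> ks3 \<Longrightarrow> O_A k (Hfam a b c) = actT Hfam (ip (LAc k)) a b c"
  "Bc k (Hfam a b c) = actT Hfam (ip (LBc k)) a b c"
  unfolding Bc_def LAc_def LBc_def by (auto simp del: One_nat_def simp: O_A_Hfam O_B_Hfam)

lemma gens_L7: "ip (LAc k) \<in> L7" "ip (LBc k) \<in> L7"
  using L7_gens unfolding L_A_ip L_B_ip LAc_def LBc_def by auto

lemma iota_single: "D \<in> SH_set \<Longrightarrow> f \<in> L7 \<Longrightarrow> (\<And>a b c. D (Hfam a b c) = actT Hfam f a b c) \<Longrightarrow> single (1, f) 1 \<in> iota D"
  unfolding iota_def using LKc_single[of "(1, f)" 1] by (simp add: actK_single)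

lemma tw_single:
  assumes "aut7 \<tau>" "D \<in> SH_set" "E \<in> SH_set" "f \<in> L7" "\<And>a b c. D (Hfam a b c) = actT Hfam f a b c"
    "\<And>a b c. E (Hfam a b c) = actT Hfam (\<tau> f) a b c"
  shows "tw \<tau> D E"
  by (rule twI[OF assms(1-3) iota_single[OF assms(2,4,5)]])
    (use iota_single[OF assms(3) aut7D(2)[OF assms(1,4)] assms(6)] in \<open>simp add: tstar_single\<close>)

lemma actT_comp:
  assumes "klin D" "f \<in> L7" "g \<in> L7" "\<And>a b c. D (Hfam a b c) = actT Hfam f a b c" "\<And>a b c. E (Hfam a b c) = actT Hfam g a b c"
  shows "D (E (Hfam a b c)) = actT Hfam (f \<odot> g) a b c"
proof -
  have "(\<lambda>a b c. D (Hfam a b c)) = actT Hfam f" using assms(4) by (simp add: fun_eq_iff)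
  then show ?thesis
    unfolding assms(5) klin_actT[OF assms(1)] by (simp add: actT_mult[OF L7_keys L7_keys] assms)
qed

lemma qh_square: "const (qlaurent_to_K (single 2 1)) = const qq" "const (qlaurent_to_K (single (- 2) (- 1))) = - const (inverse qq)"
  "const (qlaurent_to_K (single 1 1)) = const qh" "const (qlaurent_to_K (single (- 1) (- 1))) = - const (inverse qh)"
  "const (qlaurent_to_K (single (- 2) 1)) = const (inverse qq)"
  "const (qlaurent_to_K (single 4 1)) = const qq * const qq"
  "const (qlaurent_to_K (single (- 4) 1)) = const (inverse qq) * const (inverse qq)"
  "const (qlaurent_to_K (single 0 (- 2))) = - 2"
proof -
  have m: "qh powi (- 2) = inverse qq" "qh powi (- 1) = inverse qh" "qh powi 2 = qq"
    by (simp_all add: qq_def power_int_minus)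
  have f: "qh powi 4 = qq * qq" "qh powi (- 4) = inverse qq * inverse qq"
    by (simp_all add: qq_def power_int_minus power_add[symmetric] flip: inverse_mult_distrib)
  have n: "const 2 = 2" using rhom_of_int[OF rhom_const, of 2] by simp
  show "const (qlaurent_to_K (single 2 1)) = const qq" "const (qlaurent_to_K (single (- 2) (- 1))) = - const (inverse qq)"
    "const (qlaurent_to_K (single 1 1)) = const qh" "const (qlaurent_to_K (single (- 1) (- 1))) = - const (inverse qh)"
    "const (qlaurent_to_K (single (- 2) 1)) = const (inverse qq)"
    "const (qlaurent_to_K (single 4 1)) = const qq * const qq"
    "const (qlaurent_to_K (single (- 4) 1)) = const (inverse qq) * const (inverse qq)"
    "const (qlaurent_to_K (single 0 (- 2))) = - 2"
    unfolding qlaurent_to_K_single m f by (simp_all add: m f n rhom_uminus[OF rhom_const] rhomD(3)[OF rhom_const])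
qed

lemma qq_nontrivial: "qq - inverse qq \<noteq> 0"
proof
  assume "qq - inverse qq = 0"
  then have "qq powi 1 = qq powi (- 1)" by simp
  then show False unfolding qq_powi_inj by simp
qed

text \<open>The torus identity carries the factor q - q^-1 on the side of \<open>h\<close>. It is
  divided out only after acting on the family, where the scalars form a field.\<close>

lemma bracket_Hfam:
  assumes D: "A \<in> SH_set" "B \<in> SH_set" and f: "f \<in> L7" "g \<in> L7" "h \<in> L7"
    and H: "\<And>a b c. A (Hfam a b c) = actT Hfam f a b c" "\<And>a b c. B (Hfam a b c) = actT Hfam g a b c"
    and br: "scl (single 2 1) h + scl (single (- 2) (- 1)) h
      = scl (single 1 1) (g \<odot> f) + scl (single (- 1) (- 1)) (f \<odot> g)"
  shows "q_bracket B A (Hfam a b c) = actT Hfam h a b c"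
proof -
  have "actT Hfam (scl (single 2 1) h + scl (single (- 2) (- 1)) h) a b c =
    const (qq - inverse qq) * actT Hfam h a b c"
    unfolding actT_add actT_scl qh_square by (simp add: rhom_diff[OF rhom_const] left_diff_distrib)
  moreover have "actT Hfam (scl (single 1 1) (g \<odot> f) + scl (single (- 1) (- 1)) (f \<odot> g)) a b c =
    const qh * B (A (Hfam a b c)) - const (inverse qh) * A (B (Hfam a b c))"
    unfolding actT_add actT_scl qh_square actT_comp[OF klin_SH[OF D(1)] f(1,2) H] actT_comp[OF klin_SH[OF D(2)] f(2,1) H(2,1)] by simp
  ultimately have "const qh * B (A (Hfam a b c)) - const (inverse qh) * A (B (Hfam a b c)) = const (qq - inverse qq) * actT Hfam h a b c"
    using br by simp
  moreover have "const (inverse (qq - inverse qq)) * const (qq - inverse qq) = 1"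
    using qq_nontrivial by (simp add: rhomD(3)[OF rhom_const, symmetric])
  ultimately show ?thesis by (simp add: q_bracket_def mult.assoc[symmetric])
qed

text \<open>Expanded, the double bracket is the cubic relation divided by (q - q^-1)^2. Consequently
  a map that fixes B and sends A to [B, A] sends [A, B] to A, and its inverse sends A to
  [A, B].\<close>

lemma cubic_relation:
  assumes k: "k \<in> ks3" and chk: "cubic_check (LAc k) (LBc l)"
  shows "q_bracket (q_bracket (Bc l) (O_A k)) (Bc l) = O_A k"
proof
  fix f
  define A B where "A = O_A k" and "B = Bc l"
  define x y where "x = ip (LAc k)" and "y = ip (LBc l)"
  have S: "A \<in> SH_set" "B \<in> SH_set" using SH_gens k by (simp_all add: A_def B_def)
  have L: "x \<in> L7" "y \<in> L7" by (simp_all add: x_def y_def gens_L7)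
  have H: "A (Hfam a b c) = actT Hfam x a b c" "B (Hfam a b c) = actT Hfam y a b c" for a b c
    using gens_Hfam k by (simp_all add: A_def B_def x_def y_def)
  note k = klin_SH[OF S(1)] klin_SH[OF S(2)]
  define d where "d = const qq - const (inverse qq)"
  have dc: "d = const (qq - inverse qq)" by (simp add: d_def rhom_diff[OF rhom_const])
  have eq: "y \<odot> (y \<odot> x) + (x \<odot> y) \<odot> y + (scl (single 4 1) x + scl (single 0 (- 2)) x + scl (single (- 4) 1) x)
     = scl (single 2 1) (y \<odot> (x \<odot> y)) + scl (single (- 2) 1) (y \<odot> (x \<odot> y))"
    using equal7_ip[OF chk[unfolded cubic_check_def Let_def]]
    by (simp add: ip_mul7[OF rep_X7] ip_scale7 x_def y_def add.assoc)
  have cc: "const qq * const (inverse qq) = 1" by (simp add: rhomD(3)[OF rhom_const, symmetric])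
  have H3: "B (B (A (Hfam a b c))) = actT Hfam (y \<odot> (y \<odot> x)) a b c" "B (A (B (Hfam a b c))) = actT Hfam (y \<odot> (x \<odot> y)) a b c"
    "A (B (B (Hfam a b c))) = actT Hfam ((x \<odot> y) \<odot> y) a b c" for a b c
  proof -
    note c = actT_comp[OF k(2) L(2)]
    show "B (B (A (Hfam a b c))) = actT Hfam (y \<odot> (y \<odot> x)) a b c"
      by (rule actT_comp[OF k(2) L(2) L7_closed(2)[OF L(2,1)] H(2), where E = "\<lambda>f. B (A f)"]) (rule actT_comp[OF k(2) L(2,1) H(2,1)])
    show "B (A (B (Hfam a b c))) = actT Hfam (y \<odot> (x \<odot> y)) a b c"
      by (rule actT_comp[OF k(2) L(2) L7_closed(2)[OF L] H(2), where E = "\<lambda>f. A (B f)"]) (rule actT_comp[OF k(1) L H])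
    have "klin (A \<circ> B)" by (rule klin_SH[OF SH_set.mult[OF S]])
    then show "A (B (B (Hfam a b c))) = actT Hfam ((x \<odot> y) \<odot> y) a b c"
      using actT_comp[OF _ L7_closed(2)[OF L] L(2) _ H(2), of "A \<circ> B" a b c] actT_comp[OF k(1) L H] by simp
  qed
  define Z where "Z = q_bracket (q_bracket B A) B"
  have Z: "d * d * Z f = (const qq + const (inverse qq)) * B (A (B f)) - A (B (B f)) - B (B (A f))" for f
  proof -
    have di: "d * const (inverse (qq - inverse qq)) = 1"
      using qq_nontrivial by (simp add: dc rhomD(3)[OF rhom_const, symmetric])
    have q: "const qh * const qh = const qq" "const (inverse qh) * const (inverse qh) = const (inverse qq)" "const qh * const (inverse qh) = 1"
      by (simp_all add: rhomD(3)[OF rhom_const, symmetric] qq_def power2_eq_square)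
    define e where "e = const (inverse (qq - inverse qq))"
    have kd: "D (f - g) = D f - D g" if "klin D" for D f g
      using klinD(1)[OF that, of "f - g" g] by (simp add: eq_diff_eq)
    have P: "q_bracket B A g = e * (const qh * B (A g) - const (inverse qh) * A (B g))" for g
      by (simp add: q_bracket_def e_def)
    have BP: "B (q_bracket B A f) = e * (const qh * B (B (A f)) - const (inverse qh) * B (A (B f)))"
      unfolding P e_def by (simp only: klinD[OF k(2)] kd[OF k(2)])
    have "Z f = e * (const qh * q_bracket B A (B f) - const (inverse qh) * B (q_bracket B A f))"
      by (simp only: Z_def q_bracket_def[of "q_bracket B A"] e_def)
    also have "\<dots> = e * e * ((const qh * const qh + const (inverse qh) * const (inverse qh)) * B (A (B f))
        - const qh * const (inverse qh) * A (B (B f)) - const qh * const (inverse qh) * B (B (A f)))"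
      unfolding BP unfolding P by (simp add: algebra_simps)
    finally have "d * d * Z f = (d * e) * (d * e) * ((const qh * const qh + const (inverse qh) * const (inverse qh)) * B (A (B f))
        - const qh * const (inverse qh) * A (B (B f)) - const qh * const (inverse qh) * B (B (A f)))"
      by (simp only: mult_ac)
    then show ?thesis using di by (simp add: q e_def)
  qed
  have "d * d * Z (Hfam a b c) = d * d * A (Hfam a b c)" for a b c
  proof -
    have "actT Hfam (y \<odot> (y \<odot> x)) a b c + actT Hfam ((x \<odot> y) \<odot> y) a b c + d * d * actT Hfam x a b c
      = (const qq + const (inverse qq)) * actT Hfam (y \<odot> (x \<odot> y)) a b c"
      using arg_cong[OF eq, of "\<lambda>F. actT Hfam F a b c"] cc
      by (simp add: actT_add actT_scl qh_square d_def algebra_simps)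
    then show ?thesis unfolding Z H3 unfolding H(1) by (simp add: algebra_simps)
  qed
  moreover have "d \<noteq> 0" using qq_nontrivial by (simp add: dc const_nonzero)
  ultimately have "Z (Hfam a b c) - A (Hfam a b c) = 0" for a b c by simp
  then have "Z f - A f = 0"
    using iota_eq_zero[OF SH_diff[OF _ S(1)], of Z f] S by (simp add: Z_def q_bracket_SH)
  then show "q_bracket (q_bracket (Bc l) (O_A k)) (Bc l) f = O_A k f" by (simp add: Z_def A_def B_def)
qed

section \<open>Automorphisms of the source algebra induced by cluster automorphisms\<close>

definition twist :: "(qtorus \<Rightarrow> qtorus) \<Rightarrow> qdop \<Rightarrow> qdop" where
  "twist \<tau> = (\<lambda>D\<in>SH_set. SOME E. tw \<tau> D E)"

lemma twist_eq: "tw \<tau> D E \<Longrightarrow> twist \<tau> D = E"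
  using tw_unique[of \<tau> D] someI[of "tw \<tau> D" E] by (auto simp: twist_def tw_def)

lemma Bc_simps: "Bc 1 = O_B 2 3" "Bc 2 = O_B 1 3" "Bc 3 = O_B 1 2"
  by (simp_all add: Bc_def)

lemma SH_gens_induct [consumes 1, case_names scalar A B add mult]:
  assumes "D \<in> SH_set" "\<And>c. P (scal_op c)" "\<And>k. k \<in> ks3 \<Longrightarrow> P (O_A k)" "\<And>k. k \<in> ks3 \<Longrightarrow> P (Bc k)"
    "\<And>D E. D \<in> SH_set \<Longrightarrow> E \<in> SH_set \<Longrightarrow> P D \<Longrightarrow> P E \<Longrightarrow> P (\<lambda>f. D f + E f)"
    "\<And>D E. D \<in> SH_set \<Longrightarrow> E \<in> SH_set \<Longrightarrow> P D \<Longrightarrow> P E \<Longrightarrow> P (D \<circ> E)"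
  shows "P D"
  using assms(1)
proof (induction rule: SH_set.induct)
  case (O_B i j)
  then show ?case
    using O_B_cases[OF O_B] assms(4)[of 1] assms(4)[of 2] assms(4)[of 3] unfolding Bc_simps by auto
qed (use assms in blast)+

lemma SH_aut_unique:
  assumes "\<phi> \<in> SH_aut" "\<psi> \<in> SH_aut" "\<And>k. k \<in> ks3 \<Longrightarrow> \<phi> (O_A k) = \<psi> (O_A k)" "\<And>k. k \<in> ks3 \<Longrightarrow> \<phi> (Bc k) = \<psi> (Bc k)"
  shows "\<phi> = \<psi>"
proof (rule extensionalityI[where A = SH_set])
  have hom: "\<phi> \<in> ring_hom SH SH" "\<psi> \<in> ring_hom SH SH" "\<And>c. \<phi> (scal_op c) = scal_op c" "\<And>c. \<psi> (scal_op c) = scal_op c"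
    using assms(1,2) by (auto simp: SH_aut_def K_alg_hom_def)
  show "\<phi> \<in> extensional SH_set" "\<psi> \<in> extensional SH_set"
    using assms(1,2) by (auto simp: SH_aut_def SH_sel)
  fix D assume "D \<in> SH_set"
  then show "\<phi> D = \<psi> D"
  proof (induction rule: SH_gens_induct)
    case (add D E)
    then show ?case using ring_hom_add[OF hom(1), of D E] ring_hom_add[OF hom(2), of D E] by (simp add: SH_sel)
  next
    case (mult D E)
    then show ?case
      by (simp only: ring_hom_mult[OF hom(1), unfolded SH_sel, of D E] ring_hom_mult[OF hom(2), unfolded SH_sel, of D E])
  qed (simp_all add: hom assms(3,4))
qed

text \<open>Generators must have both images and preimages under \<tau>: the images make
  \<open>twist \<tau>\<close> total, the preimages make it surjective. Sums and products inherit
  both.\<close>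

lemma twist_aut:
  assumes \<tau>: "aut7 \<tau>"
    and tot: "\<And>k. k \<in> ks3 \<Longrightarrow> \<exists>E. tw \<tau> (O_A k) E" "\<And>k. k \<in> ks3 \<Longrightarrow> \<exists>E. tw \<tau> (Bc k) E"
    and sur: "\<And>k. k \<in> ks3 \<Longrightarrow> \<exists>D. tw \<tau> D (O_A k)" "\<And>k. k \<in> ks3 \<Longrightarrow> \<exists>D. tw \<tau> D (Bc k)"
  shows "twist \<tau> \<in> SH_aut" "D \<in> SH_set \<Longrightarrow> tw \<tau> D (twist \<tau> D)"
proof -
  have ex: "\<exists>E. tw \<tau> D E" if "D \<in> SH_set" for D
    using that
  proof (induction rule: SH_gens_induct)
    case (scalar c)
    show ?case using tw_scal[OF \<tau>] by blast
  next
    case (add D E)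
    then show ?case using tw_add by blast
  next
    case (mult D E)
    then show ?case using tw_mult by blast
  qed (use tot in auto)
  have ex': "\<exists>D. tw \<tau> D E" if "E \<in> SH_set" for E
    using that
  proof (induction rule: SH_gens_induct)
    case (scalar c)
    show ?case using tw_scal[OF \<tau>] by blast
  next
    case (add D E)
    then show ?case using tw_add by blast
  next
    case (mult D E)
    then show ?case using tw_mult by blast
  qed (use sur in auto)
  show tw: "tw \<tau> D (twist \<tau> D)" if "D \<in> SH_set" for D
    using ex[OF that] twist_eq by blast
  have cl: "twist \<tau> D \<in> SH_set" if "D \<in> SH_set" for D
    using tw[OF that] by (simp add: tw_def)
  have "twist \<tau> \<in> ring_hom SH SH"
  proof (rule ring_hom_memI; unfold SH_sel)
    show "twist \<tau> (D \<circ> E) = twist \<tau> D \<circ> twist \<tau> E" "twist \<tau> (\<lambda>f. D f + E f) = (\<lambda>f. twist \<tau> D f + twist \<tau> E f)"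
      if "D \<in> SH_set" "E \<in> SH_set" for D E
      using twist_eq[OF tw_mult[OF tw[OF that(1)] tw[OF that(2)]]] twist_eq[OF tw_add[OF tw[OF that(1)] tw[OF that(2)]]] by simp_all
    have "scal_op 1 = id" by (simp add: fun_eq_iff scal_op_def)
    then show "twist \<tau> id = id" using twist_eq[OF tw_scal[OF \<tau>, of 1]] by simp
  qed (rule cl)
  moreover have "twist \<tau> (scal_op c) = scal_op c" for c by (rule twist_eq[OF tw_scal[OF \<tau>]])
  moreover have "bij_betw (twist \<tau>) SH_set SH_set"
    unfolding bij_betw_def
  proof (intro conjI inj_onI equalityI subsetI)
    fix D E assume DE: "D \<in> SH_set" "E \<in> SH_set" "twist \<tau> D = twist \<tau> E"
    show "D = E"
      using tw_unique[OF tw_inverse[OF tw[OF DE(1)]]] tw_inverse[OF tw[OF DE(2)]] DE(3) by simp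
  next
    fix E assume "E \<in> SH_set"
    then obtain D where D: "tw \<tau> D E" using ex' by blast
    then show "E \<in> twist \<tau> ` SH_set" using twist_eq[OF D] by (auto simp: tw_def)
  qed (use cl in auto)
  moreover have "twist \<tau> \<in> extensional SH_set" by (simp add: twist_def)
  ultimately show "twist \<tau> \<in> SH_aut" by (simp add: SH_aut_def K_alg_hom_def SH_sel)
qed

lemma ip_C7: "ip C7 \<in> L7" "tpow 1 = scl (single 2 (- 1)) (ip C7)"
proof -
  show "ip C7 \<in> L7" by (rule laurent_check_sound[OF laurent_checks(7)])
  have "wt (- 1, - 1, - 1, - 1, - 1, - 1, - 2) = - c7"
    unfolding vec_eq_iff forall_7 by (simp_all add: c7_def ebas_def axis_def)
  then show "tpow 1 = scl (single 2 (- 1)) (ip C7)"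
    by (simp add: tpow_def C7_def tm_def)
qed

context cluster_loop
begin

lemma cm_aut7:
  assumes "cm (ip C7) = ip C7"
  shows "aut7 cm"
  unfolding aut7_def
  using cm_bij cm_add cm_mult cm_const cm_scl[OF ip_C7(1), of "single 2 (- 1)"] by (simp add: ip_C7(2) assms)

lemma cm_bracket_check:
  assumes "ks = [k]" "\<And>i. idx (\<pi> i) = p (idx i)" "bracket_check p (idx k) f g" "ip f \<in> L7"
  shows "scl (single 2 1) (cm (ip f)) + scl (single (- 2) (- 1)) (cm (ip f))
    = scl (single 1 1) (ip g \<odot> ip f) + scl (single (- 1) (- 1)) (ip f \<odot> ip g)"
proof -
  obtain h where h: "mut7 X7_mat (idx k) f = Some h"
    and e: "equal7 (scale7 2 1 (perm7 p h) @ scale7 (- 2) (- 1) (perm7 p h)) (scale7 1 1 (mul7 X7_mat g f) @ scale7 (- 1) (- 1) (mul7 X7_mat f g))"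
    using assms(3) by (auto simp: bracket_check_def Let_def split: option.splits)
  have "mut7_seq X7_mat (map idx ks) f = Some h"
    using h by (simp add: assms(1))
  note s = mut7_seq_sound[OF skew_X7 rep_X7 this L7_keys[OF assms(4)]]
  then have "cm (ip f) = lat_map (perm_lat \<pi>) (ip h)"
    unfolding cm_def by (intro cluster_map_eq) auto
  then have "cm (ip f) = ip (perm7 p h)"
    using lat_map_perm7[OF assms(2) inv] by simp
  then show ?thesis
    using equal7_ip[OF e] by (simp add: ip_scale7 ip_mul7[OF rep_X7])
qed

end

text \<open>The cluster maps before they are inverted to twists. The index \<open>l\<close> is the
  one missing from the pair of the curve B_ij, as in \<open>Bc\<close> and
  \<open>LBc\<close>.\<close>

definition bt :: "nat \<Rightarrow> qtorus \<Rightarrow> qtorus" where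
  "bt l = (if l = 1 then cluster_map X7 (Transposition.transpose 1 2) [1]
    else if l = 2 then cluster_map X7 (Transposition.transpose 3 4) [3]
    else cluster_map X7 (Transposition.transpose 5 6) [5])"

lemma bt_facts:
  assumes "l \<in> ks3"
  shows "aut7 (bt l)" "k \<in> ks3 \<Longrightarrow> bt l (ip (LBc k)) = ip (LBc k)" "bt l (ip (LAc l)) = ip (LAc l)"
    "k \<in> ks3 \<Longrightarrow> k \<noteq> l \<Longrightarrow> scl (single 2 1) (bt l (ip (LAc k))) + scl (single (- 2) (- 1)) (bt l (ip (LAc k)))
      = scl (single 1 1) (ip (LBc l) \<odot> ip (LAc k)) + scl (single (- 1) (- 1)) (ip (LAc k) \<odot> ip (LBc l))"
proof -
  have inv: "Transposition.transpose a b (Transposition.transpose a b i) = i" for a b i :: 7 by simp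
  have ix: "idx (Transposition.transpose 1 2 i) = swap7 1 2 (idx i)" "idx (Transposition.transpose 3 4 i) = swap7 3 4 (idx i)"
    "idx (Transposition.transpose 5 6 i) = swap7 5 6 (idx i)" for i
    using exhaust_7[of i] by (auto simp: swap7_def Transposition.transpose_def)
  interpret b1: cluster_loop "Transposition.transpose 1 2" "[1]"
    by (rule cluster_loopI[OF inv ix(1)]) (use quiver_checks(4) in simp)
  interpret b2: cluster_loop "Transposition.transpose 3 4" "[3]"
    by (rule cluster_loopI[OF inv ix(2)]) (use quiver_checks(3) in simp)
  interpret b3: cluster_loop "Transposition.transpose 5 6" "[5]"
    by (rule cluster_loopI[OF inv ix(3)]) (use quiver_checks(2) in simp)
  have bt: "bt 1 = b1.cm" "bt 2 = b2.cm" "bt 3 = b3.cm"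
    by (simp_all add: bt_def b1.cm_def b2.cm_def b3.cm_def fun_eq_iff)
  have s1: "bt 1 (ip f) = ip g" if "seq_check (swap7 1 2) [1] f g" "ip f \<in> L7" for f g
    unfolding bt by (rule b1.cm_seq_check[OF ix(1)]) (use that in simp_all)
  have s2: "bt 2 (ip f) = ip g" if "seq_check (swap7 3 4) [3] f g" "ip f \<in> L7" for f g
    unfolding bt by (rule b2.cm_seq_check[OF ix(2)]) (use that in simp_all)
  have s3: "bt 3 (ip f) = ip g" if "seq_check (swap7 5 6) [5] f g" "ip f \<in> L7" for f g
    unfolding bt by (rule b3.cm_seq_check[OF ix(3)]) (use that in simp_all)
  note L = gens_L7(1)[of 1, unfolded LAc_def, simplified] gens_L7(1)[of 2, unfolded LAc_def, simplified] gens_L7(1)[of 3, unfolded LAc_def, simplified]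
    gens_L7(2)[of 1, unfolded LBc_def, simplified] gens_L7(2)[of 2, unfolded LBc_def, simplified] gens_L7(2)[of 3, unfolded LBc_def, simplified]
  show "aut7 (bt l)"
    using assms b1.cm_aut7[folded bt, OF s1[OF twist_LB23_checks(5) ip_C7(1)]] b2.cm_aut7[folded bt, OF s2[OF twist_LB13_checks(5) ip_C7(1)]]
      b3.cm_aut7[folded bt, OF s3[OF twist_LB12_checks(5) ip_C7(1)]] by auto
  show "bt l (ip (LBc k)) = ip (LBc k)" if "k \<in> ks3"
    using assms that s1[OF twist_LB23_checks(1) L(6)] s1[OF twist_LB23_checks(2) L(5)] s1[OF twist_LB23_checks(3) L(4)]
      s2[OF twist_LB13_checks(1) L(6)] s2[OF twist_LB13_checks(2) L(5)] s2[OF twist_LB13_checks(3) L(4)]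
      s3[OF twist_LB12_checks(1) L(6)] s3[OF twist_LB12_checks(2) L(5)] s3[OF twist_LB12_checks(3) L(4)]
    by (auto simp: LBc_def)
  show "bt l (ip (LAc l)) = ip (LAc l)"
    using assms s1[OF twist_LB23_checks(4) L(1)] s2[OF twist_LB13_checks(4) L(2)] s3[OF twist_LB12_checks(4) L(3)] by (auto simp: LAc_def)
  show "scl (single 2 1) (bt l (ip (LAc k))) + scl (single (- 2) (- 1)) (bt l (ip (LAc k)))
      = scl (single 1 1) (ip (LBc l) \<odot> ip (LAc k)) + scl (single (- 1) (- 1)) (ip (LAc k) \<odot> ip (LBc l))"
    if "k \<in> ks3" "k \<noteq> l"
    using assms that
      b1.cm_bracket_check[OF refl ix(1), of LA2 LB23, folded bt] b1.cm_bracket_check[OF refl ix(1), of LA3 LB23, folded bt]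
      b2.cm_bracket_check[OF refl ix(2), of LA1 LB13, folded bt] b2.cm_bracket_check[OF refl ix(2), of LA3 LB13, folded bt]
      b3.cm_bracket_check[OF refl ix(3), of LA1 LB12, folded bt] b3.cm_bracket_check[OF refl ix(3), of LA2 LB12, folded bt]
      twist_LB23_checks(6,7) twist_LB13_checks(6,7) twist_LB12_checks(6,7) L
    by (elim insertE emptyE) (simp_all add: LAc_def LBc_def del: One_nat_def)
qed

lemma bt_tw:
  assumes l: "l \<in> ks3" and k: "k \<in> ks3"
  shows "tw (bt l) (Bc k) (Bc k)" "tw (bt l) (O_A l) (O_A l)"
    "k \<noteq> l \<Longrightarrow> tw (bt l) (O_A k) (q_bracket (Bc l) (O_A k))" "k \<noteq> l \<Longrightarrow> tw (bt l) (q_bracket (O_A k) (Bc l)) (O_A k)"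
proof -
  note B = bt_facts[OF l]
  have b: "tw (bt l) (Bc k) (Bc k)" if "k \<in> ks3" for k
    by (rule tw_single[OF B(1) SH_gens(2) SH_gens(2) gens_L7(2) gens_Hfam(2)]) (simp only: B(2)[OF that] gens_Hfam(2))
  show "tw (bt l) (Bc k) (Bc k)" by (rule b[OF k])
  show "tw (bt l) (O_A l) (O_A l)"
    by (rule tw_single[OF B(1) SH_gens(1)[OF l] SH_gens(1)[OF l] gens_L7(1) gens_Hfam(1)[OF l]]) (simp only: B(3) gens_Hfam(1)[OF l])
  assume kl: "k \<noteq> l"
  show a: "tw (bt l) (O_A k) (q_bracket (Bc l) (O_A k))"
    by (rule tw_single[OF B(1) SH_gens(1)[OF k] q_bracket_SH[OF SH_gens(2) SH_gens(1)[OF k]] gens_L7(1) gens_Hfam(1)[OF k]])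
      (rule bracket_Hfam[OF SH_gens(1)[OF k] SH_gens(2) gens_L7(1) gens_L7(2) aut7D(2)[OF B(1) gens_L7(1)] gens_Hfam(1)[OF k] gens_Hfam(2) B(4)[OF k kl]])
  have "cubic_check (LAc k) (LBc l)"
    using l k kl cubic_checks by (elim insertE emptyE) (simp_all add: LAc_def LBc_def)
  from tw_bracket[OF a b[OF l]] cubic_relation[OF k this]
  show "tw (bt l) (q_bracket (O_A k) (Bc l)) (O_A k)" by simp
qed

lemma sigma_tw:
  assumes k: "k \<in> ks3"
  shows "tw sigma (Bc k) (O_A k)" "tw sigma (O_A k) (Bc k)"
proof -
  define \<pi> :: "7 \<Rightarrow> 7" where "\<pi> = Transposition.transpose 1 5 \<circ> Transposition.transpose 3 7"
  have inv: "\<pi> (\<pi> i) = i" and ix: "idx (\<pi> i) = sig7 (idx i)" for i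
    using exhaust_7[of i] by (auto simp: \<pi>_def sig7_def Transposition.transpose_def)
  interpret s: cluster_loop \<pi> "[3, 7, 1, 5, 3, 7]"
    by (rule cluster_loopI[OF inv ix]) (use quiver_checks(1) in simp)
  have sg: "sigma = s.cm" unfolding sigma_def \<pi>_def[symmetric] by (simp add: s.cm_def fun_eq_iff)
  have c: "sigma (ip f) = ip g" if "seq_check sig7 [3, 7, 1, 5, 3, 7] f g" "ip f \<in> L7" for f g
    unfolding sg by (rule s.cm_seq_check[OF ix]) (use that in simp_all)
  have aut: "aut7 sigma" by (rule s.cm_aut7[folded sg, OF c[OF sigma_checks(7) ip_C7(1)]])
  note L = gens_L7(1)[of 1, unfolded LAc_def, simplified] gens_L7(1)[of 2, unfolded LAc_def, simplified] gens_L7(1)[of 3, unfolded LAc_def, simplified]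
    gens_L7(2)[of 1, unfolded LBc_def, simplified] gens_L7(2)[of 2, unfolded LBc_def, simplified] gens_L7(2)[of 3, unfolded LBc_def, simplified]
  have "sigma (ip (LBc k)) = ip (LAc k)" "sigma (ip (LAc k)) = ip (LBc k)"
    using k c[OF sigma_checks(1) L(6)] c[OF sigma_checks(2) L(5)] c[OF sigma_checks(3) L(4)]
      c[OF sigma_checks(4) L(1)] c[OF sigma_checks(5) L(2)] c[OF sigma_checks(6) L(3)] by (auto simp: LAc_def LBc_def)
  then show "tw sigma (Bc k) (O_A k)" "tw sigma (O_A k) (Bc k)"
    using tw_single[OF aut SH_gens(2) SH_gens(1)[OF k] gens_L7(2) gens_Hfam(2)] tw_single[OF aut SH_gens(1)[OF k] SH_gens(2) gens_L7(1) gens_Hfam(1)[OF k]]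
      gens_Hfam(1)[OF k] gens_Hfam(2) by simp_all
qed

definition tB :: "nat \<Rightarrow> qtorus \<Rightarrow> qtorus" where
  "tB l = inv_into L7 (bt l)"

definition tA :: "nat \<Rightarrow> qtorus \<Rightarrow> qtorus" where
  "tA l = sigma \<circ> (tB l \<circ> inv_into L7 sigma)"

lemma tau_eq: "tau_B 2 3 = tB 1" "tau_B 1 3 = tB 2" "tau_B 1 2 = tB 3" "l \<in> ks3 \<Longrightarrow> tau_A l = tA l"
  by (auto simp: tau_B_def tau_A_def tA_def tB_def bt_def doubleton_eq_iff comp_assoc)

lemma tB_tw:
  assumes l: "l \<in> ks3" and k: "k \<in> ks3"
  shows "tw (tB l) (Bc k) (Bc k)" "tw (tB l) (O_A l) (O_A l)" "k \<noteq> l \<Longrightarrow> tw (tB l) (O_A k) (q_bracket (O_A k) (Bc l))"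
    "k \<noteq> l \<Longrightarrow> tw (tB l) (q_bracket (Bc l) (O_A k)) (O_A k)"
  unfolding tB_def using bt_tw[OF l k] tw_inverse by blast+

lemma tA_tw:
  assumes l: "l \<in> ks3" and k: "k \<in> ks3"
  shows "tw (tA l) (O_A k) (O_A k)" "tw (tA l) (Bc l) (Bc l)" "k \<noteq> l \<Longrightarrow> tw (tA l) (Bc k) (q_bracket (Bc k) (O_A l))"
    "k \<noteq> l \<Longrightarrow> tw (tA l) (q_bracket (O_A l) (Bc k)) (Bc k)"
proof -
  note s = sigma_tw[OF k] sigma_tw[OF l]
  note i = tw_inverse[OF s(1)] tw_inverse[OF s(2)] tw_inverse[OF s(3)] tw_inverse[OF s(4)]
  note b = tB_tw[OF l k]
  \<comment> \<open>Conjugation by \<sigma>, which exchanges A_k with the curve B_ij disjoint from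
    it and commutes with brackets; statements about \<open>tB\<close> turn into statements about
    \<open>tA\<close>.\<close>
  have conj: "tw (tA l) D E" if "tw (inv_into L7 sigma) D D'" "tw (tB l) D' E'" "tw sigma E' E" for D D' E E'
    unfolding tA_def by (rule tw_comp[OF tw_comp[OF that(1,2)] that(3)])
  show "tw (tA l) (O_A k) (O_A k)" by (rule conj[OF i(1) b(1) s(1)])
  show "tw (tA l) (Bc l) (Bc l)" by (rule conj[OF i(4) b(2) s(4)])
  assume kl: "k \<noteq> l"
  show "tw (tA l) (Bc k) (q_bracket (Bc k) (O_A l))"
    by (rule conj[OF i(2) b(3)[OF kl] tw_bracket[OF s(2) s(3)]])
  show "tw (tA l) (q_bracket (O_A l) (Bc k)) (Bc k)"
    by (rule conj[OF tw_bracket[OF i(3) i(2)] b(4)[OF kl] s(2)])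
qed

lemma tB_twist:
  assumes l: "l \<in> ks3"
  shows "twist (tB l) \<in> SH_aut" "D \<in> SH_set \<Longrightarrow> tw (tB l) D (twist (tB l) D)"
    "k \<in> ks3 \<Longrightarrow> twist (tB l) (O_A k) = (if k = l then O_A k else q_bracket (O_A k) (Bc l))" "k \<in> ks3 \<Longrightarrow> twist (tB l) (Bc k) = Bc k"
proof -
  have t: "aut7 (tB l)" using tB_tw(1)[OF l l] by (simp add: tw_def)
  have "\<exists>E. tw (tB l) (O_A k) E" "\<exists>D. tw (tB l) D (O_A k)" "\<exists>E. tw (tB l) (Bc k) E" "\<exists>D. tw (tB l) D (Bc k)" if k: "k \<in> ks3" for k
    using tB_tw[OF l k] by (cases "k = l"; blast)+
  with twist_aut[OF t] show "twist (tB l) \<in> SH_aut" "D \<in> SH_set \<Longrightarrow> tw (tB l) D (twist (tB l) D)" by blast+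
  show "k \<in> ks3 \<Longrightarrow> twist (tB l) (O_A k) = (if k = l then O_A k else q_bracket (O_A k) (Bc l))" "k \<in> ks3 \<Longrightarrow> twist (tB l) (Bc k) = Bc k"
    using tB_tw[OF l] twist_eq by auto
qed

lemma tA_twist:
  assumes l: "l \<in> ks3"
  shows "twist (tA l) \<in> SH_aut" "D \<in> SH_set \<Longrightarrow> tw (tA l) D (twist (tA l) D)"
    "k \<in> ks3 \<Longrightarrow> twist (tA l) (Bc k) = (if k = l then Bc k else q_bracket (Bc k) (O_A l))" "k \<in> ks3 \<Longrightarrow> twist (tA l) (O_A k) = O_A k"
proof -
  have t: "aut7 (tA l)" using tA_tw(1)[OF l l] by (simp add: tw_def)
  have "\<exists>E. tw (tA l) (O_A k) E" "\<exists>D. tw (tA l) D (O_A k)" "\<exists>E. tw (tA l) (Bc k) E" "\<exists>D. tw (tA l) D (Bc k)" if k: "k \<in> ks3" for k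
    using tA_tw[OF l k] by (cases "k = l"; blast)+
  with twist_aut[OF t] show "twist (tA l) \<in> SH_aut" "D \<in> SH_set \<Longrightarrow> tw (tA l) D (twist (tA l) D)" by blast+
  show "k \<in> ks3 \<Longrightarrow> twist (tA l) (Bc k) = (if k = l then Bc k else q_bracket (Bc k) (O_A l))" "k \<in> ks3 \<Longrightarrow> twist (tA l) (O_A k) = O_A k"
    using tA_tw[OF l] twist_eq by auto
qed

lemma all_pairs: "(\<forall>i j::nat. 1 \<le> i \<and> i < j \<and> j \<le> 3 \<longrightarrow> P i j) \<longleftrightarrow> P 2 3 \<and> P 1 3 \<and> P 1 2"
  using O_B_cases by fastforce

text \<open>The definite descriptions are met by \<open>twist\<close>, which has the prescribed
  values on the generators, and by nothing else, since those values determine an extensional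
  automorphism.\<close>

lemma dehn_eqs:
  "dehn_b 2 3 = twist (tB 1)" "dehn_b 1 3 = twist (tB 2)" "dehn_b 1 2 = twist (tB 3)"
  "dehn_a 1 = twist (tA 1)" "dehn_a 2 = twist (tA 2)" "dehn_a 3 = twist (tA 3)"
proof -
  have b: "(THE \<phi>. \<phi> \<in> SH_aut \<and> (\<forall>k\<in>ks3. \<phi> (O_A k) = (if k \<in> S then q_bracket (O_A k) (Bc l) else O_A k)) \<and>
      (\<forall>k\<in>ks3. \<phi> (Bc k) = Bc k)) = twist (tB l)" if l: "l \<in> ks3" and S: "\<And>k. k \<in> ks3 \<Longrightarrow> k \<in> S \<longleftrightarrow> k \<noteq> l" for l S
  proof (rule the_equality)
    show "twist (tB l) \<in> SH_aut \<and> (\<forall>k\<in>ks3. twist (tB l) (O_A k) = (if k \<in> S then q_bracket (O_A k) (Bc l) else O_A k)) \<and>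
      (\<forall>k\<in>ks3. twist (tB l) (Bc k) = Bc k)"
      using tB_twist[OF l] S by auto
    fix \<phi> assume ph: "\<phi> \<in> SH_aut \<and> (\<forall>k\<in>ks3. \<phi> (O_A k) = (if k \<in> S then q_bracket (O_A k) (Bc l) else O_A k)) \<and>
      (\<forall>k\<in>ks3. \<phi> (Bc k) = Bc k)"
    show "\<phi> = twist (tB l)"
    proof (rule SH_aut_unique)
      fix k assume k: "k \<in> ks3"
      have "\<phi> (O_A k) = (if k \<in> S then q_bracket (O_A k) (Bc l) else O_A k)" "\<phi> (Bc k) = Bc k"
        using ph k by blast+
      then show "\<phi> (O_A k) = twist (tB l) (O_A k)" "\<phi> (Bc k) = twist (tB l) (Bc k)"
        using tB_twist(3,4)[OF l k] S[OF k] by simp_all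
    qed (use ph tB_twist(1)[OF l] in blast)+
  qed
  have a: "(THE \<phi>. \<phi> \<in> SH_aut \<and> (\<forall>k\<in>ks3. \<phi> (Bc k) = (if k \<noteq> l then q_bracket (Bc k) (O_A l) else Bc k)) \<and>
      (\<forall>k\<in>ks3. \<phi> (O_A k) = O_A k)) = twist (tA l)" if l: "l \<in> ks3" for l
  proof (rule the_equality)
    show "twist (tA l) \<in> SH_aut \<and> (\<forall>k\<in>ks3. twist (tA l) (Bc k) = (if k \<noteq> l then q_bracket (Bc k) (O_A l) else Bc k)) \<and>
      (\<forall>k\<in>ks3. twist (tA l) (O_A k) = O_A k)"
      using tA_twist[OF l] by auto
    fix \<phi> assume ph: "\<phi> \<in> SH_aut \<and> (\<forall>k\<in>ks3. \<phi> (Bc k) = (if k \<noteq> l then q_bracket (Bc k) (O_A l) else Bc k)) \<and>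
      (\<forall>k\<in>ks3. \<phi> (O_A k) = O_A k)"
    show "\<phi> = twist (tA l)"
    proof (rule SH_aut_unique)
      fix k assume k: "k \<in> ks3"
      have "\<phi> (Bc k) = (if k \<noteq> l then q_bracket (Bc k) (O_A l) else Bc k)" "\<phi> (O_A k) = O_A k"
        using ph k by blast+
      then show "\<phi> (O_A k) = twist (tA l) (O_A k)" "\<phi> (Bc k) = twist (tA l) (Bc k)"
        using tA_twist(3,4)[OF l k] by simp_all
    qed (use ph tA_twist(1)[OF l] in blast)+
  qed
  \<comment> \<open>A_k meets B_ij exactly when k differs from the third index.\<close>
  have S: "k \<in> {2, 3} \<longleftrightarrow> k \<noteq> 1" "k \<in> {1, 3} \<longleftrightarrow> k \<noteq> 2" "k \<in> {1, 2} \<longleftrightarrow> k \<noteq> 3" if "k \<in> ks3" for k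
    using that by auto
  have conj: "(\<forall>k\<in>ks3. P k) \<longleftrightarrow> P 1 \<and> P 2 \<and> P 3" for P by simp
  show "dehn_b 2 3 = twist (tB 1)" "dehn_b 1 3 = twist (tB 2)" "dehn_b 1 2 = twist (tB 3)"
    unfolding dehn_b_def all_pairs using b[OF _ S(1)] b[OF _ S(2)] b[OF _ S(3)]
    unfolding conj Bc_simps by simp_all
  show "dehn_a 1 = twist (tA 1)" "dehn_a 2 = twist (tA 2)" "dehn_a 3 = twist (tA 3)"
    unfolding dehn_a_def all_pairs using a[of 1] a[of 2] a[of 3]
    unfolding conj Bc_simps by simp_all
qed

theorem theorem4p6:
  shows "\<exists>\<iota>.
    \<iota> \<in> K_alg_hom SH scal_op Lhat_K (\<lambda>c. tensor c \<one>\<^bsub>Lhat\<^esub>) \<and>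
    inj_on \<iota> (carrier SH) \<and>
    (\<forall>k\<in>{1, 2, 3}. \<iota> (O_A k) = tensor 1 (L_A k)) \<and>
    (\<forall>i j. 1 \<le> i \<and> i < j \<and> j \<le> 3 \<longrightarrow> \<iota> (O_B i j) = tensor 1 (L_B i j)) \<and>
    (\<forall>k\<in>{1, 2, 3}. \<forall>D\<in>carrier SH. \<iota> (dehn_a k D) = K_extend (tau_A k) (\<iota> D)) \<and>
    (\<forall>i j. 1 \<le> i \<and> i < j \<and> j \<le> 3 \<longrightarrow>
       (\<forall>D\<in>carrier SH. \<iota> (dehn_b i j D) = K_extend (tau_B i j) (\<iota> D)))"
proof (rule exI[of _ iota], intro conjI iota_hom iota_inj_on)
  note g = iota_gens[THEN iota_tensor]
  show "\<forall>k\<in>{1, 2, 3}. iota (O_A k) = tensor 1 (L_A k)"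
    using g(4-6) by (simp only: ball_simps simp_thms)
  show "\<forall>i j. 1 \<le> i \<and> i < j \<and> j \<le> 3 \<longrightarrow> iota (O_B i j) = tensor 1 (L_B i j)"
    unfolding all_pairs using g(1-3) by blast
  have A: "iota (twist (tA l) D) = K_extend (tau_A l) (iota D)" if "l \<in> ks3" "D \<in> carrier SH" for l D
    using tw_iota[OF tA_twist(2)[OF that(1)], of D] that by (simp only: SH_sel tau_eq(4)[OF that(1)])
  show "\<forall>k\<in>{1, 2, 3}. \<forall>D\<in>carrier SH. iota (dehn_a k D) = K_extend (tau_A k) (iota D)"
    using A[of 1] A[of 2] A[of 3] dehn_eqs(4-6) by auto
  have B: "iota (twist (tB l) D) = K_extend (tB l) (iota D)" if "l \<in> ks3" "D \<in> carrier SH" for l D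
    using tw_iota[OF tB_twist(2)[OF that(1)], of D] that by (simp only: SH_sel)
  show "\<forall>i j. 1 \<le> i \<and> i < j \<and> j \<le> 3 \<longrightarrow>
       (\<forall>D\<in>carrier SH. iota (dehn_b i j D) = K_extend (tau_B i j) (iota D))"
    unfolding all_pairs dehn_eqs(1-3) tau_eq(1-3) using B[of 1] B[of 2] B[of 3] by simp
qed

end
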